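(* Let $N\ge1$, $p_1,\dots,p_N\in(0,1)$, $\alpha\ge0$ with $\alpha p_j<1$ for all $j$, and let $L_\alpha(N,N)$ be the last passage time from $(1,1)$ to $(N,N)$ on the diagonally symmetric random weight array with parameters $p_1,\dots,p_N,\alpha$ described in the context. Let $$c_\alpha=\prod_{1\le i<j\le N}\frac1{1-p_ip_j}\prod_{1\le j\le N}\frac{1}{1-\alpha p_j}.$$ For $u\in\frac12\mathbb{Z}_{\ge0}$, the following quantities are equal (expressions involving $\alpha^{-1}$ being considered for $\alpha>0$): $$A=c_\alpha\cdot\mathbb{P}\big(L_\alpha(N,N)\le 2u\big),$$ $$B=\sum_{\mu\subseteq(2u)^N}\alpha^{\mathrm{oddrows}\,\mu'}\cdot \mathrm{s}^{(N)}_\mu(p_1,\dots,p_N),$$ $$C=\Big[\prod_{i=1}^N p_i\Big]^u\,\mathrm{s}^{\mathrm{DB}}_{u^N}(p_1^{-1},\dots,p_N^{-1};\alpha)=\Big[\alpha\prod_{i=1}^N p_i\Big]^u\,\mathrm{so}^{(2N+2)}_{u^{N+1}}(p_1^{-1},\dots,p_N^{-1},\alpha^{-1}),$$ $$D=\Big[\alpha\prod_{i=1}^N p_i\Big]^u\sum_{\lambda_\delta\subseteq u^{N-n}}\mathrm{so}^{(2n+2)}_{(u^{2n+1-N},\lambda_\delta)}(p_1^{-1},\dots,p_n^{-1},\alpha^{-1})\cdot \mathrm{so}^{(2N-2n)}_{\lambda_\delta}(p_{n+1}^{-1},\dots,p_N^{-1}),$$ where $D$ holds for any integer $n$ with $\lceil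 (N-1)/2\rceil\le n\le N$.
   Context: Last passage percolation: $\{W_{i,j}:1\le i,j\le N\}$ is an array of random variables with $W_{i,j}=W_{j,i}$, such that the weights with $i\le j$ are independent and, for $k\in\mathbb{Z}_{\ge0}$, $\mathbb{P}(W_{i,j}=k)=(1-p_ip_j)(p_ip_j)^k$ if $i<j$, and $\mathbb{P}(W_{j,j}=k)=(1-\alpha p_j)(\alpha p_j)^k$ (with $0^0=1$). $L_\alpha(N,N)=\max_\pi\sum_{(i,j)\in\pi}W_{i,j}$, the maximum being over directed paths $\pi$ from $(1,1)$ to $(N,N)$, i.e. paths with steps $(1,0)$ or $(0,1)$. Partitions: a half-integer is an element of $\frac12+\mathbb{Z}$. An $m$-partition (resp. $m$-half-partition) is an $m$-tuple $\lambda_1\ge\dots\ge\lambda_m\ge0$ of integers (resp. half-integers). A signed $m$-partition (resp. signed $m$-half-partition) is a tuple $\lambda_\delta=(\lambda_1,\dots,\lambda_{m-1},\delta\lambda_m)$ with $\lambda$ an $m$-partition (resp. $m$-half-partition) and $\delta\in\{+1,-1\}$; if $\lambda_m=0$ then $\lambda_+=\lambda_-$ is counted once in sums. $u^m=(u,\dots,u)$ ($m$ times); $(a,b)$ denotes concatenation. A sum over $\mu\subseteq(2u)^N$ is over $N$-partitions with $\mu_1\le 2u$. A sum over $\lambda_\delta\subseteq u^m$ is over all signed $m$-partitions (if $u$ is an integer) or signed $m$-half-partitions (if $u$ is a half-integer) with $\lambda_i\le u$ for all $i$; for $m=0$ it consists of the empty tuple only. $\mu'$ is the conjugate partition of $\mu$,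 and $\mathrm{oddrows}\,\nu$ is the number of odd parts of $\nu$. $\mathrm{s}^{(N)}_\mu(x_1,\dots,x_N)$ is the usual Schur polynomial in $N$ variables. Orthogonal patterns: an orthogonal pattern of height $M$ is an array $z=(z_{i,j})_{1\le i\le M,\,1\le j\le\lceil i/2\rceil}$ whose entries are either all integers or all half-integers, where the odd ends $z_{2i-1,i}$ ($1\le i\le\lceil M/2\rceil$) may be negative and all other entries are non-negative, and $|z_{i+1,j+1}|\le|z_{i,j}|\le|z_{i+1,j}|$ (each inequality whenever both entries exist). Its shape is its last row, and $\mathrm{type}(z)_i=\sum_{j=1}^{\lceil i/2\rceil}|z_{i,j}|-\sum_{j=1}^{\lceil(i-1)/2\rceil}|z_{i-1,j}|$. Set $\mathrm{sgn}(a)=+1$ for $a\ge0$, $-1$ for $a<0$, and $$w_n(z;x)=x_1^{z_{1,1}}\prod_{i=2}^n x_i^{\mathrm{sgn}(z_{2i-3,i-1})\,\mathrm{sgn}(z_{2i-1,i})\,[\mathrm{type}(z)_{2i-1}-\mathrm{type}(z)_{2i-2}]}.$$ For a signed $n$-partition or signed $n$-half-partition $\nu$, $\mathrm{so}^{(2n)}_\nu(x_1,\dots,x_n)=\sum_z w_n(z;x)$ over orthogonal patterns of height $2n-1$ and shape $\nu$ (equal to $1$ if $n=0$). For an $n$-partition or $n$-half-partition $\lambda$, $\mathrm{s}^{\mathrm{DB}}_\lambda(x_1,\dots,x_n;\alpha)=\sum_z w_n(z;x)\,\alpha^{\sum_{i=1}^n(\lambda_i-z_{2n-1,i})}$ over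 orthogonal patterns of height $2n$ and shape $\lambda$. *)

theory Defs
  imports "HOL-Probability.Probability"
begin

definition directed_paths :: "nat \<Rightarrow> nat \<Rightarrow> (nat \<times> nat) list set" where
  "directed_paths m n = {\<pi>. \<pi> \<noteq> [] \<and> hd \<pi> = (1, 1) \<and> last \<pi> = (m, n) \<and>
     successively (\<lambda>(i, j) c. c = (i + 1, j) \<or> c = (i, j + 1)) \<pi>}"

definition last_passage :: "(nat \<Rightarrow> nat \<Rightarrow> nat) \<Rightarrow> nat \<Rightarrow> nat \<Rightarrow> nat" where
  "last_passage w m n = Max ((\<lambda>\<pi>. \<Sum>(i, j)\<leftarrow>\<pi>. w i j) ` directed_paths m n)"

definition sym_geometric_weights ::
    "'a measure \<Rightarrow> nat \<Rightarrow> (nat \<Rightarrow> real) \<Rightarrow> real \<Rightarrow> (nat \<Rightarrow> nat \<Rightarrow> 'a \<Rightarrow> nat) \<Rightarrow> bool" where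
  "sym_geometric_weights M N p \<alpha> W \<longleftrightarrow>
     prob_space M \<and>
     prob_space.indep_vars M (\<lambda>_. count_space UNIV) (\<lambda>(i, j). W i j)
       {(i, j). 1 \<le> i \<and> i \<le> j \<and> j \<le> N} \<and>
     (\<forall>i\<in>{1..N}. \<forall>j\<in>{1..N}. \<forall>\<omega>\<in>space M. W i j \<omega> = W j i \<omega>) \<and>
     (\<forall>i\<in>{1..N}. \<forall>j\<in>{1..N}. i < j \<longrightarrow>
        (\<forall>k. measure M {\<omega> \<in> space M. W i j \<omega> = k} = (1 - p i * p j) * (p i * p j) ^ k)) \<and>
     (\<forall>j\<in>{1..N}. \<forall>k. measure M {\<omega> \<in> space M. W j j \<omega> = k} = (1 - \<alpha> * p j) * (\<alpha> * p j) ^ k)"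

definition c_const :: "nat \<Rightarrow> (nat \<Rightarrow> real) \<Rightarrow> real \<Rightarrow> real" where
  "c_const N p \<alpha> =
     (\<Prod>(i, j)\<in>{(i, j). 1 \<le> i \<and> i < j \<and> j \<le> N}. 1 / (1 - p i * p j)) *
     (\<Prod>j\<in>{1..N}. 1 / (1 - \<alpha> * p j))"

text \<open>
  Tuples are lists, so the mathematical component \<open>\<lambda>\<^sub>i\<close> is \<open>l ! (i - 1)\<close>.  Integer and
  half-integer entries are both kept as reals wherever the two kinds occur side by side.
\<close>

definition half_integers :: "real set" where
  "half_integers = {1 / 2 + of_int k | k. True}"

definition decr_tuples :: "nat \<Rightarrow> 'a::linorder set \<Rightarrow> 'a list set" where
  "decr_tuples m A = {l. length l = m \<and> sorted_wrt (\<ge>) l \<and> set l \<subseteq> A}"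

definition negate_last :: "real list \<Rightarrow> real list" where
  "negate_last l = (if l = [] then [] else butlast l @ [- last l])"

text \<open>
  The signed tuples \<open>\<lambda>\<^sub>\<delta> \<subseteq> u\<^sup>m\<close>.  Being a set of tuples, it contains \<open>\<lambda>\<^sub>+ = \<lambda>\<^sub>-\<close> only once if the
  last entry of \<open>\<lambda>\<close> vanishes, and only the empty tuple if \<open>m = 0\<close>.
\<close>

definition signed_box :: "nat \<Rightarrow> real \<Rightarrow> real list set" where
  "signed_box m u =
     (let P = decr_tuples m {x \<in> (if u \<in> \<int> then \<int> else half_integers). 0 \<le> x \<and> x \<le> u}
      in P \<union> negate_last ` P)"

definition conjugate :: "nat list \<Rightarrow> nat list" where
  "conjugate mu = map (\<lambda>j. length (filter (\<lambda>k. j \<le> k) mu)) [1..<Suc (Max (insert 0 (set mu)))]"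

definition oddrows :: "nat list \<Rightarrow> nat" where
  "oddrows nu = length (filter odd nu)"

definition young_diagram :: "nat list \<Rightarrow> (nat \<times> nat) set" where
  "young_diagram mu = {(i, j). 1 \<le> i \<and> i \<le> length mu \<and> 1 \<le> j \<and> j \<le> mu ! (i - 1)}"

definition ssyt :: "nat \<Rightarrow> nat list \<Rightarrow> (nat \<times> nat \<Rightarrow> nat) set" where
  "ssyt N mu = {T \<in> young_diagram mu \<rightarrow>\<^sub>E {1..N}.
     (\<forall>i j j'. (i, j) \<in> young_diagram mu \<longrightarrow> (i, j') \<in> young_diagram mu \<longrightarrow> j < j' \<longrightarrow>
        T (i, j) \<le> T (i, j')) \<and>
     (\<forall>i i' j. (i, j) \<in> young_diagram mu \<longrightarrow> (i', j) \<in> young_diagram mu \<longrightarrow> i < i' \<longrightarrow>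
        T (i, j) < T (i', j))}"

definition schur :: "nat \<Rightarrow> nat list \<Rightarrow> real list \<Rightarrow> real" where
  "schur N mu x = (\<Sum>T\<in>ssyt N mu. \<Prod>c\<in>young_diagram mu. x ! (T c - 1))"

text \<open>Note \<open>\<lceil>i / 2\<rceil> = (i + 1) div 2\<close>.\<close>

definition pattern_index :: "nat \<Rightarrow> (nat \<times> nat) set" where
  "pattern_index M = {(i, j). 1 \<le> i \<and> i \<le> M \<and> 1 \<le> j \<and> j \<le> (i + 1) div 2}"

text \<open>
  Patterns are functions extended by zero outside their index set, so that each array is
  represented exactly once.
\<close>

definition orthogonal_patterns :: "nat \<Rightarrow> (nat \<Rightarrow> nat \<Rightarrow> real) set" where
  "orthogonal_patterns M = {z.
     (\<forall>i j. (i, j) \<notin> pattern_index M \<longrightarrow> z i j = 0) \<and>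
     ((\<forall>(i, j)\<in>pattern_index M. z i j \<in> \<int>) \<or> (\<forall>(i, j)\<in>pattern_index M. z i j \<in> half_integers)) \<and>
     (\<forall>(i, j)\<in>pattern_index M. i \<noteq> 2 * j - 1 \<longrightarrow> 0 \<le> z i j) \<and>
     (\<forall>i j. (i, j) \<in> pattern_index M \<longrightarrow> (i + 1, j + 1) \<in> pattern_index M \<longrightarrow>
        \<bar>z (i + 1) (j + 1)\<bar> \<le> \<bar>z i j\<bar>) \<and>
     (\<forall>i j. (i, j) \<in> pattern_index M \<longrightarrow> (i + 1, j) \<in> pattern_index M \<longrightarrow>
        \<bar>z i j\<bar> \<le> \<bar>z (i + 1) j\<bar>)}"

definition patterns_of_shape :: "nat \<Rightarrow> real list \<Rightarrow> (nat \<Rightarrow> nat \<Rightarrow> real) set" where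
  "patterns_of_shape M nu =
     {z \<in> orthogonal_patterns M. map (z M) [1..<(M + 1) div 2 + 1] = nu}"

definition pattern_type :: "(nat \<Rightarrow> nat \<Rightarrow> real) \<Rightarrow> nat \<Rightarrow> real" where
  "pattern_type z i =
     (\<Sum>j\<in>{1..(i + 1) div 2}. \<bar>z i j\<bar>) - (\<Sum>j\<in>{1..i div 2}. \<bar>z (i - 1) j\<bar>)"

text \<open>Unlike \<^term>\<open>sgn\<close>, this takes the value 1 at 0.\<close>

definition sgn1 :: "real \<Rightarrow> real" where
  "sgn1 a = (if 0 \<le> a then 1 else - 1)"

text \<open>The exponents may be half-integers; all arguments \<open>x\<^sub>i\<close> are meant to be positive.\<close>

definition pattern_weight :: "nat \<Rightarrow> (nat \<Rightarrow> nat \<Rightarrow> real) \<Rightarrow> real list \<Rightarrow> real" where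
  "pattern_weight n z x =
     (x ! 0) powr z 1 1 *
     (\<Prod>i\<in>{2..n}. (x ! (i - 1)) powr
        (sgn1 (z (2 * i - 3) (i - 1)) * sgn1 (z (2 * i - 1) i) *
         (pattern_type z (2 * i - 1) - pattern_type z (2 * i - 2))))"

text \<open>\<open>so_even n\<close> is the function \<open>so\<^sup>(\<^sup>2\<^sup>n\<^sup>)\<close> of \<open>n\<close> variables.\<close>

definition so_even :: "nat \<Rightarrow> real list \<Rightarrow> real list \<Rightarrow> real" where
  "so_even n nu x =
     (if n = 0 then 1 else \<Sum>z\<in>patterns_of_shape (2 * n - 1) nu. pattern_weight n z x)"

text \<open>
  The exponent of \<open>\<alpha>\<close> is always a non-negative integer; a natural-number power is used so that
  \<open>0\<^sup>0 = 1\<close>, which fails for \<^term>\<open>(powr)\<close>.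
\<close>

definition s_DB :: "nat \<Rightarrow> real list \<Rightarrow> real list \<Rightarrow> real \<Rightarrow> real" where
  "s_DB n l x \<alpha> =
     (\<Sum>z\<in>patterns_of_shape (2 * n) l.
        pattern_weight n z x * \<alpha> ^ nat \<lfloor>\<Sum>i\<in>{1..n}. l ! (i - 1) - z (2 * n - 1) i\<rfloor>)"

end

theory Submission
  imports "Jordan_Normal_Form.Determinant" Defs
begin

text \<open>
  Adding the weights of the symmetric array one cell at a time, each weight is exchanged bijectively
  for a new partition in a growth diagram whose partitions have the passage times as first parts.
  At the end this turns the array sum into a sum over interlacing chains, which is \<open>B\<close>.

  By the branching rule \<open>B\<close> is the sum of the Schur polynomials in \<open>p\<^sub>1, \<dots>, p\<^sub>N, \<alpha>\<close> over the partitions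
  in a box all of whose columns have even length.  A recursion in the width \<open>2u\<close> of the box,
  together with its limit for \<open>u \<rightarrow> \<infinity>\<close> (the Littlewood identity, which also comes out of the growth
  diagrams), expresses this sum as an alternating sum over subsets of the variables. The Weyl
  character formula for orthogonal patterns of rectangular shape expands into the same sum.
  Since the sum is symmetric in the variables, so is the orthogonal character, and the formula \<open>D\<close> is
  obtained by removing the variables \<open>p\<^sub>n\<^sub>+\<^sub>1, \<dots>, p\<^sub>N\<close> from a rectangular pattern one after the other.
\<close>

section \<open>Tuples and determinants\<close>

text \<open>The recursion in the width of the box determines the bounded sum only together with two
  boundary values, at width 0 and at infinite width. At infinite width the summand h is not
  evaluated inside the recursion: the equations required of it are limits of the finite ones. At
  width 0 the identity needed is that the Weyl sum of the trivial shape equals 1, so the Weyl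
  formula is used twice. \<alpha> can act as one more variable because every partition \<nu> has
  exactly one partition with even columns interlacing above it, and the difference of the sizes is
  the number of odd columns of \<nu>. The even orthogonal character is half the sum of a hyperbolic
  cosine and a hyperbolic sine determinant. Both satisfy the same branching rule, only the sum
  starts correctly, and taking the sum is what restricts the subsets to even size. The obstacle is
  that the subset sums have denominators, so the variables must first be distinct; coincidences are
  removed by a perturbation, and the case \<alpha> = 0, where 1 / \<alpha> is missing, by continuity
  in \<alpha>.\<close>

definition tup :: "nat \<Rightarrow> (nat \<Rightarrow> 'a set) \<Rightarrow> (nat \<Rightarrow> 'a::zero) set" where
  "tup n B = {f. (\<forall>j<n. f j \<in> B j) \<and> (\<forall>j\<ge>n. f j = 0)}"

lemma tup_0 [simp]: "tup 0 B = {\<lambda>_. 0}"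
  by (auto simp: tup_def)

lemma tup_cong: "(\<And>j. j < n \<Longrightarrow> B j = C j) \<Longrightarrow> tup n B = tup n C"
  by (auto simp: tup_def)

lemma bij_betw_PiE_tup:
  "bij_betw (\<lambda>f j. if j < n then f j else 0) (PiE {..<n} B) (tup n B)"
  by (rule bij_betw_byWitness[where f' = "\<lambda>f. restrict f {..<n}"])
     (auto simp: tup_def PiE_def extensional_def restrict_def fun_eq_iff Pi_def)

lemma finite_tup: "(\<And>j. j < n \<Longrightarrow> finite (B j)) \<Longrightarrow> finite (tup n B)"
  using bij_betw_finite[OF bij_betw_PiE_tup[of n B]] by (auto intro: finite_PiE)

lemma prod_sum_tup:
  fixes h :: "nat \<Rightarrow> 'a::zero \<Rightarrow> 'b::comm_semiring_1"
  assumes "\<And>j. j < n \<Longrightarrow> finite (B j)"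
  shows "(\<Prod>j<n. \<Sum>v\<in>B j. h j v) = (\<Sum>f\<in>tup n B. \<Prod>j<n. h j (f j))"
proof -
  have "(\<Prod>j<n. \<Sum>v\<in>B j. h j v) = (\<Sum>f\<in>PiE {..<n} B. \<Prod>j<n. h j (f j))"
    using assms by (intro prod_sum_PiE) auto
  also have "\<dots> = (\<Sum>f\<in>PiE {..<n} B. \<Prod>j<n. h j (if j < n then f j else 0))"
    by simp
  also have "\<dots> = (\<Sum>f\<in>tup n B. \<Prod>j<n. h j (f j))"
    by (rule sum.reindex_bij_betw[OF bij_betw_PiE_tup])
  finally show ?thesis .
qed

definition dt :: "nat \<Rightarrow> (nat \<Rightarrow> nat \<Rightarrow> real) \<Rightarrow> real" where
  "dt n A = Determinant.det (Matrix.mat n n (\<lambda>(i, j). A i j))"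

lemma dt_rows: "dt n A = (\<Sum>p | p permutes {..<n}. of_int (sign p) * (\<Prod>i<n. A i (p i)))"
proof -
  have "dt n A = (\<Sum>p | p permutes {0..<n}. of_int (sign p) *
      (\<Prod>i = 0..<n. Matrix.mat n n (\<lambda>(i, j). A i j) $$ (i, p i)))"
    unfolding dt_def by (rule det_def'[of _ n]) simp
  also have "\<dots> = (\<Sum>p | p permutes {0..<n}. of_int (sign p) * (\<Prod>i = 0..<n. A i (p i)))"
    by (intro sum.cong refl arg_cong2[where f = "(*)"] prod.cong)
       (use permutes_in_image in fastforce)
  finally show ?thesis by (simp add: atLeast0LessThan)
qed

lemma dt_transpose: "dt n (\<lambda>i j. A j i) = dt n A"
proof -
  have "Matrix.mat n n (\<lambda>(i, j). A j i) = transpose_mat (Matrix.mat n n (\<lambda>(i, j). A i j))"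
    by (rule eq_matI) auto
  then show ?thesis
    by (simp add: dt_def Determinant.det_transpose[of _ n])
qed

lemma dt_cols: "dt n A = (\<Sum>p | p permutes {..<n}. of_int (sign p) * (\<Prod>j<n. A (p j) j))"
  using dt_rows[of n "\<lambda>i j. A j i"] unfolding dt_transpose[of n A] .

lemma dt_cong: "(\<And>i j. i < n \<Longrightarrow> j < n \<Longrightarrow> A i j = B i j) \<Longrightarrow> dt n A = dt n B"
  unfolding dt_def by (intro arg_cong[where f = Determinant.det] eq_matI) auto

lemma dt_sum_cols:
  fixes A :: "nat \<Rightarrow> 'a::zero \<Rightarrow> nat \<Rightarrow> real"
  assumes "\<And>j. j < n \<Longrightarrow> finite (B j)"
  shows "dt n (\<lambda>i j. \<Sum>v\<in>B j. A j v i) = (\<Sum>f\<in>tup n B. dt n (\<lambda>i j. A j (f j) i))"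
proof -
  have "dt n (\<lambda>i j. \<Sum>v\<in>B j. A j v i) =
      (\<Sum>p | p permutes {..<n}. of_int (sign p) * (\<Sum>f\<in>tup n B. \<Prod>j<n. A j (f j) (p j)))"
    unfolding dt_cols using assms by (simp add: prod_sum_tup)
  also have "\<dots> = (\<Sum>f\<in>tup n B. \<Sum>p | p permutes {..<n}. of_int (sign p) * (\<Prod>j<n. A j (f j) (p j)))"
    by (subst sum.swap) (simp add: sum_distrib_left)
  finally show ?thesis by (simp add: dt_cols)
qed

text \<open>Multilinearity in the rows; \<open>S\<close> collects the rows that take the first
  summand. In \<open>cs_det_rect\<close> each \<open>S\<close> becomes a choice between a variable
  and its inverse.\<close>

lemma dt_add_rows:
  "dt n (\<lambda>i j. a i j + b i j) = (\<Sum>S\<in>Pow {..<n}. dt n (\<lambda>i j. if i \<in> S then a i j else b i j))"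
proof -
  have "dt n (\<lambda>i j. a i j + b i j) = (\<Sum>p | p permutes {..<n}. of_int (sign p) *
      (\<Sum>S\<in>Pow {..<n}. \<Prod>i<n. if i \<in> S then a i (p i) else b i (p i)))"
    unfolding dt_rows
  proof (intro sum.cong refl arg_cong2[where f = "(*)"])
    fix p
    show "(\<Prod>i<n. a i (p i) + b i (p i)) =
        (\<Sum>S\<in>Pow {..<n}. \<Prod>i<n. if i \<in> S then a i (p i) else b i (p i))"
      unfolding prod_add[OF finite_lessThan]
    proof (rule sum.cong)
      fix S assume "S \<in> Pow {..<n}"
      then have "{..<n} \<inter> {i. i \<in> S} = S" "{..<n} \<inter> - {i. i \<in> S} = {..<n} - S"
        by auto
      then show "(\<Prod>i\<in>S. a i (p i)) * (\<Prod>i\<in>{..<n} - S. b i (p i)) =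
          (\<Prod>i<n. if i \<in> S then a i (p i) else b i (p i))"
        by (simp only: prod.If_cases[OF finite_lessThan])
    qed simp
  qed
  also have "\<dots> = (\<Sum>S\<in>Pow {..<n}. \<Sum>p | p permutes {..<n}. of_int (sign p) *
      (\<Prod>i<n. if i \<in> S then a i (p i) else b i (p i)))"
    by (subst sum.swap) (simp add: sum_distrib_left)
  also have "\<dots> = (\<Sum>S\<in>Pow {..<n}. dt n (\<lambda>i j. if i \<in> S then a i j else b i j))"
    unfolding dt_rows ..
  finally show ?thesis .
qed

lemma dt_scale_cols: "dt n (\<lambda>i j. d j * A i j) = (\<Prod>j<n. d j) * dt n A"
  unfolding dt_cols by (auto simp: prod.distrib sum_distrib_left intro!: sum.cong)

lemma dt_scale_rows: "dt n (\<lambda>i j. d i * A i j) = (\<Prod>i<n. d i) * dt n A"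
  unfolding dt_rows by (auto simp: prod.distrib sum_distrib_left intro!: sum.cong)

text \<open>The right factor is a lower bidiagonal matrix with unit diagonal, so all column
  operations happen at once, each with the original neighbour. This is the form in which telescoping
  sums produce their columns.\<close>

lemma dt_diff_cols:
  "dt n (\<lambda>i j. A i j - (if Suc j < n then c j * A i (Suc j) else 0)) = dt n A"
proof -
  let ?A = "Matrix.mat n n (\<lambda>(i, j). A i j)"
  let ?L = "Matrix.mat n n (\<lambda>(k, j). if k = j then 1 else if k = Suc j then - c j else 0)"
  have "?A * ?L = Matrix.mat n n (\<lambda>(i, j). A i j - (if Suc j < n then c j * A i (Suc j) else 0))"
  proof (rule eq_matI, goal_cases)
    case (1 i j)
    then have "(?A * ?L) $$ (i, j) =
        (\<Sum>k\<in>{0..<n}. A i k * (if k = j then 1 else if k = Suc j then - c j else 0))"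
      by (simp add: scalar_prod_def)
    also have "\<dots> = (\<Sum>k\<in>{0..<n}. (if k = j then A i j else 0)) +
        (\<Sum>k\<in>{0..<n}. if k = Suc j then - c j * A i (Suc j) else 0)"
      unfolding sum.distrib[symmetric] by (rule sum.cong) auto
    also have "\<dots> = A i j - (if Suc j < n then c j * A i (Suc j) else 0)"
      using 1 by simp
    finally show ?case using 1 by simp
  qed auto
  moreover have "Determinant.det ?L = 1"
  proof -
    have "Determinant.det ?L = prod_list (diag_mat ?L)"
      by (rule det_lower_triangular[of n]) auto
    also have "\<dots> = 1"
      by (simp add: prod_list_diag_prod)
    finally show ?thesis .
  qed
  ultimately show ?thesis
    unfolding dt_def using det_mult[of ?A n ?L] by simp
qed

lemma dt_laplace_row:
  "dt (Suc n) A = (\<Sum>j\<le>n. A n j * ((-1) ^ (n + j) * dt n (\<lambda>i k. A i (insert_index j k))))"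
proof -
  have *: "mat_delete (Matrix.mat (Suc n) (Suc n) (\<lambda>(i, j). A i j)) n j =
      Matrix.mat n n (\<lambda>(i, k). A i (insert_index j k))" if "j \<le> n" for j
    using that by (intro eq_matI) (auto simp: mat_delete_def insert_index_def)
  show ?thesis
    unfolding dt_def
    by (subst laplace_expansion_row[of _ "Suc n" n])
       (auto simp: cofactor_def * lessThan_Suc_atMost intro!: sum.cong)
qed

lemma dt_laplace_col:
  "dt (Suc n) A = (\<Sum>i\<le>n. A i n * ((-1) ^ (n + i) * dt n (\<lambda>k j. A (insert_index i k) j)))"
proof -
  have "dt (Suc n) A = dt (Suc n) (\<lambda>i j. A j i)"
    by (rule dt_transpose[symmetric])
  also have "\<dots> = (\<Sum>i\<le>n. A i n * ((-1) ^ (n + i) * dt n (\<lambda>k j. A (insert_index i j) k)))"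
    by (rule dt_laplace_row)
  also have "\<dots> = (\<Sum>i\<le>n. A i n * ((-1) ^ (n + i) * dt n (\<lambda>k j. A (insert_index i k) j)))"
    by (intro sum.cong refl arg_cong2[where f = "(*)"] dt_transpose)
  finally show ?thesis .
qed

lemma dt_last_row_single:
  assumes "\<And>j. j < n \<Longrightarrow> A n j = 0"
  shows "dt (Suc n) A = A n n * dt n A"
proof -
  have "dt (Suc n) A = (\<Sum>j\<in>{n}. A n j * ((-1) ^ (n + j) * dt n (\<lambda>i k. A i (insert_index j k))))"
    unfolding dt_laplace_row by (rule sum.mono_neutral_right) (use assms in auto)
  also have "\<dots> = A n n * dt n (\<lambda>i k. A i (insert_index n k))"
    by (simp flip: mult_2 add: power_mult)
  also have "dt n (\<lambda>i k. A i (insert_index n k)) = dt n A"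
    by (rule dt_cong) (simp add: insert_index_def)
  finally show ?thesis .
qed

text \<open>Two minors survive in the expansion along the last row. They differ in their last column
  alone, so linearity in that column merges them.\<close>

lemma dt_last_row_two:
  assumes n: "n = Suc k" and "\<And>j. j < k \<Longrightarrow> A n j = 0"
  shows "dt (Suc n) A = dt n (\<lambda>i j. if j = k then A n n * A i k - A n k * A i n else A i j)"
proof -
  let ?P = "\<lambda>i j. if j = k then A i n else A i j"
  have "dt (Suc n) A = (\<Sum>j\<in>{k, n}. A n j * ((-1) ^ (n + j) * dt n (\<lambda>i k. A i (insert_index j k))))"
    unfolding dt_laplace_row[of n]
    by (rule sum.mono_neutral_right) (use assms in \<open>auto simp: le_Suc_eq\<close>)
  also have "\<dots> = A n n * dt n (\<lambda>i k. A i (insert_index n k)) - A n k * dt n (\<lambda>i j. A i (insert_index k j))"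
    by (simp flip: mult_2 add: power_mult n)
  also have "dt n (\<lambda>i k. A i (insert_index n k)) = dt n A"
    by (rule dt_cong) (simp add: insert_index_def)
  also have "dt n (\<lambda>i j. A i (insert_index k j)) = dt n ?P"
    by (rule dt_cong) (auto simp: insert_index_def less_Suc_eq n)
  also have "A n n * dt n A - A n k * dt n ?P =
      dt n (\<lambda>i j. if j = k then A n n * A i k - A n k * A i n else A i j)"
    unfolding dt_cols sum_distrib_left sum_subtractf[symmetric]
    by (rule sum.cong) (simp_all add: algebra_simps n)
  finally show ?thesis .
qed

lemma dt_0 [simp]: "dt 0 A = 1"
  by (simp add: dt_rows)

lemma dt_1 [simp]: "dt (Suc 0) A = A 0 0"
  by (subst dt_last_row_single) simp_all

section \<open>Schur polynomials\<close>

text \<open>The Gelfand-Tsetlin form of the Schur polynomial. Tuples are functions vanishing from their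
  length on; the subtraction does not truncate, since \<open>\<nu>\<close> interlaces with \<open>\<mu>\<close>.\<close>

primrec gts :: "nat \<Rightarrow> (nat \<Rightarrow> nat) \<Rightarrow> (nat \<Rightarrow> real) \<Rightarrow> real" where
  "gts 0 \<mu> x = 1"
| "gts (Suc n) \<mu> x = (\<Sum>\<nu>\<in>tup n (\<lambda>j. {\<mu> (Suc j)..\<mu> j}).
     x n ^ ((\<Sum>j<Suc n. \<mu> j) - (\<Sum>j<n. \<nu> j)) * gts n \<nu> x)"

lemma gts_cong:
  assumes "\<And>j. j < n \<Longrightarrow> \<mu> j = \<mu>' j" and "\<And>i. i < n \<Longrightarrow> x i = x' i"
  shows "gts n \<mu> x = gts n \<mu>' x'"
  using assms
proof (induction n arbitrary: \<mu> \<mu>')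
  case (Suc n)
  have "gts n \<nu> x = gts n \<nu> x'" for \<nu>
    using Suc.prems by (intro Suc.IH) auto
  moreover have "tup n (\<lambda>j. {\<mu> (Suc j)..\<mu> j}) = tup n (\<lambda>j. {\<mu>' (Suc j)..\<mu>' j})"
    using Suc.prems by (intro tup_cong) simp
  moreover have "(\<Sum>j<Suc n. \<mu> j) = (\<Sum>j<Suc n. \<mu>' j)"
    using Suc.prems by (intro sum.cong) auto
  ultimately show ?case using Suc.prems by simp
qed simp

text \<open>With this order of the differences the exponents of the matching alternant decrease from
  left to right.\<close>

definition vand :: "nat \<Rightarrow> (nat \<Rightarrow> real) \<Rightarrow> real" where
  "vand n x = (\<Prod>j<n. \<Prod>i<j. (x i - x j))"

lemma vand_0 [simp]: "vand 0 x = 1"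
  and vand_Suc: "vand (Suc n) x = vand n x * (\<Prod>i<n. (x i - x n))"
  by (simp_all add: vand_def)

lemma vand_nonzero: "inj_on x {..<n} \<Longrightarrow> vand n x \<noteq> 0"
  by (induction n) (auto simp: vand_Suc inj_on_def less_Suc_eq)

text \<open>A geometric sum. Up to a common power of x, the left side is an entry of the alternant
  after the column operation of \<open>gts_alternant\<close>, and x - y is the Vandermonde factor of
  the removed variable.\<close>

lemma power_diff_interval:
  fixes x y :: "'a::comm_ring_1"
  assumes "a \<le> b"
  shows "x ^ Suc b - y ^ (Suc b - a) * x ^ a = (x - y) * (\<Sum>v\<in>{a..b}. y ^ (b - v) * x ^ v)"
  using assms
proof (induction b rule: dec_induct)
  case base
  show ?case by (simp add: algebra_simps)
next
  case (step b)
  have "(\<Sum>v\<in>{a..Suc b}. y ^ (Suc b - v) * x ^ v) = y * (\<Sum>v\<in>{a..b}. y ^ (b - v) * x ^ v) + x ^ Suc b"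
    using step(1) by (simp add: sum_distrib_left Suc_diff_le mult.assoc)
  moreover have "x ^ Suc (Suc b) - y ^ Suc (Suc b - a) * x ^ a =
      (x - y) * x ^ Suc b + y * (x ^ Suc b - y ^ (Suc b - a) * x ^ a)"
    by (simp add: algebra_simps)
  moreover have "Suc (Suc b) - a = Suc (Suc b - a)"
    using step(1) by simp
  ultimately show ?case
    by (simp only: step(3) distrib_left mult.left_commute[of y] mult.commute[of "x ^ Suc b"] add.commute)
qed

lemma sum_diff_telescope_nat:
  fixes \<mu> \<nu> :: "nat \<Rightarrow> nat"
  assumes "\<And>j. j < n \<Longrightarrow> \<nu> j \<le> \<mu> j"
  shows "(\<Sum>j<Suc n. \<mu> j) - (\<Sum>j<n. \<nu> j) = \<mu> n + (\<Sum>j<n. \<mu> j - \<nu> j)"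
proof -
  have "(\<Sum>j<n. \<nu> j) \<le> (\<Sum>j<n. \<mu> j)"
    using assms by (intro sum_mono) simp
  moreover have "(\<Sum>j<n. \<mu> j - \<nu> j) = (\<Sum>j<n. \<mu> j) - (\<Sum>j<n. \<nu> j)"
    using assms by (intro sum_subtractf_nat) simp
  ultimately show ?thesis by simp
qed

lemma tup_interlacing_decreasing:
  fixes \<mu> \<nu> :: "nat \<Rightarrow> 'a::{order, zero}"
  assumes "\<nu> \<in> tup n (\<lambda>j. {\<mu> (Suc j)..\<mu> j})" and "Suc j < n"
  shows "\<nu> (Suc j) \<le> \<nu> j"
proof -
  have "\<nu> (Suc j) \<le> \<mu> (Suc j)" "\<mu> (Suc j) \<le> \<nu> j"
    using assms by (simp_all add: tup_def)
  then show ?thesis by (rule order.trans)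
qed

text \<open>Induction along the branching rule: column operations clear the last row up to one
  entry, the Vandermonde factors of the last variable split off the rows, and the quotients are sums
  over the intervals of an interlacing row, expanded column by column.\<close>

lemma gts_alternant:
  assumes "\<And>j. Suc j < n \<Longrightarrow> \<mu> (Suc j) \<le> \<mu> j"
  shows "gts n \<mu> x * vand n x = dt n (\<lambda>i j. x i ^ (\<mu> j + (n - 1 - j)))"
  using assms
proof (induction n arbitrary: \<mu>)
  case 0
  then show ?case by simp
next
  case (Suc n)
  define y where "y = x n"
  define l where "l j = \<mu> j + (n - j)" for j
  define B where "B = (\<lambda>j. {\<mu> (Suc j)..\<mu> j})"
  have l_le: "l (Suc j) \<le> l j" if "j < n" for j
    using Suc.prems[of j] that by (simp add: l_def)
  let ?A = "\<lambda>i j. x i ^ l j - (if Suc j < Suc n then y ^ (l j - l (Suc j)) * x i ^ l (Suc j) else 0)"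
  have "dt (Suc n) (\<lambda>i j. x i ^ l j) = dt (Suc n) ?A"
    by (rule dt_diff_cols[symmetric])
  \<comment> \<open>In the last row the variable is y itself, so every difference vanishes;
    \<open>l_le\<close> keeps the subtraction of exponents from truncating.\<close>
  also have "\<dots> = ?A n n * dt n ?A"
    by (rule dt_last_row_single) (use l_le in \<open>auto simp: y_def simp flip: power_add\<close>)
  also have "?A n n = y ^ \<mu> n"
    by (simp add: l_def y_def)
  also have "dt n ?A = dt n (\<lambda>i j. (x i - y) * (\<Sum>v\<in>B j. y ^ (\<mu> j - v) * x i ^ (v + (n - 1 - j))))"
  proof (rule dt_cong)
    fix i j assume "i < n" "j < n"
    define c where "c = n - 1 - j"
    have le: "\<mu> (Suc j) \<le> \<mu> j" and l: "l j = Suc (\<mu> j) + c" "l (Suc j) = \<mu> (Suc j) + c"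
      using Suc.prems \<open>j < n\<close> by (auto simp: l_def c_def)
    then have "l j - l (Suc j) = Suc (\<mu> j) - \<mu> (Suc j)" by simp
    then have "?A i j = x i ^ c *
        (x i ^ Suc (\<mu> j) - y ^ (Suc (\<mu> j) - \<mu> (Suc j)) * x i ^ \<mu> (Suc j))"
      using \<open>j < n\<close> by (simp add: l power_add algebra_simps)
    also have "\<dots> = (x i - y) * (\<Sum>v\<in>B j. y ^ (\<mu> j - v) * x i ^ (v + c))"
      unfolding power_diff_interval[OF le] by (simp add: B_def power_add sum_distrib_left mult_ac)
    finally show "?A i j = (x i - y) * (\<Sum>v\<in>B j. y ^ (\<mu> j - v) * x i ^ (v + (n - 1 - j)))"
      by (simp add: c_def)
  qed
  also have "\<dots> = (\<Prod>i<n. (x i - y)) * dt n (\<lambda>i j. \<Sum>v\<in>B j. y ^ (\<mu> j - v) * x i ^ (v + (n - 1 - j)))"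
    by (rule dt_scale_rows)
  also have "dt n (\<lambda>i j. \<Sum>v\<in>B j. y ^ (\<mu> j - v) * x i ^ (v + (n - 1 - j))) =
      (\<Sum>\<nu>\<in>tup n B. dt n (\<lambda>i j. y ^ (\<mu> j - \<nu> j) * x i ^ (\<nu> j + (n - 1 - j))))"
    by (rule dt_sum_cols) (simp add: B_def)
  also have "\<dots> = (\<Sum>\<nu>\<in>tup n B. y ^ (\<Sum>j<n. \<mu> j - \<nu> j) * (gts n \<nu> x * vand n x))"
  proof (rule sum.cong)
    fix \<nu> assume \<nu>: "\<nu> \<in> tup n B"
    then have "gts n \<nu> x * vand n x = dt n (\<lambda>i j. x i ^ (\<nu> j + (n - 1 - j)))"
      by (intro Suc.IH tup_interlacing_decreasing[of \<nu> n \<mu>]) (simp_all add: B_def)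
    then show "dt n (\<lambda>i j. y ^ (\<mu> j - \<nu> j) * x i ^ (\<nu> j + (n - 1 - j))) =
        y ^ (\<Sum>j<n. \<mu> j - \<nu> j) * (gts n \<nu> x * vand n x)"
      unfolding dt_scale_cols by (simp add: power_sum)
  qed simp
  also have "y ^ \<mu> n * ((\<Prod>i<n. (x i - y)) * \<dots>) =
      (\<Sum>\<nu>\<in>tup n B. y ^ (\<mu> n + (\<Sum>j<n. \<mu> j - \<nu> j)) * gts n \<nu> x) * vand (Suc n) x"
    by (simp add: vand_Suc y_def sum_distrib_left sum_distrib_right power_add mult_ac)
  also have "(\<Sum>\<nu>\<in>tup n B. y ^ (\<mu> n + (\<Sum>j<n. \<mu> j - \<nu> j)) * gts n \<nu> x) = gts (Suc n) \<mu> x"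
    unfolding gts.simps y_def B_def
    by (intro sum.cong refl arg_cong2[where f = "(*)"] arg_cong2[where f = "(^)"]
        sum_diff_telescope_nat[symmetric]) (auto simp: tup_def)
  finally show ?case by (simp add: l_def)
qed

lemma gts_zero: "(\<And>j. j < n \<Longrightarrow> \<mu> j = 0) \<Longrightarrow> gts n \<mu> x = 1"
proof (induction n arbitrary: \<mu>)
  case (Suc n)
  have "tup n (\<lambda>j. {\<mu> (Suc j)..\<mu> j}) = {\<lambda>_. 0}"
  proof -
    have "tup n (\<lambda>j. {\<mu> (Suc j)..\<mu> j}) = tup n (\<lambda>_. {0})"
      using Suc.prems by (intro tup_cong) auto
    then show ?thesis by (auto simp: tup_def fun_eq_iff not_less[symmetric])
  qed
  then show ?case using Suc by simp
qed simp

lemma vandermonde: "vand n x = dt n (\<lambda>i j. x i ^ (n - 1 - j))"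
  using gts_alternant[of n "\<lambda>_. 0" x] by (simp add: gts_zero)

lemma continuous_gts [continuous_intros]:
  "(\<And>i. i < n \<Longrightarrow> ((\<lambda>t. x t i) \<longlongrightarrow> y i) F) \<Longrightarrow> ((\<lambda>t. gts n \<mu> (x t)) \<longlongrightarrow> gts n \<mu> y) F"
proof (induction n arbitrary: \<mu>)
  case (Suc n)
  then show ?case by (auto intro!: tendsto_intros)
qed simp

section \<open>Adding a variable to a Schur polynomial\<close>

lemma prod_insert_index:
  fixes f :: "nat \<Rightarrow> 'a::comm_monoid_mult"
  assumes "i \<le> n"
  shows "(\<Prod>k<n. f (insert_index i k)) = (\<Prod>j\<in>{..n} - {i}. f j)"
proof (rule prod.reindex_bij_witness[where j = "insert_index i" and i = "delete_index i"])
qed (use assms in \<open>auto simp: insert_index_def delete_index_def split: if_splits\<close>)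

text \<open>The sign counts the n - i indices beyond i, whose differences with \<open>x i\<close>
  are reversed.\<close>

lemma vand_insert_index:
  assumes "i \<le> n"
  shows "vand (Suc n) x = (-1) ^ (n + i) * vand n (x \<circ> insert_index i) * (\<Prod>j\<in>{..n} - {i}. (x j - x i))"
  using assms
proof (induction n)
  case 0
  then show ?case by (simp add: vand_def)
next
  case (Suc n)
  show ?case
  proof (cases "i = Suc n")
    case True
    have "vand (Suc n) (x \<circ> insert_index i) = vand (Suc n) x"
      unfolding vand_def using True by (intro prod.cong) auto
    moreover have "{..Suc n} - {i} = {..<Suc n}" using True by auto
    ultimately show ?thesis
      using True by (simp add: vand_Suc[of "Suc n"] o_def flip: mult_2)
  next
    case False
    then have i: "i \<le> n" using Suc.prems by simp
    have "vand (Suc (Suc n)) x = vand (Suc n) x * (\<Prod>k\<in>{..n}. (x k - x (Suc n)))"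
      by (simp add: vand_Suc[of "Suc n"] lessThan_Suc_atMost)
    also have "(\<Prod>k\<in>{..n}. (x k - x (Suc n))) = (x i - x (Suc n)) * (\<Prod>k\<in>{..n} - {i}. (x k - x (Suc n)))"
      using i by (intro prod.remove) auto
    also have "(\<Prod>k\<in>{..n} - {i}. (x k - x (Suc n))) = (\<Prod>k<n. (x (insert_index i k) - x (Suc n)))"
      by (rule prod_insert_index[OF i, symmetric])
    also have "vand (Suc n) x = (-1) ^ (n + i) * vand n (x \<circ> insert_index i) * (\<Prod>j\<in>{..n} - {i}. (x j - x i))"
      by (rule Suc.IH[OF i])
    also have "(-1) ^ (n + i) * vand n (x \<circ> insert_index i) * (\<Prod>j\<in>{..n} - {i}. (x j - x i)) *
        ((x i - x (Suc n)) * (\<Prod>k<n. (x (insert_index i k) - x (Suc n)))) =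
        (-1) ^ (Suc n + i) * vand (Suc n) (x \<circ> insert_index i) *
        ((x (Suc n) - x i) * (\<Prod>j\<in>{..n} - {i}. (x j - x i)))"
      using i by (simp add: vand_Suc algebra_simps)
    also have "(x (Suc n) - x i) * (\<Prod>j\<in>{..n} - {i}. (x j - x i)) = (\<Prod>j\<in>{..Suc n} - {i}. (x j - x i))"
    proof -
      have "{..Suc n} - {i} = insert (Suc n) ({..n} - {i})" using i by auto
      then show ?thesis by simp
    qed
    finally show ?thesis .
  qed
qed

text \<open>Adds a variable to a symmetric polynomial by summing over the variable left out. On
  Schur polynomials it keeps the partition (\<open>gts_extend_var\<close>); the price is the
  denominators, which force the variables to be distinct.\<close>

definition extend_var :: "nat \<Rightarrow> ((nat \<Rightarrow> real) \<Rightarrow> real) \<Rightarrow> (nat \<Rightarrow> real) \<Rightarrow> real" where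
  "extend_var n F x = (\<Sum>i\<le>n. F (x \<circ> insert_index i) * (\<Prod>j\<in>{..n} - {i}. x j / (x j - x i)))"

lemma inj_on_insert_index:
  assumes "inj_on x {..<Suc n}"
  shows "inj_on (x \<circ> insert_index i) {..<n}"
proof (rule comp_inj_on)
  show "inj_on (insert_index i) {..<n}"
    by (auto simp: inj_on_def insert_index_def split: if_splits)
  show "inj_on x (insert_index i ` {..<n})"
    using assms by (rule inj_on_subset) (auto simp: insert_index_def)
qed

text \<open>Expansion of the alternant along its last column, which consists of ones because the
  last part is 0. Each minor is an alternant in the other variables times their product.\<close>

lemma gts_extend_var:
  assumes dec: "\<And>j. Suc j < Suc n \<Longrightarrow> \<mu> (Suc j) \<le> \<mu> j" and "\<mu> n = 0" and inj: "inj_on x {..<Suc n}"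
  shows "gts (Suc n) \<mu> x = extend_var n (gts n \<mu>) x"
proof -
  have nz: "vand (Suc n) x \<noteq> 0" by (rule vand_nonzero[OF inj])
  have "gts (Suc n) \<mu> x * vand (Suc n) x = dt (Suc n) (\<lambda>i j. x i ^ (\<mu> j + (n - j)))"
    using gts_alternant[of "Suc n" \<mu> x] dec by simp
  also have "\<dots> = (\<Sum>i\<le>n. (-1) ^ (n + i) * dt n (\<lambda>k j. x (insert_index i k) ^ (\<mu> j + (n - j))))"
    unfolding dt_laplace_col using assms(2) by simp
  also have "\<dots> = (\<Sum>i\<le>n. gts n \<mu> (x \<circ> insert_index i) * (\<Prod>j\<in>{..n} - {i}. x j / (x j - x i)) *
      vand (Suc n) x)"
  proof (rule sum.cong)
    fix i assume i: "i \<in> {..n}"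
    have nz': "(\<Prod>j\<in>{..n} - {i}. (x j - x i)) \<noteq> 0"
      using inj i by (auto simp: inj_on_def lessThan_Suc_atMost)
    have "dt n (\<lambda>k j. x (insert_index i k) ^ (\<mu> j + (n - j))) =
        dt n (\<lambda>k j. x (insert_index i k) * (x \<circ> insert_index i) k ^ (\<mu> j + (n - 1 - j)))"
    proof (rule dt_cong)
      fix k j assume "j < n"
      then have "\<mu> j + (n - j) = Suc (\<mu> j + (n - 1 - j))" by simp
      then show "x (insert_index i k) ^ (\<mu> j + (n - j)) =
          x (insert_index i k) * (x \<circ> insert_index i) k ^ (\<mu> j + (n - 1 - j))" by simp
    qed
    also have "\<dots> = (\<Prod>j\<in>{..n} - {i}. x j) * (gts n \<mu> (x \<circ> insert_index i) * vand n (x \<circ> insert_index i))"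
      unfolding dt_scale_rows using i dec
      by (subst gts_alternant) (auto simp: prod_insert_index)
    finally have "dt n (\<lambda>k j. x (insert_index i k) ^ (\<mu> j + (n - j))) = \<dots>" .
    then show "(-1) ^ (n + i) * dt n (\<lambda>k j. x (insert_index i k) ^ (\<mu> j + (n - j))) =
        gts n \<mu> (x \<circ> insert_index i) * (\<Prod>j\<in>{..n} - {i}. x j / (x j - x i)) * vand (Suc n) x"
      using i nz' by (simp add: vand_insert_index[of i n] prod_dividef)
  qed simp
  also have "\<dots> = extend_var n (gts n \<mu>) x * vand (Suc n) x"
    by (simp add: extend_var_def sum_distrib_right)
  finally show ?thesis using nz by simp
qed

text \<open>In tableau terms, the added column of length n has to contain every variable exactly
  once.\<close>

lemma gts_shift:
  "gts n (\<lambda>j. if j < n then Suc (\<mu> j) else 0) x = (\<Prod>i<n. x i) * gts n \<mu> x"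
proof (induction n arbitrary: \<mu>)
  case (Suc n)
  let ?\<mu> = "\<lambda>j. if j < Suc n then Suc (\<mu> j) else 0"
  let ?sh = "\<lambda>\<nu> j. if j < n then Suc (\<nu> j) else (0::nat)"
  have "(\<Sum>\<nu>\<in>tup n (\<lambda>j. {?\<mu> (Suc j)..?\<mu> j}). x n ^ ((\<Sum>j<Suc n. ?\<mu> j) - (\<Sum>j<n. \<nu> j)) * gts n \<nu> x) =
     (\<Sum>\<nu>\<in>tup n (\<lambda>j. {\<mu> (Suc j)..\<mu> j}). x n ^ ((\<Sum>j<Suc n. ?\<mu> j) - (\<Sum>j<n. ?sh \<nu> j)) * gts n (?sh \<nu>) x)"
  proof (rule sum.reindex_bij_witness[where i = ?sh and j = "\<lambda>\<nu> j. \<nu> j - 1"])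
    fix \<nu> assume \<nu>: "\<nu> \<in> tup n (\<lambda>j. {?\<mu> (Suc j)..?\<mu> j})"
    then have ge: "\<And>j. j < n \<Longrightarrow> Suc (\<mu> (Suc j)) \<le> \<nu> j \<and> \<nu> j \<le> Suc (\<mu> j)"
      by (auto simp: tup_def)
    have eq: "?sh (\<lambda>j. \<nu> j - 1) = \<nu>"
    proof
      fix j show "?sh (\<lambda>j. \<nu> j - 1) j = \<nu> j"
        using ge[of j] \<nu> by (auto simp: tup_def)
    qed
    show "?sh (\<lambda>j. \<nu> j - 1) = \<nu>" by (rule eq)
    show "(\<lambda>j. \<nu> j - 1) \<in> tup n (\<lambda>j. {\<mu> (Suc j)..\<mu> j})"
      using ge \<nu> by (fastforce simp: tup_def)
    show "x n ^ ((\<Sum>j<Suc n. ?\<mu> j) - (\<Sum>j<n. ?sh (\<lambda>j. \<nu> j - 1) j)) * gts n (?sh (\<lambda>j. \<nu> j - 1)) x =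
        x n ^ ((\<Sum>j<Suc n. ?\<mu> j) - (\<Sum>j<n. \<nu> j)) * gts n \<nu> x"
      unfolding eq ..
  next
    fix \<nu> assume \<nu>: "\<nu> \<in> tup n (\<lambda>j. {\<mu> (Suc j)..\<mu> j})"
    show "(\<lambda>j. ?sh \<nu> j - 1) = \<nu>"
    proof
      fix j show "?sh \<nu> j - 1 = \<nu> j" using \<nu> by (simp add: tup_def)
    qed
    show "?sh \<nu> \<in> tup n (\<lambda>j. {?\<mu> (Suc j)..?\<mu> j})" using \<nu> by (auto simp: tup_def)
  qed
  also have "\<dots> = (\<Sum>\<nu>\<in>tup n (\<lambda>j. {\<mu> (Suc j)..\<mu> j}).
      (\<Prod>i<Suc n. x i) * (x n ^ ((\<Sum>j<Suc n. \<mu> j) - (\<Sum>j<n. \<nu> j)) * gts n \<nu> x))"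
  proof (rule sum.cong)
    fix \<nu> assume \<nu>: "\<nu> \<in> tup n (\<lambda>j. {\<mu> (Suc j)..\<mu> j})"
    have "(\<Sum>j<Suc n. ?\<mu> j) = (\<Sum>j<Suc n. \<mu> j) + Suc n" "(\<Sum>j<n. ?sh \<nu> j) = (\<Sum>j<n. \<nu> j) + n"
      by (simp_all add: sum.distrib[of _ "\<lambda>_. Suc 0", simplified])
    moreover have "(\<Sum>j<n. \<nu> j) \<le> (\<Sum>j<n. \<mu> j)"
      using \<nu> by (intro sum_mono) (auto simp: tup_def)
    ultimately have "(\<Sum>j<Suc n. ?\<mu> j) - (\<Sum>j<n. ?sh \<nu> j) = Suc ((\<Sum>j<Suc n. \<mu> j) - (\<Sum>j<n. \<nu> j))"
      by simp
    then show "x n ^ ((\<Sum>j<Suc n. ?\<mu> j) - (\<Sum>j<n. ?sh \<nu> j)) * gts n (?sh \<nu>) x =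
        (\<Prod>i<Suc n. x i) * (x n ^ ((\<Sum>j<Suc n. \<mu> j) - (\<Sum>j<n. \<nu> j)) * gts n \<nu> x)"
      unfolding Suc.IH by simp
  qed simp
  finally show ?case by (simp only: gts.simps sum_distrib_left)
qed simp

section \<open>Partitions with columns of even length\<close>

text \<open>Rows are counted from 0, so all columns have even length precisely when none of them
  ends between the rows 2 i and 2 i + 1.\<close>

definition even_cols :: "nat \<Rightarrow> nat \<Rightarrow> (nat \<Rightarrow> nat) set" where
  "even_cols n m = {\<mu>. (\<forall>j\<ge>n. \<mu> j = 0) \<and> (\<forall>j. \<mu> (Suc j) \<le> \<mu> j) \<and> \<mu> 0 \<le> m \<and>
     (\<forall>i. \<mu> (2 * i) = \<mu> (Suc (2 * i)))}"

definition even_sum :: "nat \<Rightarrow> nat \<Rightarrow> (nat \<Rightarrow> real) \<Rightarrow> real" where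
  "even_sum n m x = (\<Sum>\<mu>\<in>even_cols n m. gts n \<mu> x)"

lemma decreasing_le_first: "(\<And>j. \<mu> (Suc j) \<le> \<mu> j) \<Longrightarrow> \<mu> j \<le> (\<mu> 0 :: nat)"
  by (induction j) (auto intro: order.trans)

lemma finite_even_cols: "finite (even_cols n m)"
proof (rule finite_subset)
  show "even_cols n m \<subseteq> tup n (\<lambda>_. {..m})"
    by (auto simp: even_cols_def tup_def intro: order.trans[OF decreasing_le_first])
qed (simp add: finite_tup)

lemma even_cols_0_left [simp]: "even_cols 0 m = {\<lambda>_. 0}"
  by (auto simp: even_cols_def)

lemma even_cols_0_right [simp]: "even_cols n 0 = {\<lambda>_. 0}"
proof -
  have "\<mu> = (\<lambda>_. 0)" if "\<mu> \<in> even_cols n 0" for \<mu>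
  proof
    fix j show "\<mu> j = 0"
      using that decreasing_le_first[of \<mu> j] by (simp add: even_cols_def)
  qed
  then show ?thesis by (auto simp: even_cols_def)
qed

lemma even_sum_0_left: "even_sum 0 m x = 1"
  and even_sum_0_right: "even_sum n 0 x = 1"
  by (simp_all add: even_sum_def gts_zero)

lemma extend_var_sum:
  "extend_var n (\<lambda>x. \<Sum>\<mu>\<in>A. f \<mu> x) x = (\<Sum>\<mu>\<in>A. extend_var n (f \<mu>) x)"
  unfolding extend_var_def by (subst sum.swap) (simp add: sum_distrib_right)

lemma extend_var_cong:
  assumes "\<And>i. i \<le> n \<Longrightarrow> F (x \<circ> insert_index i) = G (x \<circ> insert_index i)"
  shows "extend_var n F x = extend_var n G x"
  unfolding extend_var_def using assms by (intro sum.cong) auto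

text \<open>For even n, row n is paired with row n + 1, which is empty.\<close>

lemma even_cols_Suc_even: "even n \<Longrightarrow> even_cols (Suc n) m = even_cols n m"
proof (intro equalityI subsetI)
  fix \<mu> assume "even n" and \<mu>: "\<mu> \<in> even_cols (Suc n) m"
  then obtain i where "n = 2 * i" by blast
  with \<mu> have "\<mu> n = \<mu> (Suc n)" "\<mu> (Suc n) = 0" by (auto simp: even_cols_def)
  then have "\<mu> j = 0" if "j \<ge> n" for j
    using that \<mu> by (cases "j = n") (auto simp: even_cols_def)
  with \<mu> show "\<mu> \<in> even_cols n m" by (auto simp: even_cols_def)
qed (auto simp: even_cols_def)

lemma even_sum_Suc_even:
  assumes "even n" and "inj_on x {..<Suc n}"
  shows "even_sum (Suc n) m x = extend_var n (even_sum n m) x"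
  unfolding even_sum_def even_cols_Suc_even[OF assms(1)] extend_var_sum
  using assms(2) by (intro sum.cong refl gts_extend_var) (auto simp: even_cols_def)

text \<open>If the last two rows are nonempty, the first column is full and can be removed, which
  lowers the width. Otherwise both are empty, since they are equal, and \<open>extend_var\<close>
  adds the two extra variables to a sum over n rows.\<close>

lemma even_sum_rec:
  assumes "even n" and inj: "inj_on x {..<Suc (Suc n)}"
  shows "even_sum (Suc (Suc n)) (Suc m) x = (\<Prod>i<Suc (Suc n). x i) * even_sum (Suc (Suc n)) m x +
    extend_var (Suc n) (extend_var n (even_sum n (Suc m))) x"
proof -
  let ?N = "Suc (Suc n)"
  let ?sh = "\<lambda>\<mu> j. if j < ?N then Suc (\<mu> j) else (0::nat)"
  let ?P = "{\<mu> \<in> even_cols ?N (Suc m). \<mu> n \<noteq> 0}"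
  obtain k where k: "n = 2 * k" using assms(1) by blast
  have eq: "even_cols ?N (Suc m) = ?P \<union> even_cols n (Suc m)"
  proof (intro equalityI subsetI)
    fix \<mu> assume \<mu>: "\<mu> \<in> even_cols ?N (Suc m)"
    show "\<mu> \<in> ?P \<union> even_cols n (Suc m)"
    proof (cases "\<mu> n = 0")
      case True
      moreover have "\<mu> n = \<mu> (Suc n)" using \<mu> by (auto simp: even_cols_def k)
      ultimately have "\<mu> j = 0" if "j \<ge> n" for j
        using that \<mu> by (cases "j = n"; cases "j = Suc n") (auto simp: even_cols_def)
      with \<mu> show ?thesis by (auto simp: even_cols_def)
    qed (use \<mu> in auto)
  qed (auto simp: even_cols_def)
  have "even_sum ?N (Suc m) x = (\<Sum>\<mu>\<in>?P. gts ?N \<mu> x) + (\<Sum>\<mu>\<in>even_cols n (Suc m). gts ?N \<mu> x)"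
    unfolding even_sum_def
    by (subst eq, rule sum.union_disjoint) (simp_all add: finite_even_cols, auto simp: even_cols_def)
  also have "(\<Sum>\<mu>\<in>?P. gts ?N \<mu> x) = (\<Sum>\<mu>\<in>even_cols ?N m. gts ?N (?sh \<mu>) x)"
  proof (rule sum.reindex_bij_witness[where i = ?sh and j = "\<lambda>\<mu> j. \<mu> j - 1"])
    fix \<mu> assume \<mu>: "\<mu> \<in> ?P"
    have pos: "\<mu> j > 0" if "j < ?N" for j
    proof -
      have "\<mu> (Suc n) = \<mu> n" using \<mu> by (auto simp: even_cols_def k)
      moreover have "antimono \<mu>" using \<mu> by (auto simp: even_cols_def antimono_iff_le_Suc)
      ultimately have "\<mu> n \<le> \<mu> j" using that by (metis antimonoD less_Suc_eq_le)
      then show ?thesis using \<mu> by simp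
    qed
    have e: "?sh (\<lambda>j. \<mu> j - 1) = \<mu>"
    proof
      fix j show "?sh (\<lambda>j. \<mu> j - 1) j = \<mu> j" using pos[of j] \<mu> by (auto simp: even_cols_def)
    qed
    show "?sh (\<lambda>j. \<mu> j - 1) = \<mu>" by (rule e)
    show "gts ?N (?sh (\<lambda>j. \<mu> j - 1)) x = gts ?N \<mu> x" unfolding e ..
    show "(\<lambda>j. \<mu> j - 1) \<in> even_cols ?N m"
      using \<mu> by (auto simp: even_cols_def intro: diff_le_mono)
  next
    fix \<mu> assume \<mu>: "\<mu> \<in> even_cols ?N m"
    show "(\<lambda>j. ?sh \<mu> j - 1) = \<mu>" using \<mu> by (auto simp: even_cols_def)
    have "(2 * i < ?N) = (Suc (2 * i) < ?N)" for i unfolding k by presburger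
    then show "?sh \<mu> \<in> ?P" using \<mu> by (auto simp: even_cols_def)
  qed
  also have "\<dots> = (\<Prod>i<?N. x i) * even_sum ?N m x"
    unfolding gts_shift even_sum_def sum_distrib_left ..
  also have "(\<Sum>\<mu>\<in>even_cols n (Suc m). gts ?N \<mu> x) =
      (\<Sum>\<mu>\<in>even_cols n (Suc m). extend_var (Suc n) (extend_var n (gts n \<mu>)) x)"
  proof (rule sum.cong)
    fix \<mu> assume \<mu>: "\<mu> \<in> even_cols n (Suc m)"
    have "gts ?N \<mu> x = extend_var (Suc n) (gts (Suc n) \<mu>) x"
      using \<mu> inj by (intro gts_extend_var) (auto simp: even_cols_def)
    also have "\<dots> = extend_var (Suc n) (extend_var n (gts n \<mu>)) x"
      using \<mu> inj_on_insert_index[OF inj] by (intro extend_var_cong gts_extend_var) (auto simp: even_cols_def)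
    finally show "gts ?N \<mu> x = \<dots>" .
  qed simp
  also have "\<dots> = extend_var (Suc n) (extend_var n (even_sum n (Suc m))) x"
    unfolding even_sum_def[abs_def] extend_var_sum ..
  finally show ?thesis .
qed

section \<open>Alternating sums over subsets of the variables\<close>

text \<open>For symmetric functions of distinct variables only the set of values counts; this makes
  subsets of variables available as summation indices.\<close>

definition set_extend :: "(real set \<Rightarrow> real) \<Rightarrow> real set \<Rightarrow> real" where
  "set_extend F A = (\<Sum>a\<in>A. F (A - {a}) * (\<Prod>b\<in>A - {a}. b / (b - a)))"

lemma image_insert_index:
  assumes "inj_on x {..<Suc n}" "i \<le> n"
  shows "(x \<circ> insert_index i) ` {..<n} = x ` {..<Suc n} - {x i}"
proof -
  have "insert_index i ` {..<n} = {..<Suc n} - {i}"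
  proof (intro equalityI subsetI)
    fix j assume "j \<in> {..<Suc n} - {i}"
    then have "j = insert_index i (delete_index i j)" "delete_index i j < n"
      using assms(2) by (auto simp: insert_index_def delete_index_def)
    then show "j \<in> insert_index i ` {..<n}" by blast
  qed (use assms(2) in \<open>auto simp: insert_index_def\<close>)
  then have "(x \<circ> insert_index i) ` {..<n} = x ` ({..<Suc n} - {i})"
    by (metis image_comp)
  also have "\<dots> = x ` {..<Suc n} - {x i}"
    using inj_on_image_set_diff[OF assms(1), of "{..<Suc n}" "{i}"] assms(2) by simp
  finally show ?thesis .
qed

lemma extend_var_eq_set_extend:
  assumes inj: "inj_on x {..<Suc n}"
    and F: "\<And>i. i \<le> n \<Longrightarrow> F (x \<circ> insert_index i) = H (x ` {..<Suc n} - {x i})"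
  shows "extend_var n F x = set_extend H (x ` {..<Suc n})"
proof -
  have "set_extend H (x ` {..<Suc n}) = (\<Sum>i\<le>n. H (x ` {..<Suc n} - {x i}) *
      (\<Prod>b\<in>x ` {..<Suc n} - {x i}. b / (b - x i)))"
    unfolding set_extend_def by (subst sum.reindex[OF inj]) (simp add: lessThan_Suc_atMost)
  also have "\<dots> = extend_var n F x"
    unfolding extend_var_def
  proof (rule sum.cong)
    fix i assume "i \<in> {..n}"
    then have "x ` {..<Suc n} - {x i} = x ` ({..n} - {i})"
      using inj_on_image_set_diff[OF inj, of "{..<Suc n}" "{i}"] by (simp add: lessThan_Suc_atMost)
    moreover have "inj_on x ({..n} - {i})"
      using inj by (rule inj_on_subset) auto
    ultimately have "(\<Prod>b\<in>x ` {..<Suc n} - {x i}. b / (b - x i)) = (\<Prod>j\<in>{..n} - {i}. x j / (x j - x i))"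
      by (simp add: prod.reindex)
    then show "H (x ` {..<Suc n} - {x i}) * (\<Prod>b\<in>x ` {..<Suc n} - {x i}. b / (b - x i)) =
        F (x \<circ> insert_index i) * (\<Prod>j\<in>{..n} - {i}. x j / (x j - x i))"
      using F \<open>i \<in> {..n}\<close> by simp
  qed simp
  finally show ?thesis ..
qed

definition cross :: "real set \<Rightarrow> real set \<Rightarrow> real" where
  "cross S K = (\<Prod>s\<in>S. \<Prod>k\<in>K. s / (s - k))"

definition even_conv :: "(real set \<Rightarrow> real) \<Rightarrow> (real set \<Rightarrow> real) \<Rightarrow> real set \<Rightarrow> real" where
  "even_conv w h A = (\<Sum>S | S \<subseteq> A \<and> even (card S). w S * cross S (A - S) * h (A - S))"

text \<open>For a outside \<open>S\<close>, the factors b / (b - a) with b in \<open>S\<close>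
  complete \<open>cross S (A - S - {a})\<close> to \<open>cross S (A - S)\<close>. So the operator
  acts on the complement of \<open>S\<close> alone.\<close>

lemma set_extend_even_conv:
  assumes "finite A"
  shows "set_extend (even_conv w h) A = even_conv w (set_extend h) A"
proof -
  have "set_extend (even_conv w h) A = (\<Sum>a\<in>A. \<Sum>S | S \<subseteq> A - {a} \<and> even (card S).
      w S * cross S (A - S) * (h (A - S - {a}) * (\<Prod>b\<in>A - S - {a}. b / (b - a))))"
    unfolding set_extend_def even_conv_def sum_distrib_right
  proof (intro sum.cong refl)
    fix a S assume a: "a \<in> A" and "S \<in> {S. S \<subseteq> A - {a} \<and> even (card S)}"
    then have S: "S \<subseteq> A" "a \<notin> S" by auto
    have fin: "finite S" using S assms finite_subset by blast
    have 1: "(\<Prod>b\<in>A - {a}. b / (b - a)) = (\<Prod>b\<in>S. b / (b - a)) * (\<Prod>b\<in>A - S - {a}. b / (b - a))"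
      using S assms fin by (subst prod.union_disjoint[symmetric]) (auto intro!: prod.cong)
    have 2: "cross S (A - S) = cross S (A - S - {a}) * (\<Prod>b\<in>S. b / (b - a))"
      unfolding cross_def prod.distrib[symmetric]
      using S a assms by (intro prod.cong refl) (subst prod.remove[of _ a], auto)
    have 3: "A - {a} - S = A - S - {a}" by auto
    show "w S * cross S (A - {a} - S) * h (A - {a} - S) * (\<Prod>b\<in>A - {a}. b / (b - a)) =
        w S * cross S (A - S) * (h (A - S - {a}) * (\<Prod>b\<in>A - S - {a}. b / (b - a)))"
      unfolding 1 2 3 by simp
  qed
  also have "\<dots> = (\<Sum>a\<in>A. \<Sum>S\<in>{S. S \<in> {S. S \<subseteq> A \<and> even (card S)} \<and> a \<notin> S}.
      w S * cross S (A - S) * (h (A - S - {a}) * (\<Prod>b\<in>A - S - {a}. b / (b - a))))"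
    by (intro sum.cong refl) auto
  also have "\<dots> = (\<Sum>S | S \<subseteq> A \<and> even (card S). \<Sum>a\<in>{a. a \<in> A \<and> a \<notin> S}.
      w S * cross S (A - S) * (h (A - S - {a}) * (\<Prod>b\<in>A - S - {a}. b / (b - a))))"
    by (rule sum.swap_restrict) (use assms in auto)
  also have "\<dots> = (\<Sum>S | S \<subseteq> A \<and> even (card S). \<Sum>a\<in>A - S.
      w S * cross S (A - S) * (h (A - S - {a}) * (\<Prod>b\<in>A - S - {a}. b / (b - a))))"
    by (simp only: set_diff_eq)
  also have "\<dots> = even_conv w (set_extend h) A"
    by (simp add: even_conv_def set_extend_def sum_distrib_left)
  finally show ?thesis .
qed

text \<open>The width \<open>m\<close> of the box enters only through the powers \<open>s ^ m\<close>, so that for variables in \<open>(0, 1)\<close>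
  only the term with \<open>S = {}\<close> survives as \<open>m\<close> tends to infinity.\<close>

definition sign_sum :: "(real set \<Rightarrow> real) \<Rightarrow> (real set \<Rightarrow> real) \<Rightarrow> nat \<Rightarrow> real set \<Rightarrow> real" where
  "sign_sum w h m = even_conv (\<lambda>S. (\<Prod>s\<in>S. s) ^ m * w S) h"

text \<open>Removing an even set keeps the parity of the size, so an equation for h that is known in
  one parity only can still be used.\<close>

lemma even_conv_cong:
  assumes "\<And>K. K \<subseteq> A \<Longrightarrow> even (card A) = even (card K) \<Longrightarrow> h K = h' K" and "finite A"
  shows "even_conv w h A = even_conv w h' A"
  unfolding even_conv_def
proof (intro sum.cong refl arg_cong2[where f = "(*)"] assms(1))
  fix S assume "S \<in> {S. S \<subseteq> A \<and> even (card S)}"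
  then have S: "S \<subseteq> A" "even (card S)" "finite S" using assms(2) finite_subset by auto
  have "card A = card S + card (A - S)"
    using S assms(2) by (metis Diff_disjoint Diff_partition card_Un_disjoint finite_Diff)
  then show "even (card A) = even (card (A - S))" using S by simp
qed auto

text \<open>The hypothesis on h is the recursion at infinite width. The product over
  \<open>A\<close> splits into a part on \<open>S\<close>, which raises the power from m to m + 1,
  and a part on the complement, which goes to h.\<close>

lemma sign_sum_rec:
  assumes "finite A" "even (card A)"
    and h: "\<And>K. K \<subseteq> A \<Longrightarrow> even (card K) \<Longrightarrow> h K = (\<Prod>k\<in>K. k) * h K + set_extend (set_extend h) K"
  shows "sign_sum w h (Suc m) A =
    (\<Prod>a\<in>A. a) * sign_sum w h m A + set_extend (set_extend (sign_sum w h (Suc m))) A"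
proof -
  let ?w = "\<lambda>m S. (\<Prod>s\<in>S. s) ^ m * w S"
  have ext: "set_extend (set_extend (sign_sum w h (Suc m))) A = even_conv (?w (Suc m)) (set_extend (set_extend h)) A"
  proof -
    have "set_extend (set_extend (sign_sum w h (Suc m))) A =
        set_extend (even_conv (?w (Suc m)) (set_extend h)) A"
      unfolding set_extend_def[of _ A] sign_sum_def
      using assms(1) by (intro sum.cong refl arg_cong2[where f = "(*)"] set_extend_even_conv) auto
    then show ?thesis using assms(1) by (simp add: set_extend_even_conv)
  qed
  have "sign_sum w h (Suc m) A =
      even_conv (?w (Suc m)) (\<lambda>K. (\<Prod>k\<in>K. k) * h K + set_extend (set_extend h) K) A"
    unfolding sign_sum_def by (rule even_conv_cong) (use assms h in auto)
  also have "\<dots> = even_conv (?w (Suc m)) (\<lambda>K. (\<Prod>k\<in>K. k) * h K) A +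
      even_conv (?w (Suc m)) (set_extend (set_extend h)) A"
    by (simp add: even_conv_def distrib_left sum.distrib)
  also have "even_conv (?w (Suc m)) (\<lambda>K. (\<Prod>k\<in>K. k) * h K) A = (\<Prod>a\<in>A. a) * sign_sum w h m A"
    unfolding even_conv_def sign_sum_def sum_distrib_left
  proof (intro sum.cong refl)
    fix S assume "S \<in> {S. S \<subseteq> A \<and> even (card S)}"
    then have "(\<Prod>a\<in>A. a) = (\<Prod>s\<in>S. s) * (\<Prod>k\<in>A - S. k)"
      using assms(1) by (metis (no_types, lifting) mem_Collect_eq mult.commute prod.subset_diff)
    then show "?w (Suc m) S * cross S (A - S) * ((\<Prod>k\<in>A - S. k) * h (A - S)) =
        (\<Prod>a\<in>A. a) * (?w m S * cross S (A - S) * h (A - S))"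
      by simp
  qed
  finally show ?thesis unfolding ext .
qed

text \<open>Both sides satisfy the same recursion, which lowers either the width by 1 or the number
  of variables by 2. It ends at width 0, where \<open>base\<close> applies, or without
  variables.\<close>

lemma even_sum_eq_sign_sum_even:
  assumes "even n" "inj_on x {..<n}"
    and h: "\<And>K. K \<subseteq> x ` {..<n} \<Longrightarrow> even (card K) \<Longrightarrow>
      h K = (\<Prod>k\<in>K. k) * h K + set_extend (set_extend h) K"
    and base: "\<And>K. K \<subseteq> x ` {..<n} \<Longrightarrow> even (card K) \<Longrightarrow> sign_sum w h 0 K = 1"
  shows "even_sum n m x = sign_sum w h m (x ` {..<n})"
  using assms
proof (induction n arbitrary: x m rule: less_induct)
  case (less n)
  let ?A = "x ` {..<n}"
  have card: "card ?A = n" using less.prems by (simp add: card_image)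
  show ?case
  proof (cases n)
    case 0
    then show ?thesis using less.prems(4)[of "{}"]
      by (simp add: even_sum_0_left sign_sum_def even_conv_def cong: conj_cong)
  next
    case (Suc n')
    then obtain k where n: "n = Suc (Suc k)" using less.prems(1) by (cases n') auto
    have inj: "inj_on x {..<Suc (Suc k)}" using less.prems n by simp
    have "even k" using less.prems n by simp
    have step: "extend_var (Suc k) (extend_var k (even_sum k (Suc m))) x =
        set_extend (set_extend (sign_sum w h (Suc m))) ?A" for m
      unfolding n
    proof (rule extend_var_eq_set_extend[OF inj])
      fix i assume i: "i \<le> Suc k"
      let ?x = "x \<circ> insert_index i"
      have inj': "inj_on ?x {..<Suc k}" by (rule inj_on_insert_index[OF inj])
      have im: "?x ` {..<Suc k} = x ` {..<Suc (Suc k)} - {x i}"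
        by (rule image_insert_index[OF inj i])
      show "extend_var k (even_sum k (Suc m)) ?x =
          set_extend (sign_sum w h (Suc m)) (x ` {..<Suc (Suc k)} - {x i})"
        unfolding im[symmetric]
      proof (rule extend_var_eq_set_extend[OF inj'])
        fix j assume j: "j \<le> k"
        have im': "(?x \<circ> insert_index j) ` {..<k} = ?x ` {..<Suc k} - {?x j}"
          by (rule image_insert_index[OF inj' j])
        then have sub: "(?x \<circ> insert_index j) ` {..<k} \<subseteq> x ` {..<n}" using im n by auto
        show "even_sum k (Suc m) (?x \<circ> insert_index j) =
            sign_sum w h (Suc m) (?x ` {..<Suc k} - {?x j})"
          unfolding im'[symmetric]
          using less.prems \<open>even k\<close> inj_on_insert_index[OF inj'] sub n
          by (intro less.IH) (auto simp del: comp_apply)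
      qed
    qed
    show ?thesis
    proof (induction m)
      case 0
      then show ?case using less.prems card by (simp add: even_sum_0_right)
    next
      case (Suc m)
      have "even_sum n (Suc m) x = (\<Prod>i<n. x i) * sign_sum w h m ?A +
          set_extend (set_extend (sign_sum w h (Suc m))) ?A"
        using even_sum_rec[OF \<open>even k\<close> inj, of m] step[of m] Suc.IH n by simp
      also have "(\<Prod>i<n. x i) = (\<Prod>a\<in>?A. a)"
        using less.prems by (simp add: prod.reindex)
      also have "(\<Prod>a\<in>?A. a) * sign_sum w h m ?A + set_extend (set_extend (sign_sum w h (Suc m))) ?A =
          sign_sum w h (Suc m) ?A"
        using less.prems card by (intro sign_sum_rec[symmetric]) auto
      finally show ?case .
    qed
  qed
qed

text \<open>The equations required of h follow by letting m tend to infinity in the recursions of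
  \<open>even_sum\<close>; h enters as the limit only, whatever its formula.\<close>

theorem even_sum_eq_sign_sum:
  assumes inj: "inj_on x {..<n}"
    and lim: "\<And>k y. inj_on y {..<k} \<Longrightarrow> y ` {..<k} \<subseteq> x ` {..<n} \<Longrightarrow>
      (\<lambda>m. even_sum k m y) \<longlonglongrightarrow> h (y ` {..<k})"
    and base: "\<And>K. K \<subseteq> x ` {..<n} \<Longrightarrow> even (card K) \<Longrightarrow> sign_sum w h 0 K = 1"
  shows "even_sum n m x = sign_sum w h m (x ` {..<n})"
proof -
  have lim_ext: "(\<lambda>m. extend_var k (even_sum k m) y) \<longlonglongrightarrow> set_extend h (y ` {..<Suc k})"
    if y: "inj_on y {..<Suc k}" "y ` {..<Suc k} \<subseteq> x ` {..<n}" for k y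
  proof -
    have "(\<lambda>m. extend_var k (even_sum k m) y) \<longlonglongrightarrow> extend_var k (\<lambda>z. h (z ` {..<k})) y"
      unfolding extend_var_def using y image_insert_index[OF y(1)]
      by (intro tendsto_intros lim inj_on_insert_index) auto
    also have "extend_var k (\<lambda>z. h (z ` {..<k})) y = set_extend h (y ` {..<Suc k})"
      by (rule extend_var_eq_set_extend[OF y(1)]) (simp add: image_insert_index[OF y(1)] del: comp_apply)
    finally show ?thesis .
  qed
  have enum: "\<exists>y. inj_on y {..<card K} \<and> y ` {..<card K} = K" if "K \<subseteq> x ` {..<n}" for K
    using ex_bij_betw_nat_finite[of K] finite_subset[OF that]
    by (auto simp: bij_betw_def atLeast0LessThan)
  \<comment> \<open>For an odd number of variables \<open>even_sum\<close> is already an extension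
    from one variable less, and the limit inherits this.\<close>
  have odd: "h K = set_extend h K" if K: "K \<subseteq> x ` {..<n}" "odd (card K)" for K
  proof -
    obtain k where k: "card K = Suc k" "even k" using K(2) by (cases "card K") auto
    obtain y where y: "inj_on y {..<Suc k}" "y ` {..<Suc k} = K" using enum[OF K(1)] k by auto
    have "(\<lambda>m. extend_var k (even_sum k m) y) \<longlonglongrightarrow> h K"
      using lim[of y "Suc k"] y K by (simp add: even_sum_Suc_even[OF k(2)])
    moreover have "(\<lambda>m. extend_var k (even_sum k m) y) \<longlonglongrightarrow> set_extend h K"
      using lim_ext[of y k] y K by simp
    ultimately show ?thesis by (rule LIMSEQ_unique)
  qed
  have even: "h K = (\<Prod>k\<in>K. k) * h K + set_extend (set_extend h) K"
    if K: "K \<subseteq> x ` {..<n}" "even (card K)" for K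
  proof (cases "K = {}")
    case True
    then show ?thesis by (simp add: set_extend_def)
  next
    case False
    then have "card K \<noteq> 0" using finite_subset[OF K(1)] by simp
    then obtain k where k: "card K = Suc (Suc k)" "even k"
      using K(2) by (cases "card K"; cases "card K - 1") auto
    obtain y where y: "inj_on y {..<Suc (Suc k)}" "y ` {..<Suc (Suc k)} = K" using enum[OF K(1)] k by auto
    have "(\<lambda>m. extend_var (Suc k) (extend_var k (even_sum k m)) y) \<longlonglongrightarrow>
        extend_var (Suc k) (\<lambda>z. set_extend h (z ` {..<Suc k})) y"
      unfolding extend_var_def[of "Suc k"] using y(1) y(2)[symmetric] K image_insert_index[OF y(1)]
      by (intro tendsto_intros lim_ext inj_on_insert_index) auto
    also have "extend_var (Suc k) (\<lambda>z. set_extend h (z ` {..<Suc k})) y = set_extend (set_extend h) K"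
      unfolding y(2)[symmetric]
      by (rule extend_var_eq_set_extend[OF y(1)]) (simp add: image_insert_index[OF y(1)] del: comp_apply)
    finally have 1: "(\<lambda>m. (\<Prod>i<Suc (Suc k). y i) * even_sum (Suc (Suc k)) m y +
        extend_var (Suc k) (extend_var k (even_sum k (Suc m))) y) \<longlonglongrightarrow>
        (\<Prod>i<Suc (Suc k). y i) * h K + set_extend (set_extend h) K"
      using lim[OF y(1)] y(2) K by (intro tendsto_intros LIMSEQ_Suc) auto
    \<comment> \<open>The same sequence as in 1, now collapsed by the recursion into
      \<open>even_sum\<close> at width m + 1.\<close>
    have 2: "(\<lambda>m. (\<Prod>i<Suc (Suc k). y i) * even_sum (Suc (Suc k)) m y +
        extend_var (Suc k) (extend_var k (even_sum k (Suc m))) y) \<longlonglongrightarrow> h K"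
      unfolding even_sum_rec[OF k(2) y(1), symmetric]
      using lim[OF y(1)] y(2) K by (intro LIMSEQ_Suc) auto
    have "(\<Prod>i<Suc (Suc k). y i) = (\<Prod>k\<in>K. k)"
      unfolding y(2)[symmetric] using y(1) by (simp only: prod.reindex comp_def id_def)
    then show ?thesis using LIMSEQ_unique[OF 2 1] by simp
  qed
  show ?thesis
  proof (cases "even n")
    case True
    then show ?thesis by (rule even_sum_eq_sign_sum_even[OF _ inj even base])
  next
    case False
    then obtain k where n: "n = Suc k" "even k" by (cases n) auto
    have inj': "inj_on x {..<Suc k}" using inj n by simp
    \<comment> \<open>An odd number of variables is reduced to the even case by
      \<open>extend_var\<close>, which passes through the sum over subsets and is absorbed by
      h.\<close>
    have "even_sum n m x = extend_var k (even_sum k m) x"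
      using even_sum_Suc_even[OF n(2) inj'] n by simp
    also have "\<dots> = set_extend (sign_sum w h m) (x ` {..<Suc k})"
    proof (rule extend_var_eq_set_extend[OF inj'])
      fix i assume i: "i \<le> k"
      have im: "(x \<circ> insert_index i) ` {..<k} = x ` {..<Suc k} - {x i}"
        by (rule image_insert_index[OF inj' i])
      show "even_sum k m (x \<circ> insert_index i) = sign_sum w h m (x ` {..<Suc k} - {x i})"
        unfolding im[symmetric]
      proof (rule even_sum_eq_sign_sum_even[OF n(2) inj_on_insert_index[OF inj']])
        fix K assume K: "K \<subseteq> (x \<circ> insert_index i) ` {..<k}" "even (card K)"
        then have "K \<subseteq> x ` {..<n}" using im n by auto
        then show "h K = (\<Prod>k\<in>K. k) * h K + set_extend (set_extend h) K" "sign_sum w h 0 K = 1"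
          using even base K(2) by auto
      qed
    qed
    also have "\<dots> = even_conv (\<lambda>S. (\<Prod>s\<in>S. s) ^ m * w S) (set_extend h) (x ` {..<n})"
      by (simp add: sign_sum_def set_extend_even_conv n)
    also have "\<dots> = sign_sum w h m (x ` {..<n})"
      unfolding sign_sum_def
      using odd False card_image[OF inj] by (intro even_conv_cong) auto
    finally show ?thesis .
  qed
qed

section \<open>Even orthogonal characters\<close>

text \<open>Integer and half-integer entries are treated together: with \<open>q \<in> {0, 1}\<close>, the integer \<open>k\<close> stands for
  the entry \<open>k + q/2\<close>, and \<open>nabs q k\<close> for its absolute value. Below a row \<open>l\<close> of odd height \<open>2n + 1\<close> lie
  the rows \<open>r\<close> of height \<open>2n\<close> (upper rows) and \<open>m\<close> of height \<open>2n - 1\<close> (lower rows).\<close>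

definition nabs :: "int \<Rightarrow> int \<Rightarrow> int" where
  "nabs q k = (if 0 \<le> k then k else - k - q)"

definition upper_rows :: "int \<Rightarrow> nat \<Rightarrow> (nat \<Rightarrow> int) \<Rightarrow> (nat \<Rightarrow> int) set" where
  "upper_rows q n l = tup n (\<lambda>j. {nabs q (l (Suc j))..l j})"

definition lower_rows :: "int \<Rightarrow> nat \<Rightarrow> (nat \<Rightarrow> int) \<Rightarrow> (nat \<Rightarrow> int) set" where
  "lower_rows q n r = tup n (\<lambda>j. if Suc j < n then {r (Suc j)..r j} else {- r j - q..r j})"

definition so_expo :: "int \<Rightarrow> nat \<Rightarrow> (nat \<Rightarrow> int) \<Rightarrow> (nat \<Rightarrow> int) \<Rightarrow> (nat \<Rightarrow> int) \<Rightarrow> int" where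
  "so_expo q n l r m = (\<Sum>j<n. l j) + (\<Sum>j<n - 1. m j) + \<bar>l n + m (n - 1) + q\<bar> - 2 * (\<Sum>j<n. r j)"

text \<open>Every variable carries an additional factor with exponent \<open>q/2\<close>, which makes all exponents
  integers. The absolute value in \<open>so_expo\<close> replaces the signs in the weight of a pattern; the two
  weights agree only after summation over the row \<open>r\<close>.\<close>

fun so_rec :: "int \<Rightarrow> nat \<Rightarrow> (nat \<Rightarrow> int) \<Rightarrow> (nat \<Rightarrow> real) \<Rightarrow> real" where
  "so_rec q 0 l x = 1"
| "so_rec q (Suc 0) l x = x 0 powi (l 0 + q)"
| "so_rec q (Suc (Suc n)) l x = (\<Sum>r\<in>upper_rows q (Suc n) l. \<Sum>m\<in>lower_rows q (Suc n) r.
     x (Suc n) powi so_expo q (Suc n) l r m * so_rec q (Suc n) m x)"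

definition dominant :: "int \<Rightarrow> nat \<Rightarrow> (nat \<Rightarrow> int) \<Rightarrow> bool" where
  "dominant q n l \<longleftrightarrow> (\<forall>j. Suc j < n \<longrightarrow> nabs q (l (Suc j)) \<le> l j)"

section \<open>Hyperbolic determinants and their branching rule\<close>

text \<open>For x > 0, up to the factor x ^ (q/2), this is twice the hyperbolic cosine (\<eta> = 1)
  or sine (\<eta> = -1) of (k + q/2) log x.\<close>

definition cs :: "real \<Rightarrow> int \<Rightarrow> int \<Rightarrow> real \<Rightarrow> real" where
  "cs \<eta> q k x = x powi (k + q) + \<eta> * x powi (- k)"

definition cs_det :: "real \<Rightarrow> int \<Rightarrow> nat \<Rightarrow> (nat \<Rightarrow> int) \<Rightarrow> (nat \<Rightarrow> real) \<Rightarrow> real" where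
  "cs_det \<eta> q n l x = dt n (\<lambda>i j. cs \<eta> q (l j + int (n - 1 - j)) (x i))"

text \<open>The Weyl denominator of type D.\<close>

definition so_vand :: "nat \<Rightarrow> (nat \<Rightarrow> real) \<Rightarrow> real" where
  "so_vand n x = (\<Prod>j<n. \<Prod>i<j. (x i + 1 / x i - (x j + 1 / x j)))"

lemma so_vand_Suc: "so_vand (Suc n) x = so_vand n x * (\<Prod>i<n. (x i + 1 / x i - (x n + 1 / x n)))"
  by (simp add: so_vand_def)

lemma cs_reflect: "\<eta> * \<eta> = 1 \<Longrightarrow> cs \<eta> q (- k - q) x = \<eta> * cs \<eta> q k x"
  by (simp add: cs_def algebra_simps)

lemma powi_add: "x \<noteq> 0 \<Longrightarrow> x powi (m + n) = x powi m * (x::real) powi n"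
  by (simp add: power_int_add)

lemma powi_diff: "x \<noteq> 0 \<Longrightarrow> x powi (m - n) = x powi m / (x::real) powi n"
  by (simp add: power_int_diff)

text \<open>The addition theorem of the hyperbolic functions. The factor does not depend on \<eta>,
  so both determinants will obey the same branching rule.\<close>

lemma cs_rec: "x \<noteq> 0 \<Longrightarrow> cs \<eta> q (k + 1) x + cs \<eta> q (k - 1) x = (x + 1 / x) * cs \<eta> q k x"
proof -
  assume x: "x \<noteq> 0"
  have 1: "k + 1 + q = (k + q) + 1" "- (k + 1) = (- k) - 1" "k - 1 + q = (k + q) - 1" "- (k - 1) = (- k) + 1"
    by simp_all
  show ?thesis
    unfolding cs_def 1 using x by (simp only: powi_add[OF x] powi_diff[OF x]) (simp add: field_simps)
qed

text \<open>A discrete primitive: by \<open>csb_diff\<close> its increments in k are the terms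
  \<open>y powi k * cs \<eta> q k x\<close>, up to the factor of the Weyl denominator that belongs
  to x and y.\<close>

definition csb :: "real \<Rightarrow> int \<Rightarrow> real \<Rightarrow> int \<Rightarrow> real \<Rightarrow> real" where
  "csb \<eta> q y k x = y powi k * (cs \<eta> q (k + 1) x - y * cs \<eta> q k x)"

lemma csb_diff:
  assumes "x \<noteq> 0" "y \<noteq> 0"
  shows "csb \<eta> q y k x - csb \<eta> q y (k - 1) x = (x + 1 / x - (y + 1 / y)) * (y powi k * cs \<eta> q k x)"
proof -
  have "csb \<eta> q y k x - csb \<eta> q y (k - 1) x =
      y powi k * ((cs \<eta> q (k + 1) x + cs \<eta> q (k - 1) x) - (y + 1 / y) * cs \<eta> q k x)"
    using assms by (simp add: csb_def power_int_diff field_simps)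
  then show ?thesis
    unfolding cs_rec[OF assms(1)] by (simp add: algebra_simps)
qed

text \<open>At x = y the factor in \<open>csb_diff\<close> vanishes, so the primitive is constant in
  k. Hence differences of columns clear the row of the removed variable.\<close>

lemma csb_same: "y \<noteq> 0 \<Longrightarrow> csb \<eta> q y k y = \<eta> * (1 / y - y)"
proof -
  assume y: "y \<noteq> 0"
  have 1: "k + 1 + q = (k + q) + 1" "- (k + 1) = (- k) - 1" by simp_all
  have "y powi k * y powi (- k) = 1"
    using y by (simp flip: power_int_add)
  then show ?thesis
    unfolding csb_def cs_def 1 using y
    by (simp only: powi_add[OF y, of "k + q" 1] powi_diff[OF y, of "- k" 1]) (simp add: field_simps)
qed

lemma sum_csb:
  assumes "x \<noteq> 0" "y \<noteq> 0" "a \<le> b + 1"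
  shows "(x + 1 / x - (y + 1 / y)) * (\<Sum>v\<in>{a..b}. y powi v * cs \<eta> q (v + s) x) =
    y powi (- s) * (csb \<eta> q y (b + s) x - csb \<eta> q y (a - 1 + s) x)"
proof -
  have "a - 1 \<le> b" using assms(3) by simp
  then show ?thesis
  proof (induction b rule: int_ge_induct)
    case base
    then show ?case by simp
  next
    case (step b)
    have eq: "{a..b + 1} = insert (b + 1) {a..b}" using step by auto
    have "(x + 1 / x - (y + 1 / y)) * (y powi (b + 1) * cs \<eta> q (b + 1 + s) x) =
        y powi (- s) * ((x + 1 / x - (y + 1 / y)) * (y powi (b + 1 + s) * cs \<eta> q (b + 1 + s) x))"
      using assms(2) by (simp add: power_int_add power_int_minus field_simps)
    also have "\<dots> = y powi (- s) * (csb \<eta> q y (b + 1 + s) x - csb \<eta> q y (b + s) x)"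
      using csb_diff[OF assms(1,2), of \<eta> q "b + 1 + s"] by simp
    finally show ?case
      unfolding eq by (simp add: distrib_left step.IH right_diff_distrib)
  qed
qed

text \<open>The absolute value is resolved where l + v + q changes sign; the lower part is reflected
  by v -> - v - q, and both parts telescope. The result has the shape of the merged column in
  \<open>dt_last_row_two\<close>.\<close>

lemma sum_csb_signed:
  assumes xy: "x \<noteq> 0" "y \<noteq> 0" and q: "0 \<le> q" "q \<le> 1" and \<eta>: "\<eta> * \<eta> = 1" and l: "nabs q l \<le> r"
  shows "(x + 1 / x - (y + 1 / y)) * (\<Sum>v\<in>{- r - q..r}. y powi \<bar>l + v + q\<bar> * cs \<eta> q v x) =
    cs \<eta> q l y * csb \<eta> q y r x - \<eta> * (1 / y - y) * cs \<eta> q l x"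
proof -
  let ?t = "x + 1 / x - (y + 1 / y)"
  have bnd: "l \<le> r + 1" "- l - q \<le> r" "- r - q \<le> - l - q"
    using l q by (auto simp: nabs_def split: if_splits)
  have "{- r - q..r} = {- r - q..- l - q} \<union> {- l - q + 1..r}"
    using bnd by auto
  then have "(\<Sum>v\<in>{- r - q..r}. y powi \<bar>l + v + q\<bar> * cs \<eta> q v x) =
      (\<Sum>v\<in>{- r - q..- l - q}. y powi \<bar>l + v + q\<bar> * cs \<eta> q v x) +
      (\<Sum>v\<in>{- l - q + 1..r}. y powi \<bar>l + v + q\<bar> * cs \<eta> q v x)"
    by (simp only:) (rule sum.union_disjoint, auto)
  also have "(\<Sum>v\<in>{- r - q..- l - q}. y powi \<bar>l + v + q\<bar> * cs \<eta> q v x) =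
      (\<Sum>v\<in>{l..r}. \<eta> * y powi (- l) * (y powi v * cs \<eta> q (v + 0) x))"
  proof (rule sum.reindex_bij_witness[where i = "\<lambda>v. - v - q" and j = "\<lambda>v. - v - q"])
    fix v assume "v \<in> {- r - q..- l - q}"
    then have 1: "\<bar>l + v + q\<bar> = - l + (- v - q)" by auto
    have 2: "cs \<eta> q v x = \<eta> * cs \<eta> q (- v - q) x"
      using cs_reflect[OF \<eta>, of q "- v - q" x] by simp
    show "\<eta> * y powi (- l) * (y powi (- v - q) * cs \<eta> q (- v - q + 0) x) =
        y powi \<bar>l + v + q\<bar> * cs \<eta> q v x"
      unfolding 1 2 powi_add[OF xy(2)] by simp
  qed auto
  also have "(\<Sum>v\<in>{- l - q + 1..r}. y powi \<bar>l + v + q\<bar> * cs \<eta> q v x) =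
      (\<Sum>v\<in>{- l - q + 1..r}. y powi (l + q) * (y powi v * cs \<eta> q (v + 0) x))"
  proof (rule sum.cong)
    fix v assume "v \<in> {- l - q + 1..r}"
    then have "\<bar>l + v + q\<bar> = (l + q) + v" by auto
    then show "y powi \<bar>l + v + q\<bar> * cs \<eta> q v x = y powi (l + q) * (y powi v * cs \<eta> q (v + 0) x)"
      using xy by (simp only: powi_add[OF xy(2)]) simp
  qed simp
  finally have "?t * (\<Sum>v\<in>{- r - q..r}. y powi \<bar>l + v + q\<bar> * cs \<eta> q v x) =
      \<eta> * y powi (- l) * (?t * (\<Sum>v\<in>{l..r}. y powi v * cs \<eta> q (v + 0) x)) +
      y powi (l + q) * (?t * (\<Sum>v\<in>{- l - q + 1..r}. y powi v * cs \<eta> q (v + 0) x))"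
    by (simp add: sum_distrib_left distrib_left mult_ac)
  also have "?t * (\<Sum>v\<in>{l..r}. y powi v * cs \<eta> q (v + 0) x) = csb \<eta> q y r x - csb \<eta> q y (l - 1) x"
    using sum_csb[of x y l r \<eta> q 0] xy bnd by simp
  also have "?t * (\<Sum>v\<in>{- l - q + 1..r}. y powi v * cs \<eta> q (v + 0) x) =
      csb \<eta> q y r x - csb \<eta> q y (- l - q) x"
    using sum_csb[of x y "- l - q + 1" r \<eta> q 0] xy bnd by simp
  also have "csb \<eta> q y (l - 1) x = y powi l / y * (cs \<eta> q l x - y * cs \<eta> q (l - 1) x)"
    using xy by (simp add: csb_def power_int_diff)
  also have "csb \<eta> q y (- l - q) x = y powi (- (l + q)) * \<eta> * (cs \<eta> q (l - 1) x - y * cs \<eta> q l x)"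
    using cs_reflect[OF \<eta>, of q l x] cs_reflect[OF \<eta>, of q "l - 1" x]
    by (simp add: csb_def algebra_simps)
  also have "\<eta> * y powi (- l) * (csb \<eta> q y r x - y powi l / y * (cs \<eta> q l x - y * cs \<eta> q (l - 1) x)) +
      y powi (l + q) * (csb \<eta> q y r x - y powi (- (l + q)) * \<eta> * (cs \<eta> q (l - 1) x - y * cs \<eta> q l x)) =
      (y powi (l + q) + \<eta> * y powi (- l)) * csb \<eta> q y r x - \<eta> * (1 / y - y) * cs \<eta> q l x"
  proof -
    \<comment> \<open>The powers of y enter only as two reciprocal pairs, \<open>L\<close>,
      \<open>L'\<close> and \<open>M\<close>, \<open>M'\<close>.\<close>
    have alg: "\<eta> * L' * (b - L / y * (u - y * w)) + M * (b - M' * \<eta> * (w - y * u)) =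
        (M + \<eta> * L') * b - \<eta> * (1 / y - y) * u" if "L' * L = 1" "M * M' = 1" for L L' M M' b u w
    proof -
      have "\<eta> * L' * (b - L / y * (u - y * w)) + M * (b - M' * \<eta> * (w - y * u)) =
          (M + \<eta> * L') * b - \<eta> * (L' * L) * (u / y - w) - (M * M') * \<eta> * (w - y * u)"
        using xy by (simp add: field_simps)
      also have "\<dots> = (M + \<eta> * L') * b - \<eta> * (1 / y - y) * u"
        unfolding that by (simp add: algebra_simps)
      finally show ?thesis .
    qed
    show ?thesis
      by (rule alg) (use xy in \<open>simp_all flip: power_int_add\<close>)
  qed
  finally show ?thesis by (simp add: cs_def)
qed

text \<open>The second telescoping: multiplied by y ^ (-2 k), the primitive is itself a difference,
  namely of \<open>y powi (- k) * cs \<eta> q k x\<close> at neighbouring k.\<close>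

lemma sum_csb_upper:
  assumes "y \<noteq> 0" "a \<le> b + 1"
  shows "(\<Sum>v\<in>{a..b}. y powi (- 2 * (v + s)) * csb \<eta> q y (v + s) x) =
    y * (y powi (- (b + s + 1)) * cs \<eta> q (b + s + 1) x - y powi (- (a + s)) * cs \<eta> q (a + s) x)"
proof -
  have "a - 1 \<le> b" using assms(2) by simp
  then show ?thesis
  proof (induction b rule: int_ge_induct)
    case base
    then show ?case by simp
  next
    case (step b)
    have eq: "{a..b + 1} = insert (b + 1) {a..b}" using step by auto
    define k where "k = b + 1 + s"
    define P where "P = y powi (- k)"
    have "y powi (- 2 * k) = P * P" "y powi (- (k + 1)) = P / y" "y powi k * P = 1"
      using assms(1) by (simp_all add: P_def power_int_minus power_int_add field_simps flip: powi_add)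
    moreover have PY: "P * P * (y powi k * z) = P * z" for z
    proof -
      have "P * P * (y powi k * z) = (y powi k * P) * (P * z)" by (simp add: mult_ac)
      also have "y powi k * P = 1" using assms(1) by (simp add: P_def flip: powi_add)
      finally show ?thesis by simp
    qed
    ultimately have "y powi (- 2 * k) * csb \<eta> q y k x =
        y * (y powi (- (k + 1)) * cs \<eta> q (k + 1) x - y powi (- k) * cs \<eta> q k x)"
      unfolding csb_def P_def[symmetric] using assms(1) by (simp only: PY) (simp add: field_simps)
    then have "y powi (- 2 * (b + 1 + s)) * csb \<eta> q y (b + 1 + s) x =
        y * (y powi (- (b + 1 + s + 1)) * cs \<eta> q (b + 1 + s + 1) x - y powi (- (b + s + 1)) * cs \<eta> q (b + s + 1) x)"
      by (simp add: k_def add_ac)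
    moreover have "(\<Sum>v\<in>insert (b + 1) {a..b}. f v) = f (b + 1) + (\<Sum>v\<in>{a..b}. f v)" for f :: "int \<Rightarrow> real"
      by (rule sum.insert) auto
    moreover have "y * (T - U) + y * (U - V) = y * (T - V)" for T U V
      by (simp add: algebra_simps)
    ultimately show ?case
      unfolding eq by (simp only: step.IH)
  qed
qed

lemma powi_sum: "x \<noteq> 0 \<Longrightarrow> x powi (\<Sum>j\<in>A. f j) = (\<Prod>j\<in>A. (x::real) powi f j)"
  by (induction A rule: infinite_finite_induct) (simp_all add: powi_add)

lemma nabs_ge: "q \<le> 1 \<Longrightarrow> k \<le> nabs q k" "q \<le> 1 \<Longrightarrow> 0 \<le> nabs q k"
  by (auto simp: nabs_def)

lemma upper_rows_weak:
  assumes "q \<le> 1" "r \<in> upper_rows q n l" "Suc j < n"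
  shows "r (Suc j) \<le> r j"
proof -
  have "r (Suc j) \<le> l (Suc j)" "nabs q (l (Suc j)) \<le> r j"
    using assms by (auto simp: upper_rows_def tup_def)
  with nabs_ge(1)[OF assms(1), of "l (Suc j)"] show ?thesis by simp
qed

lemma finite_upper_rows [simp]: "finite (upper_rows q n l)"
  and finite_lower_rows [simp]: "finite (lower_rows q n r)"
  by (auto simp: upper_rows_def lower_rows_def intro!: finite_tup)

text \<open>Summation over the lower row turns the columns into differences of primitives, with the
  absolute value affecting the last one only. Bordering by a row for the removed variable and a
  column for \<open>l n\<close> gathers them into one determinant of size n + 1.\<close>

lemma lower_rows_cs_det:
  assumes q: "0 \<le> q" "q \<le> 1" and \<eta>: "\<eta> * \<eta> = 1" and n: "n = Suc k"
    and x: "\<And>i. i \<le> n \<Longrightarrow> x i \<noteq> 0" and r: "r \<in> upper_rows q n l"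
  shows "(\<Sum>m\<in>lower_rows q n r. x n powi so_expo q n l r m * cs_det \<eta> q n m x) *
      (\<Prod>i<n. (x i + 1 / x i - (x n + 1 / x n))) =
    x n powi (\<Sum>j<n. l j + int (n - 1 - j)) * (\<Prod>j<n. x n powi (- 2 * (r j + int (n - 1 - j)))) *
    dt (Suc n) (\<lambda>i j. if j < n then csb \<eta> q (x n) (r j + int (n - 1 - j)) (x i) else cs \<eta> q (l n) (x i))"
proof -
  define y where "y = x n"
  define s where "s j = int (n - 1 - j)" for j
  define \<theta> where "\<theta> i = x i + 1 / x i - (y + 1 / y)" for i
  define B where "B = (\<lambda>j. if Suc j < n then {r (Suc j)..r j} else {- r j - q..r j})"
  define wt where "wt j v = (if Suc j < n then y powi v else y powi \<bar>l n + v + q\<bar>)" for j v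
  define M where "M = (\<lambda>i j. if j < n then csb \<eta> q y (r j + s j) (x i) else cs \<eta> q (l n) (x i))"
  have y: "y \<noteq> 0" using x by (simp add: y_def)
  have expo: "y powi so_expo q n l r m = y powi ((\<Sum>j<n. l j) - 2 * (\<Sum>j<n. r j)) * (\<Prod>j<n. wt j (m j))" for m
  proof -
    have "(\<Prod>j<n. wt j (m j)) = (\<Prod>j<k. y powi m j) * y powi \<bar>l n + m k + q\<bar>"
      by (simp add: n wt_def)
    also have "\<dots> = y powi ((\<Sum>j<k. m j) + \<bar>l n + m k + q\<bar>)"
      by (simp only: powi_add[OF y] powi_sum[OF y])
    finally show ?thesis
      by (simp only: powi_add[OF y, symmetric]) (simp add: so_expo_def n algebra_simps)
  qed
  have "(\<Sum>m\<in>lower_rows q n r. y powi so_expo q n l r m * cs_det \<eta> q n m x) =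
      y powi ((\<Sum>j<n. l j) - 2 * (\<Sum>j<n. r j)) *
      (\<Sum>m\<in>tup n B. dt n (\<lambda>i j. wt j (m j) * cs \<eta> q (m j + s j) (x i)))"
    unfolding expo dt_scale_cols sum_distrib_left lower_rows_def B_def cs_det_def s_def
    by (simp add: mult.assoc)
  also have "(\<Sum>m\<in>tup n B. dt n (\<lambda>i j. wt j (m j) * cs \<eta> q (m j + s j) (x i))) =
      dt n (\<lambda>i j. \<Sum>v\<in>B j. wt j v * cs \<eta> q (v + s j) (x i))"
    by (rule dt_sum_cols[symmetric]) (simp add: B_def)
  finally have 1: "(\<Sum>m\<in>lower_rows q n r. y powi so_expo q n l r m * cs_det \<eta> q n m x) * (\<Prod>i<n. \<theta> i) =
      y powi ((\<Sum>j<n. l j) - 2 * (\<Sum>j<n. r j)) *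
      dt n (\<lambda>i j. \<theta> i * (\<Sum>v\<in>B j. wt j v * cs \<eta> q (v + s j) (x i)))"
    by (simp add: dt_scale_rows)
  have "dt n (\<lambda>i j. \<theta> i * (\<Sum>v\<in>B j. wt j v * cs \<eta> q (v + s j) (x i))) =
      dt n (\<lambda>i j. y powi (- s j) * (if j = k
        then M n n * M i k - \<eta> * (1 / y - y) * M i n else M i j - M i (Suc j)))"
  proof (rule dt_cong)
    fix i j assume ij: "i < n" "j < n"
    have xi: "x i \<noteq> 0" using x ij by simp
    show "\<theta> i * (\<Sum>v\<in>B j. wt j v * cs \<eta> q (v + s j) (x i)) =
        y powi (- s j) * (if j = k then M n n * M i k - \<eta> * (1 / y - y) * M i n else M i j - M i (Suc j))"
    proof (cases "j = k")
      case True
      have "nabs q (l n) \<le> r k" using r by (auto simp: upper_rows_def tup_def n)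
      from sum_csb_signed[OF xi y q \<eta> this] show ?thesis
        using True by (simp add: n s_def B_def wt_def M_def \<theta>_def y_def)
    next
      case False
      then have j: "Suc j < n" using ij n by simp
      have "r (Suc j) \<le> r j + 1" using upper_rows_weak[OF q(2) r j] by simp
      moreover have e: "r (Suc j) - 1 + s j = r (Suc j) + s (Suc j)"
        using j by (simp add: s_def)
      ultimately show ?thesis
        using False j sum_csb[OF xi y, of "r (Suc j)" "r j" \<eta> q "s j", unfolded e]
        by (simp add: B_def wt_def M_def \<theta>_def)
    qed
  qed
  also have "\<dots> = (\<Prod>j<n. y powi (- s j)) * dt n (\<lambda>i j. if j = k
        then M n n * M i k - \<eta> * (1 / y - y) * M i n else M i j - M i (Suc j))"
    by (rule dt_scale_cols)
  also have "dt n (\<lambda>i j. if j = k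
        then M n n * M i k - \<eta> * (1 / y - y) * M i n else M i j - M i (Suc j)) = dt (Suc n) M"
  proof -
    \<comment> \<open>Column n - 1 is not reduced by the border column, so the last row keeps
      exactly its last two entries.\<close>
    let ?c = "\<lambda>j. if Suc j < n then 1 else (0::real)"
    let ?A = "\<lambda>i j. M i j - (if Suc j < Suc n then ?c j * M i (Suc j) else 0)"
    have "dt (Suc n) M = dt (Suc n) ?A"
      by (rule dt_diff_cols[symmetric])
    also have "\<dots> = dt n (\<lambda>i j. if j = k then ?A n n * ?A i k - ?A n k * ?A i n else ?A i j)"
      by (rule dt_last_row_two[OF n]) (simp add: M_def n y_def[unfolded n, symmetric] csb_same[OF y])
    also have "\<dots> = dt n (\<lambda>i j. if j = k
        then M n n * M i k - \<eta> * (1 / y - y) * M i n else M i j - M i (Suc j))"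
    proof (rule dt_cong)
      fix i j assume "i < n" "j < n"
      moreover have "M n k = \<eta> * (1 / y - y)"
        by (simp add: M_def n y_def[unfolded n, symmetric] csb_same[OF y])
      ultimately show "(if j = k then ?A n n * ?A i k - ?A n k * ?A i n else ?A i j) =
          (if j = k then M n n * M i k - \<eta> * (1 / y - y) * M i n else M i j - M i (Suc j))"
        using n by auto
    qed
    finally show ?thesis ..
  qed
  finally have 2: "dt n (\<lambda>i j. \<theta> i * (\<Sum>v\<in>B j. wt j v * cs \<eta> q (v + s j) (x i))) =
      (\<Prod>j<n. y powi (- s j)) * dt (Suc n) M" .
  have 3: "y powi ((\<Sum>j<n. l j) - 2 * (\<Sum>j<n. r j)) * (\<Prod>j<n. y powi (- s j)) =
      y powi (\<Sum>j<n. l j + s j) * (\<Prod>j<n. y powi (- 2 * (r j + s j)))"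
    unfolding powi_sum[OF y, symmetric] powi_add[OF y, symmetric]
    by (simp add: sum.distrib sum_negf sum_subtractf sum_distrib_left[symmetric]
        sum_distrib_right[symmetric] algebra_simps)
  show ?thesis
    using 1 unfolding 2 mult.assoc[symmetric] 3
    unfolding \<theta>_def y_def s_def M_def .
qed

text \<open>The bordered determinants are summed over the upper row by the second telescoping. The
  resulting differences of neighbouring columns are undone by \<open>dt_diff_cols\<close>, and all
  outer powers of the removed variable cancel.\<close>

lemma so_branching_cs_det:
  assumes q: "0 \<le> q" "q \<le> 1" and \<eta>: "\<eta> * \<eta> = 1" and n: "0 < n"
    and x: "\<And>i. i \<le> n \<Longrightarrow> x i \<noteq> 0" and dom: "dominant q (Suc n) l"
  shows "(\<Sum>r\<in>upper_rows q n l. \<Sum>m\<in>lower_rows q n r. x n powi so_expo q n l r m * cs_det \<eta> q n m x) *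
      (\<Prod>i<n. (x i + 1 / x i - (x n + 1 / x n))) = cs_det \<eta> q (Suc n) l x"
proof -
  define y where "y = x n"
  define s where "s j = int (n - 1 - j)" for j
  define a where "a L z = y powi (- L) * cs \<eta> q L z" for L z
  \<comment> \<open>The entries shifted by the Weyl vector of type D, the last one made
    non-negative; \<open>\<sigma>\<close> restores its sign.\<close>
  define L where "L j = (if j < n then l j + s j + 1 else nabs q (l n))" for j
  define \<sigma> where "\<sigma> = (if 0 \<le> l n then 1 else \<eta>)"
  \<comment> \<open>The border column gets a range with one element, so that it can take part in the
    expansion over all columns.\<close>
  define B where "B = (\<lambda>j. if j < n then {nabs q (l (Suc j))..l j} else {0})"
  define G where "G j v i = (if j < n then y powi (- 2 * (v + s j)) * csb \<eta> q y (v + s j) (x i)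
    else cs \<eta> q (l n) (x i))" for j v i
  obtain k where k: "n = Suc k" using n by (cases n) auto
  have y: "y \<noteq> 0" using x by (simp add: y_def)
  have \<sigma>: "cs \<eta> q (l n) z = \<sigma> * cs \<eta> q (L n) z" for z
    using cs_reflect[OF \<eta>, of q "nabs q (l n)" z] by (auto simp: \<sigma>_def L_def nabs_def)
  have rows: "upper_rows q n l = tup (Suc n) B"
  proof -
    have "(\<forall>j\<ge>n. f j = 0) \<longleftrightarrow> f n = 0 \<and> (\<forall>j\<ge>Suc n. f j = 0)" for f :: "nat \<Rightarrow> int"
      by (metis Suc_leD Suc_leI le_eq_less_or_eq order_refl)
    then show ?thesis
      by (auto simp: upper_rows_def tup_def B_def less_Suc_eq)
  qed
  have "(\<Sum>r\<in>upper_rows q n l. \<Sum>m\<in>lower_rows q n r. x n powi so_expo q n l r m * cs_det \<eta> q n m x) *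
      (\<Prod>i<n. (x i + 1 / x i - (x n + 1 / x n))) =
      (\<Sum>r\<in>upper_rows q n l. y powi (\<Sum>j<n. l j + s j) * ((\<Prod>j<n. y powi (- 2 * (r j + s j))) *
        dt (Suc n) (\<lambda>i j. if j < n then csb \<eta> q y (r j + s j) (x i) else cs \<eta> q (l n) (x i))))"
    unfolding y_def s_def
    by (subst sum_distrib_right, intro sum.cong refl trans[OF lower_rows_cs_det[where x = x, OF q \<eta> k x]])
      (auto simp: mult.assoc)
  also have "\<dots> = y powi (\<Sum>j<n. l j + s j) *
      (\<Sum>r\<in>tup (Suc n) B. dt (Suc n) (\<lambda>i j. G j (r j) i))"
    unfolding sum_distrib_left rows
  proof (intro sum.cong refl arg_cong2[where f = "(*)"])
    fix r
    have "dt (Suc n) (\<lambda>i j. G j (r j) i) = dt (Suc n) (\<lambda>i j.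
        (if j < n then y powi (- 2 * (r j + s j)) else 1) *
        (if j < n then csb \<eta> q y (r j + s j) (x i) else cs \<eta> q (l n) (x i)))"
      by (rule dt_cong) (simp add: G_def)
    also have "\<dots> = (\<Prod>j<n. y powi (- 2 * (r j + s j))) *
        dt (Suc n) (\<lambda>i j. if j < n then csb \<eta> q y (r j + s j) (x i) else cs \<eta> q (l n) (x i))"
      unfolding dt_scale_cols by simp
    finally show "(\<Prod>j<n. y powi (- 2 * (r j + s j))) *
        dt (Suc n) (\<lambda>i j. if j < n then csb \<eta> q y (r j + s j) (x i) else cs \<eta> q (l n) (x i)) =
        dt (Suc n) (\<lambda>i j. G j (r j) i)" ..
  qed
  also have "(\<Sum>r\<in>tup (Suc n) B. dt (Suc n) (\<lambda>i j. G j (r j) i)) =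
      dt (Suc n) (\<lambda>i j. \<Sum>v\<in>B j. G j v i)"
    by (rule dt_sum_cols[symmetric]) (simp add: B_def)
  also have "\<dots> = dt (Suc n) (\<lambda>i j. (if j < n then y else \<sigma> * y powi L n) *
      (a (L j) (x i) - (if Suc j < Suc n then 1 * a (L (Suc j)) (x i) else 0)))"
  proof (rule dt_cong)
    fix i j assume ij: "i < Suc n" "j < Suc n"
    show "(\<Sum>v\<in>B j. G j v i) = (if j < n then y else \<sigma> * y powi L n) *
      (a (L j) (x i) - (if Suc j < Suc n then 1 * a (L (Suc j)) (x i) else 0))"
    proof (cases "j < n")
      case True
      have le: "nabs q (l (Suc j)) \<le> l j"
        using dom True by (simp add: dominant_def)
      have e: "l j + s j + 1 = L j" "nabs q (l (Suc j)) + s j = L (Suc j)"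
      proof -
        show "l j + s j + 1 = L j" using True by (simp add: L_def)
        show "nabs q (l (Suc j)) + s j = L (Suc j)"
        proof (cases "Suc j < n")
          case True
          have "nabs q (l (Suc (Suc j))) \<le> l (Suc j)"
            using dom True by (simp add: dominant_def)
          then have "0 \<le> l (Suc j)" using nabs_ge(2)[OF q(2), of "l (Suc (Suc j))"] by linarith
          then show ?thesis using True by (simp add: L_def nabs_def s_def)
        next
          case False
          then have "Suc j = n" using \<open>j < n\<close> by simp
          then show ?thesis by (auto simp: L_def s_def)
        qed
      qed
      show ?thesis
        using True le sum_csb_upper[OF y, of "nabs q (l (Suc j))" "l j" "s j" \<eta> q "x i"]
        unfolding e by (simp add: B_def G_def a_def)
    next
      case False
      then have "j = n" using ij by simp
      moreover have "y powi L n * y powi (- L n) = 1"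
        using y by (simp flip: powi_add)
      ultimately show ?thesis
        by (simp add: B_def G_def a_def \<sigma>)
    qed
  qed
  also have "\<dots> = y ^ n * (\<sigma> * y powi L n) * dt (Suc n) (\<lambda>i j. a (L j) (x i))"
    unfolding dt_scale_cols using dt_diff_cols[of "Suc n" "\<lambda>i j. a (L j) (x i)" "\<lambda>_. 1"] by simp
  also have "dt (Suc n) (\<lambda>i j. a (L j) (x i)) =
      (\<Prod>j<Suc n. y powi (- L j)) * dt (Suc n) (\<lambda>i j. cs \<eta> q (L j) (x i))"
    unfolding a_def dt_scale_cols ..
  also have "y powi (\<Sum>j<n. l j + s j) * (y ^ n * (\<sigma> * y powi L n) * ((\<Prod>j<Suc n. y powi (- L j)) *
      dt (Suc n) (\<lambda>i j. cs \<eta> q (L j) (x i)))) = \<sigma> * dt (Suc n) (\<lambda>i j. cs \<eta> q (L j) (x i))"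
  proof -
    have "y powi (\<Sum>j<n. l j + s j) * y ^ n * y powi L n * (\<Prod>j<Suc n. y powi (- L j)) =
        y powi ((\<Sum>j<n. l j + s j) + int n + L n + (\<Sum>j<Suc n. - L j))"
      unfolding powi_add[OF y] powi_sum[OF y] by simp
    also have "(\<Sum>j<n. l j + s j) + int n + L n + (\<Sum>j<Suc n. - L j) = 0"
      by (simp add: L_def sum.distrib sum_negf sum_subtractf)
    finally show ?thesis by (simp add: mult_ac)
  qed
  also have "\<sigma> * dt (Suc n) (\<lambda>i j. cs \<eta> q (L j) (x i)) =
      dt (Suc n) (\<lambda>i j. (if j < n then 1 else \<sigma>) * cs \<eta> q (L j) (x i))"
    unfolding dt_scale_cols by simp
  also have "\<dots> = cs_det \<eta> q (Suc n) l x"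
    unfolding cs_det_def
  proof (rule dt_cong)
    fix i j assume "j < Suc n"
    then show "(if j < n then 1 else \<sigma>) * cs \<eta> q (L j) (x i) = cs \<eta> q (l j + int (Suc n - 1 - j)) (x i)"
      using \<sigma>[of "x i"] by (auto simp: L_def s_def less_Suc_eq algebra_simps of_nat_diff)
  qed
  finally show ?thesis .
qed

lemma lower_rows_dominant:
  assumes "q \<le> 1" "r \<in> upper_rows q n l" "m \<in> lower_rows q n r"
  shows "dominant q n m"
  unfolding dominant_def
proof (intro allI impI)
  fix j assume j: "Suc j < n"
  have m: "r (Suc j) \<le> m j" "m (Suc j) \<le> r (Suc j)" "- r (Suc j) - q \<le> m (Suc j) \<or> 0 \<le> m (Suc j)"
  proof -
    have "m j \<in> (if Suc j < n then {r (Suc j)..r j} else {- r j - q..r j})"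
      using assms(3) j Suc_lessD unfolding lower_rows_def tup_def by blast
    then show "r (Suc j) \<le> m j" using j by simp
    show "m (Suc j) \<le> r (Suc j)" using assms(3) j
      by (auto simp: lower_rows_def tup_def split: if_splits)
    show "- r (Suc j) - q \<le> m (Suc j) \<or> 0 \<le> m (Suc j)"
    proof (cases "Suc (Suc j) < n")
      case True
      have "m (Suc j) \<in> (if Suc (Suc j) < n then {r (Suc (Suc j))..r (Suc j)} else {- r (Suc j) - q..r (Suc j)})"
        using assms(3) j unfolding lower_rows_def tup_def by blast
      then have "nabs q (l (Suc (Suc (Suc j)))) \<le> r (Suc (Suc j))" "r (Suc (Suc j)) \<le> m (Suc j)"
        using assms True by (auto simp: upper_rows_def tup_def)
      then show ?thesis using nabs_ge(2)[OF assms(1), of "l (Suc (Suc (Suc j)))"] by linarith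
    next
      case False
      then show ?thesis using assms(3) j by (auto simp: lower_rows_def tup_def)
    qed
  qed
  then show "nabs q (m (Suc j)) \<le> m j" by (auto simp: nabs_def)
qed

text \<open>Each determinant satisfies the branching rule, but only their sum has the right initial
  value: in one variable the terms x ^ (-l) cancel.\<close>

theorem so_weyl:
  assumes q: "0 \<le> q" "q \<le> 1" and n: "0 < n" and x: "\<And>i. i < n \<Longrightarrow> x i \<noteq> 0" and dom: "dominant q n l"
  shows "2 * so_rec q n l x * so_vand n x = cs_det 1 q n l x + cs_det (-1) q n l x"
  using assms
proof (induction q n l x rule: so_rec.induct)
  case (2 q l x)
  then show ?case by (simp add: cs_det_def cs_def so_vand_def)
next
  case (3 q n l x)
  let ?n = "Suc n"
  let ?t = "\<Prod>i<?n. (x i + 1 / x i - (x ?n + 1 / x ?n))"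
  have "2 * so_rec q (Suc ?n) l x * so_vand (Suc ?n) x =
      (\<Sum>r\<in>upper_rows q ?n l. \<Sum>m\<in>lower_rows q ?n r.
        x ?n powi so_expo q ?n l r m * (2 * so_rec q ?n m x * so_vand ?n x)) * ?t"
    unfolding so_vand_Suc[of ?n] by (simp add: sum_distrib_left sum_distrib_right mult_ac)
  also have "\<dots> = (\<Sum>r\<in>upper_rows q ?n l. \<Sum>m\<in>lower_rows q ?n r.
        x ?n powi so_expo q ?n l r m * (cs_det 1 q ?n m x + cs_det (-1) q ?n m x)) * ?t"
    using "3.IH" "3.prems" lower_rows_dominant[OF "3.prems"(2)]
    by (intro arg_cong2[where f = "(*)"] sum.cong refl) auto
  also have "\<dots> = (\<Sum>r\<in>upper_rows q ?n l. \<Sum>m\<in>lower_rows q ?n r.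
        x ?n powi so_expo q ?n l r m * cs_det 1 q ?n m x) * ?t +
      (\<Sum>r\<in>upper_rows q ?n l. \<Sum>m\<in>lower_rows q ?n r.
        x ?n powi so_expo q ?n l r m * cs_det (-1) q ?n m x) * ?t"
    by (simp add: distrib_left sum.distrib distrib_right)
  also have "\<dots> = cs_det 1 q (Suc ?n) l x + cs_det (-1) q (Suc ?n) l x"
    using "3.prems" by (subst (1 2) so_branching_cs_det) auto
  finally show ?case .
qed simp

section \<open>Rectangular shapes\<close>

text \<open>The condition a < b selects every unordered pair once; f is symmetric in all uses, so
  the product depends on the set of pairs only.\<close>

definition pair_prod :: "('a::linorder \<Rightarrow> 'a \<Rightarrow> real) \<Rightarrow> 'a set \<Rightarrow> real" where
  "pair_prod f A = (\<Prod>(a, b)\<in>{(a, b). a \<in> A \<and> b \<in> A \<and> a < b}. f a b)"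

lemma pair_prod_empty [simp]: "pair_prod f {} = 1"
  by (simp add: pair_prod_def)

lemma pair_prod_insert:
  assumes sym: "\<And>a b. f a b = f b a" and "finite A" "c \<notin> A"
  shows "pair_prod f (insert c A) = pair_prod f A * (\<Prod>b\<in>A. f c b)"
proof -
  let ?P = "{(a, b). a \<in> A \<and> b \<in> A \<and> a < b}"
  let ?h = "\<lambda>b. if b < c then (b, c) else (c, b)"
  have "finite ?P" by (rule finite_subset[of _ "A \<times> A"]) (use assms(2) in auto)
  moreover have "{(a, b). a \<in> insert c A \<and> b \<in> insert c A \<and> a < b} = ?P \<union> ?h ` A"
  proof (intro equalityI subsetI)
    fix p assume "p \<in> {(a, b). a \<in> insert c A \<and> b \<in> insert c A \<and> a < b}"
    then consider "p \<in> ?P" | b where "b \<in> A" "c < b" "p = (c, b)" | a where "a \<in> A" "a < c" "p = (a, c)"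
      by auto
    then show "p \<in> ?P \<union> ?h ` A"
    proof cases
      case (2 b)
      then have "p = ?h b" by auto
      with 2 show ?thesis by blast
    next
      case (3 a)
      then have "p = ?h a" by auto
      with 3 show ?thesis by blast
    qed blast
  qed (use assms(3) in \<open>auto simp: not_less le_less split: if_splits\<close>)
  moreover have "?P \<inter> ?h ` A = {}" using assms(3) by (auto split: if_splits)
  moreover have "inj_on ?h A"
    by (auto simp: inj_on_def split: if_splits)
  then have "(\<Prod>(a, b)\<in>?h ` A. f a b) = (\<Prod>b\<in>A. f c b)"
    by (subst prod.reindex) (auto simp: sym[of _ c] intro!: prod.cong)
  ultimately show ?thesis
    using assms(2) by (simp add: pair_prod_def prod.union_disjoint)
qed

lemma pair_prod_union:
  assumes sym: "\<And>a b. f a b = f b a" and "finite A" "finite B" "A \<inter> B = {}"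
  shows "pair_prod f (A \<union> B) = pair_prod f A * (\<Prod>a\<in>A. \<Prod>b\<in>B. f a b) * pair_prod f B"
  using assms(3,4)
proof (induction B rule: finite_induct)
  case (insert c B)
  have "(\<Prod>b\<in>A \<union> B. f c b) = (\<Prod>b\<in>A. f b c) * (\<Prod>b\<in>B. f c b)"
    using insert assms(2) by (subst prod.union_disjoint) (auto simp: sym[of c])
  then show ?case
    using insert assms(2) by (simp add: pair_prod_insert[OF sym] prod.distrib mult_ac)
qed simp

lemma pair_prod_image:
  assumes sym: "\<And>a b. f a b = f b a" and "finite A" "inj_on h A"
  shows "pair_prod f (h ` A) = pair_prod (\<lambda>a b. f (h a) (h b)) A"
  using assms(2,3)
proof (induction A rule: finite_induct)
  case (insert c A)
  then have "inj_on h A" "h c \<notin> h ` A" by (auto simp: inj_on_def)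
  with insert show ?case
    by (simp add: pair_prod_insert[of f, OF sym] pair_prod_insert[of "\<lambda>a b. f (h a) (h b)", OF sym] prod.reindex)
qed simp

lemma pair_prod_cong:
  "(\<And>a b. a \<in> A \<Longrightarrow> b \<in> A \<Longrightarrow> a < b \<Longrightarrow> f a b = g a b) \<Longrightarrow> pair_prod f A = pair_prod g A"
  unfolding pair_prod_def by (intro prod.cong) auto

lemma pair_prod_lessThan:
  "pair_prod f {..<n::nat} = (\<Prod>j<n. \<Prod>i<j. f i j)"
proof -
  have "(\<Prod>j<n. \<Prod>i<j. f i j) = (\<Prod>(j, i)\<in>Sigma {..<n} (\<lambda>j. {..<j}). f i j)"
    by (rule prod.Sigma) auto
  also have "\<dots> = pair_prod f {..<n}"
    unfolding pair_prod_def
    by (rule prod.reindex_bij_witness[where i = "\<lambda>(i, j). (j, i)" and j = "\<lambda>(j, i). (i, j)"]) auto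
  finally show ?thesis ..
qed

text \<open>The quotient of a Vandermonde factor by the corresponding factor of the Weyl denominator
  when both variables are inverted; \<open>gl_flipped\<close> belongs to pairs in which neither is.
  The product of \<open>gl_inside\<close> over all pairs is the Littlewood product.\<close>

abbreviation gl_inside :: "real \<Rightarrow> real \<Rightarrow> real" where
  "gl_inside a b \<equiv> 1 / (1 - a * b)"

abbreviation gl_flipped :: "real \<Rightarrow> real \<Rightarrow> real" where
  "gl_flipped a b \<equiv> - (a * b) / (1 - a * b)"

definition flip_set :: "nat set \<Rightarrow> (nat \<Rightarrow> real) \<Rightarrow> nat \<Rightarrow> real" where
  "flip_set S x i = (if i \<in> S then x i else 1 / x i)"

text \<open>A factor of the Weyl denominator equals (x_i - x_j) (x_i x_j - 1) / (x_i x_j). Replacing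
  variables by their inverses therefore changes it by the rational weights \<open>w\<close>.\<close>

lemma vand_flip_set:
  assumes x: "\<And>i. i < n \<Longrightarrow> x i \<noteq> 0" and inj: "inj_on x {..<n}"
    and ne: "\<And>i j. i < j \<Longrightarrow> j < n \<Longrightarrow> x i * x j \<noteq> 1" and S: "S \<subseteq> {..<n}"
  shows "vand n (flip_set S x) = so_vand n x * (pair_prod gl_flipped (x ` S) *
    cross (x ` S) (x ` ({..<n} - S)) * pair_prod gl_inside (x ` ({..<n} - S)))"
proof -
  define w where "w i j = (if i \<in> S then if j \<in> S then gl_flipped (x i) (x j) else x i / (x i - x j)
    else if j \<in> S then x j / (x j - x i) else gl_inside (x i) (x j))" for i j
  have sym: "w i j = w j i" for i j by (simp add: w_def mult.commute)
  have fin: "finite S" using S finite_subset by blast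
  have "vand n (flip_set S x) = (\<Prod>j<n. \<Prod>i<j. (x i + 1 / x i - (x j + 1 / x j)) * w i j)"
    unfolding vand_def
  proof (intro prod.cong refl)
    fix j i assume "j \<in> {..<n}" "i \<in> {..<j}"
    then have ij: "i < j" "j < n" "x i \<noteq> 0" "x j \<noteq> 0" "x i * x j \<noteq> 1" "x i \<noteq> x j"
      using x ne inj by (auto simp: inj_on_def)
    then have "1 - x i * x j \<noteq> 0" "x i - x j \<noteq> 0" "x j - x i \<noteq> 0" by auto
    then show "flip_set S x i - flip_set S x j = (x i + 1 / x i - (x j + 1 / x j)) * w i j"
      using ij(3,4) by (auto simp: flip_set_def w_def divide_simps) (simp_all add: algebra_simps)
  qed
  also have "\<dots> = so_vand n x * pair_prod w {..<n}"
    by (simp add: prod.distrib so_vand_def pair_prod_lessThan)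
  also have "pair_prod w {..<n} = pair_prod w S * (\<Prod>a\<in>S. \<Prod>b\<in>{..<n} - S. w a b) * pair_prod w ({..<n} - S)"
    using pair_prod_union[of w S "{..<n} - S", OF sym fin] S by (simp add: Un_absorb1)
  also have "pair_prod w S = pair_prod gl_flipped (x ` S)"
    using inj S fin by (subst pair_prod_image)
      (auto simp: w_def mult.commute intro!: pair_prod_cong intro: inj_on_subset)
  also have "pair_prod w ({..<n} - S) = pair_prod gl_inside (x ` ({..<n} - S))"
    using inj S by (subst pair_prod_image)
      (auto simp: w_def mult.commute intro!: pair_prod_cong intro: inj_on_subset)
  also have "(\<Prod>a\<in>S. \<Prod>b\<in>{..<n} - S. w a b) = cross (x ` S) (x ` ({..<n} - S))"
    using inj_on_subset[OF inj S] inj_on_subset[OF inj, of "{..<n} - S"]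
    by (auto simp: cross_def prod.reindex w_def intro!: prod.cong)
  finally show ?thesis .
qed

lemma so_vand_nonzero:
  assumes x: "\<And>i. i < n \<Longrightarrow> x i \<noteq> 0" and inj: "inj_on x {..<n}"
    and ne: "\<And>i j. i < j \<Longrightarrow> j < n \<Longrightarrow> x i * x j \<noteq> 1"
  shows "so_vand n x \<noteq> 0"
proof -
  have "x i + 1 / x i - (x j + 1 / x j) \<noteq> 0" if "i < j" "j < n" for i j
  proof -
    have "x i \<noteq> 0" "x j \<noteq> 0" "x i * x j \<noteq> 1" "x i \<noteq> x j"
      using x ne inj that by (auto simp: inj_on_def)
    moreover have "x i + 1 / x i - (x j + 1 / x j) = (x i - x j) * (x i * x j - 1) / (x i * x j)"
      using \<open>x i \<noteq> 0\<close> \<open>x j \<noteq> 0\<close> by (simp add: field_simps)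
    ultimately show ?thesis by simp
  qed
  then show ?thesis by (auto simp: so_vand_def)
qed

text \<open>For a rectangular shape, and after the rows are scaled, an entry is a sum of two powers
  whose exponents run through those of a Vandermonde matrix in x_i and in 1 / x_i. Splitting the
  rows chooses one of them for every variable.\<close>

lemma cs_det_rect:
  assumes x: "\<And>i. i < n \<Longrightarrow> x i \<noteq> 0" and U: "0 \<le> U" "0 \<le> q" and m: "int m = 2 * U + q"
  shows "(\<Prod>i<n. x i powi (U + q)) * cs_det \<eta> q n (\<lambda>_. U) (\<lambda>i. 1 / x i) =
    (\<Sum>S\<in>Pow {..<n}. \<eta> ^ card S * (\<Prod>i\<in>S. x i) ^ m * vand n (flip_set S x))"
proof -
  have "(\<Prod>i<n. x i powi (U + q)) * cs_det \<eta> q n (\<lambda>_. U) (\<lambda>i. 1 / x i) =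
      dt n (\<lambda>i j. \<eta> * x i ^ m * x i ^ (n - 1 - j) + (1 / x i) ^ (n - 1 - j))"
    unfolding cs_det_def dt_scale_rows[symmetric]
  proof (rule dt_cong)
    fix i j assume "i < n"
    define s where "s = n - 1 - j"
    have xi: "x i \<noteq> 0" using x \<open>i < n\<close> by simp
    have inv: "(1 / x i) powi k = x i powi (- k)" for k
      by (simp add: power_int_minus power_int_divide_distrib inverse_eq_divide)
    have "x i powi (U + q) * cs \<eta> q (U + int s) (1 / x i) =
        x i powi (U + q) * x i powi (- (U + int s + q)) + \<eta> * (x i powi (U + q) * x i powi (U + int s))"
      unfolding cs_def inv minus_minus by (simp only: distrib_left mult.left_commute)
    also have "\<dots> = x i powi (- int s) + \<eta> * x i powi (int m + int s)"
      unfolding powi_add[OF xi, symmetric] by (simp add: m algebra_simps)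
    also have "\<dots> = \<eta> * x i ^ m * x i ^ s + (1 / x i) ^ s"
      using xi by (simp add: powi_add power_int_minus power_divide field_simps)
    finally show "x i powi (U + q) * cs \<eta> q (U + int (n - 1 - j)) (1 / x i) =
        \<eta> * x i ^ m * x i ^ (n - 1 - j) + (1 / x i) ^ (n - 1 - j)"
      by (simp add: s_def)
  qed
  also have "\<dots> = (\<Sum>S\<in>Pow {..<n}. dt n (\<lambda>i j. if i \<in> S then \<eta> * x i ^ m * x i ^ (n - 1 - j)
      else (1 / x i) ^ (n - 1 - j)))"
    by (rule dt_add_rows)
  also have "\<dots> = (\<Sum>S\<in>Pow {..<n}. \<eta> ^ card S * (\<Prod>i\<in>S. x i) ^ m * vand n (flip_set S x))"
  proof (rule sum.cong)
    fix S assume "S \<in> Pow {..<n}"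
    then have S: "{..<n} \<inter> S = S" by auto
    have "dt n (\<lambda>i j. if i \<in> S then \<eta> * x i ^ m * x i ^ (n - 1 - j) else (1 / x i) ^ (n - 1 - j)) =
        dt n (\<lambda>i j. (if i \<in> S then \<eta> * x i ^ m else 1) * flip_set S x i ^ (n - 1 - j))"
      by (rule dt_cong) (simp add: flip_set_def)
    also have "\<dots> = (\<Prod>i<n. if i \<in> S then \<eta> * x i ^ m else 1) * vand n (flip_set S x)"
      unfolding dt_scale_rows vandermonde ..
    also have "(\<Prod>i<n. if i \<in> S then \<eta> * x i ^ m else 1) = \<eta> ^ card S * (\<Prod>i\<in>S. x i) ^ m"
      unfolding prod.If_cases[OF finite_lessThan] using S by (simp add: prod.distrib prod_power_distrib)
    finally show "dt n (\<lambda>i j. if i \<in> S then \<eta> * x i ^ m * x i ^ (n - 1 - j) else (1 / x i) ^ (n - 1 - j)) =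
        \<eta> ^ card S * (\<Prod>i\<in>S. x i) ^ m * vand n (flip_set S x)" .
  qed simp
  finally show ?thesis .
qed

text \<open>Adding \<eta> = 1 and \<eta> = -1 cancels the odd subsets and doubles the even ones; the
  Weyl denominator divides out.\<close>

theorem so_rect_sign_sum:
  assumes q: "0 \<le> q" "q \<le> 1" and U: "0 \<le> U" and m: "int m = 2 * U + q" and n: "0 < n"
    and x: "\<And>i. i < n \<Longrightarrow> x i \<noteq> 0" and inj: "inj_on x {..<n}"
    and ne: "\<And>i j. i < j \<Longrightarrow> j < n \<Longrightarrow> x i * x j \<noteq> 1"
  shows "(\<Prod>i<n. x i powi (U + q)) * so_rec q n (\<lambda>_. U) (\<lambda>i. 1 / x i) =
    sign_sum (pair_prod gl_flipped) (pair_prod gl_inside) m (x ` {..<n})"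
proof -
  let ?X = "\<lambda>i. 1 / x i"
  let ?P = "\<lambda>S. pair_prod gl_flipped (x ` S) * cross (x ` S) (x ` ({..<n} - S)) *
    pair_prod gl_inside (x ` ({..<n} - S))"
  have X: "so_vand n ?X = so_vand n x" by (simp add: so_vand_def add.commute)
  have "dominant q n (\<lambda>_. U)" using U by (simp add: dominant_def nabs_def)
  then have weyl: "2 * so_rec q n (\<lambda>_. U) ?X * so_vand n x =
      cs_det 1 q n (\<lambda>_. U) ?X + cs_det (-1) q n (\<lambda>_. U) ?X"
    using so_weyl[OF q n, of ?X "\<lambda>_. U"] x unfolding X by simp
  have "2 * ((\<Prod>i<n. x i powi (U + q)) * so_rec q n (\<lambda>_. U) ?X) * so_vand n x =
      (\<Prod>i<n. x i powi (U + q)) * (2 * so_rec q n (\<lambda>_. U) ?X * so_vand n x)"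
    by (simp only: mult_ac)
  also have "\<dots> =
      (\<Prod>i<n. x i powi (U + q)) * cs_det 1 q n (\<lambda>_. U) ?X +
      (\<Prod>i<n. x i powi (U + q)) * cs_det (-1) q n (\<lambda>_. U) ?X"
    unfolding weyl by (rule distrib_left)
  also have "\<dots> = (\<Sum>S\<in>Pow {..<n}. (1 + (-1) ^ card S) * (\<Prod>i\<in>S. x i) ^ m * vand n (flip_set S x))"
  proof -
    have "(\<Prod>i<n. x i powi (U + q)) * cs_det \<eta> q n (\<lambda>_. U) ?X =
        (\<Sum>S\<in>Pow {..<n}. \<eta> ^ card S * (\<Prod>i\<in>S. x i) ^ m * vand n (flip_set S x))" for \<eta>
      by (rule cs_det_rect) (use assms in auto)
    then show ?thesis
      by (simp only: sum.distrib[symmetric] distrib_right mult_1_left power_one)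
  qed
  also have "\<dots> = (\<Sum>S | S \<subseteq> {..<n} \<and> even (card S).
      (1 + (-1) ^ card S) * (\<Prod>i\<in>S. x i) ^ m * vand n (flip_set S x))"
    by (rule sum.mono_neutral_right) auto
  also have "\<dots> = (\<Sum>S | S \<subseteq> {..<n} \<and> even (card S). (\<Prod>i\<in>S. x i) ^ m * ?P S) * (2 * so_vand n x)"
    unfolding sum_distrib_right
  proof (intro sum.cong refl)
    fix S assume "S \<in> {S. S \<subseteq> {..<n} \<and> even (card S)}"
    then have "S \<subseteq> {..<n}" "even (card S)" by auto
    then show "(1 + (-1) ^ card S) * (\<Prod>i\<in>S. x i) ^ m * vand n (flip_set S x) =
        (\<Prod>i\<in>S. x i) ^ m * ?P S * (2 * so_vand n x)"
      using vand_flip_set[where x = x, OF x inj ne] by simp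
  qed
  also have "(\<Sum>S | S \<subseteq> {..<n} \<and> even (card S). (\<Prod>i\<in>S. x i) ^ m * ?P S) =
      sign_sum (pair_prod gl_flipped) (pair_prod gl_inside) m (x ` {..<n})"
    unfolding sign_sum_def even_conv_def
  proof (rule sum.reindex_bij_witness[where j = "\<lambda>S. x ` S" and i = "\<lambda>T. {..<n} \<inter> x -` T"])
    fix S assume "S \<in> {S. S \<subseteq> {..<n} \<and> even (card S)}"
    then have S: "S \<subseteq> {..<n}" "even (card S)" by auto
    then have inj': "inj_on x S" by (intro inj_on_subset[OF inj])
    show "{..<n} \<inter> x -` x ` S = S" using S inj by (auto simp: inj_on_def)
    show "x ` S \<in> {T. T \<subseteq> x ` {..<n} \<and> even (card T)}"
      using S card_image[OF inj'] by auto
    have "x ` {..<n} - x ` S = x ` ({..<n} - S)"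
      using inj_on_image_set_diff[OF inj] S by auto
    then show "(\<Prod>s\<in>x ` S. s) ^ m * pair_prod gl_flipped (x ` S) * cross (x ` S) (x ` {..<n} - x ` S) *
        pair_prod gl_inside (x ` {..<n} - x ` S) = (\<Prod>i\<in>S. x i) ^ m * ?P S"
      by (simp add: prod.reindex[OF inj'] mult.assoc)
  next
    fix T assume T: "T \<in> {T. T \<subseteq> x ` {..<n} \<and> even (card T)}"
    then show eq: "x ` ({..<n} \<inter> x -` T) = T" by auto
    have "inj_on x ({..<n} \<inter> x -` T)" by (rule inj_on_subset[OF inj]) auto
    then have "card ({..<n} \<inter> x -` T) = card T" using card_image[of x "{..<n} \<inter> x -` T"] eq by simp
    then show "{..<n} \<inter> x -` T \<in> {S. S \<subseteq> {..<n} \<and> even (card S)}" using T by auto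
  qed
  finally show ?thesis
    using so_vand_nonzero[where x = x, OF x inj ne] by simp
qed

lemma so_rec_zero: "so_rec 0 n (\<lambda>_. 0) x = 1"
proof (induction n rule: nat_less_induct)
  case (1 n)
  consider "n = 0" | "n = Suc 0" | k where "n = Suc (Suc k)" by (metis nat.exhaust)
  then show ?case
  proof cases
    case 3
    have "upper_rows 0 (Suc k) (\<lambda>_. 0) = {\<lambda>_. 0}" "lower_rows 0 (Suc k) (\<lambda>_. 0) = {\<lambda>_. 0}"
      by (auto simp: upper_rows_def lower_rows_def tup_def nabs_def fun_eq_iff not_less split: if_splits)
        (metis linorder_not_less order_antisym)+
    then show ?thesis using 1 3 by (simp add: so_expo_def)
  qed simp_all
qed

text \<open>The character of the trivial shape is 1, and the Weyl sum turns this into the required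
  identity of rational functions.\<close>

lemma sign_sum_zero:
  assumes "finite K" "0 \<notin> K" and "\<And>a b. a \<in> K \<Longrightarrow> b \<in> K \<Longrightarrow> a \<noteq> b \<Longrightarrow> a * b \<noteq> 1"
  shows "sign_sum (pair_prod gl_flipped) (pair_prod gl_inside) 0 K = 1"
proof (cases "K = {}")
  case True
  then show ?thesis by (simp add: sign_sum_def even_conv_def cross_def cong: conj_cong)
next
  case False
  obtain x where x: "inj_on x {..<card K}" "x ` {..<card K} = K"
    using ex_bij_betw_nat_finite[OF assms(1)] by (auto simp: bij_betw_def atLeast0LessThan)
  have mem: "x i \<in> K" if "i < card K" for i using that x(2) by auto
  have nz: "x i \<noteq> 0" if "i < card K" for i using mem[OF that] assms(2) by metis
  have ne: "x i * x j \<noteq> 1" if "i < j" "j < card K" for i j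
    using that mem[of i] mem[of j] x(1) by (intro assms(3)) (auto simp: inj_on_def)
  show ?thesis
    using so_rect_sign_sum[of 0 0 0 "card K" x, OF _ _ _ _ _ nz x(1) ne] False assms(1) x(2)
    by (simp add: so_rec_zero card_gt_0_iff)
qed

theorem even_sum_so_rect:
  assumes q: "0 \<le> q" "q \<le> 1" and U: "0 \<le> U" and m: "int m = 2 * U + q" and n: "0 < n"
    and x: "\<And>i. i < n \<Longrightarrow> x i \<noteq> 0" and inj: "inj_on x {..<n}"
    and ne: "\<And>i j. i \<noteq> j \<Longrightarrow> i < n \<Longrightarrow> j < n \<Longrightarrow> x i * x j \<noteq> 1"
    and lim: "\<And>k y. inj_on y {..<k} \<Longrightarrow> y ` {..<k} \<subseteq> x ` {..<n} \<Longrightarrow>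
      (\<lambda>m. even_sum k m y) \<longlonglongrightarrow> pair_prod gl_inside (y ` {..<k})"
  shows "even_sum n m x = (\<Prod>i<n. x i powi (U + q)) * so_rec q n (\<lambda>_. U) (\<lambda>i. 1 / x i)"
proof -
  have "even_sum n m x = sign_sum (pair_prod gl_flipped) (pair_prod gl_inside) m (x ` {..<n})"
  proof (rule even_sum_eq_sign_sum[OF inj lim])
    fix K assume K: "K \<subseteq> x ` {..<n}"
    show "sign_sum (pair_prod gl_flipped) (pair_prod gl_inside) 0 K = 1"
    proof (rule sign_sum_zero)
      show "finite K" using finite_subset[OF K] by simp
      show "0 \<notin> K" using K x by auto
      fix a b assume "a \<in> K" "b \<in> K" "a \<noteq> b"
      moreover from this K obtain i j where "a = x i" "b = x j" "i < n" "j < n" by blast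
      ultimately show "a * b \<noteq> 1" using ne[of i j] by auto
    qed
  qed
  also have "\<dots> = (\<Prod>i<n. x i powi (U + q)) * so_rec q n (\<lambda>_. U) (\<lambda>i. 1 / x i)"
    by (rule so_rect_sign_sum[symmetric]) (use assms in auto)
  finally show ?thesis .
qed

section \<open>Growth diagrams\<close>

lemma finite_nat_arrays:
  "finite {s :: nat \<Rightarrow> nat \<Rightarrow> nat. (\<forall>i j. s i j \<le> M) \<and> (\<forall>i j. K \<le> i \<or> K \<le> j \<longrightarrow> s i j = 0)}"
proof (rule finite_subset)
  let ?g = "\<lambda>f i j. if i < K \<and> j < K then f (i, j) else (0::nat)"
  show "{s. (\<forall>i j. s i j \<le> M) \<and> (\<forall>i j. K \<le> i \<or> K \<le> j \<longrightarrow> s i j = 0)} \<subseteq>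
      ?g ` PiE ({..<K} \<times> {..<K}) (\<lambda>_. {..M})"
  proof
    fix s :: "nat \<Rightarrow> nat \<Rightarrow> nat"
    assume s: "s \<in> {s. (\<forall>i j. s i j \<le> M) \<and> (\<forall>i j. K \<le> i \<or> K \<le> j \<longrightarrow> s i j = 0)}"
    have "s = ?g (restrict (\<lambda>(i, j). s i j) ({..<K} \<times> {..<K}))"
      using s by (intro ext) (auto simp: not_less)
    moreover have "restrict (\<lambda>(i, j). s i j) ({..<K} \<times> {..<K}) \<in> PiE ({..<K} \<times> {..<K}) (\<lambda>_. {..M})"
      using s by auto
    ultimately show "s \<in> ?g ` PiE ({..<K} \<times> {..<K}) (\<lambda>_. {..M})" by (rule image_eqI)
  qed
  show "finite (?g ` PiE ({..<K} \<times> {..<K}) (\<lambda>_. {..M}))"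
    by (intro finite_imageI finite_PiE) auto
qed

section \<open>The local growth rule\<close>

definition interlace :: "(nat \<Rightarrow> nat) \<Rightarrow> (nat \<Rightarrow> nat) \<Rightarrow> bool" where
  "interlace a b \<longleftrightarrow> (\<forall>j. a j \<le> b j \<and> b (Suc j) \<le> a j)"

text \<open>\<open>K\<close> is a bound on the lengths that all partitions of a diagram have in
  common.\<close>

definition psize :: "nat \<Rightarrow> (nat \<Rightarrow> nat) \<Rightarrow> nat" where
  "psize K a = (\<Sum>j<K. a j)"

text \<open>For a partition this is the number of columns of odd length, the exponent of \<alpha> in
  B; see \<open>oddrows_conjugate\<close>.\<close>

definition alt_sum :: "nat \<Rightarrow> (nat \<Rightarrow> nat) \<Rightarrow> int" where
  "alt_sum K a = (\<Sum>j<K. (-1) ^ j * int (a j))"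

text \<open>The local rule of the growth diagram: from the two neighbours \<open>a\<close>, \<open>b\<close> of \<open>c\<close> and the new first
  part \<open>y\<close> it produces a partition of size \<open>|a| + |b| - |c| + (y - max (a 0) (b 0))\<close>.\<close>

definition grow :: "(nat \<Rightarrow> nat) \<Rightarrow> (nat \<Rightarrow> nat) \<Rightarrow> (nat \<Rightarrow> nat) \<Rightarrow> nat \<Rightarrow> nat \<Rightarrow> nat" where
  "grow a b c y i = (case i of 0 \<Rightarrow> y | Suc j \<Rightarrow> max (a (Suc j)) (b (Suc j)) + min (a j) (b j) - c j)"

definition ungrow :: "(nat \<Rightarrow> nat) \<Rightarrow> (nat \<Rightarrow> nat) \<Rightarrow> (nat \<Rightarrow> nat) \<Rightarrow> nat \<Rightarrow> nat" where
  "ungrow a b d j = max (a (Suc j)) (b (Suc j)) + min (a j) (b j) - d (Suc j)"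

lemma interlaceD:
  assumes "interlace a b"
  shows "a j \<le> b j" "b (Suc j) \<le> a j" "a (Suc j) \<le> a j" "b (Suc j) \<le> b j"
  using assms by (auto simp: interlace_def intro: order.trans)

text \<open>Part j of c and part j + 1 of the grown partition lie in the same interval and are
  mirror images in it. This reflection makes the rule invertible.\<close>

lemma grow_bounds:
  assumes "interlace c a" "interlace c b"
  shows "max (a (Suc j)) (b (Suc j)) \<le> c j" "c j \<le> min (a j) (b j)"
    "max (a (Suc j)) (b (Suc j)) \<le> grow a b c y (Suc j)" "grow a b c y (Suc j) \<le> min (a j) (b j)"
    "grow a b c y (Suc j) + c j = max (a (Suc j)) (b (Suc j)) + min (a j) (b j)"
  using interlaceD(1,2)[OF assms(1), of j] interlaceD(1,2)[OF assms(2), of j]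
  by (auto simp: grow_def)

lemma ungrow_bounds:
  assumes "interlace a d" "interlace b d"
  shows "max (a (Suc j)) (b (Suc j)) \<le> ungrow a b d j" "ungrow a b d j \<le> min (a j) (b j)"
    "max (a (Suc j)) (b (Suc j)) \<le> d (Suc j)" "d (Suc j) \<le> min (a j) (b j)"
  using interlaceD(2)[OF assms(1), of j] interlaceD(2)[OF assms(2), of j]
    interlaceD(1)[OF assms(1), of "Suc j"] interlaceD(1)[OF assms(2), of "Suc j"]
  by (auto simp: ungrow_def)

lemma interlace_grow:
  assumes "interlace c a" "interlace c b" "max (a 0) (b 0) \<le> y"
  shows "interlace a (grow a b c y)" "interlace b (grow a b c y)"
proof -
  have "a j \<le> grow a b c y j \<and> b j \<le> grow a b c y j" for j
    using grow_bounds(3)[OF assms(1,2), where y = y] assms(3) by (cases j) (auto simp: grow_def)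
  moreover have "grow a b c y (Suc j) \<le> a j \<and> grow a b c y (Suc j) \<le> b j" for j
    using grow_bounds(4)[OF assms(1,2), where j = j and y = y] by auto
  ultimately show "interlace a (grow a b c y)" "interlace b (grow a b c y)"
    by (simp_all add: interlace_def)
qed

lemma interlace_ungrow:
  assumes "interlace a d" "interlace b d"
  shows "interlace (ungrow a b d) a" "interlace (ungrow a b d) b"
  using ungrow_bounds(1,2)[OF assms] by (simp_all add: interlace_def)

lemma ungrow_grow: "interlace c a \<Longrightarrow> interlace c b \<Longrightarrow> ungrow a b (grow a b c y) = c"
proof
  fix j assume "interlace c a" "interlace c b"
  then show "ungrow a b (grow a b c y) j = c j"
    using grow_bounds(5)[of c a b 0 j] by (simp add: ungrow_def grow_def)
qed

lemma grow_ungrow: "interlace a d \<Longrightarrow> interlace b d \<Longrightarrow> grow a b (ungrow a b d) (d 0) = d"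
proof
  fix i assume "interlace a d" "interlace b d"
  then show "grow a b (ungrow a b d) (d 0) i = d i"
    using ungrow_bounds(3,4)[of a d b "i - 1"] by (cases i) (auto simp: ungrow_def grow_def)
qed

text \<open>Every reflected pair adds up to a max and a min whose indices differ by one, so after
  regrouping only the first part is left over; \<open>a (K - 1) = 0\<close> closes the sum at the
  far end.\<close>

lemma psize_grow:
  assumes "interlace c a" "interlace c b" "max (a 0) (b 0) \<le> y" "0 < K" "a (K - 1) = 0"
  shows "psize K (grow a b c y) + psize K c = psize K a + psize K b + (y - max (a 0) (b 0))"
proof -
  obtain k where K: "K = Suc k" using assms(4) by (cases K) auto
  have "c k = 0" "min (a k) (b k) = 0" using grow_bounds(2)[OF assms(1,2), of k] assms(5) K by auto
  have "psize K (grow a b c y) + psize K c = y + (\<Sum>j<k. grow a b c y (Suc j) + c j)"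
  proof -
    have "psize K (grow a b c y) = y + (\<Sum>j<k. grow a b c y (Suc j))"
      unfolding psize_def K sum.lessThan_Suc_shift by (simp add: grow_def)
    moreover have "psize K c = (\<Sum>j<k. c j)"
      using \<open>c k = 0\<close> by (simp add: psize_def K)
    ultimately show ?thesis by (simp add: sum.distrib)
  qed
  also have "\<dots> = y + (\<Sum>j<k. max (a (Suc j)) (b (Suc j)) + min (a j) (b j))"
    using grow_bounds(5)[OF assms(1,2)] by simp
  also have "\<dots> = (y - max (a 0) (b 0)) + (\<Sum>j<K. max (a j) (b j)) + (\<Sum>j<K. min (a j) (b j))"
  proof -
    have "(\<Sum>j<K. max (a j) (b j)) = max (a 0) (b 0) + (\<Sum>j<k. max (a (Suc j)) (b (Suc j)))"
      unfolding K by (rule sum.lessThan_Suc_shift)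
    moreover have "(\<Sum>j<K. min (a j) (b j)) = (\<Sum>j<k. min (a j) (b j))"
      using \<open>min (a k) (b k) = 0\<close> by (simp add: K)
    ultimately show ?thesis using assms(3) by (simp add: sum.distrib)
  qed
  also have "\<dots> = (y - max (a 0) (b 0)) + (\<Sum>j<K. max (a j) (b j) + min (a j) (b j))"
    by (simp add: sum.distrib)
  also have "(\<Sum>j<K. max (a j) (b j) + min (a j) (b j)) = (\<Sum>j<K. a j + b j)"
    by (intro sum.cong) (auto simp: max_def min_def)
  finally show ?thesis by (simp add: psize_def sum.distrib)
qed

lemma alt_sum_telescope: "(\<Sum>j<k. (-1) ^ j * (int (a j) + int (a (Suc j)))) = int (a 0) - (-1) ^ k * int (a k)"
  by (induction k) (simp_all add: algebra_simps)

text \<open>At a diagonal cell both neighbours are a, whose parts enter as a j + a (j + 1) and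
  telescope under alternating signs. So the number of odd columns exceeds that of c by exactly the
  weight of the cell.\<close>

lemma alt_sum_grow:
  assumes "interlace c a" "a 0 \<le> y" "0 < K" "a (K - 1) = 0"
  shows "alt_sum K (grow a a c y) = alt_sum K c + int (y - a 0)"
proof -
  obtain k where K: "K = Suc k" using assms(3) by (cases K) auto
  have "c k = 0" using grow_bounds(2)[OF assms(1,1), of k] assms(4) K by auto
  have g: "int (grow a a c y (Suc j)) = int (a j) + int (a (Suc j)) - int (c j)" for j
    using grow_bounds(5)[OF assms(1,1), where j = j and y = y] by simp
  have "alt_sum K (grow a a c y) = int y + (\<Sum>j<k. (-1) ^ Suc j * int (grow a a c y (Suc j)))"
    by (simp only: alt_sum_def K sum.lessThan_Suc_shift) (simp add: grow_def)
  also have "\<dots> = int y - (\<Sum>j<k. (-1) ^ j * (int (a j) + int (a (Suc j)))) + (\<Sum>j<k. (-1) ^ j * int (c j))"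
    unfolding g by (simp add: algebra_simps sum_subtractf sum.distrib sum_negf)
  also have "\<dots> = int (y - a 0) + alt_sum K c"
    unfolding alt_sum_telescope using assms K \<open>c k = 0\<close> by (simp add: alt_sum_def)
  finally show ?thesis by simp
qed

lemma alt_sum_nonneg: "(\<And>j. a (Suc j) \<le> a j) \<Longrightarrow> 0 \<le> alt_sum K a"
proof -
  assume dec: "\<And>j. a (Suc j) \<le> a j"
  have "0 \<le> alt_sum (2 * k) a \<and> alt_sum (2 * k) a \<le> alt_sum (Suc (2 * k)) a" for k
  proof (induction k)
    case (Suc k)
    then show ?case using dec[of "2 * k"] by (simp add: alt_sum_def)
  qed (simp add: alt_sum_def)
  from this[of "K div 2"] show ?thesis
    by (cases "even K") (auto elim!: oddE)
qed

text \<open>Sequences of partitions along the boundary path after the cells up to \<open>(N, k - 1)\<close> have been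
  added: \<open>s 1, \<dots>, s k\<close> belong to the cells \<open>(N, 0), \<dots>, (N, k - 1)\<close>, and \<open>s (k + 1), \<dots>, s (N + 1)\<close> to
  \<open>(N - 1, k - 1), \<dots>, (N - 1, N - 1)\<close>.\<close>

definition hybrids :: "nat \<Rightarrow> nat \<Rightarrow> nat \<Rightarrow> (nat \<Rightarrow> nat \<Rightarrow> nat) set" where
  "hybrids M N k = {s. (\<forall>i<k. interlace (s i) (s (Suc i))) \<and> (k \<le> N \<longrightarrow> interlace (s (Suc k)) (s k)) \<and>
     (\<forall>i. k < i \<and> i \<le> N \<longrightarrow> interlace (s i) (s (Suc i))) \<and> (\<forall>i>Suc N. s i = (\<lambda>_. 0)) \<and>
     (\<forall>i\<le>k. \<forall>j\<ge>i. s i j = 0) \<and> (\<forall>i>k. \<forall>j\<ge>i - 1. s i j = 0) \<and> (\<forall>i. s i 0 \<le> M)}"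

lemma hybridsI:
  assumes "\<And>i. i < k \<Longrightarrow> interlace (s i) (s (Suc i))" "k \<le> N \<Longrightarrow> interlace (s (Suc k)) (s k)"
    "\<And>i. k < i \<Longrightarrow> i \<le> N \<Longrightarrow> interlace (s i) (s (Suc i))" "\<And>i. Suc N < i \<Longrightarrow> s i = (\<lambda>_. 0)"
    "\<And>i j. i \<le> k \<Longrightarrow> i \<le> j \<Longrightarrow> s i j = 0" "\<And>i j. k < i \<Longrightarrow> i - 1 \<le> j \<Longrightarrow> s i j = 0" "\<And>i. s i 0 \<le> M"
  shows "s \<in> hybrids M N k"
  using assms by (simp add: hybrids_def)

text \<open>Every edge of the boundary path carries the variable of its row or column, raised to the
  difference in size of its end points. The partition \<open>s (Suc N)\<close> sits on the diagonal
  and carries \<alpha>.\<close>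

definition hybrid_weight :: "(nat \<Rightarrow> real) \<Rightarrow> real \<Rightarrow> nat \<Rightarrow> nat \<Rightarrow> (nat \<Rightarrow> nat \<Rightarrow> nat) \<Rightarrow> real" where
  "hybrid_weight p \<alpha> N k s =
     (\<Prod>i<k. p i ^ (psize (N + 2) (s (Suc i)) - psize (N + 2) (s i))) *
     (if k \<le> N then p N ^ (psize (N + 2) (s k) - psize (N + 2) (s (Suc k))) else 1) *
     (\<Prod>i\<in>{k..<N}. p i ^ (psize (N + 2) (s (Suc (Suc i))) - psize (N + 2) (s (Suc i)))) *
     \<alpha> ^ nat (alt_sum (N + 2) (s (Suc N)))"

definition hybrid_sum :: "nat \<Rightarrow> (nat \<Rightarrow> real) \<Rightarrow> real \<Rightarrow> nat \<Rightarrow> nat \<Rightarrow> ((nat \<Rightarrow> nat) \<Rightarrow> real) \<Rightarrow> real" where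
  "hybrid_sum M p \<alpha> N k f = (\<Sum>s\<in>hybrids M N k. hybrid_weight p \<alpha> N k s * f (\<lambda>i. s i 0))"

definition cell_param :: "(nat \<Rightarrow> real) \<Rightarrow> real \<Rightarrow> nat \<Rightarrow> nat \<Rightarrow> real" where
  "cell_param p \<alpha> i j = (if j < i then p i * p j else \<alpha> * p i)"

text \<open>The effect of one cell on a function of the current passage times: y is the time of the
  new cell, so its weight is y minus the larger neighbouring time. Growth diagrams and weight arrays
  both evolve by this operator.\<close>

definition cell_op :: "nat \<Rightarrow> real \<Rightarrow> nat \<Rightarrow> ((nat \<Rightarrow> nat) \<Rightarrow> real) \<Rightarrow> (nat \<Rightarrow> nat) \<Rightarrow> real" where
  "cell_op M r k f v = (\<Sum>y\<in>{max (v k) (v (k + 2))..M}. r ^ (y - max (v k) (v (k + 2))) * f (v(Suc k := y)))"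

lemma psize_mono: "interlace a b \<Longrightarrow> psize K a \<le> psize K b"
  unfolding psize_def by (intro sum_mono interlaceD(1))

lemma finite_hybrids: "k \<le> Suc N \<Longrightarrow> finite (hybrids M N k)"
proof (rule finite_subset[OF _ finite_nat_arrays[of M "N + 2"]], rule subsetI)
  fix s assume k: "k \<le> Suc N" and s: "s \<in> hybrids M N k"
  have "s i (Suc j) \<le> s i j" for i j
  proof -
    consider "i < k" | "i = k" "k \<le> N" | "i = k" "k = Suc N" | "k < i" "i \<le> N" | "i = Suc N" "k \<le> N" | "Suc N < i"
      using k by linarith
    then show ?thesis
    proof cases
      case 1
      then have "interlace (s i) (s (Suc i))" using s by (auto simp: hybrids_def)
      then show ?thesis by (rule interlaceD)
    next
      case 2
      then have "interlace (s (Suc k)) (s k)" using s by (auto simp: hybrids_def)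
      then show ?thesis unfolding 2 by (rule interlaceD)
    next
      case 3
      then have "interlace (s N) (s (Suc N))" using s by (auto simp: hybrids_def)
      then show ?thesis unfolding 3 by (rule interlaceD)
    next
      case 4
      then have "interlace (s i) (s (Suc i))" using s by (auto simp: hybrids_def)
      then show ?thesis by (rule interlaceD)
    next
      case 5
      show ?thesis
      proof (cases "k = N")
        case True
        then have "interlace (s (Suc N)) (s N)" using s by (auto simp: hybrids_def)
        then show ?thesis unfolding 5 by (rule interlaceD)
      next
        case False
        then have "interlace (s N) (s (Suc N))" using s 5 by (auto simp: hybrids_def)
        then show ?thesis unfolding 5 by (rule interlaceD)
      qed
    next
      case 6
      then show ?thesis using s by (auto simp: hybrids_def)
    qed
  qed
  then have "s i j \<le> s i 0" for i j
    by (rule decreasing_le_first)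
  moreover have "s i 0 \<le> M" for i
    using s by (simp add: hybrids_def)
  ultimately have "s i j \<le> M" for i j
    by (rule order.trans)
  moreover have "s i j = 0" if "N + 2 \<le> i \<or> N + 2 \<le> j" for i j
  proof (cases "N + 2 \<le> i")
    case False
    then have "N + 2 \<le> j" "i \<le> j" "i - 1 \<le> j" using that by auto
    then show ?thesis using s by (cases "i \<le> k") (auto simp: hybrids_def)
  qed (use s in \<open>auto simp: hybrids_def\<close>)
  ultimately show "s \<in> {s. (\<forall>i j. s i j \<le> M) \<and> (\<forall>i j. N + 2 \<le> i \<or> N + 2 \<le> j \<longrightarrow> s i j = 0)}"
    by blast
qed

text \<open>By symmetry the upper neighbour of a diagonal cell carries the same partition as its
  left neighbour.\<close>

definition right_neighbour :: "nat \<Rightarrow> nat \<Rightarrow> (nat \<Rightarrow> nat \<Rightarrow> nat) \<Rightarrow> nat \<Rightarrow> nat" where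
  "right_neighbour N k s = (if k < N then s (k + 2) else s k)"

lemma hybrids_interlace_old:
  assumes "s \<in> hybrids M N k" "k \<le> N"
  shows "interlace (s (Suc k)) (s k)" "interlace (s (Suc k)) (right_neighbour N k s)"
  using assms by (auto simp: hybrids_def right_neighbour_def)

lemma hybrids_interlace_new:
  assumes "s \<in> hybrids M N (Suc k)" "k \<le> N"
  shows "interlace (s k) (s (Suc k))" "interlace (right_neighbour N k s) (s (Suc k))"
  using assms by (auto simp: hybrids_def right_neighbour_def)

lemma right_neighbour_upd [simp]: "right_neighbour N k (s(Suc k := d)) = right_neighbour N k s"
  by (simp add: right_neighbour_def)

lemma hybrids_flip:
  assumes s: "s \<in> hybrids M N k" and k: "k \<le> N"
    and y: "max (s k 0) (right_neighbour N k s 0) \<le> y" "y \<le> M"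
  shows "s(Suc k := grow (s k) (right_neighbour N k s) (s (Suc k)) y) \<in> hybrids M N (Suc k)"
proof -
  let ?b = "right_neighbour N k s"
  let ?d = "grow (s k) ?b (s (Suc k)) y"
  let ?s = "s(Suc k := ?d)"
  note old = hybrids_interlace_old[OF s k]
  note new = interlace_grow[OF old y(1)]
  have supp: "?d j = 0" if j: "j \<ge> Suc k" for j
  proof -
    obtain i where i: "j = Suc i" "i \<ge> k" using j by (cases j) auto
    then have "s k i = 0" using s by (auto simp: hybrids_def)
    then show ?thesis
      using grow_bounds(4)[OF old, where j = i and y = y] i by simp
  qed
  have 1: "interlace (?s i) (?s (Suc i))" if "i < Suc k" for i
    using that new(1) s by (cases "i = k") (auto simp: hybrids_def)
  have 2: "interlace (?s (Suc (Suc k))) (?s (Suc k))" if "Suc k \<le> N"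
    using that new(2) by (simp add: right_neighbour_def)
  have 3: "interlace (?s i) (?s (Suc i))" if "Suc k < i" "i \<le> N" for i
    using that s by (auto simp: hybrids_def)
  have 4: "?s i j = 0" if "i \<le> Suc k" "j \<ge> i" for i j
    using that supp s by (cases "i = Suc k") (auto simp: hybrids_def)
  have 5: "?s i j = 0" if "i > Suc k" "j \<ge> i - 1" for i j
    using that s by (auto simp: hybrids_def)
  have 6: "?s i 0 \<le> M" for i
    using s y(2) by (auto simp: hybrids_def grow_def)
  have 7: "?s i = (\<lambda>_. 0)" if "i > Suc N" for i
    using that s k by (auto simp: hybrids_def)
  show ?thesis
    by (rule hybridsI) (fact 1 2 3 4 5 6 7)+
qed

lemma hybrids_unflip:
  assumes s: "s \<in> hybrids M N (Suc k)" and k: "k \<le> N"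
  shows "s(Suc k := ungrow (s k) (right_neighbour N k s) (s (Suc k))) \<in> hybrids M N k"
proof -
  let ?b = "right_neighbour N k s"
  let ?c = "ungrow (s k) ?b (s (Suc k))"
  let ?s = "s(Suc k := ?c)"
  note new = hybrids_interlace_new[OF s k]
  note old = interlace_ungrow[OF new]
  have le: "?c j \<le> s k j" for j
    using ungrow_bounds(2)[OF new, of j] by simp
  have supp: "?c j = 0" if "j \<ge> k" for j
    using le[of j] that s by (auto simp: hybrids_def)
  have 1: "interlace (?s i) (?s (Suc i))" if "i < k" for i
    using that s by (auto simp: hybrids_def)
  have 2: "interlace (?s (Suc k)) (?s k)" if "k \<le> N" using old(1) by simp
  have 3: "interlace (?s i) (?s (Suc i))" if "k < i" "i \<le> N" for i
    using that old(2) s by (cases "i = Suc k") (auto simp: hybrids_def right_neighbour_def)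
  have 4: "?s i j = 0" if "i \<le> k" "j \<ge> i" for i j
    using that s by (auto simp: hybrids_def)
  have 5: "?s i j = 0" if "i > k" "j \<ge> i - 1" for i j
    using that s supp by (cases "i = Suc k") (auto simp: hybrids_def)
  have "s k 0 \<le> M" using s by (auto simp: hybrids_def)
  then have "?c 0 \<le> M" using le[of 0] by simp
  then have 6: "?s i 0 \<le> M" for i
    using s by (cases "i = Suc k") (auto simp: hybrids_def)
  have 7: "?s i = (\<lambda>_. 0)" if "i > Suc N" for i
    using that s k by (auto simp: hybrids_def)
  show ?thesis
    by (rule hybridsI) (fact 1 2 3 4 5 6 7)+
qed

text \<open>Off the diagonal the exponents of p N and of p k both increase by the weight of the
  cell. On the diagonal only that of p N does, and the factor with \<alpha> comes from
  \<open>alt_sum_grow\<close>.\<close>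

lemma hybrid_weight_flip:
  assumes s: "s \<in> hybrids M N k" and k: "k \<le> N"
    and y: "max (s k 0) (right_neighbour N k s 0) \<le> y"
  shows "hybrid_weight p \<alpha> N (Suc k) (s(Suc k := grow (s k) (right_neighbour N k s) (s (Suc k)) y)) =
    cell_param p \<alpha> N k ^ (y - max (s k 0) (right_neighbour N k s 0)) * hybrid_weight p \<alpha> N k s"
proof -
  define K where "K = N + 2"
  let ?b = "right_neighbour N k s"
  let ?d = "grow (s k) ?b (s (Suc k)) y"
  let ?s = "s(Suc k := ?d)"
  define w where "w = y - max (s k 0) (?b 0)"
  note old = hybrids_interlace_old[OF s k]
  note new = interlace_grow[OF old y]
  have sk: "s k (K - 1) = 0" "0 < K" using s k by (auto simp: hybrids_def K_def)
  have size: "psize K ?d + psize K (s (Suc k)) = psize K (s k) + psize K ?b + w"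
    using psize_grow[OF old y sk(2,1)] by (simp add: w_def)
  have le: "psize K (s (Suc k)) \<le> psize K (s k)" "psize K (s (Suc k)) \<le> psize K ?b"
    "psize K (s k) \<le> psize K ?d" "psize K ?b \<le> psize K ?d"
    using psize_mono old new by auto
  have left: "(\<Prod>i<Suc k. p i ^ (psize K (?s (Suc i)) - psize K (?s i))) =
      (\<Prod>i<k. p i ^ (psize K (s (Suc i)) - psize K (s i))) * p k ^ (psize K ?d - psize K (s k))"
    by simp
  show ?thesis
  proof (cases "k < N")
    case True
    then have b: "?b = s (Suc (Suc k))" by (simp add: right_neighbour_def)
    have right: "(\<Prod>i\<in>{k..<N}. p i ^ (psize K (s (Suc (Suc i))) - psize K (s (Suc i)))) =
        p k ^ (psize K ?b - psize K (s (Suc k))) *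
        (\<Prod>i\<in>{Suc k..<N}. p i ^ (psize K (?s (Suc (Suc i))) - psize K (?s (Suc i))))"
    proof -
      have "{k..<N} = insert k {Suc k..<N}" using True by auto
      then show ?thesis by (simp add: b)
    qed
    have e1: "psize K ?d - psize K (s k) = w + (psize K ?b - psize K (s (Suc k)))"
      and e2: "psize K ?d - psize K ?b = w + (psize K (s k) - psize K (s (Suc k)))"
      using size le by linarith+
    have "?s (Suc N) = s (Suc N)" using True by simp
    moreover have "cell_param p \<alpha> N k = p N * p k" using True by (simp add: cell_param_def)
    ultimately show ?thesis
      unfolding hybrid_weight_def K_def[symmetric] left right w_def[symmetric]
      using True b by (simp add: e1[unfolded b] e2[unfolded b] power_add power_mult_distrib)
  next
    case False
    then have kN: "k = N" using k by simp
    then have b: "?b = s k" by (simp add: right_neighbour_def)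
    have e1: "psize K ?d - psize K (s k) = w + (psize K (s k) - psize K (s (Suc k)))"
      using size le unfolding b by linarith
    have "s k 0 \<le> y" using y b by simp
    have "alt_sum K ?d = alt_sum K (s (Suc k)) + int w"
      using alt_sum_grow[OF old(1) \<open>s k 0 \<le> y\<close> sk(2,1)] unfolding b w_def by simp
    moreover have "0 \<le> alt_sum K (s (Suc k))"
      by (rule alt_sum_nonneg) (rule interlaceD(3)[OF old(1)])
    ultimately have e2: "nat (alt_sum K ?d) = w + nat (alt_sum K (s (Suc k)))" by simp
    have "cell_param p \<alpha> N k = \<alpha> * p k" using kN by (simp add: cell_param_def)
    then show ?thesis
      unfolding hybrid_weight_def K_def[symmetric] left w_def[symmetric]
      using kN by (simp add: e1[unfolded b, unfolded kN] e2[unfolded b, unfolded kN] b[unfolded kN] power_add power_mult_distrib)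
  qed
qed

text \<open>\<open>grow\<close> and \<open>ungrow\<close> match an old sequence together with a new
  first part y to a new sequence.\<close>

lemma hybrid_sum_Suc:
  assumes k: "k \<le> N"
  shows "hybrid_sum M p \<alpha> N (Suc k) f = hybrid_sum M p \<alpha> N k (cell_op M (cell_param p \<alpha> N k) k f)"
proof -
  let ?b = "right_neighbour N k"
  \<comment> \<open>For k = N the entry at k + 2 is the empty partition, while
    \<open>right_neighbour\<close> repeats \<open>s k\<close>; the maximum is the same.\<close>
  have nb: "max (s k 0) (s (k + 2) 0) = max (s k 0) (?b s 0)" if "s \<in> hybrids M N k'" for s k'
    using that k by (cases "k = N") (auto simp: right_neighbour_def hybrids_def)
  have "hybrid_sum M p \<alpha> N k (cell_op M (cell_param p \<alpha> N k) k f) =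
      (\<Sum>s\<in>hybrids M N k. \<Sum>y\<in>{max (s k 0) (?b s 0)..M}. hybrid_weight p \<alpha> N k s *
        (cell_param p \<alpha> N k ^ (y - max (s k 0) (?b s 0)) * f ((\<lambda>i. s i 0)(Suc k := y))))"
    unfolding hybrid_sum_def cell_op_def sum_distrib_left
    by (intro sum.cong refl) (simp_all only: nb)
  also have "\<dots> = (\<Sum>(s, y)\<in>Sigma (hybrids M N k) (\<lambda>s. {max (s k 0) (?b s 0)..M}). hybrid_weight p \<alpha> N k s *
        (cell_param p \<alpha> N k ^ (y - max (s k 0) (?b s 0)) * f ((\<lambda>i. s i 0)(Suc k := y))))"
    using k by (intro sum.Sigma) (auto intro: finite_hybrids)
  also have "\<dots> = hybrid_sum M p \<alpha> N (Suc k) f"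
    unfolding hybrid_sum_def
  proof (rule sum.reindex_bij_witness[where
        j = "\<lambda>(s, y). s(Suc k := grow (s k) (?b s) (s (Suc k)) y)" and
        i = "\<lambda>s. (s(Suc k := ungrow (s k) (?b s) (s (Suc k))), s (Suc k) 0)"])
    fix z assume z: "z \<in> Sigma (hybrids M N k) (\<lambda>s. {max (s k 0) (?b s 0)..M})"
    obtain s y where sy: "z = (s, y)" by (cases z)
    with z have s: "s \<in> hybrids M N k" and y: "max (s k 0) (?b s 0) \<le> y" "y \<le> M" by auto
    let ?s = "s(Suc k := grow (s k) (?b s) (s (Suc k)) y)"
    have "(\<lambda>i. ?s i 0) = (\<lambda>i. s i 0)(Suc k := y)"
      by (auto simp: grow_def)
    then show "hybrid_weight p \<alpha> N (Suc k) (case z of (s, y) \<Rightarrow> s(Suc k := grow (s k) (?b s) (s (Suc k)) y)) *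
        f (\<lambda>i. (case z of (s, y) \<Rightarrow> s(Suc k := grow (s k) (?b s) (s (Suc k)) y)) i 0) =
        (case z of (s, y) \<Rightarrow> hybrid_weight p \<alpha> N k s *
        (cell_param p \<alpha> N k ^ (y - max (s k 0) (?b s 0)) * f ((\<lambda>i. s i 0)(Suc k := y))))"
      using hybrid_weight_flip[OF s k y(1)] by (simp add: sy mult_ac)
    show "(case z of (s, y) \<Rightarrow> s(Suc k := grow (s k) (?b s) (s (Suc k)) y)) \<in> hybrids M N (Suc k)"
      using hybrids_flip[OF s k y] by (simp add: sy)
    show "(\<lambda>s. (s(Suc k := ungrow (s k) (?b s) (s (Suc k))), s (Suc k) 0))
        (case z of (s, y) \<Rightarrow> s(Suc k := grow (s k) (?b s) (s (Suc k)) y)) = z"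
      using ungrow_grow[OF hybrids_interlace_old[OF s k]] by (simp add: sy grow_def)
  next
    fix s assume s: "s \<in> hybrids M N (Suc k)"
    note new = hybrids_interlace_new[OF s k]
    show "(case (s(Suc k := ungrow (s k) (?b s) (s (Suc k))), s (Suc k) 0) of (s, y) \<Rightarrow>
        s(Suc k := grow (s k) (?b s) (s (Suc k)) y)) = s"
      using grow_ungrow[OF new] by simp
    have "max (s k 0) (?b s 0) \<le> s (Suc k) 0"
      using interlaceD(1)[OF new(1), of 0] interlaceD(1)[OF new(2), of 0] by simp
    moreover have "s (Suc k) 0 \<le> M" using s by (auto simp: hybrids_def)
    ultimately show "(s(Suc k := ungrow (s k) (?b s) (s (Suc k))), s (Suc k) 0)
        \<in> Sigma (hybrids M N k) (\<lambda>s. {max (s k 0) (?b s 0)..M})"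
      using hybrids_unflip[OF s k] by simp
  qed
  finally show ?thesis ..
qed

section \<open>Passage times of weight arrays\<close>

text \<open>At the start of a new row this moves column j of the old row to index j + 2. Then the
  cell in column k finds its left neighbour at k and its upper neighbour at k + 2, and overwrites
  the diagonal predecessor at k + 1.\<close>

definition shift :: "(nat \<Rightarrow> 'a::zero) \<Rightarrow> nat \<Rightarrow> 'a" where
  "shift v i = (case i of 0 \<Rightarrow> 0 | Suc j \<Rightarrow> v j)"

lemma shift_simps [simp]: "shift v 0 = 0" "shift v (Suc j) = v j"
  by (simp_all add: shift_def)

text \<open>The index \<open>Suc j\<close> of a vector of passage times refers to column \<open>j\<close>, and indices without a cell
  hold the value 0. In particular the vertical predecessor of a diagonal cell counts as 0, which is
  harmless by symmetry.\<close>

primrec row_passage :: "(nat \<Rightarrow> nat) \<Rightarrow> (nat \<Rightarrow> nat) \<Rightarrow> nat \<Rightarrow> nat \<Rightarrow> nat" where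
  "row_passage r v 0 = v"
| "row_passage r v (Suc k) = (row_passage r v k)
     (Suc k := max (row_passage r v k k) (row_passage r v k (k + 2)) + r k)"

primrec passage :: "(nat \<Rightarrow> nat \<Rightarrow> nat) \<Rightarrow> nat \<Rightarrow> nat \<Rightarrow> nat" where
  "passage w 0 = (\<lambda>_. 0)"
| "passage w (Suc N) = row_passage (w N) (shift (passage w N)) (Suc N)"

definition partial_passage :: "(nat \<Rightarrow> nat \<Rightarrow> nat) \<Rightarrow> nat \<Rightarrow> nat \<Rightarrow> nat \<Rightarrow> nat" where
  "partial_passage w N k = row_passage (w N) (shift (passage w N)) k"

lemma row_passage_cong: "(\<And>j. j < k \<Longrightarrow> r j = r' j) \<Longrightarrow> row_passage r v k = row_passage r' v k"
  by (induction k) auto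

lemma passage_cong: "(\<And>i. i < N \<Longrightarrow> w i = w' i) \<Longrightarrow> passage w N = passage w' N"
  by (induction N) auto

definition cells :: "nat \<Rightarrow> nat \<Rightarrow> (nat \<times> nat) set" where
  "cells N k = {(i, j). i < N \<and> j \<le> i \<or> i = N \<and> j < k}"

text \<open>Every passage time is bounded, to match the truncated sums of \<open>cell_op\<close>.
  For a full triangle this is a bound on the last time alone, see
  \<open>mem_arrays_iff\<close>.\<close>

definition arrays :: "nat \<Rightarrow> nat \<Rightarrow> nat \<Rightarrow> (nat \<Rightarrow> nat \<Rightarrow> nat) set" where
  "arrays M N k = {w. (\<forall>i j. (i, j) \<notin> cells N k \<longrightarrow> w i j = 0) \<and>
     (\<forall>(i, j)\<in>cells N k. partial_passage w i (Suc j) (Suc j) \<le> M)}"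

definition array_weight :: "(nat \<Rightarrow> real) \<Rightarrow> real \<Rightarrow> nat \<Rightarrow> nat \<Rightarrow> (nat \<Rightarrow> nat \<Rightarrow> nat) \<Rightarrow> real" where
  "array_weight p \<alpha> N k w = (\<Prod>i<N. \<Prod>j\<le>i. cell_param p \<alpha> i j ^ w i j) * (\<Prod>j<k. cell_param p \<alpha> N j ^ w N j)"

definition array_sum :: "nat \<Rightarrow> (nat \<Rightarrow> real) \<Rightarrow> real \<Rightarrow> nat \<Rightarrow> nat \<Rightarrow> ((nat \<Rightarrow> nat) \<Rightarrow> real) \<Rightarrow> real" where
  "array_sum M p \<alpha> N k f = (\<Sum>w\<in>arrays M N k. array_weight p \<alpha> N k w * f (partial_passage w N k))"

definition set_cell :: "(nat \<Rightarrow> nat \<Rightarrow> nat) \<Rightarrow> nat \<Rightarrow> nat \<Rightarrow> nat \<Rightarrow> nat \<Rightarrow> nat \<Rightarrow> nat" where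
  "set_cell w N k y = w(N := (w N)(k := y))"

lemma set_cell_idem: "set_cell (set_cell w N k y) N k z = set_cell w N k z"
  by (simp add: set_cell_def)

lemma partial_passage_cong:
  assumes "\<And>i j. (i, j) \<in> cells N k \<Longrightarrow> w i j = w' i j"
    and "\<And>i. i < N \<Longrightarrow> w i = w' i"
  shows "partial_passage w N k = partial_passage w' N k"
proof -
  have "passage w N = passage w' N" by (rule passage_cong) (rule assms(2))
  moreover have "row_passage (w N) v k = row_passage (w' N) v k" for v
    using assms(1) by (intro row_passage_cong) (simp add: cells_def)
  ultimately show ?thesis by (simp add: partial_passage_def)
qed

lemma partial_passage_set_cell:
  "i < N \<or> i = N \<and> l \<le> k \<Longrightarrow> partial_passage (set_cell w N k y) i l = partial_passage w i l"
  by (rule partial_passage_cong) (auto simp: set_cell_def cells_def)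

lemma partial_passage_Suc:
  "partial_passage w N (Suc k) = (partial_passage w N k)
     (Suc k := max (partial_passage w N k k) (partial_passage w N k (k + 2)) + w N k)"
  by (simp add: partial_passage_def)

lemma cells_Suc: "cells N (Suc k) = insert (N, k) (cells N k)"
  by (auto simp: cells_def less_Suc_eq)

lemma cells_next_row: "cells (Suc N) 0 = cells N (Suc N)"
  by (auto simp: cells_def less_Suc_eq)

lemma partial_passage_next_row: "partial_passage w (Suc N) 0 = shift (partial_passage w N (Suc N))"
  by (simp add: partial_passage_def)

lemma arrays_set_cell:
  assumes w: "w \<in> arrays M N k"
    and y: "max (partial_passage w N k k) (partial_passage w N k (k + 2)) \<le> y" "y \<le> M"
    and w': "w' = set_cell w N k (y - max (partial_passage w N k k) (partial_passage w N k (k + 2)))"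
  shows "w' \<in> arrays M N (Suc k)" "partial_passage w' N (Suc k) = (partial_passage w N k)(Suc k := y)"
proof -
  show 1: "partial_passage w' N (Suc k) = (partial_passage w N k)(Suc k := y)"
    using y(1) by (simp add: w' partial_passage_Suc partial_passage_set_cell) (simp add: set_cell_def)
  have "partial_passage w' i (Suc j) (Suc j) \<le> M" if "(i, j) \<in> cells N (Suc k)" for i j
  proof (cases "i = N \<and> j = k")
    case True
    then show ?thesis using 1 y(2) by simp
  next
    case False
    then have ij: "(i, j) \<in> cells N k" using that by (auto simp: cells_Suc)
    then have "partial_passage w' i (Suc j) = partial_passage w i (Suc j)"
      unfolding w' by (intro partial_passage_set_cell) (auto simp: cells_def)
    then show ?thesis using w ij by (auto simp: arrays_def)
  qed
  moreover have "w' i j = 0" if "(i, j) \<notin> cells N (Suc k)" for i j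
    using w that by (auto simp: w' set_cell_def arrays_def cells_Suc)
  ultimately show "w' \<in> arrays M N (Suc k)" by (auto simp: arrays_def)
qed

lemma arrays_clear_cell:
  assumes w: "w \<in> arrays M N (Suc k)"
  shows "set_cell w N k 0 \<in> arrays M N k"
proof -
  have "partial_passage (set_cell w N k 0) i (Suc j) (Suc j) \<le> M" if ij: "(i, j) \<in> cells N k" for i j
  proof -
    have "partial_passage (set_cell w N k 0) i (Suc j) = partial_passage w i (Suc j)"
      using ij by (intro partial_passage_set_cell) (auto simp: cells_def)
    then show ?thesis using w ij by (auto simp: arrays_def cells_Suc)
  qed
  moreover have "(set_cell w N k 0) i j = 0" if "(i, j) \<notin> cells N k" for i j
    using w that by (auto simp: set_cell_def arrays_def cells_Suc)
  ultimately show ?thesis by (auto simp: arrays_def)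
qed

text \<open>Once the neighbouring times are fixed, the weight of a cell and its passage time
  determine each other.\<close>

lemma arrays_cell_bij:
  defines "m \<equiv> \<lambda>w N k. max (partial_passage w N k k) (partial_passage w N k (k + 2))"
  shows "bij_betw (\<lambda>(w, y). set_cell w N k (y - m w N k)) (SIGMA w:arrays M N k. {m w N k..M}) (arrays M N (Suc k))"
proof (rule bij_betw_byWitness[where f' = "\<lambda>w. (set_cell w N k 0, partial_passage w N (Suc k) (Suc k))"])
  show "(\<lambda>(w, y). set_cell w N k (y - m w N k)) ` (SIGMA w:arrays M N k. {m w N k..M}) \<subseteq> arrays M N (Suc k)"
    using arrays_set_cell(1) by (auto simp: m_def)
  show "\<forall>z\<in>SIGMA w:arrays M N k. {m w N k..M}.
      (set_cell (case z of (w, y) \<Rightarrow> set_cell w N k (y - m w N k)) N k 0,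
       partial_passage (case z of (w, y) \<Rightarrow> set_cell w N k (y - m w N k)) N (Suc k) (Suc k)) = z"
  proof
    fix z assume "z \<in> (SIGMA w:arrays M N k. {m w N k..M})"
    then obtain w y where z: "z = (w, y)" "w \<in> arrays M N k" "m w N k \<le> y" "y \<le> M" by auto
    have "w N k = 0" using z(2) by (auto simp: arrays_def cells_def)
    then have "set_cell w N k 0 = w" by (auto simp: set_cell_def fun_eq_iff)
    then show "(set_cell (case z of (w, y) \<Rightarrow> set_cell w N k (y - m w N k)) N k 0,
       partial_passage (case z of (w, y) \<Rightarrow> set_cell w N k (y - m w N k)) N (Suc k) (Suc k)) = z"
      using arrays_set_cell(2)[OF z(2) z(3)[unfolded m_def] z(4) refl] by (simp add: z set_cell_idem m_def)
  qed
  have eq: "m (set_cell w N k 0) N k + w N k = partial_passage w N (Suc k) (Suc k)" for w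
    by (simp add: m_def partial_passage_set_cell partial_passage_Suc)
  show "\<forall>w\<in>arrays M N (Suc k). (case (set_cell w N k 0, partial_passage w N (Suc k) (Suc k)) of
      (w, y) \<Rightarrow> set_cell w N k (y - m w N k)) = w"
    unfolding eq[symmetric] by (simp add: set_cell_def)
  show "(\<lambda>w. (set_cell w N k 0, partial_passage w N (Suc k) (Suc k))) ` arrays M N (Suc k)
      \<subseteq> (SIGMA w:arrays M N k. {m w N k..M})"
  proof
    fix z assume "z \<in> (\<lambda>w. (set_cell w N k 0, partial_passage w N (Suc k) (Suc k))) ` arrays M N (Suc k)"
    then obtain w where w: "w \<in> arrays M N (Suc k)" "z = (set_cell w N k 0, partial_passage w N (Suc k) (Suc k))"
      by blast
    have "partial_passage w N (Suc k) (Suc k) \<le> M"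
      using w(1) by (auto simp: arrays_def cells_def)
    then show "z \<in> (SIGMA w:arrays M N k. {m w N k..M})"
      using arrays_clear_cell[OF w(1)] eq[of w] by (simp add: w(2))
  qed
qed

lemma arrays_0: "arrays M 0 0 = {\<lambda>_ _. 0}"
  by (auto simp: arrays_def cells_def)

lemma arrays_next_row: "arrays M (Suc N) 0 = arrays M N (Suc N)"
  by (simp add: arrays_def cells_next_row)

lemma finite_arrays: "finite (arrays M N k)"
proof -
  have step: "finite (arrays M N k)" if "finite (arrays M N 0)" for N k
  proof (induction k)
    case (Suc k)
    then show ?case using bij_betw_finite[OF arrays_cell_bij[of N k M]] by simp
  qed (rule that)
  have "finite (arrays M N 0)"
    by (induction N) (simp_all add: arrays_0 arrays_next_row step)
  then show ?thesis by (rule step)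
qed

lemma array_weight_set_cell:
  assumes "w \<in> arrays M N k"
  shows "array_weight p \<alpha> N (Suc k) (set_cell w N k y) = cell_param p \<alpha> N k ^ y * array_weight p \<alpha> N k w"
  by (simp add: array_weight_def set_cell_def)

lemma array_sum_Suc:
  "array_sum M p \<alpha> N (Suc k) f = array_sum M p \<alpha> N k (cell_op M (cell_param p \<alpha> N k) k f)"
proof -
  define m where "m w = max (partial_passage w N k k) (partial_passage w N k (k + 2))" for w
  have "array_sum M p \<alpha> N k (cell_op M (cell_param p \<alpha> N k) k f) =
      (\<Sum>w\<in>arrays M N k. \<Sum>y\<in>{m w..M}. array_weight p \<alpha> N k w *
        (cell_param p \<alpha> N k ^ (y - m w) * f ((partial_passage w N k)(Suc k := y))))"
    unfolding array_sum_def cell_op_def sum_distrib_left m_def ..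
  also have "\<dots> = (\<Sum>(w, y)\<in>(SIGMA w:arrays M N k. {m w..M}). array_weight p \<alpha> N k w *
        (cell_param p \<alpha> N k ^ (y - m w) * f ((partial_passage w N k)(Suc k := y))))"
    by (rule sum.Sigma) (auto simp: finite_arrays)
  also have "\<dots> = (\<Sum>z\<in>(SIGMA w:arrays M N k. {m w..M}).
      (\<lambda>w. array_weight p \<alpha> N (Suc k) w * f (partial_passage w N (Suc k)))
        ((\<lambda>(w, y). set_cell w N k (y - m w)) z))"
  proof (rule sum.cong)
    fix z assume "z \<in> (SIGMA w:arrays M N k. {m w..M})"
    then obtain w y where z: "z = (w, y)" "w \<in> arrays M N k" "m w \<le> y" "y \<le> M" by auto
    show "(case z of (w, y) \<Rightarrow> array_weight p \<alpha> N k w *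
        (cell_param p \<alpha> N k ^ (y - m w) * f ((partial_passage w N k)(Suc k := y)))) =
        (\<lambda>w. array_weight p \<alpha> N (Suc k) w * f (partial_passage w N (Suc k)))
        ((\<lambda>(w, y). set_cell w N k (y - m w)) z)"
      using arrays_set_cell(2)[OF z(2) z(3)[unfolded m_def] z(4) refl] array_weight_set_cell[OF z(2)]
      by (simp add: z(1) m_def)
  qed simp
  also have "\<dots> = array_sum M p \<alpha> N (Suc k) f"
    unfolding array_sum_def m_def by (rule sum.reindex_bij_betw[OF arrays_cell_bij])
  finally show ?thesis ..
qed

lemma array_sum_next_row:
  "array_sum M p \<alpha> (Suc N) 0 f = array_sum M p \<alpha> N (Suc N) (\<lambda>v. f (shift v))"
proof -
  have "array_weight p \<alpha> (Suc N) 0 w = array_weight p \<alpha> N (Suc N) w" for w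
  proof -
    have "(\<Prod>j\<le>N. cell_param p \<alpha> N j ^ w N j) = (\<Prod>j<Suc N. cell_param p \<alpha> N j ^ w N j)"
      by (simp only: lessThan_Suc_atMost)
    then show ?thesis by (simp add: array_weight_def)
  qed
  then show ?thesis
    by (simp add: array_sum_def arrays_next_row partial_passage_next_row)
qed

lemma array_sum_0: "array_sum M p \<alpha> 0 0 f = f (shift (\<lambda>_. 0))"
  by (simp add: array_sum_def arrays_0 array_weight_def partial_passage_def)

lemma hybrid_sum_0: "hybrid_sum M p \<alpha> 0 0 f = f (shift (\<lambda>_. 0))"
proof -
  have "hybrids M 0 0 = {\<lambda>_ _. 0}"
  proof (intro equalityI subsetI)
    fix s assume s: "s \<in> hybrids M 0 0"
    have "s i j = 0" for i j
    proof -
      consider "i = 0" | "i = 1" | "i > 1" by linarith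
      then show ?thesis using s by cases (auto simp: hybrids_def)
    qed
    then show "s \<in> {\<lambda>_ _. 0}" by (auto simp: fun_eq_iff)
  qed (auto simp: hybrids_def interlace_def)
  moreover have "shift (\<lambda>_. 0) = (\<lambda>_. 0::nat)" by (auto simp: shift_def split: nat.splits)
  ultimately show ?thesis
    by (simp add: hybrid_sum_def hybrid_weight_def psize_def alt_sum_def)
qed

definition shift_rows :: "(nat \<Rightarrow> nat \<Rightarrow> nat) \<Rightarrow> nat \<Rightarrow> nat \<Rightarrow> nat" where
  "shift_rows s i = (case i of 0 \<Rightarrow> (\<lambda>_. 0) | Suc j \<Rightarrow> s j)"

lemma shift_rows_simps [simp]: "shift_rows s 0 = (\<lambda>_. 0)" "shift_rows s (Suc j) = s j"
  by (simp_all add: shift_rows_def)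

text \<open>Passing to the next row only relabels the boundary path: an empty partition is put in
  front and the indices move by one.\<close>

lemma hybrid_sum_next_row:
  "hybrid_sum M p \<alpha> (Suc N) 0 f = hybrid_sum M p \<alpha> N (Suc N) (\<lambda>v. f (shift v))"
  unfolding hybrid_sum_def
proof (rule sum.reindex_bij_witness[where i = shift_rows and j = "\<lambda>s i. s (Suc i)"])
  fix s assume s: "s \<in> hybrids M (Suc N) 0"
  show "shift_rows (\<lambda>i. s (Suc i)) = s"
    using s by (auto simp: fun_eq_iff shift_rows_def hybrids_def split: nat.splits)
  have s1: "s (Suc 0) = (\<lambda>_. 0)" using s by (auto simp: hybrids_def)
  show "(\<lambda>i. s (Suc i)) \<in> hybrids M N (Suc N)"
  proof (rule hybridsI)
    fix i j :: nat assume "i \<le> Suc N" "i \<le> j"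
    then show "s (Suc i) j = 0" using s by (auto simp: hybrids_def)
  qed (use s in \<open>auto simp: hybrids_def\<close>)
  \<comment> \<open>The common length bound grows with N, so the part that is newly counted has to
    vanish.\<close>
  have z: "s i (Suc (Suc N)) = 0" for i
    using s by (cases "i \<le> N + 2"; cases "i = 0") (auto simp: hybrids_def)
  have "psize (Suc N + 2) (s i) = psize (N + 2) (s i)" "alt_sum (Suc N + 2) (s i) = alt_sum (N + 2) (s i)" for i
    using z[of i] by (simp_all add: psize_def alt_sum_def)
  moreover have "(\<lambda>i. s i 0) = shift (\<lambda>i. s (Suc i) 0)"
    using s by (auto simp: fun_eq_iff shift_def hybrids_def split: nat.splits)
  ultimately show "hybrid_weight p \<alpha> N (Suc N) (\<lambda>i. s (Suc i)) * f (shift (\<lambda>i. s (Suc i) 0)) =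
      hybrid_weight p \<alpha> (Suc N) 0 s * f (\<lambda>i. s i 0)"
    using s1 s by (simp add: hybrid_weight_def atLeast0LessThan psize_def hybrids_def)
next
  fix s assume s: "s \<in> hybrids M N (Suc N)"
  show "(\<lambda>i. shift_rows s (Suc i)) = s" by simp
  have s0: "s 0 = (\<lambda>_. 0)" using s by (auto simp: hybrids_def)
  show "shift_rows s \<in> hybrids M (Suc N) 0"
  proof (rule hybridsI)
    fix i :: nat assume "0 < i" "i \<le> Suc N"
    then show "interlace (shift_rows s i) (shift_rows s (Suc i))"
      using s by (cases i) (auto simp: hybrids_def)
  next
    fix i :: nat assume "Suc (Suc N) < i"
    then show "shift_rows s i = (\<lambda>_. 0)" using s by (cases i) (auto simp: hybrids_def)
  next
    fix i j :: nat assume "0 < i" "i - 1 \<le> j"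
    then show "shift_rows s i j = 0"
      using s by (cases i; cases "i - 1 \<le> Suc N") (auto simp: hybrids_def)
  next
    fix i show "shift_rows s i 0 \<le> M" using s by (cases i) (auto simp: hybrids_def)
  qed (auto simp: s0 interlace_def)
qed

text \<open>Both sums start from the same value and are changed by the same operators. The
  correspondence between arrays and chains is thus composed of single cells and never written out as
  a whole.\<close>

theorem hybrid_sum_eq_array_sum: "k \<le> Suc N \<Longrightarrow> hybrid_sum M p \<alpha> N k f = array_sum M p \<alpha> N k f"
proof -
  have step: "hybrid_sum M p \<alpha> N k f = array_sum M p \<alpha> N k f"
    if "\<And>f. hybrid_sum M p \<alpha> N 0 f = array_sum M p \<alpha> N 0 f" "k \<le> Suc N" for N k f
    using that(2)
  proof (induction k arbitrary: f)
    case (Suc k)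
    then show ?case by (simp add: hybrid_sum_Suc array_sum_Suc)
  qed (rule that(1))
  have "hybrid_sum M p \<alpha> N 0 f = array_sum M p \<alpha> N 0 f" for f
  proof (induction N arbitrary: f)
    case 0
    then show ?case by (simp add: hybrid_sum_0 array_sum_0)
  next
    case (Suc N)
    then show ?case by (simp add: hybrid_sum_next_row array_sum_next_row step)
  qed
  then show "k \<le> Suc N \<Longrightarrow> ?thesis" by (rule step)
qed

section \<open>Interlacing chains and Schur polynomials\<close>

definition partitions_le :: "nat \<Rightarrow> nat \<Rightarrow> (nat \<Rightarrow> nat) set" where
  "partitions_le n M = {\<mu>. (\<forall>j\<ge>n. \<mu> j = 0) \<and> (\<forall>j. \<mu> (Suc j) \<le> \<mu> j) \<and> \<mu> 0 \<le> M}"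

lemma finite_partitions_le: "finite (partitions_le n M)"
proof (rule finite_subset)
  show "partitions_le n M \<subseteq> tup n (\<lambda>_. {..M})"
    by (auto simp: partitions_le_def tup_def intro: order.trans[OF decreasing_le_first])
qed (simp add: finite_tup)

definition chains :: "nat \<Rightarrow> (nat \<Rightarrow> nat) \<Rightarrow> (nat \<Rightarrow> nat \<Rightarrow> nat) set" where
  "chains n \<mu> = {s. (\<forall>i<n. interlace (s i) (s (Suc i))) \<and> s n = \<mu> \<and> (\<forall>i>n. s i = (\<lambda>_. 0)) \<and>
     (\<forall>i\<le>n. \<forall>j\<ge>i. s i j = 0)}"

lemma finite_chains: "finite (chains n \<mu>)"
proof (rule finite_subset[OF _ finite_nat_arrays[of "\<mu> 0" "Suc n"]], rule subsetI)
  fix s assume s: "s \<in> chains n \<mu>"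
  have first: "s i 0 \<le> \<mu> 0" if "i \<le> n" for i
    using that
  proof (induction i rule: inc_induct)
    case (step i)
    then have "s i 0 \<le> s (Suc i) 0" using s by (auto simp: chains_def interlace_def)
    with step show ?case by simp
  qed (use s in \<open>simp add: chains_def\<close>)
  have "s i j \<le> \<mu> 0" for i j
  proof (cases "i \<le> n")
    case True
    have dec: "s i (Suc j) \<le> s i j" for j
    proof (cases i)
      case 0
      then show ?thesis using s by (auto simp: chains_def)
    next
      case (Suc i')
      then have "interlace (s i') (s i)" using s True by (auto simp: chains_def)
      then show ?thesis by (rule interlaceD)
    qed
    show ?thesis using decreasing_le_first[of "s i" j, OF dec] first[OF True] by simp
  qed (use s in \<open>simp add: chains_def\<close>)
  moreover have "s i j = 0" if "Suc n \<le> i \<or> Suc n \<le> j" for i j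
    using that s by (cases "i \<le> n") (auto simp: chains_def)
  ultimately show "s \<in> {s. (\<forall>i j. s i j \<le> \<mu> 0) \<and> (\<forall>i j. Suc n \<le> i \<or> Suc n \<le> j \<longrightarrow> s i j = 0)}"
    by blast
qed

text \<open>The branching recursion of \<open>gts\<close> unrolled into Gelfand-Tsetlin
  patterns.\<close>

lemma gts_eq_chain_sum:
  assumes "n \<le> K" "\<And>j. n \<le> j \<Longrightarrow> \<mu> j = 0"
  shows "(\<Sum>s\<in>chains n \<mu>. \<Prod>i<n. x i ^ (psize K (s (Suc i)) - psize K (s i))) = gts n \<mu> x"
  using assms
proof (induction n arbitrary: \<mu>)
  case 0
  then have "\<mu> = (\<lambda>_. 0)" by auto
  then have "chains 0 \<mu> = {\<lambda>_ _. 0}"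
    by (auto simp: chains_def fun_eq_iff) (metis neq0_conv)
  then show ?case by simp
next
  case (Suc n)
  let ?T = "tup n (\<lambda>j. {\<mu> (Suc j)..\<mu> j})"
  let ?w = "\<lambda>n s. \<Prod>i<n. x i ^ (psize K (s (Suc i)) - psize K (s i))"
  have supp: "\<mu> (Suc j) = 0" if "j \<ge> n" for j using Suc.prems(2) that by simp
  have inter: "interlace \<nu> \<mu>" if "\<nu> \<in> ?T" for \<nu>
  proof -
    have "\<nu> j \<le> \<mu> j \<and> \<mu> (Suc j) \<le> \<nu> j" for j
      using that supp[of j] by (cases "j < n") (auto simp: tup_def)
    then show ?thesis by (simp add: interlace_def)
  qed
  have "gts (Suc n) \<mu> x = (\<Sum>\<nu>\<in>?T. \<Sum>s\<in>chains n \<nu>. x n ^ (psize K \<mu> - psize K \<nu>) * ?w n s)"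
    unfolding gts.simps sum_distrib_left[symmetric]
  proof (intro sum.cong refl arg_cong2[where f = "(*)"])
    fix \<nu> assume \<nu>: "\<nu> \<in> ?T"
    show "gts n \<nu> x = (\<Sum>s\<in>chains n \<nu>. ?w n s)"
      using \<nu> Suc.prems(1) by (intro Suc.IH[symmetric]) (auto simp: tup_def)
    have "psize K \<mu> = (\<Sum>j<Suc n. \<mu> j)" "psize K \<nu> = (\<Sum>j<n. \<nu> j)"
      unfolding psize_def using Suc.prems \<nu>
      by (intro sum.mono_neutral_right; auto simp: tup_def)+
    then show "x n ^ ((\<Sum>j<Suc n. \<mu> j) - (\<Sum>j<n. \<nu> j)) = x n ^ (psize K \<mu> - psize K \<nu>)" by simp
  qed
  also have "\<dots> = (\<Sum>(\<nu>, s)\<in>(SIGMA \<nu>:?T. chains n \<nu>). x n ^ (psize K \<mu> - psize K \<nu>) * ?w n s)"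
    by (rule sum.Sigma) (auto simp: finite_chains finite_tup)
  also have "\<dots> = (\<Sum>s\<in>chains (Suc n) \<mu>. ?w (Suc n) s)"
  proof (rule sum.reindex_bij_witness[where j = "\<lambda>(\<nu>, s). s(Suc n := \<mu>)" and i = "\<lambda>s. (s n, s(Suc n := (\<lambda>_. 0)))"])
    fix z assume "z \<in> (SIGMA \<nu>:?T. chains n \<nu>)"
    then obtain \<nu> s where z: "z = (\<nu>, s)" "\<nu> \<in> ?T" "s \<in> chains n \<nu>" by auto
    have sn: "s n = \<nu>" "s (Suc n) = (\<lambda>_. 0)" using z(3) by (auto simp: chains_def)
    have "(case z of (\<nu>, s) \<Rightarrow> s(Suc n := \<mu>)) = s(Suc n := \<mu>)" by (simp add: z)
    moreover have "(s(Suc n := \<mu>))(Suc n := (\<lambda>_. 0)) = s" using sn by auto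
    ultimately show "(\<lambda>s. (s n, s(Suc n := (\<lambda>_. 0)))) (case z of (\<nu>, s) \<Rightarrow> s(Suc n := \<mu>)) = z"
      using sn by (simp add: z)
    show "(case z of (\<nu>, s) \<Rightarrow> s(Suc n := \<mu>)) \<in> chains (Suc n) \<mu>"
      using z(3) inter[OF z(2)] sn Suc.prems(2) by (auto simp: z(1) chains_def le_Suc_eq less_Suc_eq)
    have "?w n (s(Suc n := \<mu>)) = ?w n s" by (intro prod.cong) auto
    then show "?w (Suc n) (case z of (\<nu>, s) \<Rightarrow> s(Suc n := \<mu>)) =
        (case z of (\<nu>, s) \<Rightarrow> x n ^ (psize K \<mu> - psize K \<nu>) * ?w n s)"
      using sn by (simp add: z(1))
  next
    fix s assume s: "s \<in> chains (Suc n) \<mu>"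
    have "interlace (s n) \<mu>" using s by (auto simp: chains_def)
    then have "s n \<in> ?T" using s by (auto simp: tup_def interlace_def chains_def)
    then show "(s n, s(Suc n := (\<lambda>_. 0))) \<in> (SIGMA \<nu>:?T. chains n \<nu>)"
      using s by (auto simp: chains_def)
    show "(case (s n, s(Suc n := (\<lambda>_. 0))) of (\<nu>, s) \<Rightarrow> s(Suc n := \<mu>)) = s"
      using s by (auto simp: chains_def)
  qed
  finally show ?case ..
qed

lemma hybrids_eq_chains:
  "hybrids M N (Suc N) = (\<Union>\<mu>\<in>partitions_le (Suc N) M. chains (Suc N) \<mu>)"
proof (intro equalityI subsetI)
  fix s assume s: "s \<in> hybrids M N (Suc N)"
  then have "interlace (s N) (s (Suc N))" by (auto simp: hybrids_def)
  then have "s (Suc N) \<in> partitions_le (Suc N) M"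
    using s by (auto simp: partitions_le_def hybrids_def intro: interlaceD)
  moreover have "s \<in> chains (Suc N) (s (Suc N))"
    using s by (auto simp: chains_def hybrids_def)
  ultimately show "s \<in> (\<Union>\<mu>\<in>partitions_le (Suc N) M. chains (Suc N) \<mu>)" by blast
next
  fix s assume "s \<in> (\<Union>\<mu>\<in>partitions_le (Suc N) M. chains (Suc N) \<mu>)"
  then obtain \<mu> where \<mu>: "\<mu> \<in> partitions_le (Suc N) M" and s: "s \<in> chains (Suc N) \<mu>" by blast
  have first: "s i 0 \<le> \<mu> 0" if "i \<le> Suc N" for i
    using that
  proof (induction i rule: inc_induct)
    case (step i)
    then have "s i 0 \<le> s (Suc i) 0" using s by (auto simp: chains_def interlace_def)
    with step show ?case by simp
  qed (use s in \<open>simp add: chains_def\<close>)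
  show "s \<in> hybrids M N (Suc N)"
  proof (rule hybridsI)
    fix i
    show "s i 0 \<le> M"
      using first[of i] \<mu> s by (cases "i \<le> Suc N") (auto simp: chains_def partitions_le_def)
  qed (use s in \<open>auto simp: chains_def\<close>)
qed

theorem array_sum_eq_gts:
  "array_sum M p \<alpha> N (Suc N) (\<lambda>_. 1) =
    (\<Sum>\<mu>\<in>partitions_le (Suc N) M. \<alpha> ^ nat (alt_sum (N + 2) \<mu>) * gts (Suc N) \<mu> p)"
proof -
  have "array_sum M p \<alpha> N (Suc N) (\<lambda>_. 1) = hybrid_sum M p \<alpha> N (Suc N) (\<lambda>_. 1)"
    by (rule hybrid_sum_eq_array_sum[symmetric]) simp
  also have "\<dots> = (\<Sum>\<mu>\<in>partitions_le (Suc N) M. \<Sum>s\<in>chains (Suc N) \<mu>. hybrid_weight p \<alpha> N (Suc N) s)"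
    unfolding hybrid_sum_def hybrids_eq_chains
    by (subst sum.UNION_disjoint) (auto simp: finite_partitions_le finite_chains, auto simp: chains_def)
  also have "\<dots> = (\<Sum>\<mu>\<in>partitions_le (Suc N) M. \<alpha> ^ nat (alt_sum (N + 2) \<mu>) * gts (Suc N) \<mu> p)"
  proof (rule sum.cong)
    fix \<mu> assume \<mu>: "\<mu> \<in> partitions_le (Suc N) M"
    have "(\<Sum>s\<in>chains (Suc N) \<mu>. hybrid_weight p \<alpha> N (Suc N) s) = (\<Sum>s\<in>chains (Suc N) \<mu>.
        \<alpha> ^ nat (alt_sum (N + 2) \<mu>) * (\<Prod>i<Suc N. p i ^ (psize (N + 2) (s (Suc i)) - psize (N + 2) (s i))))"
      by (intro sum.cong refl) (auto simp: hybrid_weight_def chains_def)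
    also have "\<dots> = \<alpha> ^ nat (alt_sum (N + 2) \<mu>) * gts (Suc N) \<mu> p"
      unfolding sum_distrib_left[symmetric]
      using \<mu> by (subst gts_eq_chain_sum) (auto simp: partitions_le_def)
    finally show "(\<Sum>s\<in>chains (Suc N) \<mu>. hybrid_weight p \<alpha> N (Suc N) s) = \<dots>" .
  qed simp
  finally show ?thesis .
qed

text \<open>Branching off the last variable. Interlacing squeezes \<nu> (2 i) between the equal rows
  2 i and 2 i + 1 of \<mu>, so \<nu> determines \<mu>, and the difference in size is the number of
  odd columns of \<nu>.\<close>

lemma even_sum_Suc:
  "even_sum (Suc n) M x = (\<Sum>\<nu>\<in>partitions_le n M. x n ^ nat (alt_sum (Suc n) \<nu>) * gts n \<nu> x)"
proof -
  have "even_sum (Suc n) M x = (\<Sum>(\<mu>, \<nu>)\<in>(SIGMA \<mu>:even_cols (Suc n) M. tup n (\<lambda>j. {\<mu> (Suc j)..\<mu> j})).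
      x n ^ ((\<Sum>j<Suc n. \<mu> j) - (\<Sum>j<n. \<nu> j)) * gts n \<nu> x)"
    unfolding even_sum_def gts.simps
    by (rule sum.Sigma) (auto simp: finite_even_cols finite_tup)
  also have "\<dots> = (\<Sum>\<nu>\<in>partitions_le n M. x n ^ nat (alt_sum (Suc n) \<nu>) * gts n \<nu> x)"
  proof (rule sum.reindex_bij_witness[where j = snd and i = "\<lambda>\<nu>. (\<lambda>j. \<nu> (2 * (j div 2)), \<nu>)"])
    fix z assume "z \<in> (SIGMA \<mu>:even_cols (Suc n) M. tup n (\<lambda>j. {\<mu> (Suc j)..\<mu> j}))"
    then obtain \<mu> \<nu> where z: "z = (\<mu>, \<nu>)" and \<mu>: "\<mu> \<in> even_cols (Suc n) M"
      and \<nu>: "\<nu> \<in> tup n (\<lambda>j. {\<mu> (Suc j)..\<mu> j})" by auto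
    have le: "\<mu> (Suc j) \<le> \<nu> j \<and> \<nu> j \<le> \<mu> j" for j
      using \<nu> \<mu> by (cases "j < n") (auto simp: tup_def even_cols_def)
    have pair: "\<mu> (2 * i) = \<nu> (2 * i)" "\<mu> (Suc (2 * i)) = \<nu> (2 * i)" for i
      using le[of "2 * i"] \<mu> by (auto simp: even_cols_def)
    have eq: "\<mu> = (\<lambda>j. \<nu> (2 * (j div 2)))"
    proof
      fix j show "\<mu> j = \<nu> (2 * (j div 2))"
        using pair[of "j div 2"] by (cases "even j") (auto elim!: oddE)
    qed
    then show "(\<lambda>j. snd z (2 * (j div 2)), snd z) = z" by (simp add: z)
    show "snd z \<in> partitions_le n M"
      using \<nu> \<mu> le by (auto simp: z partitions_le_def tup_def even_cols_def intro: order.trans)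
    have \<nu>0: "\<nu> j = 0" if "j \<ge> n" for j using \<nu> that by (auto simp: tup_def)
    have \<mu>0: "\<mu> j = 0" if "j \<ge> Suc n" for j using \<mu> that by (auto simp: even_cols_def)
    have pairs: "(\<Sum>j<2 * k. int (\<mu> j) - int (\<nu> j)) = (\<Sum>j<2 * k. (-1) ^ j * int (\<nu> j))" for k
      by (induction k) (simp_all add: pair)
    have "int (\<Sum>j<Suc n. \<mu> j) - int (\<Sum>j<n. \<nu> j) = (\<Sum>j<2 * Suc n. int (\<mu> j)) - (\<Sum>j<2 * Suc n. int (\<nu> j))"
      unfolding of_nat_sum
      by (intro arg_cong2[where f = "(-)"] sum.mono_neutral_left) (auto simp: \<mu>0 \<nu>0)
    also have "\<dots> = (\<Sum>j<2 * Suc n. (-1) ^ j * int (\<nu> j))"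
      unfolding pairs[symmetric] by (simp add: sum_subtractf)
    also have "\<dots> = alt_sum (Suc n) \<nu>"
      unfolding alt_sum_def by (rule sum.mono_neutral_right) (auto simp: \<nu>0)
    finally have "(\<Sum>j<Suc n. \<mu> j) - (\<Sum>j<n. \<nu> j) = nat (alt_sum (Suc n) \<nu>)" by linarith
    then show "x n ^ nat (alt_sum (Suc n) (snd z)) * gts n (snd z) x =
        (case z of (\<mu>, \<nu>) \<Rightarrow> x n ^ ((\<Sum>j<Suc n. \<mu> j) - (\<Sum>j<n. \<nu> j)) * gts n \<nu> x)"
      by (simp add: z)
  next
    fix \<nu> assume \<nu>: "\<nu> \<in> partitions_le n M"
    have anti: "antimono \<nu>" using \<nu> by (auto simp: partitions_le_def antimono_iff_le_Suc)
    let ?\<mu> = "\<lambda>j. \<nu> (2 * (j div 2))"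
    have "?\<mu> \<in> even_cols (Suc n) M"
      using \<nu> by (auto simp: even_cols_def partitions_le_def intro!: antimonoD[OF anti])
    moreover have "\<nu> \<in> tup n (\<lambda>j. {?\<mu> (Suc j)..?\<mu> j})"
    proof -
      have "j \<le> 2 * (Suc j div 2)" "2 * (j div 2) \<le> j" for j :: nat by presburger+
      then have "\<nu> (2 * (Suc j div 2)) \<le> \<nu> j" "\<nu> j \<le> \<nu> (2 * (j div 2))" for j
        by (auto intro: antimonoD[OF anti])
      then show ?thesis using \<nu> by (auto simp: tup_def partitions_le_def)
    qed
    ultimately show "(?\<mu>, \<nu>) \<in> (SIGMA \<mu>:even_cols (Suc n) M. tup n (\<lambda>j. {\<mu> (Suc j)..\<mu> j}))" by simp
  qed simp
  finally show ?thesis .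
qed

section \<open>Boxes of growing width\<close>

lemma cell_finite: "finite (cells N k)"
  by (rule finite_subset[of _ "{..N} \<times> {..N + k}"]) (auto simp: cells_def)

definition cell_bounded :: "nat \<Rightarrow> nat \<Rightarrow> nat \<Rightarrow> (nat \<Rightarrow> nat \<Rightarrow> nat) set" where
  "cell_bounded b N k = {w. (\<forall>i j. (i, j) \<notin> cells N k \<longrightarrow> w i j = 0) \<and> (\<forall>i j. w i j \<le> b)}"

lemma sum_cell_bounded:
  fixes f :: "nat \<times> nat \<Rightarrow> nat \<Rightarrow> real"
  shows "(\<Sum>w\<in>cell_bounded b N k. \<Prod>c\<in>cells N k. f c (w (fst c) (snd c))) = (\<Prod>c\<in>cells N k. \<Sum>v\<le>b. f c v)"
proof -
  have "(\<Prod>c\<in>cells N k. \<Sum>v\<le>b. f c v) = (\<Sum>g\<in>PiE (cells N k) (\<lambda>_. {..b}). \<Prod>c\<in>cells N k. f c (g c))"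
    by (rule prod_sum_PiE) (auto simp: cell_finite)
  also have "\<dots> = (\<Sum>w\<in>cell_bounded b N k. \<Prod>c\<in>cells N k. f c (w (fst c) (snd c)))"
  proof (rule sum.reindex_bij_witness[where j = "\<lambda>g i j. if (i, j) \<in> cells N k then g (i, j) else 0"
        and i = "\<lambda>w. restrict (\<lambda>(i, j). w i j) (cells N k)"])
    fix g assume g: "g \<in> PiE (cells N k) (\<lambda>_. {..b})"
    show "restrict (\<lambda>(i, j). if (i, j) \<in> cells N k then g (i, j) else 0) (cells N k) = g"
      using g by (auto simp: PiE_def extensional_def restrict_def fun_eq_iff)
    show "(\<lambda>i j. if (i, j) \<in> cells N k then g (i, j) else 0) \<in> cell_bounded b N k"
      using g by (auto simp: cell_bounded_def PiE_def Pi_def)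
    show "(\<Prod>c\<in>cells N k. f c (if (fst c, snd c) \<in> cells N k then g (fst c, snd c) else 0)) =
        (\<Prod>c\<in>cells N k. f c (g c))"
      by (intro prod.cong) auto
  next
    fix w assume w: "w \<in> cell_bounded b N k"
    show "(\<lambda>i j. if (i, j) \<in> cells N k then restrict (\<lambda>(i, j). w i j) (cells N k) (i, j) else 0) = w"
      using w by (auto simp: cell_bounded_def fun_eq_iff)
    show "restrict (\<lambda>(i, j). w i j) (cells N k) \<in> PiE (cells N k) (\<lambda>_. {..b})"
      using w by (auto simp: cell_bounded_def)
  qed
  finally show ?thesis ..
qed

lemma array_weight_eq_prod:
  "array_weight p \<alpha> N k w = (\<Prod>c\<in>cells N k. cell_param p \<alpha> (fst c) (snd c) ^ w (fst c) (snd c))"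
proof -
  have "cells N k = (SIGMA i:{..<N}. {..i}) \<union> {N} \<times> {..<k}"
    by (auto simp: cells_def)
  moreover have "(SIGMA i:{..<N}. {..i}) \<inter> {N} \<times> {..<k} = {}" by auto
  moreover have "(\<Prod>c\<in>(SIGMA i:{..<N}. {..i}). cell_param p \<alpha> (fst c) (snd c) ^ w (fst c) (snd c)) =
      (\<Prod>i<N. \<Prod>j\<le>i. cell_param p \<alpha> i j ^ w i j)"
    by (subst prod.Sigma) (auto simp: split_beta)
  moreover have "(\<Prod>c\<in>{N} \<times> {..<k}. cell_param p \<alpha> (fst c) (snd c) ^ w (fst c) (snd c)) =
      (\<Prod>j<k. cell_param p \<alpha> N j ^ w N j)"
  proof -
    have "{N} \<times> {..<k} = Pair N ` {..<k}" by auto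
    then show ?thesis by (simp add: prod.reindex inj_on_def)
  qed
  ultimately show ?thesis
    by (simp add: array_weight_def prod.union_disjoint)
qed

text \<open>Each cell raises the largest time by at most b; N (N + 1) is a generous count of the
  cells in the first N rows.\<close>

lemma partial_passage_le:
  assumes "\<And>i j. w i j \<le> b"
  shows "partial_passage w N k i \<le> (N * (N + 1) + k) * b"
proof -
  have row: "row_passage r v k i \<le> B + k * b" if "\<And>i. v i \<le> B" "\<And>j. r j \<le> b" for r v k i B
    using that(1)
  proof (induction k arbitrary: i)
    case (Suc k)
    show ?case
    proof (cases "i = Suc k")
      case True
      have "max (row_passage r v k k) (row_passage r v k (k + 2)) \<le> B + k * b"
        using Suc.IH[OF Suc.prems] by simp
      from add_mono[OF this that(2)[of k]] show ?thesis using True by (simp add: algebra_simps)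
    next
      case False
      then show ?thesis using Suc.IH[OF Suc.prems, of i] by simp
    qed
  qed simp
  have pass: "passage w N i \<le> N * (N + 1) * b" for N i
  proof (induction N arbitrary: i)
    case (Suc N)
    have "shift (passage w N) i \<le> N * (N + 1) * b" for i
      using Suc.IH by (cases i) auto
    then have "passage w (Suc N) i \<le> N * (N + 1) * b + Suc N * b"
      unfolding passage.simps using assms by (intro row) auto
    also have "\<dots> \<le> Suc N * (Suc N + 1) * b" by (simp add: algebra_simps)
    finally show ?case .
  qed simp
  have "shift (passage w N) i \<le> N * (N + 1) * b" for i
    using pass by (cases i) auto
  then have "partial_passage w N k i \<le> N * (N + 1) * b + k * b"
    unfolding partial_passage_def using assms by (intro row) auto
  then show ?thesis by (simp add: algebra_simps)
qed

text \<open>A bound M on the passage times lies between the bounds \<open>M div C\<close> and M on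
  the single weights, and for bounded weights the sum is a product of truncated geometric
  series.\<close>

lemma array_sum_tendsto:
  assumes "\<And>i. i \<le> N \<Longrightarrow> 0 \<le> p i" "0 \<le> \<alpha>" and r: "\<And>i j. (i, j) \<in> cells N (Suc N) \<Longrightarrow> cell_param p \<alpha> i j < 1"
  shows "(\<lambda>M. array_sum M p \<alpha> N (Suc N) (\<lambda>_. 1)) \<longlonglongrightarrow>
    (\<Prod>c\<in>cells N (Suc N). 1 / (1 - cell_param p \<alpha> (fst c) (snd c)))"
proof -
  let ?C = "cells N (Suc N)"
  \<comment> \<open>The factor of \<open>partial_passage_le\<close> at the last row and column,
    which dominates that of every other cell.\<close>
  define C where "C = N * (N + 1) + Suc N"
  define g where "g b = (\<Sum>w\<in>cell_bounded b N (Suc N). array_weight p \<alpha> N (Suc N) w)" for b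
  have nonneg: "0 \<le> cell_param p \<alpha> i j" if "(i, j) \<in> ?C" for i j
    using assms(1,2) that by (auto simp: cell_param_def cells_def)
  have wt: "0 \<le> array_weight p \<alpha> N (Suc N) w" for w
    unfolding array_weight_eq_prod by (intro prod_nonneg zero_le_power nonneg) auto
  have lim: "g \<longlonglongrightarrow> (\<Prod>c\<in>?C. 1 / (1 - cell_param p \<alpha> (fst c) (snd c)))"
  proof -
    have "g = (\<lambda>b. \<Prod>c\<in>?C. \<Sum>v\<le>b. cell_param p \<alpha> (fst c) (snd c) ^ v)"
      unfolding g_def array_weight_eq_prod
      by (rule ext) (rule sum_cell_bounded[of "\<lambda>c v. cell_param p \<alpha> (fst c) (snd c) ^ v"])
    moreover have "(\<lambda>b. \<Sum>v\<le>b. cell_param p \<alpha> (fst c) (snd c) ^ v) \<longlonglongrightarrow> 1 / (1 - cell_param p \<alpha> (fst c) (snd c))"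
      if "c \<in> ?C" for c
    proof -
      have "(\<lambda>v. cell_param p \<alpha> (fst c) (snd c) ^ v) sums (1 / (1 - cell_param p \<alpha> (fst c) (snd c)))"
        using r[of "fst c" "snd c"] that nonneg[of "fst c" "snd c"] by (intro geometric_sums) simp
      then show ?thesis unfolding sums_def_le .
    qed
    ultimately show ?thesis by (simp only:) (rule tendsto_prod)
  qed
  have fin: "finite (cell_bounded b N (Suc N))" for b
  proof (rule finite_subset[OF _ finite_nat_arrays[of b "Suc N"]])
    show "cell_bounded b N (Suc N) \<subseteq> {s. (\<forall>i j. s i j \<le> b) \<and> (\<forall>i j. Suc N \<le> i \<or> Suc N \<le> j \<longrightarrow> s i j = 0)}"
      by (auto simp: cell_bounded_def cells_def)
  qed
  have upper: "arrays M N (Suc N) \<subseteq> cell_bounded M N (Suc N)" for M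
  proof
    fix w assume w: "w \<in> arrays M N (Suc N)"
    have "w i j \<le> M" for i j
    proof (cases "(i, j) \<in> cells N (Suc N)")
      case True
      have "w i j \<le> partial_passage w i (Suc j) (Suc j)" by (simp add: partial_passage_Suc)
      also have "\<dots> \<le> M" using w True by (auto simp: arrays_def)
      finally show ?thesis .
    qed (use w in \<open>simp add: arrays_def\<close>)
    then show "w \<in> cell_bounded M N (Suc N)" using w by (auto simp: cell_bounded_def arrays_def)
  qed
  have lower: "cell_bounded b N (Suc N) \<subseteq> arrays (C * b) N (Suc N)" for b
  proof
    fix w assume w: "w \<in> cell_bounded b N (Suc N)"
    have "partial_passage w i (Suc j) (Suc j) \<le> C * b" if "(i, j) \<in> cells N (Suc N)" for i j
    proof -
      have "i \<le> N" "j \<le> N" using that by (auto simp: cells_def)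
      then have "i * (i + 1) + Suc j \<le> C" unfolding C_def by (intro add_mono mult_mono) auto
      moreover have "partial_passage w i (Suc j) (Suc j) \<le> (i * (i + 1) + Suc j) * b"
        using w by (intro partial_passage_le) (auto simp: cell_bounded_def)
      ultimately show ?thesis using mult_le_mono1 order.trans by blast
    qed
    then show "w \<in> arrays (C * b) N (Suc N)" using w by (auto simp: arrays_def cell_bounded_def)
  qed
  have sum_eq: "array_sum M p \<alpha> N (Suc N) (\<lambda>_. 1) = (\<Sum>w\<in>arrays M N (Suc N). array_weight p \<alpha> N (Suc N) w)" for M
    by (simp add: array_sum_def)
  show ?thesis
  proof (rule tendsto_sandwich[where h = g and f = "\<lambda>M. g (M div C)"])
    show "\<forall>\<^sub>F M in sequentially. array_sum M p \<alpha> N (Suc N) (\<lambda>_. 1) \<le> g M"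
      unfolding sum_eq g_def by (intro always_eventually allI sum_mono2 fin upper wt)
    show "g \<longlonglongrightarrow> (\<Prod>c\<in>?C. 1 / (1 - cell_param p \<alpha> (fst c) (snd c)))" by (rule lim)
    have "g (M div C) \<le> array_sum M p \<alpha> N (Suc N) (\<lambda>_. 1)" for M
    proof -
      have "arrays (C * (M div C)) N (Suc N) \<subseteq> arrays M N (Suc N)"
        by (auto simp: arrays_def intro: order.trans)
      then have "cell_bounded (M div C) N (Suc N) \<subseteq> arrays M N (Suc N)" using lower by blast
      then show ?thesis unfolding sum_eq g_def by (intro sum_mono2 finite_arrays wt)
    qed
    then show "\<forall>\<^sub>F M in sequentially. g (M div C) \<le> array_sum M p \<alpha> N (Suc N) (\<lambda>_. 1)" by simp
    have "filterlim (\<lambda>M. M div C) sequentially sequentially"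
      by (rule filterlim_at_top_div_const_nat) (simp add: C_def)
    then show "(\<lambda>M. g (M div C)) \<longlonglongrightarrow> (\<Prod>c\<in>?C. 1 / (1 - cell_param p \<alpha> (fst c) (snd c)))"
      by (rule filterlim_compose[OF lim])
  qed
qed

section \<open>The bounded Littlewood identity\<close>

lemma prod_cells:
  "(\<Prod>c\<in>cells N (Suc N). f (fst c) (snd c)) = (\<Prod>i\<le>N. (\<Prod>j<i. f i j) * f i i)"
proof -
  have "cells N (Suc N) = (SIGMA i:{..N}. {..i})" by (auto simp: cells_def)
  then have "(\<Prod>c\<in>cells N (Suc N). f (fst c) (snd c)) = (\<Prod>i\<le>N. \<Prod>j\<le>i. f i j)"
    by (simp add: prod.Sigma split_beta)
  also have "\<dots> = (\<Prod>i\<le>N. (\<Prod>j<i. f i j) * f i i)"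
    by (simp flip: lessThan_Suc_atMost)
  finally show ?thesis .
qed

text \<open>The Littlewood identity: the last variable plays the role of \<alpha> in the growth
  diagrams of the others, whose unbounded array sum is a product.\<close>

theorem even_sum_tendsto:
  assumes nn: "\<And>i. i < n \<Longrightarrow> 0 \<le> y i" and lt: "\<And>i j. i < n \<Longrightarrow> j < n \<Longrightarrow> i \<noteq> j \<Longrightarrow> y i * y j < 1"
    and inj: "inj_on y {..<n}"
  shows "(\<lambda>m. even_sum n m y) \<longlonglongrightarrow> pair_prod gl_inside (y ` {..<n})"
proof -
  have im: "pair_prod gl_inside (y ` {..<n}) = (\<Prod>j<n. \<Prod>i<j. 1 / (1 - y i * y j))"
    using inj by (subst pair_prod_image) (auto simp: pair_prod_lessThan mult.commute)
  \<comment> \<open>A growth diagram needs a variable besides the one in the role of \<alpha>, so at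
    most one variable is treated directly.\<close>
  consider "n = 0" | "n = Suc 0" | N where "n = Suc (Suc N)" by (metis nat.exhaust)
  then show ?thesis
  proof cases
    case 1
    then show ?thesis by (simp add: even_sum_0_left)
  next
    case 2
    have "even_cols (Suc 0) m = {\<lambda>_. 0}" for m by (simp add: even_cols_Suc_even)
    then show ?thesis using 2 im by (simp add: even_sum_def)
  next
    case (3 N)
    have eq: "even_sum n m y = array_sum m y (y (Suc N)) N (Suc N) (\<lambda>_. 1)" for m
      unfolding 3 array_sum_eq_gts even_sum_Suc by simp
    have "(\<lambda>m. even_sum n m y) \<longlonglongrightarrow>
        (\<Prod>c\<in>cells N (Suc N). 1 / (1 - cell_param y (y (Suc N)) (fst c) (snd c)))"
      unfolding eq
    proof (rule array_sum_tendsto)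
      fix i j assume "(i, j) \<in> cells N (Suc N)"
      then show "cell_param y (y (Suc N)) i j < 1"
        using lt 3 by (auto simp: cell_param_def cells_def)
    qed (use nn 3 in auto)
    also have "(\<Prod>c\<in>cells N (Suc N). 1 / (1 - cell_param y (y (Suc N)) (fst c) (snd c))) =
        (\<Prod>i\<le>N. (\<Prod>j<i. 1 / (1 - cell_param y (y (Suc N)) i j)) * (1 / (1 - cell_param y (y (Suc N)) i i)))"
      by (rule prod_cells)
    also have "\<dots> = (\<Prod>i\<le>N. \<Prod>j<i. 1 / (1 - y j * y i)) * (\<Prod>i\<le>N. 1 / (1 - y i * y (Suc N)))"
      unfolding prod.distrib by (simp add: cell_param_def mult.commute)
    also have "\<dots> = (\<Prod>j<n. \<Prod>i<j. 1 / (1 - y i * y j))"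
      by (simp add: 3 lessThan_Suc_atMost)
    finally show ?thesis by (simp only: im)
  qed
qed

section \<open>Passing to coinciding variables\<close>

lemma tendsto_so_rec:
  assumes "\<And>i. i < n \<Longrightarrow> ((\<lambda>t. x t i) \<longlongrightarrow> y i) F" "\<And>i. i < n \<Longrightarrow> y i \<noteq> 0"
  shows "((\<lambda>t. so_rec q n l (x t)) \<longlongrightarrow> so_rec q n l y) F"
  using assms
proof (induction q n l "y" rule: so_rec.induct)
  case (3 q n l y)
  show ?case
    unfolding so_rec.simps
    by (intro tendsto_sum tendsto_mult tendsto_power_int "3.IH" "3.prems") auto
qed (auto intro!: tendsto_power_int)

lemma tendsto_even_sum:
  assumes "\<And>i. i < n \<Longrightarrow> ((\<lambda>t. x t i) \<longlongrightarrow> y i) F"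
  shows "((\<lambda>t. even_sum n m (x t)) \<longlongrightarrow> even_sum n m y) F"
  unfolding even_sum_def using assms by (intro tendsto_sum continuous_gts)

text \<open>The different slopes separate coinciding variables for all small t > 0.\<close>

definition perturb :: "(nat \<Rightarrow> real) \<Rightarrow> real \<Rightarrow> nat \<Rightarrow> real" where
  "perturb x t i = x i + t * real (Suc i)"

lemma tendsto_perturb: "((\<lambda>t. perturb x t i) \<longlongrightarrow> x i) (at_right 0)"
  unfolding perturb_def by (auto intro!: tendsto_eq_intros)

lemma eventually_perturb_generic:
  assumes pos: "\<And>i. i < n \<Longrightarrow> 0 < x i"
    and lt: "\<And>i j. i < n \<Longrightarrow> j < n \<Longrightarrow> i \<noteq> j \<Longrightarrow> x i * x j < 1"
  shows "\<forall>\<^sub>F t in at_right 0. inj_on (perturb x t) {..<n} \<and> (\<forall>i<n. 0 < perturb x t i) \<and>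
    (\<forall>i<n. \<forall>j<n. i \<noteq> j \<longrightarrow> perturb x t i * perturb x t j < 1)"
proof -
  have "\<forall>\<^sub>F t in at_right 0. \<forall>i\<in>{..<n}. \<forall>j\<in>{..<n}. i \<noteq> j \<longrightarrow> perturb x t i \<noteq> perturb x t j"
  proof (intro eventually_ball_finite ballI finite_lessThan)
    fix i j
    show "\<forall>\<^sub>F t in at_right 0. i \<noteq> j \<longrightarrow> perturb x t i \<noteq> perturb x t j"
    proof (cases "i = j")
      case False
      \<comment> \<open>Two coordinates with different slopes meet for one value of t only.\<close>
      have "\<forall>\<^sub>F t in at_right (0::real). t \<noteq> (x j - x i) / (real i - real j)"
        by (rule eventually_neq_at_within)
      then show ?thesis
        using False by eventually_elim (auto simp: perturb_def field_simps)
    qed simp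
  qed
  moreover have "\<forall>\<^sub>F t in at_right 0. \<forall>i\<in>{..<n}. 0 < perturb x t i"
    using pos by (intro eventually_ball_finite ballI finite_lessThan order_tendstoD(1)[OF tendsto_perturb]) simp
  moreover have "\<forall>\<^sub>F t in at_right 0. \<forall>i\<in>{..<n}. \<forall>j\<in>{..<n}. i \<noteq> j \<longrightarrow> perturb x t i * perturb x t j < 1"
  proof (intro eventually_ball_finite ballI finite_lessThan)
    fix i j assume "i \<in> {..<n}" "j \<in> {..<n}"
    show "\<forall>\<^sub>F t in at_right 0. i \<noteq> j \<longrightarrow> perturb x t i * perturb x t j < 1"
    proof (cases "i = j")
      case False
      then have "x i * x j < 1" using lt \<open>i \<in> {..<n}\<close> \<open>j \<in> {..<n}\<close> by simp
      from order_tendstoD(2)[OF tendsto_mult[OF tendsto_perturb[of x i] tendsto_perturb[of x j]] this]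
      show ?thesis by eventually_elim simp
    qed simp
  qed
  ultimately show ?thesis
    by eventually_elim (auto simp: inj_on_def)
qed

text \<open>The denominators have disappeared from both sides, so continuity extends the identity
  from distinct variables to all admissible ones.\<close>

theorem even_sum_eq_so_rect:
  assumes q: "0 \<le> q" "q \<le> 1" and U: "0 \<le> U" and m: "int m = 2 * U + q" and n: "0 < n"
    and pos: "\<And>i. i < n \<Longrightarrow> 0 < x i"
    and lt: "\<And>i j. i < n \<Longrightarrow> j < n \<Longrightarrow> i \<noteq> j \<Longrightarrow> x i * x j < 1"
  shows "even_sum n m x = (\<Prod>i<n. x i powi (U + q)) * so_rec q n (\<lambda>_. U) (\<lambda>i. 1 / x i)"
proof -
  have generic: "even_sum n m x = (\<Prod>i<n. x i powi (U + q)) * so_rec q n (\<lambda>_. U) (\<lambda>i. 1 / x i)"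
    if inj: "inj_on x {..<n}" and pos: "\<And>i. i < n \<Longrightarrow> 0 < x i"
      and lt: "\<And>i j. i < n \<Longrightarrow> j < n \<Longrightarrow> i \<noteq> j \<Longrightarrow> x i * x j < 1" for x
  proof (rule even_sum_so_rect[OF q U m n _ inj])
    fix i assume "i < n" then show "x i \<noteq> 0" using pos[of i] by simp
  next
    fix i j assume "i \<noteq> j" "i < n" "j < n" then show "x i * x j \<noteq> 1" using lt[of i j] by simp
  next
    fix k :: nat and y assume y: "inj_on y {..<k}" "y ` {..<k} \<subseteq> x ` {..<n}"
    show "(\<lambda>m. even_sum k m y) \<longlonglongrightarrow> pair_prod gl_inside (y ` {..<k})"
    proof (rule even_sum_tendsto[OF _ _ y(1)])
      fix i assume "i < k"
      then have "y i \<in> x ` {..<n}" using y(2) by blast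
      then show "0 \<le> y i" using pos by (auto intro: less_imp_le)
    next
      fix i j assume ij: "i < k" "j < k" "i \<noteq> j"
      then have "y i \<in> x ` {..<n}" "y j \<in> x ` {..<n}" "y i \<noteq> y j" using y by (auto simp: inj_on_def)
      moreover from this obtain a b where ab: "y i = x a" "y j = x b" "a < n" "b < n" by auto
      ultimately have "a \<noteq> b" by auto
      then show "y i * y j < 1" using lt[of a b] ab by simp
    qed
  qed
  show ?thesis
  proof (rule tendsto_unique[OF trivial_limit_at_right_real[of 0]])
    show "((\<lambda>t. even_sum n m (perturb x t)) \<longlongrightarrow> even_sum n m x) (at_right 0)"
      by (intro tendsto_even_sum tendsto_perturb)
    have "((\<lambda>t. (\<Prod>i<n. perturb x t i powi (U + q)) * so_rec q n (\<lambda>_. U) (\<lambda>i. 1 / perturb x t i)) \<longlongrightarrow>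
        (\<Prod>i<n. x i powi (U + q)) * so_rec q n (\<lambda>_. U) (\<lambda>i. 1 / x i)) (at_right 0)"
    proof (intro tendsto_mult tendsto_prod tendsto_power_int tendsto_so_rec tendsto_divide tendsto_const tendsto_perturb)
      fix i assume "i < n"
      then show "x i \<noteq> 0" "1 / x i \<noteq> 0" using pos[of i] by simp_all
    next
      fix i assume "i \<in> {..<n}"
      then show "x i \<noteq> 0" using pos[of i] by simp
    qed
    then show "((\<lambda>t. even_sum n m (perturb x t)) \<longlongrightarrow>
        (\<Prod>i<n. x i powi (U + q)) * so_rec q n (\<lambda>_. U) (\<lambda>i. 1 / x i)) (at_right 0)"
    proof (rule Lim_transform_eventually)
      have "\<forall>\<^sub>F t in at_right 0. inj_on (perturb x t) {..<n} \<and> (\<forall>i<n. 0 < perturb x t i) \<and>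
          (\<forall>i<n. \<forall>j<n. i \<noteq> j \<longrightarrow> perturb x t i * perturb x t j < 1)"
        by (rule eventually_perturb_generic) (use pos lt in auto)
      then show "\<forall>\<^sub>F t in at_right 0. (\<Prod>i<n. perturb x t i powi (U + q)) *
          so_rec q n (\<lambda>_. U) (\<lambda>i. 1 / perturb x t i) = even_sum n m (perturb x t)"
        by eventually_elim (rule generic[symmetric], auto)
    qed
  qed
qed

text \<open>\<open>so_rec\<close> removes the variables in a fixed order, but the subset sum of
  \<open>so_rect_sign_sum\<close> depends only on the set of their values.\<close>

theorem so_rect_permute:
  assumes q: "0 \<le> q" "q \<le> 1" and U: "0 \<le> U" and \<sigma>: "\<sigma> permutes {..<n}"
    and pos: "\<And>i. i < n \<Longrightarrow> 0 < x i"
    and lt: "\<And>i j. i < n \<Longrightarrow> j < n \<Longrightarrow> i \<noteq> j \<Longrightarrow> x i * x j < 1"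
  shows "so_rec q n (\<lambda>_. U) (\<lambda>i. 1 / x (\<sigma> i)) = so_rec q n (\<lambda>_. U) (\<lambda>i. 1 / x i)"
proof (cases "n = 0")
  case False
  then have n: "0 < n" by simp
  have m: "int (nat (2 * U + q)) = 2 * U + q" using q U by simp
  have \<sigma>n: "\<sigma> i < n \<longleftrightarrow> i < n" for i using permutes_in_image[OF \<sigma>, of i] by simp
  have generic: "so_rec q n (\<lambda>_. U) (\<lambda>i. 1 / x (\<sigma> i)) = so_rec q n (\<lambda>_. U) (\<lambda>i. 1 / x i)"
    if inj: "inj_on x {..<n}" and pos: "\<And>i. i < n \<Longrightarrow> 0 < x i"
      and lt: "\<And>i j. i < n \<Longrightarrow> j < n \<Longrightarrow> i \<noteq> j \<Longrightarrow> x i * x j < 1" for x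
  proof -
    have nz: "x i \<noteq> 0" if "i < n" for i using pos[OF that] by simp
    have ne: "x i * x j \<noteq> 1" if "i < j" "j < n" for i j using lt[of i j] that by simp
    have im: "(x \<circ> \<sigma>) ` {..<n} = x ` {..<n}"
      unfolding image_comp[symmetric] permutes_image[OF \<sigma>] ..
    have inj': "inj_on (x \<circ> \<sigma>) {..<n}"
      using inj permutes_image[OF \<sigma>] by (intro comp_inj_on permutes_inj_on[OF \<sigma>]) simp
    have nz': "(x \<circ> \<sigma>) i \<noteq> 0" if "i < n" for i using nz[of "\<sigma> i"] that \<sigma>n by simp
    have ne': "(x \<circ> \<sigma>) i * (x \<circ> \<sigma>) j \<noteq> 1" if "i < j" "j < n" for i j
    proof -
      have "\<sigma> i \<noteq> \<sigma> j" using injD[OF permutes_inj[OF \<sigma>], of i j] that by auto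
      then have "x (\<sigma> i) * x (\<sigma> j) < 1" using that \<sigma>n by (intro lt) auto
      then show ?thesis by simp
    qed
    have "(\<Prod>i<n. (x \<circ> \<sigma>) i powi (U + q)) * so_rec q n (\<lambda>_. U) (\<lambda>i. 1 / (x \<circ> \<sigma>) i) =
        (\<Prod>i<n. x i powi (U + q)) * so_rec q n (\<lambda>_. U) (\<lambda>i. 1 / x i)"
      using so_rect_sign_sum[of q U "nat (2 * U + q)" n x, OF q U m n nz inj ne]
        so_rect_sign_sum[of q U "nat (2 * U + q)" n "x \<circ> \<sigma>", OF q U m n nz' inj' ne']
      unfolding im by simp
    moreover have "(\<Prod>i<n. (x \<circ> \<sigma>) i powi (U + q)) = (\<Prod>i<n. x i powi (U + q))"
      using prod.permute[OF \<sigma>, of "\<lambda>i. x i powi (U + q)"] by (simp add: comp_def)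
    moreover have "(\<Prod>i<n. x i powi (U + q)) \<noteq> 0" using nz by simp
    ultimately show ?thesis using nz by auto
  qed
  show ?thesis
  proof (rule tendsto_unique[OF trivial_limit_at_right_real[of 0]])
    have lim: "((\<lambda>t. so_rec q n (\<lambda>_. U) (\<lambda>i. 1 / perturb x t (\<tau> i))) \<longlongrightarrow>
        so_rec q n (\<lambda>_. U) (\<lambda>i. 1 / x (\<tau> i))) (at_right 0)" if "\<And>i. i < n \<Longrightarrow> \<tau> i < n" for \<tau>
    proof (intro tendsto_so_rec tendsto_divide tendsto_const tendsto_perturb)
      fix i assume "i < n"
      then show "x (\<tau> i) \<noteq> 0" "1 / x (\<tau> i) \<noteq> 0" using pos[OF that, of i] by simp_all
    qed
    show "((\<lambda>t. so_rec q n (\<lambda>_. U) (\<lambda>i. 1 / perturb x t i)) \<longlongrightarrow>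
        so_rec q n (\<lambda>_. U) (\<lambda>i. 1 / x i)) (at_right 0)"
      by (rule lim)
    from lim[of \<sigma>] show "((\<lambda>t. so_rec q n (\<lambda>_. U) (\<lambda>i. 1 / perturb x t i)) \<longlongrightarrow>
        so_rec q n (\<lambda>_. U) (\<lambda>i. 1 / x (\<sigma> i))) (at_right 0)"
    proof (rule Lim_transform_eventually)
      have "\<forall>\<^sub>F t in at_right 0. inj_on (perturb x t) {..<n} \<and> (\<forall>i<n. 0 < perturb x t i) \<and>
          (\<forall>i<n. \<forall>j<n. i \<noteq> j \<longrightarrow> perturb x t i * perturb x t j < 1)"
        by (rule eventually_perturb_generic) (use pos lt in auto)
      then show "\<forall>\<^sub>F t in at_right 0. so_rec q n (\<lambda>_. U) (\<lambda>i. 1 / perturb x t (\<sigma> i)) =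
          so_rec q n (\<lambda>_. U) (\<lambda>i. 1 / perturb x t i)"
        by eventually_elim (rule generic, auto)
    qed (simp add: \<sigma>n)
  qed
qed simp

section \<open>Splitting the variables\<close>

text \<open>The upper rows that fit between l and m. With the order of summation exchanged, removing
  one variable becomes a kernel from l to m; at j = 0 there is no entry of m to the left, so l alone
  bounds from above.\<close>

definition kernel_rows :: "int \<Rightarrow> nat \<Rightarrow> (nat \<Rightarrow> int) \<Rightarrow> (nat \<Rightarrow> int) \<Rightarrow> (nat \<Rightarrow> int) set" where
  "kernel_rows q n l m = tup n (\<lambda>j. {max (nabs q (l (Suc j))) (nabs q (m j))..
     min (l j) (if j = 0 then l 0 else m (j - 1))})"

definition so_kernel :: "int \<Rightarrow> nat \<Rightarrow> (nat \<Rightarrow> int) \<Rightarrow> (nat \<Rightarrow> int) \<Rightarrow> real \<Rightarrow> real" where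
  "so_kernel q n l m y = (\<Sum>r\<in>kernel_rows q n l m. y powi so_expo q n l r m)"

text \<open>A box containing all lower rows that can occur; unsuitable tuples in it have an empty
  kernel.\<close>

definition signed_tuples :: "int \<Rightarrow> int \<Rightarrow> nat \<Rightarrow> (nat \<Rightarrow> int) set" where
  "signed_tuples q U n = tup n (\<lambda>_. {- U - q..U})"

lemma finite_kernel_rows [simp]: "finite (kernel_rows q n l m)"
  and finite_signed_tuples [simp]: "finite (signed_tuples q U n)"
  by (auto simp: kernel_rows_def signed_tuples_def intro!: finite_tup)

lemma rows_kernel_rows:
  assumes q: "0 \<le> q" "q \<le> 1" and U: "\<And>j. j < n \<Longrightarrow> l j \<le> U"
  shows "r \<in> upper_rows q n l \<and> m \<in> lower_rows q n r \<longleftrightarrow> m \<in> signed_tuples q U n \<and> r \<in> kernel_rows q n l m"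
proof
  assume A: "r \<in> upper_rows q n l \<and> m \<in> lower_rows q n r"
  have r: "nabs q (l (Suc j)) \<le> r j" "r j \<le> l j" if "j < n" for j
    using A that by (auto simp: upper_rows_def tup_def)
  have m: "m j \<in> (if Suc j < n then {r (Suc j)..r j} else {- r j - q..r j})" if "j < n" for j
    using A that by (auto simp: lower_rows_def tup_def)
  have abs: "nabs q (m j) \<le> r j" if "j < n" for j
  proof (cases "Suc j < n")
    case True
    then have "0 \<le> r (Suc j)" using r(1)[OF True] nabs_ge(2)[OF q(2), of "l (Suc (Suc j))"] by linarith
    then show ?thesis using m[OF that] True by (simp add: nabs_def)
  next
    case False
    then show ?thesis using m[OF that] by (auto simp: nabs_def)
  qed
  have prev: "r j \<le> m (j - 1)" if "j < n" "j \<noteq> 0" for j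
    using m[of "j - 1"] that by simp
  have bnd: "- U - q \<le> m j \<and> m j \<le> U" if "j < n" for j
    using abs[OF that] r(2)[OF that] U[OF that] q by (auto simp: nabs_def split: if_splits)
  have zero: "r j = 0" "m j = 0" if "n \<le> j" for j
    using A that by (auto simp: upper_rows_def lower_rows_def tup_def)
  show "m \<in> signed_tuples q U n \<and> r \<in> kernel_rows q n l m"
    using r abs prev bnd zero by (auto simp: signed_tuples_def kernel_rows_def tup_def)
next
  assume A: "m \<in> signed_tuples q U n \<and> r \<in> kernel_rows q n l m"
  have r: "nabs q (l (Suc j)) \<le> r j" "r j \<le> l j" "nabs q (m j) \<le> r j" "j \<noteq> 0 \<Longrightarrow> r j \<le> m (j - 1)" if "j < n" for j
    using A that by (auto simp: kernel_rows_def tup_def)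
  have zero: "r j = 0" "m j = 0" if "n \<le> j" for j
    using A that by (auto simp: signed_tuples_def kernel_rows_def tup_def)
  have "m j \<le> r j" "- r j - q \<le> m j" if "j < n" for j
    using r(3)[OF that] nabs_ge[OF q(2), of "m j"] q by (auto simp: nabs_def split: if_splits)
  moreover have "r (Suc j) \<le> m j" if "Suc j < n" for j
    using r(4)[OF that] by simp
  ultimately show "r \<in> upper_rows q n l \<and> m \<in> lower_rows q n r"
    using r(1,2) zero by (auto simp: upper_rows_def lower_rows_def tup_def)
qed

lemma sum_rows_kernel_rows:
  assumes q: "0 \<le> q" "q \<le> 1" and U: "\<And>j. j < n \<Longrightarrow> l j \<le> U"
  shows "(\<Sum>r\<in>upper_rows q n l. \<Sum>m\<in>lower_rows q n r. f r m) =
    (\<Sum>m\<in>signed_tuples q U n. \<Sum>r\<in>kernel_rows q n l m. (f r m :: real))"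
proof -
  have "(\<Sum>r\<in>upper_rows q n l. \<Sum>m\<in>lower_rows q n r. f r m) =
      (\<Sum>(r, m)\<in>(SIGMA r:upper_rows q n l. lower_rows q n r). f r m)"
    by (rule sum.Sigma) auto
  also have "\<dots> = (\<Sum>(m, r)\<in>(SIGMA m:signed_tuples q U n. kernel_rows q n l m). f r m)"
    by (rule sum.reindex_bij_witness[where i = "\<lambda>(m, r). (r, m)" and j = "\<lambda>(r, m). (m, r)"])
      (use rows_kernel_rows[OF q, of n l U] U in auto)
  also have "\<dots> = (\<Sum>m\<in>signed_tuples q U n. \<Sum>r\<in>kernel_rows q n l m. f r m)"
    by (rule sum.Sigma[symmetric]) auto
  finally show ?thesis .
qed

lemma so_rec_kernel:
  assumes q: "0 \<le> q" "q \<le> 1" and U: "\<And>j. j < Suc n \<Longrightarrow> l j \<le> U"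
  shows "so_rec q (Suc (Suc n)) l x =
    (\<Sum>m\<in>signed_tuples q U (Suc n). so_kernel q (Suc n) l m (x (Suc n)) * so_rec q (Suc n) m x)"
  unfolding so_rec.simps so_kernel_def sum_distrib_right
  by (rule sum_rows_kernel_rows[OF q U])

lemma so_rec_cong:
  assumes "\<And>j. j < n \<Longrightarrow> l j = l' j" "\<And>i. i < n \<Longrightarrow> x i = x' i"
  shows "so_rec q n l x = so_rec q n l' x'"
proof -
  consider "n = 0" | "n = Suc 0" | k where "n = Suc (Suc k)" by (metis nat.exhaust)
  then show ?thesis
  proof cases
    case (3 k)
    have x: "so_rec q k' m x = so_rec q k' m x'" if "k' \<le> n" for k' m
      using that assms(2)
    proof (induction q k' m x rule: so_rec.induct)
      case (3 q n l x)
      then show ?case by simp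
    qed auto
    have "upper_rows q (Suc k) l = upper_rows q (Suc k) l'"
      unfolding upper_rows_def using assms(1) 3 by (intro tup_cong) auto
    moreover have "so_expo q (Suc k) l r m = so_expo q (Suc k) l' r m" for r m
      using assms(1) 3 by (simp add: so_expo_def)
    ultimately show ?thesis using 3 x assms(2) by simp
  qed (use assms in auto)
qed

text \<open>This lets sums over dominant tuples run over the whole box.\<close>

lemma so_rec_not_dominant:
  assumes "\<not> dominant q n l"
  shows "so_rec q n l x = 0"
proof -
  obtain j where j: "Suc j < n" "l j < nabs q (l (Suc j))"
    using assms by (auto simp: dominant_def not_le)
  then obtain k where k: "n = Suc (Suc k)" by (cases n; cases "n - 1") auto
  have "upper_rows q (Suc k) l = {}"
    using j k by (force simp: upper_rows_def tup_def)
  then show ?thesis by (simp add: k)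
qed

definition rect_join :: "nat \<Rightarrow> int \<Rightarrow> (nat \<Rightarrow> int) \<Rightarrow> nat \<Rightarrow> int" where
  "rect_join a U k j = (if j < a then U else k (j - a))"

lemma sum_rect_join: "(\<Sum>j<a + b. rect_join a U k j) = int a * U + (\<Sum>i<b. k i)"
proof (induction b)
  case 0
  have "(\<Sum>j<a. rect_join a U k j) = (\<Sum>j<a. U)" by (intro sum.cong) (auto simp: rect_join_def)
  then show ?case by simp
qed (simp add: rect_join_def)

text \<open>The bounds on the leading entries collapse to U. For the others, l and m enter through a
  maximum and a minimum over neighbours that differ only by a shift of index, so exchanging the
  tails k and k' gives the same intervals.\<close>

lemma kernel_rows_rect:
  assumes q: "0 \<le> q" "q \<le> 1" and U: "0 \<le> U" and k': "k' \<in> signed_tuples q U (Suc d)"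
  shows "kernel_rows q (Suc a + d) (rect_join (Suc (Suc a)) U k) (rect_join a U k') =
    rect_join (Suc a) U ` kernel_rows q d k' k" (is "?L = ?R")
proof -
  let ?l = "rect_join (Suc (Suc a)) U k" and ?m = "rect_join a U k'"
  have k0: "- U - q \<le> k' 0" "k' 0 \<le> U" using k' by (auto simp: signed_tuples_def tup_def)
  then have nk0: "nabs q (k' 0) \<le> U" by (auto simp: nabs_def)
  have nU: "nabs q U = U" using U by (simp add: nabs_def)
  have low: "max (nabs q (?l (Suc j))) (nabs q (?m j)) = U" "min (?l j) (if j = 0 then ?l 0 else ?m (j - 1)) = U"
    if "j < Suc a" for j
    using that nk0 nU by (auto simp: rect_join_def less_Suc_eq)
  have high: "max (nabs q (?l (Suc (Suc a + i)))) (nabs q (?m (Suc a + i))) = max (nabs q (k' (Suc i))) (nabs q (k i))"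
    "min (?l (Suc a + i)) (if Suc a + i = 0 then ?l 0 else ?m (Suc a + i - 1)) =
      min (k' i) (if i = 0 then k' 0 else k (i - 1))" for i
    using k0 by (auto simp: rect_join_def max.commute min.commute min_def split: nat.splits)
  have mem: "r \<in> ?L \<longleftrightarrow> (\<forall>j<Suc a. r j = U) \<and> (\<lambda>i. r (Suc a + i)) \<in> kernel_rows q d k' k" for r
  proof -
    have "r \<in> ?L \<longleftrightarrow> (\<forall>j<Suc a. r j = U) \<and>
        (\<forall>i<d. r (Suc a + i) \<in> {max (nabs q (?l (Suc (Suc a + i)))) (nabs q (?m (Suc a + i)))..
          min (?l (Suc a + i)) (if Suc a + i = 0 then ?l 0 else ?m (Suc a + i - 1))}) \<and>
        (\<forall>j\<ge>Suc a + d. r j = 0)"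
    proof -
      have split: "(\<forall>j<Suc a + d. P j) \<longleftrightarrow> (\<forall>j<Suc a. P j) \<and> (\<forall>i<d. P (Suc a + i))" for P :: "nat \<Rightarrow> bool"
      proof -
        have "P j" if "\<forall>i<d. P (Suc a + i)" "\<not> j < Suc a" "j < Suc a + d" for j
          using spec[OF that(1), of "j - Suc a"] that(2,3) by simp
        then show ?thesis by (meson nat_add_left_cancel_less trans_less_add1)
      qed
      have eqU: "r j \<in> {U..U} \<longleftrightarrow> r j = U" for j by auto
      show ?thesis
        unfolding kernel_rows_def tup_def mem_Collect_eq split using low eqU by simp
    qed
    also have "(\<forall>j\<ge>Suc a + d. r j = 0) \<longleftrightarrow> (\<forall>i\<ge>d. r (Suc a + i) = 0)"
    proof -
      have "r j = 0" if "\<forall>i\<ge>d. r (Suc a + i) = 0" "Suc a + d \<le> j" for j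
        using spec[OF that(1), of "j - Suc a"] that(2) by simp
      then show ?thesis by (meson nat_add_left_cancel_le)
    qed
    finally show ?thesis
      unfolding high by (simp add: kernel_rows_def tup_def)
  qed
  show ?thesis
  proof (intro equalityI subsetI)
    fix r assume "r \<in> ?L"
    then have r: "\<forall>j<Suc a. r j = U" "(\<lambda>i. r (Suc a + i)) \<in> kernel_rows q d k' k" using mem by auto
    then have "r = rect_join (Suc a) U (\<lambda>i. r (Suc a + i))"
      by (auto simp: rect_join_def fun_eq_iff)
    with r(2) show "r \<in> ?R" by blast
  next
    fix r assume "r \<in> ?R"
    then obtain r' where "r = rect_join (Suc a) U r'" "r' \<in> kernel_rows q d k' k" by blast
    then show "r \<in> ?L" unfolding mem by (simp add: rect_join_def)
  qed
qed

text \<open>Once the leading entries are frozen at \<open>U\<close>, removing a variable from a rectangular shape amounts to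
  adding it to the remaining entries: the two rows of the kernel exchange their roles.\<close>

lemma so_kernel_rect:
  assumes q: "0 \<le> q" "q \<le> 1" and U: "0 \<le> U" and k': "k' \<in> signed_tuples q U (Suc d)"
  shows "so_kernel q (Suc a + d) (rect_join (Suc (Suc a)) U k) (rect_join a U k') y =
    (if d = 0 then y powi (k' 0 + q) else so_kernel q d k' k y)"
proof -
  have inj: "inj_on (rect_join (Suc a) U) A" for A
  proof (rule inj_onI)
    fix r r' assume eq: "rect_join (Suc a) U r = rect_join (Suc a) U r'"
    show "r = r'"
    proof
      fix i show "r i = r' i" using fun_cong[OF eq, of "Suc a + i"] by (simp add: rect_join_def)
    qed
  qed
  have "so_kernel q (Suc a + d) (rect_join (Suc (Suc a)) U k) (rect_join a U k') y =
      (\<Sum>r\<in>kernel_rows q d k' k. y powi so_expo q (Suc a + d) (rect_join (Suc (Suc a)) U k)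
        (rect_join (Suc a) U r) (rect_join a U k'))"
    unfolding so_kernel_def kernel_rows_rect[OF q U k'] by (simp add: sum.reindex[OF inj])
  also have "\<dots> = (if d = 0 then y powi (k' 0 + q) else so_kernel q d k' k y)"
  proof (cases d)
    case 0
    have k0: "- U - q \<le> k' 0" using k' by (auto simp: signed_tuples_def tup_def)
    have "kernel_rows q 0 k' k = {\<lambda>_. 0}" by (simp add: kernel_rows_def)
    moreover have "(\<Sum>j<Suc a. rect_join (Suc (Suc a)) U k j) = int (Suc a) * U"
      using sum_rect_join[where a="Suc a" and b=0 and U=U and k=k] by (auto simp: rect_join_def intro!: sum.cong)
    moreover have "(\<Sum>j<a. rect_join a U k' j) = int a * U"
      using sum_rect_join[where a=a and b=0 and U=U and k=k'] by simp
    moreover have "(\<Sum>j<Suc a. rect_join (Suc a) U (\<lambda>_. 0) j) = int (Suc a) * U"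
      using sum_rect_join[where a="Suc a" and b=0 and U=U and k="\<lambda>_. 0"] by simp
    moreover have "rect_join (Suc (Suc a)) U k (Suc a) = U" "rect_join a U k' a = k' 0"
      by (simp_all add: rect_join_def)
    ultimately have "so_expo q (Suc a + 0) (rect_join (Suc (Suc a)) U k) (rect_join (Suc a) U (\<lambda>_. 0)) (rect_join a U k') = k' 0 + q"
      using k0 by (simp add: so_expo_def algebra_simps del: sum.lessThan_Suc)
    with \<open>kernel_rows q 0 k' k = {\<lambda>_. 0}\<close> 0 show ?thesis by simp
  next
    case (Suc c)
    have "so_expo q (Suc a + d) (rect_join (Suc (Suc a)) U k) (rect_join (Suc a) U r) (rect_join a U k') =
        so_expo q d k' r k" for r
    proof -
      have "(\<Sum>j<Suc a + d. rect_join (Suc (Suc a)) U k j) = int (Suc (Suc a)) * U + (\<Sum>i<c. k i)"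
        using sum_rect_join[where a="Suc (Suc a)" and b=c and U=U and k=k] Suc by simp
      moreover have "(\<Sum>j<Suc a + d - 1. rect_join a U k' j) = int a * U + (\<Sum>i<d. k' i)"
        using sum_rect_join[where a=a and b=d and U=U and k=k'] by simp
      moreover have "(\<Sum>j<Suc a + d. rect_join (Suc a) U r j) = int (Suc a) * U + (\<Sum>i<d. r i)"
        by (rule sum_rect_join)
      moreover have "rect_join (Suc (Suc a)) U k (Suc a + d) = k c" "rect_join a U k' (Suc a + d - 1) = k' d"
        using Suc by (simp_all add: rect_join_def)
      ultimately show ?thesis
        unfolding so_expo_def by (simp only:) (simp add: Suc algebra_simps)
    qed
    then show ?thesis using Suc by (simp add: so_kernel_def)
  qed
  finally show ?thesis .
qed

text \<open>Interlacing twice carries the value U downwards: \<open>l (Suc (Suc j))\<close> is at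
  most \<open>r (Suc j)\<close>, which is at most \<open>m j\<close>.\<close>

lemma so_kernel_rect_support:
  assumes q: "0 \<le> q" "q \<le> 1" and U: "0 \<le> U" and m: "m \<in> signed_tuples q U (Suc a + d)"
    and nz: "so_kernel q (Suc a + d) (rect_join (Suc (Suc a)) U k) m y \<noteq> 0" and j: "j < a"
  shows "m j = U"
proof -
  have "kernel_rows q (Suc a + d) (rect_join (Suc (Suc a)) U k) m \<noteq> {}"
    using nz by (auto simp: so_kernel_def)
  then obtain r where r: "r \<in> kernel_rows q (Suc a + d) (rect_join (Suc (Suc a)) U k) m" by blast
  define l where "l = rect_join (Suc (Suc a)) U k"
  have "\<forall>i<Suc a + d. r i \<in> {max (nabs q (l (Suc i))) (nabs q (m i))..min (l i) (if i = 0 then l 0 else m (i - 1))}"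
    using r unfolding l_def[symmetric] kernel_rows_def tup_def mem_Collect_eq by (rule conjunct1)
  from spec[OF this, of "Suc j"]
  have "nabs q (l (Suc (Suc j))) \<le> m j" using j by simp
  moreover have "l (Suc (Suc j)) = U" using j by (simp add: l_def rect_join_def)
  ultimately have "U \<le> m j"
    using j U by (auto simp: nabs_def)
  moreover have "m j \<le> U" using m j by (auto simp: signed_tuples_def tup_def)
  ultimately show ?thesis by simp
qed

theorem so_rect_split:
  assumes q: "0 \<le> q" "q \<le> 1" and U: "0 \<le> U" and d: "2 * d \<le> T"
  shows "so_rec q T (\<lambda>_. U) x = (\<Sum>k\<in>signed_tuples q U d.
    so_rec q d k (\<lambda>i. x (T - 1 - i)) * so_rec q (T - d) (rect_join (T - 2 * d) U k) x)"
  using d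
proof (induction d)
  case 0
  have "so_rec q T (\<lambda>_. U) x = so_rec q T (rect_join T U (\<lambda>_. 0)) x"
    by (rule so_rec_cong) (auto simp: rect_join_def)
  then show ?case by (simp add: signed_tuples_def)
next
  case (Suc d)
  define a where "a = T - 2 * Suc d"
  have T: "T - 2 * d = Suc (Suc a)" "T - d = Suc (Suc a + d)" "T - Suc d = Suc a + d"
    "T - 1 - d = Suc a + d" using Suc.prems by (auto simp: a_def)
  let ?X = "\<lambda>i. x (T - 1 - i)"
  let ?rj = "rect_join (Suc (Suc a)) U"
  \<comment> \<open>Rows that do not begin with a copies of U have an empty kernel, so only the
    tails remain to be summed over.\<close>
  have step: "so_rec q (T - d) (?rj k) x = (\<Sum>k'\<in>signed_tuples q U (Suc d).
      so_kernel q (Suc a + d) (?rj k) (rect_join a U k') (x (Suc a + d)) * so_rec q (Suc a + d) (rect_join a U k') x)"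
    if k: "k \<in> signed_tuples q U d" for k
  proof -
    have le: "?rj k j \<le> U" if "j < Suc (a + d)" for j
      using k that U by (auto simp: rect_join_def signed_tuples_def tup_def)
    have "so_rec q (T - d) (?rj k) x = (\<Sum>m\<in>signed_tuples q U (Suc a + d).
        so_kernel q (Suc a + d) (?rj k) m (x (Suc a + d)) * so_rec q (Suc a + d) m x)"
      using so_rec_kernel[OF q, of "a + d" "?rj k" U x] le by (simp add: T)
    also have "\<dots> = (\<Sum>m\<in>rect_join a U ` signed_tuples q U (Suc d).
        so_kernel q (Suc a + d) (?rj k) m (x (Suc a + d)) * so_rec q (Suc a + d) m x)"
    proof (rule sum.mono_neutral_right)
      show "rect_join a U ` signed_tuples q U (Suc d) \<subseteq> signed_tuples q U (Suc a + d)"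
        using U q by (auto simp: signed_tuples_def tup_def rect_join_def)
      show "\<forall>m\<in>signed_tuples q U (Suc a + d) - rect_join a U ` signed_tuples q U (Suc d).
          so_kernel q (Suc a + d) (?rj k) m (x (Suc a + d)) * so_rec q (Suc a + d) m x = 0"
      proof (rule ballI, rule ccontr)
        fix m assume m: "m \<in> signed_tuples q U (Suc a + d) - rect_join a U ` signed_tuples q U (Suc d)"
          and nz: "so_kernel q (Suc a + d) (?rj k) m (x (Suc a + d)) * so_rec q (Suc a + d) m x \<noteq> 0"
        have "m j = U" if "j < a" for j
          using so_kernel_rect_support[OF q U, of m a d k "x (Suc a + d)" j] m nz that by simp
        then have "m = rect_join a U (\<lambda>i. m (a + i))" by (auto simp: rect_join_def fun_eq_iff)
        moreover have "(\<lambda>i. m (a + i)) \<in> signed_tuples q U (Suc d)"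
          using m by (auto simp: signed_tuples_def tup_def)
        ultimately show False using m by blast
      qed
    qed simp
    also have "\<dots> = (\<Sum>k'\<in>signed_tuples q U (Suc d).
      so_kernel q (Suc a + d) (?rj k) (rect_join a U k') (x (Suc a + d)) * so_rec q (Suc a + d) (rect_join a U k') x)"
    proof (rule sum.reindex_cong[OF _ refl refl])
      show "inj_on (rect_join a U) (signed_tuples q U (Suc d))"
      proof (rule inj_onI)
        fix r r' assume eq: "rect_join a U r = rect_join a U r'"
        show "r = r'"
        proof
          fix i show "r i = r' i" using fun_cong[OF eq, of "a + i"] by (simp add: rect_join_def)
        qed
      qed
    qed
    finally show ?thesis .
  qed
  \<comment> \<open>After the exchange of roles this is the branching rule of the tail k', with the
    variable just removed in the last place.\<close>
  have glue: "(\<Sum>k\<in>signed_tuples q U d. so_rec q d k ?X *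
      so_kernel q (Suc a + d) (?rj k) (rect_join a U k') (x (Suc a + d))) = so_rec q (Suc d) k' ?X"
    if k': "k' \<in> signed_tuples q U (Suc d)" for k'
  proof (cases d)
    case 0
    then show ?thesis
      using so_kernel_rect[OF q U k', of a] Suc.prems T by (simp add: signed_tuples_def)
  next
    case (Suc c)
    have le: "k' j \<le> U" if "j < Suc c" for j
      using k' that Suc by (auto simp: signed_tuples_def tup_def)
    have "so_rec q (Suc d) k' ?X = (\<Sum>k\<in>signed_tuples q U d. so_kernel q d k' k (?X d) * so_rec q d k ?X)"
      unfolding Suc by (rule so_rec_kernel[OF q le])
    moreover have "?X d = x (Suc a + d)" by (simp only: T)
    ultimately show ?thesis
      using so_kernel_rect[OF q U k', of a] Suc by (simp add: mult.commute)
  qed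
  have "so_rec q T (\<lambda>_. U) x = (\<Sum>k\<in>signed_tuples q U d. so_rec q d k ?X * so_rec q (T - d) (?rj k) x)"
    using Suc by (simp add: T)
  also have "\<dots> = (\<Sum>k'\<in>signed_tuples q U (Suc d). \<Sum>k\<in>signed_tuples q U d. so_rec q d k ?X *
      (so_kernel q (Suc a + d) (?rj k) (rect_join a U k') (x (Suc a + d)) * so_rec q (Suc a + d) (rect_join a U k') x))"
    by (subst sum.swap) (simp only: step sum_distrib_left cong: sum.cong)
  also have "\<dots> = (\<Sum>k'\<in>signed_tuples q U (Suc d). so_rec q (Suc d) k' ?X *
      so_rec q (Suc a + d) (rect_join a U k') x)"
    unfolding mult.assoc[symmetric] sum_distrib_right[symmetric] by (intro sum.cong refl) (simp only: glue)
  finally show ?case by (simp add: T a_def)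
qed

section \<open>Orthogonal patterns\<close>

definition shape :: "int \<Rightarrow> nat \<Rightarrow> (nat \<Rightarrow> int) \<Rightarrow> real list" where
  "shape q n l = map (\<lambda>j. of_int (l j) + of_int q / 2) [0..<n]"

definition parity_class :: "int \<Rightarrow> real set" where
  "parity_class q = range (\<lambda>a :: int. of_int a + of_int q / 2)"

lemma length_shape [simp]: "length (shape q n l) = n"
  and nth_shape [simp]: "j < n \<Longrightarrow> shape q n l ! j = of_int (l j) + of_int q / 2"
  by (simp_all add: shape_def)

lemma abs_of_int_add_half:
  assumes "0 \<le> q" "q \<le> 1"
  shows "\<bar>of_int k + of_int q / 2 :: real\<bar> = of_int (nabs q k) + of_int q / 2"
proof -
  have "q = 0 \<or> q = 1" using assms by auto
  then show ?thesis by (auto simp: nabs_def)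
qed

lemma sgn1_of_int_add_half:
  assumes "0 \<le> q" "q \<le> 1"
  shows "sgn1 (of_int k + of_int q / 2) = (if 0 \<le> k then 1 else - 1)"
proof -
  have "q = 0 \<or> q = 1" using assms by auto
  then show ?thesis by (auto simp: sgn1_def)
qed

lemma floor_of_int_add_half:
  assumes "0 \<le> q" "q \<le> 1"
  shows "\<lfloor>of_int k + of_int q / 2 :: real\<rfloor> = k"
proof -
  have "q = 0 \<or> q = 1" using assms by auto
  then show ?thesis by auto
qed

lemma parity_class_cases:
  shows "parity_class 0 = \<int>" "parity_class 1 = half_integers"
  by (auto simp: parity_class_def half_integers_def Ints_def add.commute image_def)

lemma parity_class_disjoint: "\<int> \<inter> half_integers = {}"
proof (rule ccontr)
  assume "\<int> \<inter> half_integers \<noteq> {}"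
  then obtain a b :: int where ab: "of_int a = (1 / 2 + of_int b :: real)"
    by (auto simp: half_integers_def elim!: Ints_cases)
  then have "of_int (2 * a) = (of_int (1 + 2 * b) :: real)" by simp
  then have "2 * a = 1 + 2 * b" by (simp only: of_int_eq_iff)
  then show False by presburger
qed

text \<open>The top row decides between integers and half-integers, so the alternative in the
  definition collapses to one parity class.\<close>

lemma patterns_of_shape_iff:
  assumes q: "0 \<le> q" "q \<le> 1" and M: "1 \<le> M"
  shows "z \<in> patterns_of_shape M (shape q ((M + 1) div 2) l) \<longleftrightarrow>
    (\<forall>i j. (i, j) \<notin> pattern_index M \<longrightarrow> z i j = 0) \<and>
    (\<forall>(i, j)\<in>pattern_index M. z i j \<in> parity_class q) \<and>
    (\<forall>(i, j)\<in>pattern_index M. i \<noteq> 2 * j - 1 \<longrightarrow> 0 \<le> z i j) \<and>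
    (\<forall>i j. (i, j) \<in> pattern_index M \<longrightarrow> (i + 1, j + 1) \<in> pattern_index M \<longrightarrow>
       \<bar>z (i + 1) (j + 1)\<bar> \<le> \<bar>z i j\<bar>) \<and>
    (\<forall>i j. (i, j) \<in> pattern_index M \<longrightarrow> (i + 1, j) \<in> pattern_index M \<longrightarrow>
       \<bar>z i j\<bar> \<le> \<bar>z (i + 1) j\<bar>) \<and>
    (\<forall>j<(M + 1) div 2. z M (Suc j) = of_int (l j) + of_int q / 2)"
    (is "_ \<longleftrightarrow> ?Z \<and> ?P \<and> ?N \<and> ?I \<and> ?J \<and> ?L")
proof -
  have L: "map (z M) [1..<(M + 1) div 2 + 1] = shape q ((M + 1) div 2) l \<longleftrightarrow> ?L"
    by (auto simp: list_eq_iff_nth_eq simp del: upt_Suc)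
  have P: "(\<forall>(i, j)\<in>pattern_index M. z i j \<in> \<int>) \<or> (\<forall>(i, j)\<in>pattern_index M. z i j \<in> half_integers) \<longleftrightarrow> ?P"
    if ?L
  proof -
    have idx: "(M, 1) \<in> pattern_index M" using M by (auto simp: pattern_index_def)
    have "z M 1 = of_int (l 0) + of_int q / 2" using spec[OF that, of 0] M by simp
    then have cls: "z M 1 \<in> parity_class q" by (auto simp: parity_class_def)
    have "q = 0 \<or> q = 1" using q by auto
    then show ?thesis
    proof
      assume "q = 0"
      then have "z M 1 \<notin> half_integers" using cls parity_class_cases parity_class_disjoint by blast
      then show ?thesis using idx \<open>q = 0\<close> parity_class_cases by auto
    next
      assume "q = 1"
      then have "z M 1 \<notin> \<int>" using cls parity_class_cases parity_class_disjoint by blast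
      then show ?thesis using idx \<open>q = 1\<close> parity_class_cases by auto
    qed
  qed
  show ?thesis
    unfolding patterns_of_shape_def orthogonal_patterns_def mem_Collect_eq L using P by argo
qed

section \<open>Peeling off the top row of a pattern\<close>

text \<open>The rows of height M that fit below the row l of height M + 1, in integer coordinates; M
  = 2 j + 1 marks the odd end, which may be negative.\<close>

definition next_rows :: "int \<Rightarrow> nat \<Rightarrow> (nat \<Rightarrow> int) \<Rightarrow> (nat \<Rightarrow> int) set" where
  "next_rows q M l = {r. (\<forall>j\<ge>(M + 1) div 2. r j = 0) \<and> (\<forall>j<(M + 1) div 2.
     (Suc j < (M + 2) div 2 \<longrightarrow> nabs q (l (Suc j)) \<le> nabs q (r j)) \<and>
     nabs q (r j) \<le> nabs q (l j) \<and> (M \<noteq> 2 * j + 1 \<longrightarrow> 0 \<le> r j))}"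

definition add_row :: "int \<Rightarrow> nat \<Rightarrow> (nat \<Rightarrow> int) \<Rightarrow> (nat \<Rightarrow> nat \<Rightarrow> real) \<Rightarrow> nat \<Rightarrow> nat \<Rightarrow> real" where
  "add_row q M l z = z(M := (\<lambda>j. if 1 \<le> j \<and> j \<le> (M + 1) div 2 then of_int (l (j - 1)) + of_int q / 2 else 0))"

lemma patterns_add_row_iff:
  assumes q: "0 \<le> q" "q \<le> 1" and M: "1 \<le> M"
    and l: "\<And>j. j < (M + 2) div 2 \<Longrightarrow> M \<noteq> 2 * j \<Longrightarrow> 0 \<le> l j"
    and z: "z \<in> patterns_of_shape M (shape q ((M + 1) div 2) r)" and r: "r \<in> next_rows q M l"
  shows "add_row q (Suc M) l z \<in> patterns_of_shape (Suc M) (shape q ((M + 2) div 2) l)"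
proof -
  have M2: "(Suc M + 1) div 2 = (M + 2) div 2" by simp
  have idx: "(i, j) \<in> pattern_index (Suc M) \<longleftrightarrow> (i, j) \<in> pattern_index M \<or> i = Suc M \<and> 1 \<le> j \<and> j \<le> (M + 2) div 2"
    for i j by (auto simp: pattern_index_def)
  have idxM: "(i, j) \<in> pattern_index M \<Longrightarrow> i \<le> M \<and> 1 \<le> j" for i j by (auto simp: pattern_index_def)
  have new: "add_row q (Suc M) l z (Suc M) j = (if 1 \<le> j \<and> j \<le> (M + 2) div 2 then of_int (l (j - 1)) + of_int q / 2 else 0)" for j
    by (simp add: add_row_def)
  have old: "add_row q (Suc M) l z i j = z i j" if "i \<noteq> Suc M" for i j using that by (simp add: add_row_def)
  have zs: "\<And>i j. (i, j) \<notin> pattern_index M \<Longrightarrow> z i j = 0"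
    "\<And>i j. (i, j) \<in> pattern_index M \<Longrightarrow> z i j \<in> parity_class q"
    "\<And>i j. (i, j) \<in> pattern_index M \<Longrightarrow> i \<noteq> 2 * j - 1 \<Longrightarrow> 0 \<le> z i j"
    "\<And>i j. (i, j) \<in> pattern_index M \<Longrightarrow> (i + 1, j + 1) \<in> pattern_index M \<Longrightarrow> \<bar>z (i + 1) (j + 1)\<bar> \<le> \<bar>z i j\<bar>"
    "\<And>i j. (i, j) \<in> pattern_index M \<Longrightarrow> (i + 1, j) \<in> pattern_index M \<Longrightarrow> \<bar>z i j\<bar> \<le> \<bar>z (i + 1) j\<bar>"
    "\<And>j. j < (M + 1) div 2 \<Longrightarrow> z M (Suc j) = of_int (r j) + of_int q / 2"
    using z unfolding patterns_of_shape_iff[OF q M] by auto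
  have rr: "\<And>j. j < (M + 1) div 2 \<Longrightarrow> Suc j < (M + 2) div 2 \<Longrightarrow> nabs q (l (Suc j)) \<le> nabs q (r j)"
    "\<And>j. j < (M + 1) div 2 \<Longrightarrow> nabs q (r j) \<le> nabs q (l j)"
    using r by (auto simp: next_rows_def)
  have rowM: "z M j = of_int (r (j - 1)) + of_int q / 2" if "(M, j) \<in> pattern_index M" for j
    using zs(6)[of "j - 1"] that by (auto simp: pattern_index_def)
  have "1 \<le> Suc M" by simp
  show ?thesis
    unfolding M2[symmetric] patterns_of_shape_iff[OF q \<open>1 \<le> Suc M\<close>]
  proof (intro conjI allI impI ballI)
    fix i j assume "(i, j) \<notin> pattern_index (Suc M)"
    then show "add_row q (Suc M) l z i j = 0" using zs(1)[of i j] new[of j] old[of i j] unfolding idx by (cases "i = Suc M") auto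
  next
    fix c assume c: "c \<in> pattern_index (Suc M)"
    show "case c of (i, j) \<Rightarrow> add_row q (Suc M) l z i j \<in> parity_class q"
    proof (cases c)
      case (Pair i j)
      show ?thesis using c zs(2)[of i j] new[of j] old[of i j] idxM[of i j] unfolding Pair idx
        by (cases "i = Suc M") (auto simp: parity_class_def)
    qed
  next
    fix c assume c: "c \<in> pattern_index (Suc M)"
    show "case c of (i, j) \<Rightarrow> i \<noteq> 2 * j - 1 \<longrightarrow> 0 \<le> add_row q (Suc M) l z i j"
    proof (cases c)
      case (Pair i j)
      show ?thesis
      proof (cases "i = Suc M")
        case True
        then have j: "1 \<le> j" "j \<le> (M + 2) div 2" using c idxM[of i j] unfolding Pair idx by auto
        show ?thesis using j l[of "j - 1"] q unfolding Pair True by (auto simp: new)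
      next
        case False
        then show ?thesis using c zs(3)[of i j] unfolding Pair idx by (simp add: old)
      qed
    qed
  next
    fix i j assume c: "(i, j) \<in> pattern_index (Suc M)" "(i + 1, j + 1) \<in> pattern_index (Suc M)"
    have i: "i \<le> M" using c by (auto simp: pattern_index_def)
    show "\<bar>add_row q (Suc M) l z (i + 1) (j + 1)\<bar> \<le> \<bar>add_row q (Suc M) l z i j\<bar>"
    proof (cases "i = M")
      case True
      then have j: "(M, j) \<in> pattern_index M" "j + 1 \<le> (M + 2) div 2" "1 \<le> j" "j \<le> (M + 1) div 2"
        using c by (auto simp: pattern_index_def)
      show ?thesis
        using rr(1)[of "j - 1"] j rowM[OF j(1)] True by (simp add: new old abs_of_int_add_half[OF q])
    next
      case False
      then show ?thesis using c zs(4)[of i j] i by (auto simp: old idx)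
    qed
  next
    fix i j assume c: "(i, j) \<in> pattern_index (Suc M)" "(i + 1, j) \<in> pattern_index (Suc M)"
    have i: "i \<le> M" using c by (auto simp: pattern_index_def)
    show "\<bar>add_row q (Suc M) l z i j\<bar> \<le> \<bar>add_row q (Suc M) l z (i + 1) j\<bar>"
    proof (cases "i = M")
      case True
      then have j: "(M, j) \<in> pattern_index M" "j \<le> (M + 2) div 2" "1 \<le> j" "j \<le> (M + 1) div 2"
        using c by (auto simp: pattern_index_def)
      show ?thesis
        using rr(2)[of "j - 1"] j rowM[OF j(1)] True by (simp add: new old abs_of_int_add_half[OF q])
    next
      case False
      then show ?thesis using c zs(5)[of i j] i by (auto simp: old idx)
    qed
  next
    fix j assume "j < (Suc M + 1) div 2"
    then show "add_row q (Suc M) l z (Suc M) (Suc j) = of_int (l j) + of_int q / 2" by (simp add: new)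
  qed
qed

lemma patterns_drop_row:
  assumes q: "0 \<le> q" "q \<le> 1" and M: "1 \<le> M"
    and z: "z \<in> patterns_of_shape (Suc M) (shape q ((M + 2) div 2) l)"
  defines "r \<equiv> \<lambda>j. if j < (M + 1) div 2 then \<lfloor>z M (Suc j)\<rfloor> else 0"
  shows "\<And>j. j < (M + 2) div 2 \<Longrightarrow> M \<noteq> 2 * j \<Longrightarrow> 0 \<le> l j"
    and "r \<in> next_rows q M l"
    and "z(Suc M := (\<lambda>_. 0)) \<in> patterns_of_shape M (shape q ((M + 1) div 2) r)"
    and "add_row q (Suc M) l (z(Suc M := (\<lambda>_. 0))) = z"
proof -
  have M2: "(Suc M + 1) div 2 = (M + 2) div 2" by simp
  have "1 \<le> Suc M" by simp
  have idx: "(i, j) \<in> pattern_index (Suc M) \<longleftrightarrow> (i, j) \<in> pattern_index M \<or> i = Suc M \<and> 1 \<le> j \<and> j \<le> (M + 2) div 2"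
    for i j by (auto simp: pattern_index_def)
  have idxM: "(i, j) \<in> pattern_index M \<Longrightarrow> i \<le> M \<and> 1 \<le> j" for i j by (auto simp: pattern_index_def)
  have zs: "\<And>i j. (i, j) \<notin> pattern_index (Suc M) \<Longrightarrow> z i j = 0"
    "\<And>i j. (i, j) \<in> pattern_index (Suc M) \<Longrightarrow> z i j \<in> parity_class q"
    "\<And>i j. (i, j) \<in> pattern_index (Suc M) \<Longrightarrow> i \<noteq> 2 * j - 1 \<Longrightarrow> 0 \<le> z i j"
    "\<And>i j. (i, j) \<in> pattern_index (Suc M) \<Longrightarrow> (i + 1, j + 1) \<in> pattern_index (Suc M) \<Longrightarrow> \<bar>z (i + 1) (j + 1)\<bar> \<le> \<bar>z i j\<bar>"
    "\<And>i j. (i, j) \<in> pattern_index (Suc M) \<Longrightarrow> (i + 1, j) \<in> pattern_index (Suc M) \<Longrightarrow> \<bar>z i j\<bar> \<le> \<bar>z (i + 1) j\<bar>"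
    "\<And>j. j < (M + 2) div 2 \<Longrightarrow> z (Suc M) (Suc j) = of_int (l j) + of_int q / 2"
    using z unfolding M2[symmetric] patterns_of_shape_iff[OF q \<open>1 \<le> Suc M\<close>] by auto
  have rowM: "z M (Suc j) = of_int (r j) + of_int q / 2" if "j < (M + 1) div 2" for j
  proof -
    have "(M, Suc j) \<in> pattern_index (Suc M)" using that M by (auto simp: pattern_index_def)
    from zs(2)[OF this] obtain a :: int where "z M (Suc j) = of_int a + of_int q / 2" by (auto simp: parity_class_def)
    then show ?thesis using that floor_of_int_add_half[OF q, of a] by (simp add: r_def)
  qed
  show l: "0 \<le> l j" if "j < (M + 2) div 2" "M \<noteq> 2 * j" for j
  proof -
    have "0 \<le> of_int (l j) + of_int q / (2 :: real)"
      using zs(3)[of "Suc M" "Suc j"] zs(6)[OF that(1)] that by (simp add: idx)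
    then have "0 \<le> \<lfloor>of_int (l j) + of_int q / (2 :: real)\<rfloor>" by (simp only: zero_le_floor)
    then show ?thesis by (simp only: floor_of_int_add_half[OF q])
  qed
  show "r \<in> next_rows q M l"
    unfolding next_rows_def mem_Collect_eq
  proof (intro conjI allI impI)
    fix j assume "(M + 1) div 2 \<le> j" then show "r j = 0" by (simp add: r_def)
  next
    fix j assume j: "j < (M + 1) div 2" "Suc j < (M + 2) div 2"
    then show "nabs q (l (Suc j)) \<le> nabs q (r j)"
      using zs(4)[of M "Suc j"] zs(6)[of "Suc j"] rowM[of j] M
      by (simp add: idx pattern_index_def abs_of_int_add_half[OF q])
  next
    fix j assume j: "j < (M + 1) div 2"
    then have "j < (M + 2) div 2" by linarith
    then show "nabs q (r j) \<le> nabs q (l j)"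
      using zs(5)[of M "Suc j"] zs(6)[of "j"] rowM[of j] M j
      by (simp add: idx pattern_index_def abs_of_int_add_half[OF q])
  next
    fix j assume j: "j < (M + 1) div 2" "M \<noteq> 2 * j + 1"
    have "0 \<le> z M (Suc j)"
      using zs(3)[of M "Suc j"] M j by (simp add: idx pattern_index_def)
    then show "0 \<le> r j" using j by (simp add: r_def)
  qed
  show "z(Suc M := (\<lambda>_. 0)) \<in> patterns_of_shape M (shape q ((M + 1) div 2) r)"
    unfolding patterns_of_shape_iff[OF q M]
  proof (intro conjI allI impI ballI)
    fix i j assume "(i, j) \<notin> pattern_index M"
    then show "(z(Suc M := (\<lambda>_. 0))) i j = 0" using zs(1)[of i j] by (auto simp: idx)
  next
    fix c assume "c \<in> pattern_index M"
    then show "case c of (i, j) \<Rightarrow> (z(Suc M := (\<lambda>_. 0))) i j \<in> parity_class q"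
      using zs(2) idxM by (cases c) (fastforce simp: idx)
  next
    fix c assume c: "c \<in> pattern_index M"
    show "case c of (i, j) \<Rightarrow> i \<noteq> 2 * j - 1 \<longrightarrow> 0 \<le> (z(Suc M := (\<lambda>_. 0))) i j"
      using zs(3)[of "fst c" "snd c"] idxM[of "fst c" "snd c"] c by (cases c) (simp add: idx)
  next
    fix i j assume "(i, j) \<in> pattern_index M" "(i + 1, j + 1) \<in> pattern_index M"
    then show "\<bar>(z(Suc M := (\<lambda>_. 0))) (i + 1) (j + 1)\<bar> \<le> \<bar>(z(Suc M := (\<lambda>_. 0))) i j\<bar>"
      using zs(4)[of i j] idxM[of i j] idxM[of "i + 1" "j + 1"] by (simp add: idx)
  next
    fix i j assume "(i, j) \<in> pattern_index M" "(i + 1, j) \<in> pattern_index M"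
    then show "\<bar>(z(Suc M := (\<lambda>_. 0))) i j\<bar> \<le> \<bar>(z(Suc M := (\<lambda>_. 0))) (i + 1) j\<bar>"
      using zs(5)[of i j] idxM[of i j] idxM[of "i + 1" j] by (simp add: idx)
  next
    fix j assume "j < (M + 1) div 2"
    then show "(z(Suc M := (\<lambda>_. 0))) M (Suc j) = of_int (r j) + of_int q / 2"
      by (simp add: rowM)
  qed
  show "add_row q (Suc M) l (z(Suc M := (\<lambda>_. 0))) = z"
  proof (intro ext)
    fix i j
    show "add_row q (Suc M) l (z(Suc M := (\<lambda>_. 0))) i j = z i j"
    proof (cases "i = Suc M")
      case True
      show ?thesis
      proof (cases "1 \<le> j \<and> j \<le> (M + 2) div 2")
        case j: True
        then show ?thesis using zs(6)[of "j - 1"] True by (auto simp: add_row_def)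
      next
        case j: False
        then have "(i, j) \<notin> pattern_index (Suc M)" using True by (auto simp: pattern_index_def)
        then show ?thesis using zs(1)[of i j] True j by (auto simp: add_row_def)
      qed
    qed (simp add: add_row_def)
  qed
qed

lemma finite_next_rows: "finite (next_rows q M l)"
proof (rule finite_subset)
  have bnd: "k \<in> {- c - \<bar>q\<bar>..c + \<bar>q\<bar>}" if "nabs q k \<le> c" for k c
    using that unfolding nabs_def atLeastAtMost_iff by (cases "0 \<le> k") arith+
  show "next_rows q M l \<subseteq> tup ((M + 1) div 2) (\<lambda>j. {- nabs q (l j) - \<bar>q\<bar>..nabs q (l j) + \<bar>q\<bar>})"
    unfolding next_rows_def tup_def using bnd by blast
qed (rule finite_tup, simp)

lemma finite_patterns_of_shape:
  assumes q: "0 \<le> q" "q \<le> 1"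
  shows "finite (patterns_of_shape (Suc M) (shape q ((M + 2) div 2) l))"
proof (induction M arbitrary: l)
  case 0
  have "patterns_of_shape (Suc 0) (shape q 1 l) \<subseteq> {(\<lambda>i j. if i = 1 \<and> j = 1 then of_int (l 0) + of_int q / 2 else 0)}"
  proof
    fix z assume z: "z \<in> patterns_of_shape (Suc 0) (shape q 1 l)"
    have z': "\<And>i j. (i, j) \<notin> pattern_index 1 \<Longrightarrow> z i j = 0" "z 1 1 = of_int (l 0) + of_int q / 2"
      using z patterns_of_shape_iff[OF q, of 1 z l] by auto
    have "z i j = (if i = 1 \<and> j = 1 then of_int (l 0) + of_int q / 2 else 0)" for i j
    proof (cases "(i, j) \<in> pattern_index 1")
      case True
      then have "i = 1 \<and> j = 1" by (auto simp: pattern_index_def)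
      then show ?thesis using z'(2) by simp
    next
      case False
      moreover from False have "\<not> (i = 1 \<and> j = 1)" by (auto simp: pattern_index_def)
      ultimately show ?thesis using z'(1) by auto
    qed
    then show "z \<in> {(\<lambda>i j. if i = 1 \<and> j = 1 then of_int (l 0) + of_int q / 2 else 0)}" by auto
  qed
  from finite_subset[OF this] show ?case by simp
next
  case (Suc M)
  let ?P = "\<lambda>r. patterns_of_shape (Suc M) (shape q ((M + 2) div 2) r)"
  have "patterns_of_shape (Suc (Suc M)) (shape q ((Suc M + 2) div 2) l) \<subseteq>
      add_row q (Suc (Suc M)) l ` (\<Union>r\<in>next_rows q (Suc M) l. ?P r)"
  proof
    fix z assume z: "z \<in> patterns_of_shape (Suc (Suc M)) (shape q ((Suc M + 2) div 2) l)"
    have "1 \<le> Suc M" by simp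
    note drop = patterns_drop_row[OF q this z]
    show "z \<in> add_row q (Suc (Suc M)) l ` (\<Union>r\<in>next_rows q (Suc M) l. ?P r)"
    proof (rule image_eqI)
      show "z = add_row q (Suc (Suc M)) l (z(Suc (Suc M) := (\<lambda>_. 0)))" using drop(4) by simp
      show "z(Suc (Suc M) := (\<lambda>_. 0)) \<in> (\<Union>r\<in>next_rows q (Suc M) l. ?P r)"
        using drop(2,3) by auto
    qed
  qed
  moreover have "finite (\<Union>r\<in>next_rows q (Suc M) l. ?P r)"
    by (rule finite_UN_I[OF finite_next_rows]) (rule Suc.IH)
  ultimately show ?case by (rule finite_subset[OF _ finite_imageI])
qed

text \<open>The top row peels off bijectively; a row that is negative away from its odd end carries
  no pattern, see \<open>patterns_empty\<close>.\<close>

lemma sum_patterns_step: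
  assumes q: "0 \<le> q" "q \<le> 1" and M: "1 \<le> M"
    and l: "\<And>j. j < (M + 2) div 2 \<Longrightarrow> M \<noteq> 2 * j \<Longrightarrow> 0 \<le> l j"
  shows "(\<Sum>z\<in>patterns_of_shape (Suc M) (shape q ((M + 2) div 2) l). F z) =
    (\<Sum>r\<in>next_rows q M l. \<Sum>z\<in>patterns_of_shape M (shape q ((M + 1) div 2) r). F (add_row q (Suc M) l z) :: real)"
    (is "?L = ?R")
proof -
  let ?P = "\<lambda>r. patterns_of_shape M (shape q ((M + 1) div 2) r)"
  let ?rf = "\<lambda>z j. if j < (M + 1) div 2 then \<lfloor>z M (Suc j) :: real\<rfloor> else 0"
  have fin: "finite (?P r)" for r
    using finite_patterns_of_shape[OF q, of "M - 1" r] M by simp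
  have zero: "z(Suc M := (\<lambda>_. 0)) = z" if "z \<in> ?P r" for z r
  proof (rule ext, rule ext)
    fix i j show "(z(Suc M := (\<lambda>_. 0))) i j = z i j"
    using that unfolding patterns_of_shape_iff[OF q M] by (auto simp: pattern_index_def)
  qed
  have "?R = (\<Sum>(r, z)\<in>Sigma (next_rows q M l) ?P. F (add_row q (Suc M) l z))"
    by (intro sum.Sigma ballI finite_next_rows fin)
  also have "\<dots> = ?L"
  proof (rule sum.reindex_bij_witness[where i = "\<lambda>z. (?rf z, z(Suc M := (\<lambda>_. 0)))" and
        j = "\<lambda>(r, z). add_row q (Suc M) l z"], goal_cases)
    case (1 c)
    obtain r z where c: "c = (r, z)" and r: "r \<in> next_rows q M l" and z: "z \<in> ?P r" using 1 by auto
    have "?rf (add_row q (Suc M) l z) j = r j" for j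
    proof (cases "j < (M + 1) div 2")
      case True
      have "z M (Suc j) = of_int (r j) + of_int q / 2"
        using z True unfolding patterns_of_shape_iff[OF q M] by blast
      then show ?thesis using True by (simp add: add_row_def floor_of_int_add_half[OF q] del: floor_add_int int_add_floor)
    next
      case False
      then show ?thesis using r by (simp add: next_rows_def)
    qed
    moreover have "(add_row q (Suc M) l z)(Suc M := (\<lambda>_. 0)) = z"
      using zero[OF z] by (simp add: add_row_def)
    ultimately show ?case unfolding c prod.case by auto
  next
    case (2 c)
    then show ?case using patterns_add_row_iff[OF q M l] by auto
  next
    case (3 z)
    then show ?case using patterns_drop_row(4)[OF q M 3] by simp
  next
    case (4 z)
    then show ?case using patterns_drop_row(2,3)[OF q M 4] by simp
  qed auto
  finally show ?thesis by simp
qed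

lemma patterns_empty:
  assumes q: "0 \<le> q" "q \<le> 1" and M: "1 \<le> M" and l: "j < (M + 2) div 2" "M \<noteq> 2 * j" "l j < 0"
  shows "patterns_of_shape (Suc M) (shape q ((M + 2) div 2) l) = {}"
proof (rule equals0I)
  fix z assume "z \<in> patterns_of_shape (Suc M) (shape q ((M + 2) div 2) l)"
  from patterns_drop_row(1)[OF q M this l(1,2)] show False using l(3) by simp
qed

lemma next_rows_upper:
  assumes q: "0 \<le> q" "q \<le> 1" and l: "\<And>j. j < n \<Longrightarrow> 0 \<le> l j"
  shows "next_rows q (2 * n) l = upper_rows q n l"
proof -
  have M: "(2 * n + 1) div 2 = n" "(2 * n + 2) div 2 = Suc n" by simp_all
  have ge: "0 \<le> nabs q k" for k using nabs_ge[OF q(2)] by auto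
  have ne: "2 * n \<noteq> 2 * j + 1" for j by presburger
  have "(nabs q (l (Suc j)) \<le> nabs q (k) \<and> nabs q k \<le> nabs q (l j) \<and> 0 \<le> k) \<longleftrightarrow> k \<in> {nabs q (l (Suc j))..l j}"
    if "j < n" for j k
    using l[OF that] ge[of "l (Suc j)"] by (auto simp: nabs_def[of q k] nabs_def[of q "l j"])
  then show ?thesis
    unfolding next_rows_def upper_rows_def tup_def M using ne by auto
qed

lemma next_rows_lower:
  assumes q: "0 \<le> q" "q \<le> 1" and r: "\<And>j. 0 \<le> r j"
  shows "next_rows q (2 * n + 1) r = lower_rows q (Suc n) r"
proof -
  have M: "(2 * n + 1 + 1) div 2 = Suc n" "(2 * n + 1 + 2) div 2 = Suc n" by simp_all
  have eq: "(nabs q (r (Suc j)) \<le> nabs q (k) \<and> nabs q k \<le> nabs q (r j) \<and> 0 \<le> k) \<longleftrightarrow> k \<in> {r (Suc j)..r j}"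
    for j k
    using r[of j] r[of "Suc j"] by (auto simp: nabs_def)
  have eq': "nabs q k \<le> nabs q (r j) \<longleftrightarrow> k \<in> {- r j - q..r j}" for j k
    using r[of j] q by (auto simp: nabs_def)
  have "(Suc j < Suc n \<longrightarrow> nabs q (r (Suc j)) \<le> nabs q k) \<and> nabs q k \<le> nabs q (r j) \<and> (2 * n + 1 \<noteq> 2 * j + 1 \<longrightarrow> 0 \<le> k) \<longleftrightarrow>
      k \<in> (if Suc j < Suc n then {r (Suc j)..r j} else {- r j - q..r j})" if "j < Suc n" for j k
    using eq[of j k] eq'[of k j] that by (cases "j = n") auto
  then show ?thesis
    unfolding next_rows_def lower_rows_def tup_def M
    by (intro Collect_cong, subst conj_commute, intro conj_cong[OF all_cong refl])
qed

section \<open>Pattern weights and characters\<close>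

text \<open>The exponent of the variable with index n in \<open>pattern_weight\<close>. Unlike
  \<open>so_expo\<close> it carries the product of the signs of the two odd ends.\<close>

definition pattern_expo :: "int \<Rightarrow> nat \<Rightarrow> (nat \<Rightarrow> int) \<Rightarrow> (nat \<Rightarrow> int) \<Rightarrow> (nat \<Rightarrow> int) \<Rightarrow> real" where
  "pattern_expo q n l r m = (if 0 \<le> l n \<longleftrightarrow> 0 \<le> m (n - 1) then 1 else - 1) *
     (of_int ((\<Sum>j<Suc n. nabs q (l j)) + (\<Sum>j<n. nabs q (m j)) - 2 * (\<Sum>j<n. r j)) + of_int q / 2)"

text \<open>The maximum at position j and the minimum at position j + 1 involve the same two entries
  and add up to their sum; only the last maximum is left over.\<close>

lemma sum_kernel_bounds:
  assumes l: "\<And>j. j < Suc n \<Longrightarrow> 0 \<le> l j" and m: "\<And>j. j < n \<Longrightarrow> 0 \<le> m j"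
  shows "(\<Sum>j<Suc n. max (nabs q (l (Suc j))) (nabs q (m j)) + min (l j) (if j = 0 then l 0 else m (j - 1))) =
    (\<Sum>j<Suc n. l j) + (\<Sum>j<n. m j) + max (nabs q (l (Suc n))) (nabs q (m n))"
  using assms
proof (induction n)
  case (Suc n)
  have "nabs q (l (Suc n)) = l (Suc n)" "nabs q (m n) = m n" using Suc.prems by (simp_all add: nabs_def)
  moreover have "max a b + min a b = a + b" for a b :: int by simp
  ultimately show ?case using Suc by simp
qed simp

text \<open>If the signs of the two odd ends differ, the two exponents are exchanged by reflecting every
  entry of the row in between within its interval.\<close>

lemma sum_kernel_powr:
  assumes q: "0 \<le> q" "q \<le> 1" and x: "0 < x" and n: "0 < n"
  shows "(\<Sum>r\<in>kernel_rows q n l m. x powr pattern_expo q n l r m) = x powr (- of_int q / 2) * so_kernel q n l m x"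
proof (cases "kernel_rows q n l m = {}")
  case True
  then show ?thesis by (simp add: so_kernel_def)
next
  case False
  then obtain r0 where r0: "r0 \<in> kernel_rows q n l m" by blast
  have ge: "0 \<le> nabs q k" for k using nabs_ge[OF q(2)] by auto
  define a where "a = (\<lambda>j. max (nabs q (l (Suc j))) (nabs q (m j)))"
  define b where "b = (\<lambda>j. min (l j) (if j = 0 then l 0 else m (j - 1)))"
  have K: "kernel_rows q n l m = tup n (\<lambda>j. {a j..b j})"
    by (simp add: kernel_rows_def a_def b_def)
  have ab: "a j \<le> b j" "0 \<le> a j" if "j < n" for j
    using r0 ge[of "m j"] that unfolding K by (auto simp: tup_def a_def)
  have l0: "0 \<le> l j" if "j < n" for j using ab[OF that] by (auto simp: b_def)
  have m0: "0 \<le> m j" if "Suc j < n" for j using ab[OF that] by (auto simp: b_def)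
  define L where "L = (\<Sum>j<n. l j)"
  define R where "R = (\<Sum>j<n - 1. m j)"
  obtain k where k: "n = Suc k" using n by (cases n) auto
  have sl: "(\<Sum>j<Suc n. nabs q (l j)) = L + nabs q (l n)"
    using l0 by (simp add: L_def nabs_def)
  have sm: "(\<Sum>j<n. nabs q (m j)) = R + nabs q (m (n - 1))"
    using m0 by (simp add: R_def k nabs_def)
  have sab: "(\<Sum>j<n. a j + b j) = L + R + max (nabs q (l n)) (nabs q (m (n - 1)))"
    using sum_kernel_bounds[of k l m q] l0 m0 by (simp add: k a_def b_def L_def R_def)
  have powi: "x powr of_int i = x powi i" for i using x by (simp add: powr_real_of_int')
  have split: "x powr (- of_int q / 2) * x powi i = x powr (of_int i - of_int q / 2)" for i
    unfolding powi[symmetric] powr_add[symmetric] by simp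
  show ?thesis
  proof (cases "0 \<le> l n \<longleftrightarrow> 0 \<le> m (n - 1)")
    case True
    have expo: "pattern_expo q n l r m = of_int (so_expo q n l r m) - of_int q / 2" for r
    proof -
      have "\<bar>l n + m (n - 1) + q\<bar> = nabs q (l n) + nabs q (m (n - 1)) + q"
        using True q by (auto simp: nabs_def)
      then have "so_expo q n l r m = (L + nabs q (l n)) + (R + nabs q (m (n - 1))) - 2 * (\<Sum>j<n. r j) + q"
        by (simp add: so_expo_def L_def R_def)
      then show ?thesis using True unfolding pattern_expo_def sl sm by simp
    qed
    show ?thesis by (simp only: so_kernel_def sum_distrib_left split expo)
  next
    case False
    define refl where "refl = (\<lambda>r j. if j < n then a j + b j - r j else (0::int))"
    have expo: "pattern_expo q n l r m = of_int (so_expo q n l (refl r) m) - of_int q / 2" for r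
    proof -
      have "(\<Sum>j<n. refl r j) = (\<Sum>j<n. (a j + b j) - r j)" by (intro sum.cong) (auto simp: refl_def)
      then have "(\<Sum>j<n. refl r j) = L + R + max (nabs q (l n)) (nabs q (m (n - 1))) - (\<Sum>j<n. r j)"
        by (simp only: sum_subtractf sab)
      \<comment> \<open>With opposite signs, the sum of the odd ends is a difference of absolute
        values, and its doubled maximum cancels against the one in \<open>sab\<close>.\<close>
      moreover have "\<bar>l n + m (n - 1) + q\<bar> = 2 * max (nabs q (l n)) (nabs q (m (n - 1))) - nabs q (l n) - nabs q (m (n - 1))"
      proof -
        have dist: "\<bar>s - t\<bar> = 2 * max s t - s - t" for s t :: int by auto
        have "\<bar>l n + m (n - 1) + q\<bar> = \<bar>nabs q (l n) - nabs q (m (n - 1))\<bar>"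
          using False by (cases "0 \<le> l n") (simp_all add: nabs_def abs_minus_commute algebra_simps)
        then show ?thesis unfolding dist .
      qed
      ultimately have "so_expo q n l (refl r) m = - ((L + nabs q (l n)) + (R + nabs q (m (n - 1))) - 2 * (\<Sum>j<n. r j))"
        by (simp add: so_expo_def L_def R_def)
      then show ?thesis using False unfolding pattern_expo_def sl sm by simp
    qed
    have mem: "refl r \<in> kernel_rows q n l m" if "r \<in> kernel_rows q n l m" for r
      using that unfolding K by (auto simp: tup_def refl_def)
    have inv: "refl (refl r) = r" if "r \<in> kernel_rows q n l m" for r
      using that unfolding K by (auto simp: tup_def refl_def fun_eq_iff)
    have "(\<Sum>r\<in>kernel_rows q n l m. x powr pattern_expo q n l r m) =
        (\<Sum>r\<in>kernel_rows q n l m. x powr (of_int (so_expo q n l r m) - of_int q / 2))"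
      by (rule sum.reindex_bij_witness[where i = refl and j = refl]) (simp_all add: mem inv expo)
    then show ?thesis by (simp only: so_kernel_def sum_distrib_left split)
  qed
qed

text \<open>The types and odd ends of the lower rows are unchanged, so two new rows contribute only
  the factor of the new variable.\<close>

lemma pattern_weight_add_rows:
  assumes q: "0 \<le> q" "q \<le> 1" and n: "1 \<le> n"
    and z: "z \<in> patterns_of_shape (2 * n - 1) (shape q n m)" and r: "\<And>j. j < n \<Longrightarrow> 0 \<le> r j"
  shows "pattern_weight (Suc n) (add_row q (2 * n + 1) l (add_row q (2 * n) r z)) x =
    pattern_weight n z x * (x ! n) powr pattern_expo q n l r m"
proof -
  define y where "y = add_row q (2 * n + 1) l (add_row q (2 * n) r z)"
  have zm: "z (2 * n - 1) (Suc j) = of_int (m j) + of_int q / 2" if "j < n" for j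
    using z patterns_of_shape_iff[OF q, of "2 * n - 1" z m] n that by auto
  have old: "y i = z i" if "i \<le> 2 * n - 1" for i
  proof -
    have "i \<noteq> 2 * n" "i \<noteq> 2 * n + 1" using that n by linarith+
    then show ?thesis by (simp add: y_def add_row_def)
  qed
  have yl: "y (2 * n + 1) (Suc j) = of_int (l j) + of_int q / 2" if "j < Suc n" for j
    using that by (simp add: y_def add_row_def)
  have yr: "y (2 * n) (Suc j) = of_int (r j) + of_int q / 2" if "j < n" for j
    using that by (simp add: y_def add_row_def)
  have type: "pattern_type y i = pattern_type z i" if "i \<le> 2 * n - 1" for i
    using that by (simp add: pattern_type_def old)
  have shift: "(\<Sum>j\<in>{1..k}. f j) = (\<Sum>j<k. f (Suc j))" for f :: "nat \<Rightarrow> real" and k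
    by (rule sum.reindex_bij_witness[where i = Suc and j = "\<lambda>j. j - 1"]) auto
  have s1: "(\<Sum>j\<in>{1..Suc n}. \<bar>y (2 * n + 1) j\<bar>) = (\<Sum>j<Suc n. of_int (nabs q (l j)) + of_int q / 2)"
    unfolding shift by (intro sum.cong refl) (simp only: lessThan_iff yl abs_of_int_add_half[OF q])
  have s2: "(\<Sum>j\<in>{1..n}. \<bar>y (2 * n) j\<bar>) = (\<Sum>j<n. of_int (r j) + of_int q / 2)"
    unfolding shift
  proof (intro sum.cong refl)
    fix j assume "j \<in> {..<n}"
    then show "\<bar>y (2 * n) (Suc j)\<bar> = of_int (r j) + of_int q / 2"
      using yr[of j] r[of j] abs_of_int_add_half[OF q, of "r j"] by (simp add: nabs_def)
  qed
  have s3: "(\<Sum>j\<in>{1..n}. \<bar>y (2 * n - 1) j\<bar>) = (\<Sum>j<n. of_int (nabs q (m j)) + of_int q / 2)"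
    unfolding shift
    by (intro sum.cong refl) (simp only: lessThan_iff old order.refl zm abs_of_int_add_half[OF q])
  have t1: "pattern_type y (2 * n + 1) = (\<Sum>j\<in>{1..Suc n}. \<bar>y (2 * n + 1) j\<bar>) - (\<Sum>j\<in>{1..n}. \<bar>y (2 * n) j\<bar>)"
    by (simp add: pattern_type_def del: sum.cl_ivl_Suc)
  have t2: "pattern_type y (2 * n) = (\<Sum>j\<in>{1..n}. \<bar>y (2 * n) j\<bar>) - (\<Sum>j\<in>{1..n}. \<bar>y (2 * n - 1) j\<bar>)"
    by (simp add: pattern_type_def)
  have types: "pattern_type y (2 * n + 1) - pattern_type y (2 * n) =
      of_int ((\<Sum>j<Suc n. nabs q (l j)) + (\<Sum>j<n. nabs q (m j)) - 2 * (\<Sum>j<n. r j)) + of_int q / 2"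
    unfolding t1 t2 s1 s2 s3 sum.distrib sum_constant card_lessThan by (simp add: algebra_simps add_divide_distrib)
  have y1: "y (2 * n - 1) n = of_int (m (n - 1)) + of_int q / 2"
    using zm[of "n - 1"] old[of "2 * n - 1"] n by simp
  have y2: "y (2 * n + 1) (Suc n) = of_int (l n) + of_int q / 2"
    by (rule yl) simp
  have last: "sgn1 (y (2 * n - 1) n) * sgn1 (y (2 * n + 1) (Suc n)) *
      (pattern_type y (2 * n + 1) - pattern_type y (2 * n)) = pattern_expo q n l r m"
    unfolding y1 y2 sgn1_of_int_add_half[OF q] types pattern_expo_def by simp
  have "{2..Suc n} = insert (Suc n) {2..n}" using n by auto
  then have "pattern_weight (Suc n) y x = (x ! 0) powr y 1 1 * ((x ! n) powr pattern_expo q n l r m *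
     (\<Prod>i\<in>{2..n}. (x ! (i - 1)) powr (sgn1 (y (2 * i - 3) (i - 1)) * sgn1 (y (2 * i - 1) i) *
         (pattern_type y (2 * i - 1) - pattern_type y (2 * i - 2)))))"
    using last n by (simp add: pattern_weight_def)
  also have "(\<Prod>i\<in>{2..n}. (x ! (i - 1)) powr (sgn1 (y (2 * i - 3) (i - 1)) * sgn1 (y (2 * i - 1) i) *
         (pattern_type y (2 * i - 1) - pattern_type y (2 * i - 2)))) =
     (\<Prod>i\<in>{2..n}. (x ! (i - 1)) powr (sgn1 (z (2 * i - 3) (i - 1)) * sgn1 (z (2 * i - 1) i) *
         (pattern_type z (2 * i - 1) - pattern_type z (2 * i - 2))))"
    by (intro prod.cong refl) (auto simp: old type)
  also have "y 1 1 = z 1 1" using old[of 1] n by simp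
  finally show ?thesis by (simp add: pattern_weight_def y_def)
qed

lemma upper_rows_empty:
  assumes "q \<le> 1" "j < n" "l j < 0"
  shows "upper_rows q n l = {}"
proof -
  have "l j < nabs q (l (Suc j))" using nabs_ge(2)[OF assms(1), of "l (Suc j)"] assms(3) by linarith
  then have "\<not> (nabs q (l (Suc j)) \<le> r j \<and> r j \<le> l j)" for r by linarith
  then show ?thesis using assms(2) by (auto simp: upper_rows_def tup_def)
qed

text \<open>Patterns are peeled two rows at a time. The weights match \<open>so_rec\<close> only
  after the sums are exchanged, with m fixed and r summed inside, where
  \<open>sum_kernel_powr\<close> applies.\<close>

lemma sum_pattern_weight:
  assumes q: "0 \<le> q" "q \<le> 1" and x: "\<And>i. i < Suc n \<Longrightarrow> 0 < x ! i"
  shows "(\<Sum>z\<in>patterns_of_shape (2 * n + 1) (shape q (Suc n) l). pattern_weight (Suc n) z x) =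
    (\<Prod>i<Suc n. (x ! i) powr (- of_int q / 2)) * so_rec q (Suc n) l (\<lambda>i. x ! i)"
  using x
proof (induction n arbitrary: l)
  case 0
  define z0 where "z0 = (\<lambda>(i::nat) (j::nat). if i = 1 \<and> j = 1 then of_int (l 0) + of_int q / 2 else (0::real))"
  have "patterns_of_shape 1 (shape q 1 l) = {z0}"
  proof (intro equalityI subsetI)
    fix z assume z: "z \<in> patterns_of_shape 1 (shape q 1 l)"
    have z': "\<And>i j. (i, j) \<notin> pattern_index 1 \<Longrightarrow> z i j = 0" "z 1 1 = of_int (l 0) + of_int q / 2"
      using z patterns_of_shape_iff[OF q, of 1 z l] by auto
    have "z i j = z0 i j" for i j
    proof (cases "i = 1 \<and> j = 1")
      case True
      then show ?thesis using z'(2) by (simp add: z0_def)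
    next
      case False
      then have "(i, j) \<notin> pattern_index 1" by (auto simp: pattern_index_def)
      then show ?thesis using z'(1)[of i j] False by (auto simp: z0_def)
    qed
    then show "z \<in> {z0}" by auto
  next
    fix z assume "z \<in> {z0}"
    moreover have "(1 + 1) div 2 = (1::nat)" by simp
    ultimately show "z \<in> patterns_of_shape 1 (shape q 1 l)"
      using patterns_of_shape_iff[OF q order.refl, of z0 l]
      by (auto simp: z0_def pattern_index_def parity_class_def)
  qed
  moreover have "pattern_weight 1 z0 x = (x ! 0) powr (of_int (l 0) + of_int q / 2)"
    by (simp add: pattern_weight_def z0_def)
  moreover have "\<dots> = (x ! 0) powr (- of_int q / 2) * (x ! 0) powi (l 0 + q)"
  proof -
    have eq: "(x ! 0) powi (l 0 + q) = (x ! 0) powr of_int (l 0 + q)" using 0 powr_real_of_int'[of "x ! 0" "l 0 + q"] by simp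
    show ?thesis unfolding eq powr_add[symmetric] by (simp add: field_simps)
  qed
  ultimately show ?case by simp
next
  case (Suc n)
  define k where "k = Suc n"
  have k1: "1 \<le> k" "0 < k" by (simp_all add: k_def)
  show ?case
  proof (cases "\<forall>j<k. 0 \<le> l j")
    \<comment> \<open>A negative entry before the odd end makes both sides empty: there is neither a
      pattern nor an upper row.\<close>
    case False
    then obtain j where j: "j < k" "l j < 0" by auto
    have "patterns_of_shape (Suc (2 * k)) (shape q ((2 * k + 2) div 2) l) = {}"
      by (rule patterns_empty[OF q, of _ j]) (use j k_def in auto)
    moreover have "upper_rows q k l = {}" using upper_rows_empty[of q j k l] q(2) j by simp
    ultimately show ?thesis by (simp add: k_def)
  next
    case True
    \<comment> \<open>Any bound on the entries serves as the size of the summation box.\<close>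
    obtain U where U: "\<And>j. j < k \<Longrightarrow> l j \<le> U"
      using that[of "Max (l ` {..<k})"] by auto
    have lnn: "0 \<le> l j" if "j < (2 * k + 2) div 2" "2 * k \<noteq> 2 * j" for j
      using True that by auto
    let ?W = "\<lambda>n z. pattern_weight n z x"
    let ?c = "\<lambda>n. \<Prod>i<n. (x ! i) powr (- of_int q / 2)"
    have "(\<Sum>z\<in>patterns_of_shape (Suc (2 * k)) (shape q ((2 * k + 2) div 2) l). ?W (Suc k) z) =
      (\<Sum>r\<in>next_rows q (2 * k) l. \<Sum>z\<in>patterns_of_shape (2 * k) (shape q ((2 * k + 1) div 2) r).
        ?W (Suc k) (add_row q (Suc (2 * k)) l z))"
      by (rule sum_patterns_step[OF q _ lnn]) (use k1 in auto)
    also have "\<dots> = (\<Sum>r\<in>upper_rows q k l. \<Sum>z\<in>patterns_of_shape (2 * k) (shape q k r).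
        ?W (Suc k) (add_row q (Suc (2 * k)) l z))"
      using next_rows_upper[OF q, of k l] True by simp
    also have "\<dots> = (\<Sum>r\<in>upper_rows q k l. \<Sum>m\<in>lower_rows q k r.
        (x ! k) powr pattern_expo q k l r m * (\<Sum>z\<in>patterns_of_shape (2 * n + 1) (shape q k m). ?W k z))"
    proof (rule sum.cong[OF refl])
      fix r assume r: "r \<in> upper_rows q k l"
      have rn: "0 \<le> r j" for j
      proof (cases "j < k")
        case True
        then have "nabs q (l (Suc j)) \<le> r j" using r by (auto simp: upper_rows_def tup_def)
        then show ?thesis using nabs_ge(2)[OF q(2), of "l (Suc j)"] by linarith
      qed (use r in \<open>auto simp: upper_rows_def tup_def\<close>)
      have e: "2 * k = Suc (2 * n + 1)" "k = (2 * n + 1 + 2) div 2" "k = (2 * n + 1 + 1) div 2"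
        by (simp_all add: k_def)
      have "(\<Sum>z\<in>patterns_of_shape (Suc (2 * n + 1)) (shape q ((2 * n + 1 + 2) div 2) r).
          ?W (Suc k) (add_row q (Suc (2 * k)) l z)) = (\<Sum>m\<in>next_rows q (2 * n + 1) r.
          \<Sum>z\<in>patterns_of_shape (2 * n + 1) (shape q ((2 * n + 1 + 1) div 2) m).
          ?W (Suc k) (add_row q (Suc (2 * k)) l (add_row q (Suc (2 * n + 1)) r z)))"
        by (rule sum_patterns_step[OF q _ rn]) simp
      then have "(\<Sum>z\<in>patterns_of_shape (2 * k) (shape q k r). ?W (Suc k) (add_row q (Suc (2 * k)) l z)) =
          (\<Sum>m\<in>next_rows q (2 * n + 1) r. \<Sum>z\<in>patterns_of_shape (2 * n + 1) (shape q k m).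
          ?W (Suc k) (add_row q (Suc (2 * k)) l (add_row q (2 * k) r z)))"
        unfolding e[symmetric] .
      also have "next_rows q (2 * n + 1) r = lower_rows q k r"
        unfolding k_def by (rule next_rows_lower[OF q rn])
      also have "(\<Sum>m\<in>lower_rows q k r. \<Sum>z\<in>patterns_of_shape (2 * n + 1) (shape q k m).
          ?W (Suc k) (add_row q (Suc (2 * k)) l (add_row q (2 * k) r z))) =
        (\<Sum>m\<in>lower_rows q k r. \<Sum>z\<in>patterns_of_shape (2 * n + 1) (shape q k m).
          (x ! k) powr pattern_expo q k l r m * ?W k z)"
      proof (intro sum.cong refl)
        fix m z assume "z \<in> patterns_of_shape (2 * n + 1) (shape q k m)"
        then have "z \<in> patterns_of_shape (2 * k - 1) (shape q k m)" by (simp add: k_def)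
        from pattern_weight_add_rows[OF q k1(1) this rn, where l = l and x = x]
        show "?W (Suc k) (add_row q (Suc (2 * k)) l (add_row q (2 * k) r z)) =
            (x ! k) powr pattern_expo q k l r m * ?W k z" by (simp add: mult.commute)
      qed
      finally show "(\<Sum>z\<in>patterns_of_shape (2 * k) (shape q k r). ?W (Suc k) (add_row q (Suc (2 * k)) l z)) =
        (\<Sum>m\<in>lower_rows q k r. (x ! k) powr pattern_expo q k l r m *
          (\<Sum>z\<in>patterns_of_shape (2 * n + 1) (shape q k m). ?W k z))"
        by (simp add: sum_distrib_left)
    qed
    also have "\<dots> = (\<Sum>m\<in>signed_tuples q U k. \<Sum>r\<in>kernel_rows q k l m.
        (x ! k) powr pattern_expo q k l r m * (\<Sum>z\<in>patterns_of_shape (2 * n + 1) (shape q k m). ?W k z))"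
      by (rule sum_rows_kernel_rows[OF q U])
    also have "\<dots> = (\<Sum>m\<in>signed_tuples q U k. ((x ! k) powr (- of_int q / 2) * so_kernel q k l m (x ! k)) *
        (?c k * so_rec q k m (\<lambda>i. x ! i)))"
      unfolding sum_distrib_right[symmetric]
    proof (intro sum.cong refl)
      fix m
      have "(\<Sum>z\<in>patterns_of_shape (2 * n + 1) (shape q k m). ?W k z) = ?c k * so_rec q k m (\<lambda>i. x ! i)"
        unfolding k_def by (rule Suc.IH) (use Suc.prems in simp)
      moreover have "0 < x ! k" using Suc.prems[of k] by (simp add: k_def)
      ultimately show "(\<Sum>r\<in>kernel_rows q k l m. (x ! k) powr pattern_expo q k l r m) *
          (\<Sum>z\<in>patterns_of_shape (2 * n + 1) (shape q k m). ?W k z) =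
          ((x ! k) powr (- of_int q / 2) * so_kernel q k l m (x ! k)) * (?c k * so_rec q k m (\<lambda>i. x ! i))"
        by (simp only: sum_kernel_powr[OF q _ k1(2)])
    qed
    also have "\<dots> = ?c (Suc k) * (\<Sum>m\<in>signed_tuples q U k. so_kernel q k l m (x ! k) * so_rec q k m (\<lambda>i. x ! i))"
      by (simp add: sum_distrib_left mult_ac)
    also have "(\<Sum>m\<in>signed_tuples q U k. so_kernel q k l m (x ! k) * so_rec q k m (\<lambda>i. x ! i)) =
        so_rec q (Suc k) l (\<lambda>i. x ! i)"
      using so_rec_kernel[OF q, of n l U "\<lambda>i. x ! i"] U by (simp add: k_def)
    finally show ?thesis by (simp add: k_def)
  qed
qed

corollary so_even_shape:
  assumes q: "0 \<le> q" "q \<le> 1" and x: "\<And>i. i < n \<Longrightarrow> 0 < x ! i"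
  shows "so_even n (shape q n l) x = (\<Prod>i<n. (x ! i) powr (- of_int q / 2)) * so_rec q n l (\<lambda>i. x ! i)"
  using sum_pattern_weight[OF q, of "n - 1" x l] x by (cases n) (simp_all add: so_even_def)

text \<open>Below a constant row of even height only the odd end k of the next row is free, and U -
  k is the exponent of \<alpha>. This is the shape in which one step of \<open>so_rect_split\<close>
  removes the variable \<alpha>.\<close>

lemma s_DB_rect:
  assumes q: "0 \<le> q" "q \<le> 1" and U: "0 \<le> U" and x: "\<And>i. i < Suc n \<Longrightarrow> 0 < x ! i"
  shows "s_DB (Suc n) (shape q (Suc n) (\<lambda>_. U)) x \<alpha> = (\<Prod>i<Suc n. (x ! i) powr (- of_int q / 2)) *
    (\<Sum>k\<in>{- U - q..U}. \<alpha> ^ nat (U - k) * so_rec q (Suc n) (rect_join n U (\<lambda>i. if i = 0 then k else 0)) (\<lambda>i. x ! i))"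
proof -
  define N where "N = Suc n"
  define row where "row = (\<lambda>k. rect_join n U (\<lambda>i. if i = 0 then k else (0::int)))"
  have e: "2 * N = Suc (2 * n + 1)" "N = (2 * n + 1 + 2) div 2" "N = (2 * n + 1 + 1) div 2"
    by (simp_all add: N_def)
  let ?F = "\<lambda>z. pattern_weight N z x * \<alpha> ^ nat \<lfloor>\<Sum>i\<in>{1..N}. shape q N (\<lambda>_. U) ! (i - 1) - z (2 * N - 1) i\<rfloor>"
  have rows: "lower_rows q N (\<lambda>_. U) = row ` {- U - q..U}"
  proof (intro equalityI subsetI)
    fix m assume m: "m \<in> lower_rows q N (\<lambda>_. U)"
    have "m j = row (m n) j" for j
    proof (cases "j < N")
      case True
      then have "m j \<in> (if Suc j < N then {U..U} else {- U - q..U})"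
        using m by (simp add: lower_rows_def tup_def)
      then show ?thesis using True by (auto simp: row_def rect_join_def N_def less_Suc_eq split: if_splits)
    next
      case False
      then show ?thesis using m by (auto simp: lower_rows_def tup_def row_def rect_join_def N_def)
    qed
    then have "m = row (m n)" by (rule ext)
    moreover have "m n \<in> (if Suc n < N then {U..U} else {- U - q..U})"
    proof -
      have "\<forall>j<N. m j \<in> (if Suc j < N then {U..U} else {- U - q..U})"
        using m by (simp add: lower_rows_def tup_def)
      from spec[OF this, of n] show ?thesis by (simp add: N_def)
    qed
    then have "m n \<in> {- U - q..U}" by (simp add: N_def)
    ultimately show "m \<in> row ` {- U - q..U}" by (rule image_eqI)
  next
    fix m assume "m \<in> row ` {- U - q..U}"
    then show "m \<in> lower_rows q N (\<lambda>_. U)"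
      by (auto simp: lower_rows_def tup_def row_def rect_join_def N_def)
  qed
  have inj: "inj_on row {- U - q..U}"
  proof (rule inj_onI)
    fix k k' assume "row k = row k'"
    from fun_cong[OF this, of n] show "k = k'" by (simp add: row_def rect_join_def)
  qed
  have "s_DB N (shape q N (\<lambda>_. U)) x \<alpha> =
      (\<Sum>z\<in>patterns_of_shape (Suc (2 * n + 1)) (shape q ((2 * n + 1 + 2) div 2) (\<lambda>_. U)). ?F z)"
    unfolding s_DB_def e[symmetric] ..
  also have "\<dots> = (\<Sum>m\<in>next_rows q (2 * n + 1) (\<lambda>_. U).
      \<Sum>z\<in>patterns_of_shape (2 * n + 1) (shape q ((2 * n + 1 + 1) div 2) m). ?F (add_row q (Suc (2 * n + 1)) (\<lambda>_. U) z))"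
    by (rule sum_patterns_step[OF q]) (use U in auto)
  also have "\<dots> = (\<Sum>m\<in>lower_rows q N (\<lambda>_. U). \<Sum>z\<in>patterns_of_shape (2 * n + 1) (shape q N m).
      ?F (add_row q (2 * N) (\<lambda>_. U) z))"
    unfolding e[symmetric] using next_rows_lower[OF q, of "\<lambda>_. U" n] U by (simp add: N_def)
  also have "\<dots> = (\<Sum>k\<in>{- U - q..U}. \<Sum>z\<in>patterns_of_shape (2 * n + 1) (shape q N (row k)).
      ?F (add_row q (2 * N) (\<lambda>_. U) z))"
    unfolding rows by (simp add: sum.reindex[OF inj])
  also have "\<dots> = (\<Sum>k\<in>{- U - q..U}. \<Sum>z\<in>patterns_of_shape (2 * n + 1) (shape q N (row k)).
      \<alpha> ^ nat (U - k) * pattern_weight N z x)"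
  proof (intro sum.cong refl)
    fix k z assume k: "k \<in> {- U - q..U}" and z: "z \<in> patterns_of_shape (2 * n + 1) (shape q N (row k))"
    define y where "y = add_row q (2 * N) (\<lambda>_. U) z"
    have old: "y i = z i" if "i \<le> 2 * N - 1" for i using that by (simp add: y_def add_row_def N_def)
    have "z (2 * n + 1) (Suc j) = of_int (row k j) + of_int q / 2" if "j < N" for j
      using z patterns_of_shape_iff[OF q, of "2 * n + 1" z "row k"] that by (auto simp: N_def)
    then have rowz: "y (2 * N - 1) (Suc j) = of_int (row k j) + of_int q / 2" if "j < N" for j
      using that by (simp add: old N_def)
    have "(\<Sum>i\<in>{1..N}. shape q N (\<lambda>_. U) ! (i - 1) - y (2 * N - 1) i) =
        (\<Sum>j<N. shape q N (\<lambda>_. U) ! j - y (2 * N - 1) (Suc j))"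
      by (rule sum.reindex_bij_witness[where i = Suc and j = "\<lambda>j. j - 1"]) auto
    also have "\<dots> = (\<Sum>j<N. of_int (U - row k j))"
      by (intro sum.cong refl) (simp only: lessThan_iff nth_shape rowz of_int_diff add_diff_cancel_right)
    also have "\<dots> = of_int (\<Sum>j<N. U - row k j)" by simp
    also have "(\<Sum>j<N. U - row k j) = U - k"
      by (simp add: N_def row_def rect_join_def)
    finally have expo: "\<lfloor>\<Sum>i\<in>{1..N}. shape q N (\<lambda>_. U) ! (i - 1) - y (2 * N - 1) i\<rfloor> = U - k"
      by (simp only: floor_of_int)
    have type: "pattern_type y i = pattern_type z i" if "i \<le> 2 * N - 1" for i
      using that by (simp add: pattern_type_def old)
    have "pattern_weight N y x = pattern_weight N z x"
      unfolding pattern_weight_def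
    proof (intro arg_cong2[where f = "(*)"] prod.cong refl)
      show "(x ! 0) powr y 1 1 = (x ! 0) powr z 1 1" by (simp add: old N_def)
    qed (auto simp: old type)
    then show "?F (add_row q (2 * N) (\<lambda>_. U) z) = \<alpha> ^ nat (U - k) * pattern_weight N z x"
      unfolding y_def[symmetric] expo by simp
  qed
  also have "\<dots> = (\<Sum>k\<in>{- U - q..U}. \<alpha> ^ nat (U - k) * ((\<Prod>i<N. (x ! i) powr (- of_int q / 2)) *
      so_rec q N (row k) (\<lambda>i. x ! i)))"
    unfolding sum_distrib_left[symmetric] N_def using sum_pattern_weight[OF q x] by simp
  also have "\<dots> = (\<Prod>i<N. (x ! i) powr (- of_int q / 2)) * (\<Sum>k\<in>{- U - q..U}. \<alpha> ^ nat (U - k) * so_rec q N (row k) (\<lambda>i. x ! i))"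
    by (simp add: sum_distrib_left mult_ac)
  finally show ?thesis by (simp only: N_def row_def)
qed

section \<open>Semistandard tableaux\<close>

definition diagram :: "nat \<Rightarrow> (nat \<Rightarrow> nat) \<Rightarrow> (nat \<times> nat) set" where
  "diagram n \<mu> = {(i, j). 1 \<le> i \<and> i \<le> n \<and> 1 \<le> j \<and> j \<le> \<mu> (i - 1)}"

definition tableaux :: "nat \<Rightarrow> (nat \<Rightarrow> nat) \<Rightarrow> (nat \<times> nat \<Rightarrow> nat) set" where
  "tableaux n \<mu> = {T \<in> diagram n \<mu> \<rightarrow>\<^sub>E {1..n}.
     (\<forall>i j j'. (i, j) \<in> diagram n \<mu> \<longrightarrow> (i, j') \<in> diagram n \<mu> \<longrightarrow> j < j' \<longrightarrow> T (i, j) \<le> T (i, j')) \<and>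
     (\<forall>i i' j. (i, j) \<in> diagram n \<mu> \<longrightarrow> (i', j) \<in> diagram n \<mu> \<longrightarrow> i < i' \<longrightarrow> T (i, j) < T (i', j))}"

lemma diagram_eq_Sigma: "diagram n \<mu> = (SIGMA i:{1..n}. {1..\<mu> (i - 1)})"
  by (auto simp: diagram_def)

lemma finite_diagram [simp]: "finite (diagram n \<mu>)"
  by (simp add: diagram_eq_Sigma)

lemma card_diagram: "card (diagram n \<mu>) = (\<Sum>j<n. \<mu> j)"
proof -
  have "card (diagram n \<mu>) = (\<Sum>i\<in>{1..n}. \<mu> (i - 1))"
    unfolding diagram_eq_Sigma by (subst card_SigmaI) auto
  also have "\<dots> = (\<Sum>j<n. \<mu> j)"
    by (rule sum.reindex_bij_witness[where i = Suc and j = "\<lambda>j. j - 1"]) auto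
  finally show ?thesis .
qed

lemma down_closed_eq_atLeastAtMost_card:
  fixes S :: "nat set"
  assumes "finite S" "0 \<notin> S" and down: "\<And>i j. j \<in> S \<Longrightarrow> 1 \<le> i \<Longrightarrow> i < j \<Longrightarrow> i \<in> S"
  shows "S = {1..card S}"
proof (cases "S = {}")
  case False
  have "S = {1..Max S}"
  proof (intro equalityI subsetI)
    fix i assume i: "i \<in> S"
    then have "i \<noteq> 0" using assms(2) by metis
    then show "i \<in> {1..Max S}" using Max_ge[OF assms(1) i] by simp
  next
    fix i assume i: "i \<in> {1..Max S}"
    show "i \<in> S"
    proof (cases "i = Max S")
      case True
      then show ?thesis using Max_in[OF assms(1) False] by simp
    next
      case ne: False
      then show ?thesis using down[OF Max_in[OF assms(1) False], of i] i by simp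
    qed
  qed
  moreover from arg_cong[OF this, of card] have "card S = Max S" by simp
  ultimately show ?thesis by simp
qed simp

text \<open>The shape formed by the entries up to n. Row n + 1 has none, by
  \<open>tableaux_ge_row\<close>.\<close>

definition sub_shape :: "nat \<Rightarrow> (nat \<Rightarrow> nat) \<Rightarrow> (nat \<times> nat \<Rightarrow> nat) \<Rightarrow> nat \<Rightarrow> nat" where
  "sub_shape n \<mu> T = (\<lambda>j. if j < n then card {k \<in> {1..\<mu> j}. T (Suc j, k) \<le> n} else 0)"

definition extend_tableau :: "nat \<Rightarrow> (nat \<Rightarrow> nat) \<Rightarrow> (nat \<Rightarrow> nat) \<Rightarrow> (nat \<times> nat \<Rightarrow> nat) \<Rightarrow> nat \<times> nat \<Rightarrow> nat" where
  "extend_tableau n \<mu> \<nu> T = (\<lambda>c. if c \<in> diagram n \<nu> then T c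
     else if c \<in> diagram (Suc n) \<mu> then Suc n else undefined)"

lemma tableaux_ge_row:
  assumes T: "T \<in> tableaux n \<mu>" and dec: "\<And>j. Suc j < n \<Longrightarrow> \<mu> (Suc j) \<le> \<mu> j"
  shows "(Suc i, j) \<in> diagram n \<mu> \<Longrightarrow> Suc i \<le> T (Suc i, j)"
proof (induction i)
  case 0
  have "T \<in> diagram n \<mu> \<rightarrow>\<^sub>E {1..n}" using T by (simp add: tableaux_def)
  from PiE_mem[OF this 0] show ?case by simp
next
  case (Suc i)
  have "\<mu> (Suc i) \<le> \<mu> i" using Suc.prems by (intro dec) (simp add: diagram_def)
  then have i: "(Suc i, j) \<in> diagram n \<mu>" using Suc.prems by (simp add: diagram_def)
  moreover have "T (Suc i, j) < T (Suc (Suc i), j)"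
    using T i Suc.prems unfolding tableaux_def by blast
  ultimately show ?case using Suc.IH by linarith
qed

text \<open>Rows increase weakly, so the entries up to n form an initial segment of each row,
  determined by its length.\<close>

lemma sub_shape_iff:
  assumes T: "T \<in> tableaux (Suc n) \<mu>" and dec: "\<And>j. Suc j < Suc n \<Longrightarrow> \<mu> (Suc j) \<le> \<mu> j"
    and c: "(i, j) \<in> diagram (Suc n) \<mu>"
  shows "T (i, j) \<le> n \<longleftrightarrow> (i, j) \<in> diagram n (sub_shape n \<mu> T)"
proof (cases "i \<le> n")
  case True
  define r where "r = i - 1"
  have r: "i = Suc r" "r < n" using c True by (auto simp: diagram_def r_def)
  define S where "S = {k \<in> {1..\<mu> r}. T (Suc r, k) \<le> n}"
  have "S = {1..card S}"
  proof (rule down_closed_eq_atLeastAtMost_card)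
    fix a b assume ab: "b \<in> S" "1 \<le> a" "a < b"
    then have "(Suc r, a) \<in> diagram (Suc n) \<mu>" "(Suc r, b) \<in> diagram (Suc n) \<mu>"
      using r by (auto simp: S_def diagram_def)
    then have "T (Suc r, a) \<le> T (Suc r, b)"
      using T ab(3) unfolding tableaux_def by blast
    then show "a \<in> S" using ab by (simp add: S_def)
  qed (auto simp: S_def)
  then have "j \<in> S \<longleftrightarrow> j \<in> {1..card S}" by (rule arg_cong[where f = "\<lambda>X. j \<in> X"])
  moreover have "card S = sub_shape n \<mu> T r" using r by (simp add: S_def sub_shape_def)
  ultimately have "j \<in> S \<longleftrightarrow> 1 \<le> j \<and> j \<le> sub_shape n \<mu> T r" by simp
  moreover have "j \<in> S \<longleftrightarrow> T (i, j) \<le> n" using c r by (simp add: S_def diagram_def)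
  ultimately show ?thesis using r by (simp add: diagram_def)
next
  case False
  then have i: "i = Suc n" using c by (simp add: diagram_def)
  then show ?thesis using tableaux_ge_row[OF T dec, of n j] c by (auto simp: diagram_def)
qed

lemma sub_shape_mem:
  assumes T: "T \<in> tableaux (Suc n) \<mu>" and dec: "\<And>j. Suc j < Suc n \<Longrightarrow> \<mu> (Suc j) \<le> \<mu> j"
  shows "sub_shape n \<mu> T \<in> tup n (\<lambda>j. {\<mu> (Suc j)..\<mu> j})"
proof -
  have le: "sub_shape n \<mu> T j \<le> \<mu> j" for j
  proof -
    have "card {k \<in> {1..\<mu> j}. T (Suc j, k) \<le> n} \<le> card {1..\<mu> j}" by (rule card_mono) auto
    then show ?thesis by (simp add: sub_shape_def)
  qed
  have ge: "\<mu> (Suc j) \<le> sub_shape n \<mu> T j" if j: "j < n" for j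
  proof (cases "\<mu> (Suc j) = 0")
    case False
    have "\<mu> (Suc j) \<le> \<mu> j" using j by (intro dec) simp
    then have c: "(Suc (Suc j), \<mu> (Suc j)) \<in> diagram (Suc n) \<mu>" "(Suc j, \<mu> (Suc j)) \<in> diagram (Suc n) \<mu>"
      using False j by (auto simp: diagram_def)
    then have "T (Suc j, \<mu> (Suc j)) < T (Suc (Suc j), \<mu> (Suc j))"
      using T unfolding tableaux_def by blast
    moreover have "T (Suc (Suc j), \<mu> (Suc j)) \<le> Suc n"
    proof -
      have "T \<in> diagram (Suc n) \<mu> \<rightarrow>\<^sub>E {1..Suc n}" using T by (simp add: tableaux_def)
      from PiE_mem[OF this c(1)] show ?thesis by simp
    qed
    ultimately have "(Suc j, \<mu> (Suc j)) \<in> diagram n (sub_shape n \<mu> T)"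
      using sub_shape_iff[OF T dec c(2)] by simp
    then show ?thesis by (simp add: diagram_def)
  qed simp
  have "sub_shape n \<mu> T j = 0" if "n \<le> j" for j using that by (simp add: sub_shape_def)
  then show ?thesis using le ge by (simp add: tup_def)
qed

lemma diagram_subset:
  assumes "\<nu> \<in> tup n (\<lambda>j. {\<mu> (Suc j)..\<mu> j})"
  shows "diagram n \<nu> \<subseteq> diagram (Suc n) \<mu>"
proof
  fix c assume "c \<in> diagram n \<nu>"
  then obtain i j where c: "c = (i, j)" "1 \<le> i" "i \<le> n" "1 \<le> j" "j \<le> \<nu> (i - 1)" by (auto simp: diagram_def)
  then have "\<nu> (i - 1) \<le> \<mu> (i - 1)" using assms by (simp add: tup_def)
  then show "c \<in> diagram (Suc n) \<mu>" using c by (simp add: diagram_def)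
qed

lemma restrict_tableau:
  assumes T: "T \<in> tableaux (Suc n) \<mu>" and dec: "\<And>j. Suc j < Suc n \<Longrightarrow> \<mu> (Suc j) \<le> \<mu> j"
  defines "\<nu> \<equiv> sub_shape n \<mu> T"
  shows "restrict T (diagram n \<nu>) \<in> tableaux n \<nu>" and "extend_tableau n \<mu> \<nu> (restrict T (diagram n \<nu>)) = T"
proof -
  have T': "T \<in> diagram (Suc n) \<mu> \<rightarrow>\<^sub>E {1..Suc n}" using T by (simp add: tableaux_def)
  have sub: "c \<in> diagram n \<nu> \<Longrightarrow> c \<in> diagram (Suc n) \<mu>" for c
    using diagram_subset[OF sub_shape_mem[OF T dec]] by (auto simp: \<nu>_def)
  have iff: "T c \<le> n \<longleftrightarrow> c \<in> diagram n \<nu>" if "c \<in> diagram (Suc n) \<mu>" for c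
    using sub_shape_iff[OF T dec, of "fst c" "snd c"] that by (simp add: \<nu>_def)
  show "restrict T (diagram n \<nu>) \<in> tableaux n \<nu>"
    unfolding tableaux_def mem_Collect_eq
  proof (intro conjI allI impI)
    show "restrict T (diagram n \<nu>) \<in> diagram n \<nu> \<rightarrow>\<^sub>E {1..n}"
    proof (rule restrict_PiE_iff[THEN iffD2], rule ballI)
      fix c assume c: "c \<in> diagram n \<nu>"
      then show "T c \<in> {1..n}" using PiE_mem[OF T' sub[OF c]] iff[OF sub[OF c]] by simp
    qed
  next
    fix i j j' assume c: "(i, j) \<in> diagram n \<nu>" "(i, j') \<in> diagram n \<nu>" "j < j'"
    then have "T (i, j) \<le> T (i, j')" using T sub[OF c(1)] sub[OF c(2)] unfolding tableaux_def by blast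
    then show "restrict T (diagram n \<nu>) (i, j) \<le> restrict T (diagram n \<nu>) (i, j')" using c by simp
  next
    fix i i' j assume c: "(i, j) \<in> diagram n \<nu>" "(i', j) \<in> diagram n \<nu>" "i < i'"
    then have "T (i, j) < T (i', j)" using T sub[OF c(1)] sub[OF c(2)] unfolding tableaux_def by blast
    then show "restrict T (diagram n \<nu>) (i, j) < restrict T (diagram n \<nu>) (i', j)" using c by simp
  qed
  show "extend_tableau n \<mu> \<nu> (restrict T (diagram n \<nu>)) = T"
  proof
    fix c
    consider "c \<in> diagram n \<nu>" | "c \<notin> diagram n \<nu>" "c \<in> diagram (Suc n) \<mu>" | "c \<notin> diagram (Suc n) \<mu>"
      by blast
    then show "extend_tableau n \<mu> \<nu> (restrict T (diagram n \<nu>)) c = T c"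
    proof cases
      case 2
      then have "T c = Suc n" using PiE_mem[OF T' 2(2)] iff[OF 2(2)] by simp
      then show ?thesis using 2 by (simp add: extend_tableau_def)
    next
      case 3
      then have "c \<notin> diagram n \<nu>" using sub by blast
      then show ?thesis using 3 PiE_arb[OF T' 3] by (simp add: extend_tableau_def)
    qed (simp add: extend_tableau_def)
  qed
qed

lemma extend_tableau_mem:
  assumes T: "T \<in> tableaux n \<nu>" and \<nu>: "\<nu> \<in> tup n (\<lambda>j. {\<mu> (Suc j)..\<mu> j})"
    and dec: "\<And>j. Suc j < Suc n \<Longrightarrow> \<mu> (Suc j) \<le> \<mu> j"
  shows "extend_tableau n \<mu> \<nu> T \<in> tableaux (Suc n) \<mu>"
    and "sub_shape n \<mu> (extend_tableau n \<mu> \<nu> T) = \<nu>"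
    and "restrict (extend_tableau n \<mu> \<nu> T) (diagram n \<nu>) = T"
proof -
  have T': "T \<in> diagram n \<nu> \<rightarrow>\<^sub>E {1..n}" using T by (simp add: tableaux_def)
  have Tle: "1 \<le> T c \<and> T c \<le> n" if "c \<in> diagram n \<nu>" for c using PiE_mem[OF T' that] by simp
  have sub: "c \<in> diagram n \<nu> \<Longrightarrow> c \<in> diagram (Suc n) \<mu>" for c
    using diagram_subset[where \<mu> = \<mu>, OF \<nu>] by blast
  have lo: "\<mu> (Suc j) \<le> \<nu> j" and hi: "\<nu> j \<le> \<mu> j" if "j < n" for j
    using \<nu> that by (auto simp: tup_def)
  have anti: "\<mu> b \<le> \<mu> a" if "a \<le> b" "b \<le> n" for a b
    using that
  proof (induction b rule: dec_induct)
    case (step b)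
    then show ?case using dec[of b] by simp
  qed simp
  let ?E = "extend_tableau n \<mu> \<nu> T"
  have in_E: "?E c = T c" if "c \<in> diagram n \<nu>" for c using that by (simp add: extend_tableau_def)
  have out_E: "?E c = Suc n" if "c \<notin> diagram n \<nu>" "c \<in> diagram (Suc n) \<mu>" for c
    using that by (simp add: extend_tableau_def)
  have E_le: "1 \<le> ?E c \<and> ?E c \<le> Suc n" if "c \<in> diagram (Suc n) \<mu>" for c
    using that Tle[of c] by (auto simp: extend_tableau_def)
  show "?E \<in> tableaux (Suc n) \<mu>"
    unfolding tableaux_def mem_Collect_eq
  proof (intro conjI allI impI)
    show "?E \<in> diagram (Suc n) \<mu> \<rightarrow>\<^sub>E {1..Suc n}"
    proof (rule PiE_I)
      fix c assume "c \<in> diagram (Suc n) \<mu>"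
      then show "?E c \<in> {1..Suc n}" using E_le by simp
    next
      fix c assume c: "c \<notin> diagram (Suc n) \<mu>"
      then have "c \<notin> diagram n \<nu>" using sub by blast
      then show "?E c = undefined" using c by (simp add: extend_tableau_def)
    qed
  next
    fix i j j' assume c: "(i, j) \<in> diagram (Suc n) \<mu>" "(i, j') \<in> diagram (Suc n) \<mu>" "j < j'"
    show "?E (i, j) \<le> ?E (i, j')"
    proof (cases "(i, j') \<in> diagram n \<nu>")
      case True
      then have "(i, j) \<in> diagram n \<nu>" using c by (auto simp: diagram_def)
      moreover from this have "T (i, j) \<le> T (i, j')" using T True c(3) unfolding tableaux_def by blast
      ultimately show ?thesis using in_E True by simp
    next
      case False
      then show ?thesis using out_E[OF False c(2)] E_le[OF c(1)] by simp
    qed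
  next
    fix i i' j assume c: "(i, j) \<in> diagram (Suc n) \<mu>" "(i', j) \<in> diagram (Suc n) \<mu>" "i < i'"
    \<comment> \<open>The cells added to \<nu> form a horizontal strip: a cell with another one
      below it already belongs to \<nu>.\<close>
    have "j \<le> \<mu> (i' - 1)" "i \<le> n" "1 \<le> i" "i' \<le> Suc n" "1 \<le> j" using c by (auto simp: diagram_def)
    moreover have "\<mu> (i' - 1) \<le> \<mu> i" using anti[of i "i' - 1"] c(3) \<open>i' \<le> Suc n\<close> by simp
    moreover have "\<mu> i \<le> \<nu> (i - 1)" using lo[of "i - 1"] \<open>i \<le> n\<close> \<open>1 \<le> i\<close> by simp
    ultimately have ij: "(i, j) \<in> diagram n \<nu>" by (simp add: diagram_def)
    show "?E (i, j) < ?E (i', j)"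
    proof (cases "(i', j) \<in> diagram n \<nu>")
      case True
      have "T (i, j) < T (i', j)" using T True ij c(3) unfolding tableaux_def by blast
      then show ?thesis using in_E[OF True] in_E[OF ij] by simp
    next
      case False
      then show ?thesis using out_E[OF False c(2)] in_E[OF ij] Tle[OF ij] by simp
    qed
  qed
  show "sub_shape n \<mu> ?E = \<nu>"
  proof
    fix j
    show "sub_shape n \<mu> ?E j = \<nu> j"
    proof (cases "j < n")
      case True
      have "?E (Suc j, k) \<le> n \<longleftrightarrow> k \<le> \<nu> j" if "k \<in> {1..\<mu> j}" for k
      proof -
        have "(Suc j, k) \<in> diagram (Suc n) \<mu>" using that True by (simp add: diagram_def)
        moreover have "(Suc j, k) \<in> diagram n \<nu> \<longleftrightarrow> k \<le> \<nu> j" using that True by (simp add: diagram_def)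
        ultimately show ?thesis using in_E[of "(Suc j, k)"] Tle[of "(Suc j, k)"] out_E[of "(Suc j, k)"]
          by (cases "k \<le> \<nu> j") auto
      qed
      then have "{k \<in> {1..\<mu> j}. ?E (Suc j, k) \<le> n} = {1..\<nu> j}"
        using hi[OF True] by auto
      then show ?thesis using True by (simp add: sub_shape_def)
    next
      case False
      then show ?thesis using \<nu> by (simp add: sub_shape_def tup_def)
    qed
  qed
  show "restrict ?E (diagram n \<nu>) = T"
  proof
    fix c show "restrict ?E (diagram n \<nu>) c = T c"
      using PiE_arb[OF T', of c] in_E[of c] by (cases "c \<in> diagram n \<nu>") auto
  qed
qed

lemma finite_tableaux: "finite (tableaux n \<mu>)"
  unfolding tableaux_def by (rule finite_subset[OF Collect_restrict finite_PiE]) auto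

text \<open>Deleting all entries n + 1 from a tableau is the branching step of
  \<open>gts\<close>.\<close>

lemma sum_tableaux_eq_gts:
  assumes "\<And>j. Suc j < n \<Longrightarrow> \<mu> (Suc j) \<le> \<mu> j"
  shows "(\<Sum>T\<in>tableaux n \<mu>. \<Prod>c\<in>diagram n \<mu>. x (T c - 1)) = gts n \<mu> x"
  using assms
proof (induction n arbitrary: \<mu>)
  case 0
  have "diagram 0 \<mu> = {}" by (auto simp: diagram_def)
  then show ?case by (simp add: tableaux_def)
next
  case (Suc n)
  let ?N = "tup n (\<lambda>j. {\<mu> (Suc j)..\<mu> j})"
  let ?E = "extend_tableau n \<mu>"
  have fin: "finite ?N" by (intro finite_tup) simp
  have "(\<Sum>T\<in>tableaux (Suc n) \<mu>. \<Prod>c\<in>diagram (Suc n) \<mu>. x (T c - 1)) =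
      (\<Sum>(\<nu>, T)\<in>(SIGMA \<nu>:?N. tableaux n \<nu>). \<Prod>c\<in>diagram (Suc n) \<mu>. x (?E \<nu> T c - 1))"
  proof (rule sum.reindex_bij_witness[where i = "\<lambda>(\<nu>, T). ?E \<nu> T" and
        j = "\<lambda>T. (sub_shape n \<mu> T, restrict T (diagram n (sub_shape n \<mu> T)))"], goal_cases)
    case (1 T)
    from restrict_tableau(2)[OF 1 Suc.prems] show ?case by simp
  next
    case (2 T)
    from restrict_tableau(1)[OF 2 Suc.prems] sub_shape_mem[OF 2 Suc.prems] show ?case by simp
  next
    case (3 c)
    then obtain \<nu> T where c: "c = (\<nu>, T)" "\<nu> \<in> ?N" "T \<in> tableaux n \<nu>" by auto
    from extend_tableau_mem(2,3)[where \<mu> = \<mu>, OF c(3,2) Suc.prems] show ?case by (simp add: c(1))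
  next
    case (4 c)
    then obtain \<nu> T where c: "c = (\<nu>, T)" "\<nu> \<in> ?N" "T \<in> tableaux n \<nu>" by auto
    from extend_tableau_mem(1)[where \<mu> = \<mu>, OF c(3,2) Suc.prems] show ?case by (simp add: c(1))
  next
    case (5 T)
    from restrict_tableau(2)[OF 5 Suc.prems] show ?case by simp
  qed
  also have "\<dots> = (\<Sum>\<nu>\<in>?N. \<Sum>T\<in>tableaux n \<nu>. \<Prod>c\<in>diagram (Suc n) \<mu>. x (?E \<nu> T c - 1))"
    by (intro sum.Sigma[symmetric] ballI fin finite_tableaux)
  also have "\<dots> = (\<Sum>\<nu>\<in>?N. x n ^ ((\<Sum>j<Suc n. \<mu> j) - (\<Sum>j<n. \<nu> j)) * gts n \<nu> x)"
  proof (rule sum.cong[OF refl])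
    fix \<nu> assume \<nu>: "\<nu> \<in> ?N"
    have sub: "diagram n \<nu> \<subseteq> diagram (Suc n) \<mu>" by (rule diagram_subset[where \<mu> = \<mu>, OF \<nu>])
    have card: "card (diagram (Suc n) \<mu> - diagram n \<nu>) = (\<Sum>j<Suc n. \<mu> j) - (\<Sum>j<n. \<nu> j)"
      by (simp only: card_Diff_subset[OF finite_diagram sub] card_diagram)
    have dec: "\<nu> (Suc j) \<le> \<nu> j" if "Suc j < n" for j
    proof -
      have "\<nu> (Suc j) \<le> \<mu> (Suc j)" "\<mu> (Suc j) \<le> \<nu> j" using \<nu> that by (simp_all add: tup_def)
      then show ?thesis by simp
    qed
    have "(\<Prod>c\<in>diagram (Suc n) \<mu>. x (?E \<nu> T c - 1)) =
        x n ^ ((\<Sum>j<Suc n. \<mu> j) - (\<Sum>j<n. \<nu> j)) * (\<Prod>c\<in>diagram n \<nu>. x (T c - 1))" for T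
    proof -
      have "(\<Prod>c\<in>diagram (Suc n) \<mu>. x (?E \<nu> T c - 1)) =
          (\<Prod>c\<in>diagram (Suc n) \<mu> - diagram n \<nu>. x (?E \<nu> T c - 1)) * (\<Prod>c\<in>diagram n \<nu>. x (?E \<nu> T c - 1))"
        by (rule prod.subset_diff[OF sub finite_diagram])
      also have "(\<Prod>c\<in>diagram (Suc n) \<mu> - diagram n \<nu>. x (?E \<nu> T c - 1)) =
          (\<Prod>c\<in>diagram (Suc n) \<mu> - diagram n \<nu>. x n)"
        by (intro prod.cong) (auto simp: extend_tableau_def)
      also have "(\<Prod>c\<in>diagram n \<nu>. x (?E \<nu> T c - 1)) = (\<Prod>c\<in>diagram n \<nu>. x (T c - 1))"
        by (intro prod.cong) (auto simp: extend_tableau_def)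
      finally show ?thesis by (simp only: prod_constant card)
    qed
    then show "(\<Sum>T\<in>tableaux n \<nu>. \<Prod>c\<in>diagram (Suc n) \<mu>. x (?E \<nu> T c - 1)) =
        x n ^ ((\<Sum>j<Suc n. \<mu> j) - (\<Sum>j<n. \<nu> j)) * gts n \<nu> x"
      using Suc.IH[where \<mu> = \<nu>, OF dec] by (simp only: sum_distrib_left[symmetric])
  qed
  finally show ?case by simp
qed

corollary schur_eq_gts:
  assumes "length mu = n" "sorted_wrt (\<ge>) mu"
  shows "schur n mu x = gts n (\<lambda>j. if j < n then mu ! j else 0) (\<lambda>i. x ! i)"
proof -
  let ?\<mu> = "\<lambda>j. if j < n then mu ! j else 0"
  have "young_diagram mu = diagram n ?\<mu>"
    using assms(1) by (auto simp: young_diagram_def diagram_def split: if_splits)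
  moreover from this have "ssyt n mu = tableaux n ?\<mu>"
    by (simp add: ssyt_def tableaux_def)
  moreover have "?\<mu> (Suc j) \<le> ?\<mu> j" if "Suc j < n" for j
    using sorted_wrt_nth_less[OF assms(2), of j "Suc j"] that assms(1) by simp
  ultimately show ?thesis
    unfolding schur_def using sum_tableaux_eq_gts[of n ?\<mu> "\<lambda>i. x ! i"] by simp
qed

section \<open>Last passage percolation\<close>

text \<open>Index 0 is a boundary of zeros around the array, which starts at 1.\<close>

fun lpp :: "(nat \<Rightarrow> nat \<Rightarrow> nat) \<Rightarrow> nat \<Rightarrow> nat \<Rightarrow> nat" where
  "lpp w 0 b = 0"
| "lpp w (Suc a) 0 = 0"
| "lpp w (Suc a) (Suc b) = max (lpp w a (Suc b)) (lpp w (Suc a) b) + w (Suc a) (Suc b)"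

lemma lpp_0_right [simp]: "lpp w a 0 = 0"
  by (cases a) auto

lemma lpp_mono: "a \<le> a' \<Longrightarrow> b \<le> b' \<Longrightarrow> lpp w a b \<le> lpp w a' b'"
proof -
  have 1: "lpp w a b \<le> lpp w (Suc a) b" for a b by (cases b) auto
  have 2: "lpp w a b \<le> lpp w a (Suc b)" for a b by (cases a) auto
  assume "a \<le> a'" "b \<le> b'"
  have "lpp w a b \<le> lpp w a' b"
    by (rule lift_Suc_mono_le[where f = "\<lambda>a. lpp w a b", OF 1 \<open>a \<le> a'\<close>])
  also have "\<dots> \<le> lpp w a' b'"
    by (rule lift_Suc_mono_le[where f = "\<lambda>b. lpp w a' b", OF 2 \<open>b \<le> b'\<close>])
  finally show ?thesis .
qed

lemma lpp_sym:
  assumes "\<And>i j. 1 \<le> i \<Longrightarrow> i \<le> N \<Longrightarrow> 1 \<le> j \<Longrightarrow> j \<le> N \<Longrightarrow> w i j = w j i"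
  shows "a \<le> N \<Longrightarrow> b \<le> N \<Longrightarrow> lpp w a b = lpp w b a"
proof (induction "a + b" arbitrary: a b rule: less_induct)
  case less
  show ?case
  proof (cases "a = 0 \<or> b = 0")
    case False
    then obtain a' b' where ab: "a = Suc a'" "b = Suc b'" by (cases a; cases b) auto
    have "lpp w a' b = lpp w b a'" "lpp w a b' = lpp w b' a"
      using less by (auto simp: ab intro!: less.hyps)
    moreover have "w a b = w b a" using less.prems ab by (intro assms) auto
    ultimately show ?thesis by (simp add: ab max.commute)
  qed auto
qed

lemma path_weight_le_lpp:
  "\<pi> \<in> directed_paths m n \<Longrightarrow> 1 \<le> m \<and> 1 \<le> n \<and> (\<Sum>(i, j)\<leftarrow>\<pi>. w i j) \<le> lpp w m n"
proof (induction \<pi> arbitrary: m n rule: rev_induct)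
  case Nil
  then show ?case by (simp add: directed_paths_def)
next
  case (snoc c xs)
  have c: "c = (m, n)" using snoc.prems by (simp add: directed_paths_def)
  show ?case
  proof (cases "xs = []")
    case True
    then have "m = 1" "n = 1" using snoc.prems c by (auto simp: directed_paths_def)
    then show ?thesis using True c by simp
  next
    case False
    obtain a b where ab: "last xs = (a, b)" by (cases "last xs")
    have xs: "xs \<in> directed_paths a b" and step: "(m, n) = (a + 1, b) \<or> (m, n) = (a, b + 1)"
      using snoc.prems False ab c by (auto simp: directed_paths_def successively_append_iff)
    note IH = snoc.IH[OF xs]
    then obtain a' b' where ab': "a = Suc a'" "b = Suc b'" by (cases a; cases b) auto
    from step IH show ?thesis by (auto simp: c ab')
  qed
qed

lemma path_snoc:
  assumes "\<pi> \<in> directed_paths a b" "(m, n) = (a + 1, b) \<or> (m, n) = (a, b + 1)"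
  shows "\<pi> @ [(m, n)] \<in> directed_paths m n"
  using assms by (auto simp: directed_paths_def successively_append_iff)

lemma lpp_attained: "\<exists>\<pi>\<in>directed_paths (Suc a) (Suc b). (\<Sum>(i, j)\<leftarrow>\<pi>. w i j) = lpp w (Suc a) (Suc b)"
proof (induction "a + b" arbitrary: a b)
  case 0
  then have "[(1, 1)] \<in> directed_paths (Suc a) (Suc b)" by (simp add: directed_paths_def)
  then show ?case using 0 by (intro bexI[of _ "[(1, 1)]"]) auto
next
  case (Suc k)
  \<comment> \<open>No path passes through the zero boundary, so along an edge of the array the
    predecessor is forced and the comparison of values must not decide.\<close>
  show ?case
  proof (cases "0 < a \<and> (b = 0 \<or> lpp w (Suc a) b \<le> lpp w a (Suc b))")
    case True
    then obtain a' where a': "a = Suc a'" by (cases a) auto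
    with Suc.hyps(2) have "k = a' + b" by simp
    from Suc.hyps(1)[OF this] obtain \<pi> where \<pi>: "\<pi> \<in> directed_paths a (Suc b)" "(\<Sum>(i, j)\<leftarrow>\<pi>. w i j) = lpp w a (Suc b)"
      unfolding a' by blast
    show ?thesis
    proof (rule bexI)
      show "\<pi> @ [(Suc a, Suc b)] \<in> directed_paths (Suc a) (Suc b)" by (rule path_snoc[OF \<pi>(1)]) simp
      show "(\<Sum>(i, j)\<leftarrow>\<pi> @ [(Suc a, Suc b)]. w i j) = lpp w (Suc a) (Suc b)" using \<pi>(2) True by auto
    qed
  next
    case False
    then have "0 < b" using Suc.hyps(2) by (cases b) auto
    then obtain b' where b': "b = Suc b'" by (cases b) auto
    with Suc.hyps(2) have "k = a + b'" by simp
    from Suc.hyps(1)[OF this] obtain \<pi> where \<pi>: "\<pi> \<in> directed_paths (Suc a) b" "(\<Sum>(i, j)\<leftarrow>\<pi>. w i j) = lpp w (Suc a) b"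
      unfolding b' by blast
    have "lpp w a (Suc b) \<le> lpp w (Suc a) b" using False b' by (cases a) auto
    then show ?thesis
      using \<pi> path_snoc[OF \<pi>(1), of "Suc a" "Suc b"] by (intro bexI[of _ "\<pi> @ [(Suc a, Suc b)]"]) auto
  qed
qed

text \<open>The maximum exists because the path weights are natural numbers bounded by
  \<open>lpp\<close>.\<close>

lemma last_passage_eq_lpp: "last_passage w (Suc a) (Suc b) = lpp w (Suc a) (Suc b)"
  unfolding last_passage_def
proof (rule Max_eqI)
  let ?S = "(\<lambda>\<pi>. \<Sum>(i, j)\<leftarrow>\<pi>. w i j) ` directed_paths (Suc a) (Suc b)"
  show le: "y \<le> lpp w (Suc a) (Suc b)" if "y \<in> ?S" for y
    using that path_weight_le_lpp[of _ "Suc a" "Suc b" w] by auto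
  then have "?S \<subseteq> {..lpp w (Suc a) (Suc b)}" by (intro subsetI) simp
  then show "finite ?S" by (rule finite_subset) simp
  obtain \<pi> where "\<pi> \<in> directed_paths (Suc a) (Suc b)" "(\<Sum>(i, j)\<leftarrow>\<pi>. w i j) = lpp w (Suc a) (Suc b)"
    using lpp_attained[of a b w] by blast
  then show "lpp w (Suc a) (Suc b) \<in> ?S" by (intro image_eqI[of _ _ \<pi>]) auto
qed

section \<open>From paths to the passage times of growth diagrams\<close>

lemma row_passage_above: "k < j \<Longrightarrow> row_passage r v k j = v j"
  by (induction k) auto

lemma row_passage_below: "j \<le> k \<Longrightarrow> row_passage r v k j = row_passage r v j j"
  by (induction k rule: dec_induct) auto

lemma passage_above: "N < j \<Longrightarrow> passage w N j = 0"
proof (induction N arbitrary: j)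
  case (Suc N)
  then obtain i where i: "j = Suc i" by (cases j) auto
  have "passage w (Suc N) j = shift (passage w N) j"
    using Suc.prems by (simp add: row_passage_above del: row_passage.simps)
  then show ?case using Suc i by simp
qed simp

lemma partial_passage_eq_lpp:
  assumes sym: "\<And>i j. 1 \<le> i \<Longrightarrow> i \<le> Suc n \<Longrightarrow> 1 \<le> j \<Longrightarrow> j \<le> Suc n \<Longrightarrow> w i j = w j i"
    and v: "\<And>i j. i \<le> n \<Longrightarrow> j \<le> i \<Longrightarrow> v i j = w (Suc i) (Suc j)"
  shows "i \<le> n \<Longrightarrow> j \<le> i \<Longrightarrow> partial_passage v i (Suc j) (Suc j) = lpp w (Suc i) (Suc j)"
proof (induction "i + j" arbitrary: i j rule: less_induct)
  case less
  have left: "partial_passage v i j j = lpp w (Suc i) j"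
  proof (cases j)
    case 0
    then show ?thesis by (simp add: partial_passage_def)
  next
    case (Suc j')
    then show ?thesis using less.hyps[of i j'] less.prems by simp
  qed
  have "partial_passage v i j (j + 2) = passage v i (Suc j)"
    by (simp add: partial_passage_def row_passage_above)
  also have "max (lpp w (Suc i) j) \<dots> = max (lpp w (Suc i) j) (lpp w i (Suc j))"
  proof (cases "j = i")
    \<comment> \<open>The upper predecessor is missing from the triangle and reads 0; by
      \<open>lpp_sym\<close> its true value is that of the left one, so the maximum does not
      change.\<close>
    case True
    have "lpp w (Suc i) j = lpp w i (Suc j)"
      unfolding True by (rule lpp_sym[of "Suc n", OF sym]) (use less.prems in auto)
    then show ?thesis using passage_above[of i "Suc j" v] True by simp
  next
    case False
    then obtain i' where i': "i = Suc i'" "j \<le> i'" using less.prems by (cases i) auto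
    have "passage v i (Suc j) = partial_passage v i' (Suc j) (Suc j)"
      unfolding i' partial_passage_def passage.simps using i' by (intro row_passage_below) simp
    also have "\<dots> = lpp w i (Suc j)" using less.hyps[of i' j] less.prems i' by simp
    finally show ?thesis by simp
  qed
  finally show ?case
    unfolding partial_passage_Suc using left v[OF less.prems] by (simp add: max.commute)
qed

text \<open>Passage times are monotone, so the last cell bounds all the others.\<close>

lemma mem_arrays_iff:
  assumes sym: "\<And>i j. 1 \<le> i \<Longrightarrow> i \<le> Suc n \<Longrightarrow> 1 \<le> j \<Longrightarrow> j \<le> Suc n \<Longrightarrow> w i j = w j i"
  shows "(\<lambda>i j. if (i, j) \<in> cells n (Suc n) then w (Suc i) (Suc j) else 0) \<in> arrays m n (Suc n) \<longleftrightarrow>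
    last_passage w (Suc n) (Suc n) \<le> m"
proof -
  let ?v = "\<lambda>i j. if (i, j) \<in> cells n (Suc n) then w (Suc i) (Suc j) else 0"
  have cells: "(i, j) \<in> cells n (Suc n) \<longleftrightarrow> i \<le> n \<and> j \<le> i" for i j by (auto simp: cells_def)
  have pp: "partial_passage ?v i (Suc j) (Suc j) = lpp w (Suc i) (Suc j)" if "i \<le> n" "j \<le> i" for i j
    by (rule partial_passage_eq_lpp[OF sym _ that]) (auto simp: cells)
  have "?v \<in> arrays m n (Suc n) \<longleftrightarrow> (\<forall>i j. i \<le> n \<longrightarrow> j \<le> i \<longrightarrow> lpp w (Suc i) (Suc j) \<le> m)"
  proof -
    have "(\<forall>(i, j)\<in>cells n (Suc n). P i j) \<longleftrightarrow> (\<forall>i j. i \<le> n \<longrightarrow> j \<le> i \<longrightarrow> P i j)" for P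
      using cells by (fastforce simp: Ball_def)
    then show ?thesis unfolding arrays_def mem_Collect_eq using pp by auto
  qed
  also have "\<dots> \<longleftrightarrow> lpp w (Suc n) (Suc n) \<le> m"
  proof
    assume *: "lpp w (Suc n) (Suc n) \<le> m"
    show "\<forall>i j. i \<le> n \<longrightarrow> j \<le> i \<longrightarrow> lpp w (Suc i) (Suc j) \<le> m"
    proof (intro allI impI)
      fix i j assume "i \<le> n" "j \<le> i"
      then have "lpp w (Suc i) (Suc j) \<le> lpp w (Suc n) (Suc n)" by (intro lpp_mono) auto
      then show "lpp w (Suc i) (Suc j) \<le> m" using * by simp
    qed
  qed simp
  finally show ?thesis unfolding last_passage_eq_lpp .
qed

lemma c_const_eq_prod:
  "c_const (Suc n) p \<alpha> = (\<Prod>c\<in>cells n (Suc n). 1 / (1 - cell_param (\<lambda>i. p (Suc i)) \<alpha> (fst c) (snd c)))"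
proof -
  let ?S = "{(i, j). j < i \<and> i \<le> n}" and ?D = "(\<lambda>i. (i, i)) ` {..n}"
  let ?f = "\<lambda>c. 1 / (1 - cell_param (\<lambda>i. p (Suc i)) \<alpha> (fst c) (snd c))"
  have finS: "finite ?S" by (rule finite_subset[of _ "{..n} \<times> {..n}"]) auto
  have "cells n (Suc n) = ?S \<union> ?D" by (auto simp: cells_def)
  moreover have "?S \<inter> ?D = {}" by auto
  ultimately have "(\<Prod>c\<in>cells n (Suc n). ?f c) = (\<Prod>c\<in>?S. ?f c) * (\<Prod>c\<in>?D. ?f c)"
    by (simp only: prod.union_disjoint[OF finS finite_imageI[OF finite_atMost]])
  also have "(\<Prod>c\<in>?S. ?f c) = (\<Prod>(i, j)\<in>{(i, j). 1 \<le> i \<and> i < j \<and> j \<le> Suc n}. 1 / (1 - p i * p j))"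
    by (rule prod.reindex_bij_witness[where i = "\<lambda>(i, j). (j - 1, i - 1)" and j = "\<lambda>(i, j). (Suc j, Suc i)"])
      (auto simp: cell_param_def mult.commute)
  also have "(\<Prod>c\<in>?D. ?f c) = (\<Prod>j\<in>{1..Suc n}. 1 / (1 - \<alpha> * p j))"
    by (rule prod.reindex_bij_witness[where i = "\<lambda>j. (j - 1, j - 1)" and j = "\<lambda>c. Suc (fst c)"])
      (auto simp: cell_param_def)
  finally show ?thesis by (simp add: c_const_def)
qed

text \<open>The event is a finite disjoint union over the admissible arrays. By independence each
  array has probability its weight times a common factor, the reciprocal of
  \<open>c_const\<close>.\<close>

theorem last_passage_distribution:
  assumes W: "sym_geometric_weights M (Suc n) p \<alpha> W" and \<alpha>: "0 \<le> \<alpha>"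
    and p: "\<And>j. j \<in> {1..Suc n} \<Longrightarrow> 0 < p j \<and> p j < 1" "\<And>j. j \<in> {1..Suc n} \<Longrightarrow> \<alpha> * p j < 1"
  shows "c_const (Suc n) p \<alpha> * measure M {\<omega> \<in> space M. last_passage (\<lambda>i j. W i j \<omega>) (Suc n) (Suc n) \<le> m} =
    array_sum m (\<lambda>i. p (Suc i)) \<alpha> n (Suc n) (\<lambda>_. 1)"
proof -
  interpret prob_space M using W by (simp add: sym_geometric_weights_def)
  let ?I = "{(i, j). 1 \<le> i \<and> i \<le> j \<and> j \<le> Suc n}"
  let ?C = "cells n (Suc n)"
  let ?q = "\<lambda>c. cell_param (\<lambda>i. p (Suc i)) \<alpha> (fst c) (snd c)"
  have indep: "indep_vars (\<lambda>_. count_space UNIV) (\<lambda>(i, j). W i j) ?I"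
    and sym: "\<And>i j \<omega>. i \<in> {1..Suc n} \<Longrightarrow> j \<in> {1..Suc n} \<Longrightarrow> \<omega> \<in> space M \<Longrightarrow> W i j \<omega> = W j i \<omega>"
    and off: "\<And>i j k. i \<in> {1..Suc n} \<Longrightarrow> j \<in> {1..Suc n} \<Longrightarrow> i < j \<Longrightarrow>
        measure M {\<omega> \<in> space M. W i j \<omega> = k} = (1 - p i * p j) * (p i * p j) ^ k"
    and diag: "\<And>j k. j \<in> {1..Suc n} \<Longrightarrow> measure M {\<omega> \<in> space M. W j j \<omega> = k} = (1 - \<alpha> * p j) * (\<alpha> * p j) ^ k"
    using W unfolding sym_geometric_weights_def by blast+
  have cells: "(i, j) \<in> ?C \<longleftrightarrow> i \<le> n \<and> j \<le> i" for i j by (auto simp: cells_def)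
  have inI: "(Suc (snd c), Suc (fst c)) \<in> ?I" if "c \<in> ?C" for c
    using that cells[of "fst c" "snd c"] by simp
  \<comment> \<open>The lower triangle is filled from the upper one, on which independence is
    assumed.\<close>
  define V where "V = (\<lambda>\<omega> i j. if (i, j) \<in> ?C then W (Suc j) (Suc i) \<omega> else 0)"
  have one: "prob {\<omega> \<in> space M. W (Suc (snd c)) (Suc (fst c)) \<omega> = k} = (1 - ?q c) * ?q c ^ k" if "c \<in> ?C" for c k
  proof (cases "snd c = fst c")
    case True
    then show ?thesis using diag[of "Suc (fst c)" k] inI[OF that] by (simp add: cell_param_def)
  next
    case False
    then show ?thesis using off[of "Suc (snd c)" "Suc (fst c)" k] inI[OF that]
      by (simp add: cell_param_def mult.commute)
  qed
  have rv: "{\<omega> \<in> space M. W (Suc (snd c)) (Suc (fst c)) \<omega> = k} \<in> events" if "c \<in> ?C" for c k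
  proof -
    have "(\<lambda>(i, j). W i j) (Suc (snd c), Suc (fst c)) \<in> measurable M (count_space UNIV)"
      using indep inI[OF that] unfolding indep_vars_def by blast
    then have "W (Suc (snd c)) (Suc (fst c)) \<in> measurable M (count_space UNIV)" by simp
    from measurable_sets[OF this, of "{k}"] show ?thesis
      by (simp add: vimage_def Int_def conj_commute)
  qed
  have event_V: "{\<omega> \<in> space M. V \<omega> = w} = (\<Inter>c\<in>?C. {\<omega> \<in> space M. W (Suc (snd c)) (Suc (fst c)) \<omega> = w (fst c) (snd c)})"
    if w: "w \<in> arrays m n (Suc n)" for w
  proof -
    have ne: "(0, 0) \<in> ?C" by (simp add: cells)
    have zero: "w i j = 0" if "(i, j) \<notin> ?C" for i j using w that by (simp add: arrays_def)
    have "V \<omega> = w \<longleftrightarrow> (\<forall>c\<in>?C. W (Suc (snd c)) (Suc (fst c)) \<omega> = w (fst c) (snd c))" for \<omega>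
    proof
      assume eq: "V \<omega> = w"
      show "\<forall>c\<in>?C. W (Suc (snd c)) (Suc (fst c)) \<omega> = w (fst c) (snd c)"
        unfolding eq[symmetric] by (simp add: V_def)
    next
      assume *: "\<forall>c\<in>?C. W (Suc (snd c)) (Suc (fst c)) \<omega> = w (fst c) (snd c)"
      show "V \<omega> = w"
      proof (intro ext)
        fix i j show "V \<omega> i j = w i j"
          using bspec[OF *, of "(i, j)"] zero[of i j] by (cases "(i, j) \<in> ?C") (simp_all add: V_def)
      qed
    qed
    then show ?thesis using ne by auto
  qed
  have prob_V: "prob {\<omega> \<in> space M. V \<omega> = w} = (\<Prod>c\<in>?C. 1 - ?q c) * array_weight (\<lambda>i. p (Suc i)) \<alpha> n (Suc n) w"
    if w: "w \<in> arrays m n (Suc n)" for w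
  proof -
    let ?g = "\<lambda>c. (Suc (snd c), Suc (fst c))"
    let ?A = "\<lambda>d. {w (snd d - 1) (fst d - 1)}"
    have ne: "?C \<noteq> {}" using cells[of 0 0] by blast
    have inj: "inj_on ?g ?C" by (auto simp: inj_on_def)
    have "prob {\<omega> \<in> space M. V \<omega> = w} = prob (\<Inter>d\<in>?g ` ?C. (\<lambda>(i, j). W i j) d -` ?A d \<inter> space M)"
      unfolding event_V[OF w] by (rule arg_cong[where f = prob]) auto
    also have "\<dots> = (\<Prod>d\<in>?g ` ?C. prob ((\<lambda>(i, j). W i j) d -` ?A d \<inter> space M))"
    proof (rule indep_varsD[OF indep])
      show "?g ` ?C \<subseteq> ?I" using inI by (intro image_subsetI)
    qed (use ne cell_finite in auto)
    also have "\<dots> = (\<Prod>c\<in>?C. prob {\<omega> \<in> space M. W (Suc (snd c)) (Suc (fst c)) \<omega> = w (fst c) (snd c)})"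
      unfolding prod.reindex[OF inj] by (intro prod.cong refl) (auto intro!: arg_cong[where f = prob])
    also have "\<dots> = (\<Prod>c\<in>?C. (1 - ?q c) * ?q c ^ w (fst c) (snd c))"
      by (intro prod.cong refl one)
    finally show ?thesis by (simp only: prod.distrib array_weight_eq_prod)
  qed
  have event: "{\<omega> \<in> space M. last_passage (\<lambda>i j. W i j \<omega>) (Suc n) (Suc n) \<le> m} =
      (\<Union>w\<in>arrays m n (Suc n). {\<omega> \<in> space M. V \<omega> = w})"
  proof -
    have "last_passage (\<lambda>i j. W i j \<omega>) (Suc n) (Suc n) \<le> m \<longleftrightarrow> V \<omega> \<in> arrays m n (Suc n)" if \<omega>: "\<omega> \<in> space M" for \<omega>
    proof -
      have s: "W i j \<omega> = W j i \<omega>" if "1 \<le> i" "i \<le> Suc n" "1 \<le> j" "j \<le> Suc n" for i j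
        using that \<omega> by (intro sym) auto
      have "V \<omega> = (\<lambda>i j. if (i, j) \<in> ?C then W (Suc i) (Suc j) \<omega> else 0)"
        unfolding V_def by (intro ext) (auto simp: cells intro!: s)
      then show ?thesis using mem_arrays_iff[of n "\<lambda>i j. W i j \<omega>" m, OF s] by simp
    qed
    then show ?thesis by auto
  qed
  have "prob {\<omega> \<in> space M. last_passage (\<lambda>i j. W i j \<omega>) (Suc n) (Suc n) \<le> m} =
      (\<Sum>w\<in>arrays m n (Suc n). prob {\<omega> \<in> space M. V \<omega> = w})"
    unfolding event
  proof (rule finite_measure_finite_Union[OF finite_arrays])
    show "(\<lambda>w. {\<omega> \<in> space M. V \<omega> = w}) ` arrays m n (Suc n) \<subseteq> events"
    proof (rule image_subsetI)
      fix w assume w: "w \<in> arrays m n (Suc n)"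
      have "?C \<noteq> {}" using cells[of 0 0] by blast
      then show "{\<omega> \<in> space M. V \<omega> = w} \<in> events"
        unfolding event_V[OF w] by (intro sets.finite_INT cell_finite rv)
    qed
    show "disjoint_family_on (\<lambda>w. {\<omega> \<in> space M. V \<omega> = w}) (arrays m n (Suc n))"
      by (auto simp: disjoint_family_on_def)
  qed
  also have "\<dots> = (\<Prod>c\<in>?C. 1 - ?q c) * array_sum m (\<lambda>i. p (Suc i)) \<alpha> n (Suc n) (\<lambda>_. 1)"
    unfolding array_sum_def sum_distrib_left by (intro sum.cong refl) (simp only: prob_V mult_1_right)
  finally have P: "prob {\<omega> \<in> space M. last_passage (\<lambda>i j. W i j \<omega>) (Suc n) (Suc n) \<le> m} =
      (\<Prod>c\<in>?C. 1 - ?q c) * array_sum m (\<lambda>i. p (Suc i)) \<alpha> n (Suc n) (\<lambda>_. 1)" .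
  have "?q c < 1" if "c \<in> ?C" for c
  proof (cases "snd c < fst c")
    case True
    have "p (Suc (fst c)) * p (Suc (snd c)) < 1 * 1"
      using p(1)[of "Suc (fst c)"] p(1)[of "Suc (snd c)"] inI[OF that] by (intro mult_strict_mono) auto
    then show ?thesis using True by (simp add: cell_param_def)
  next
    case False
    then show ?thesis using p(2)[of "Suc (fst c)"] inI[OF that] by (simp add: cell_param_def)
  qed
  then have "(\<Prod>c\<in>?C. 1 / (1 - ?q c)) * (\<Prod>c\<in>?C. 1 - ?q c) = 1"
    unfolding prod.distrib[symmetric] by (intro prod.neutral ballI) (simp add: less_imp_neq)
  then show ?thesis unfolding P c_const_eq_prod by (simp only: mult.assoc[symmetric] mult_1_left)
qed

section \<open>Comparison of the expressions\<close>

definition fun_of_list :: "nat list \<Rightarrow> nat \<Rightarrow> nat" where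
  "fun_of_list l j = (if j < length l then l ! j else 0)"

text \<open>The entries that are at least j form an initial segment, over which alternating signs
  add up to its parity.\<close>

lemma alternating_count:
  fixes l :: "nat list"
  shows "sorted_wrt (\<ge>) l \<Longrightarrow> (\<Sum>i<length l. (-1) ^ i * of_bool (j \<le> l ! i)) =
     (of_bool (odd (length (filter (\<lambda>k. j \<le> k) l))) :: int)"
proof (induction l)
  case (Cons a l)
  have "(\<Sum>i<length (a # l). (-1) ^ i * of_bool (j \<le> (a # l) ! i)) =
      of_bool (j \<le> a) - (\<Sum>i<length l. (-1) ^ i * (of_bool (j \<le> l ! i) :: int))"
    by (simp add: sum.lessThan_Suc_shift sum_negf del: sum.lessThan_Suc)
  also have "\<dots> = of_bool (j \<le> a) - of_bool (odd (length (filter (\<lambda>k. j \<le> k) l)))"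
    using Cons by simp
  also have "\<dots> = of_bool (odd (length (filter (\<lambda>k. j \<le> k) (a # l))))"
  proof (cases "j \<le> a")
    case False
    have "x \<le> a" if "x \<in> set l" for x using Cons.prems that by simp
    then have "\<not> j \<le> x" if "x \<in> set l" for x using that False by (meson le_trans)
    then have "filter (\<lambda>k. j \<le> k) l = []" by (simp add: filter_empty_conv)
    then show ?thesis using False by simp
  qed simp
  finally show ?case .
qed simp

text \<open>Every part is written as a sum over the columns it meets; exchanging the sums leaves the
  parity of each column.\<close>

lemma oddrows_conjugate:
  assumes "sorted_wrt (\<ge>) l"
  shows "int (oddrows (conjugate l)) = alt_sum (Suc (length l)) (fun_of_list l)"
proof -
  define L where "L = Max (insert 0 (set l))"
  let ?c = "\<lambda>j. length (filter (\<lambda>k. j \<le> k) l)"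
  have le: "l ! i \<le> L" if "i < length l" for i
    unfolding L_def using that by (intro Max_ge) auto
  have count: "int (length (filter P [1..<Suc L])) = (\<Sum>j\<in>{1..L}. of_bool (P j))" for P :: "nat \<Rightarrow> bool" and L
    by (induction L) auto
  have "(\<Sum>j\<in>{1..L}. of_bool (j \<le> a)) = int (min a L)" for a L
    by (induction L) auto
  then have upto: "(\<Sum>j\<in>{1..L}. of_bool (j \<le> a)) = int a" if "a \<le> L" for a
    using that by simp
  have "int (oddrows (conjugate l)) = (\<Sum>j\<in>{1..L}. of_bool (odd (?c j)))"
    unfolding oddrows_def conjugate_def L_def[symmetric] filter_map length_map o_def by (rule count)
  also have "\<dots> = (\<Sum>j\<in>{1..L}. \<Sum>i<length l. (-1) ^ i * of_bool (j \<le> l ! i))"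
    by (simp only: alternating_count[OF assms])
  also have "\<dots> = (\<Sum>i<length l. (-1) ^ i * (\<Sum>j\<in>{1..L}. of_bool (j \<le> l ! i)))"
    by (subst sum.swap) (simp only: sum_distrib_left)
  also have "\<dots> = (\<Sum>i<length l. (-1) ^ i * int (l ! i))"
    by (intro sum.cong refl) (simp only: lessThan_iff upto le)
  also have "\<dots> = alt_sum (Suc (length l)) (fun_of_list l)"
    by (simp add: alt_sum_def fun_of_list_def)
  finally show ?thesis .
qed

lemma transp_ge: "transp ((\<ge>) :: 'a :: linorder \<Rightarrow> 'a \<Rightarrow> bool)"
  by (auto intro!: transpI)

lemma sum_decr_tuples:
  fixes f :: "nat list \<Rightarrow> real"
  assumes eq: "\<And>l. l \<in> decr_tuples n {..m} \<Longrightarrow> f l = g (fun_of_list l)"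
  shows "(\<Sum>l\<in>decr_tuples n {..m}. f l) = (\<Sum>\<mu>\<in>partitions_le n m. g \<mu>)"
proof (rule sum.reindex_bij_witness[where i = "\<lambda>\<mu>. map \<mu> [0..<n]" and j = fun_of_list], goal_cases)
  case (1 l)
  then have "length l = n" by (simp add: decr_tuples_def)
  then show ?case by (intro nth_equalityI) (auto simp: fun_of_list_def)
next
  case (2 l)
  then have len: "length l = n" and s: "sorted_wrt (\<ge>) l" and le: "set l \<subseteq> {..m}" by (auto simp: decr_tuples_def)
  have "fun_of_list l (Suc j) \<le> fun_of_list l j" for j
    using sorted_wrt_nth_less[OF s, of j "Suc j"] by (simp add: fun_of_list_def)
  moreover have "fun_of_list l 0 \<le> m" using le nth_mem[of 0 l] by (cases l) (auto simp: fun_of_list_def)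
  ultimately show ?case using len by (simp add: partitions_le_def fun_of_list_def)
next
  case (3 \<mu>)
  then show ?case by (auto simp: fun_of_list_def partitions_le_def fun_eq_iff)
next
  case (4 \<mu>)
  have dec: "\<mu> (Suc j) \<le> \<mu> j" for j using 4 by (simp add: partitions_le_def)
  have "\<mu> j \<le> m" for j
    using 4 lift_Suc_antimono_le[of \<mu> 0 j, OF dec] by (simp add: partitions_le_def)
  moreover have "sorted_wrt (\<ge>) (map \<mu> [0..<n])"
    unfolding sorted_wrt_iff_nth_Suc_transp[OF transp_ge] using dec by simp
  ultimately show ?case by (auto simp: decr_tuples_def)
next
  case (5 l)
  then show ?case by (simp add: eq)
qed

text \<open>Changing the sign of the last entry k + q/2 means k -> - k - q. A vanishing last entry
  is its own image, so both descriptions contain it once.\<close>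

lemma signed_box_eq:
  assumes q: "0 \<le> q" "q \<le> 1" and U: "0 \<le> U"
  shows "signed_box d (of_int U + of_int q / 2) = shape q d ` {k \<in> signed_tuples q U d. dominant q d k}"
proof -
  define u :: real where "u = of_int U + of_int q / 2"
  define S where "S = {k. (\<forall>j<d. 0 \<le> k j \<and> k j \<le> U) \<and> (\<forall>j\<ge>d. k j = 0) \<and> (\<forall>j. Suc j < d \<longrightarrow> k (Suc j) \<le> (k j :: int))}"
  define flip where "flip = (\<lambda>k :: nat \<Rightarrow> int. k(d - 1 := - k (d - 1) - q))"
  have q01: "q = 0 \<or> q = 1" using q by auto
  have "(if u \<in> \<int> then \<int> else half_integers) = parity_class q"
    using q01
  proof
    assume "q = 1"
    then have "u \<in> half_integers" by (auto simp: u_def half_integers_def)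
    then have "u \<notin> \<int>" using parity_class_disjoint by blast
    then show ?thesis using \<open>q = 1\<close> parity_class_cases by simp
  qed (simp add: u_def parity_class_cases)
  then have box: "signed_box d u = decr_tuples d {x \<in> parity_class q. 0 \<le> x \<and> x \<le> u} \<union>
      negate_last ` decr_tuples d {x \<in> parity_class q. 0 \<le> x \<and> x \<le> u}"
    by (simp add: signed_box_def Let_def)
  have le_iff: "of_int a + of_int q / 2 \<le> (of_int b + of_int q / 2 :: real) \<longleftrightarrow> a \<le> b" for a b by simp
  have nonneg_iff: "0 \<le> (of_int a + of_int q / 2 :: real) \<longleftrightarrow> 0 \<le> a" for a
    using q01 by auto
  have P: "decr_tuples d {x \<in> parity_class q. 0 \<le> x \<and> x \<le> u} = shape q d ` S"
  proof (intro equalityI subsetI)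
    fix l assume l: "l \<in> decr_tuples d {x \<in> parity_class q. 0 \<le> x \<and> x \<le> u}"
    then have len: "length l = d" and s: "sorted_wrt (\<ge>) l" and sub: "set l \<subseteq> {x \<in> parity_class q. 0 \<le> x \<and> x \<le> u}"
      by (auto simp: decr_tuples_def)
    define k where "k = (\<lambda>j. if j < d then \<lfloor>l ! j\<rfloor> else 0)"
    have lj: "l ! j = of_int (k j) + of_int q / 2" if j: "j < d" for j
    proof -
      have "l ! j \<in> parity_class q" using sub nth_mem[of j l] len j by blast
      then obtain a :: int where "l ! j = of_int a + of_int q / 2" by (auto simp: parity_class_def)
      then show ?thesis using j floor_of_int_add_half[OF q, of a] by (simp add: k_def)
    qed
    have "0 \<le> k j \<and> k j \<le> U" if j: "j < d" for j
    proof -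
      have "0 \<le> l ! j \<and> l ! j \<le> u" using sub nth_mem[of j l] len j by blast
      then show ?thesis unfolding lj[OF j] u_def le_iff nonneg_iff .
    qed
    moreover have "k (Suc j) \<le> k j" if j: "Suc j < d" for j
    proof -
      have "l ! Suc j \<le> l ! j" using sorted_wrt_nth_less[OF s, of j "Suc j"] len j by simp
      then show ?thesis using lj[of j] lj[of "Suc j"] j by simp
    qed
    ultimately have "k \<in> S" by (simp add: S_def k_def)
    moreover have "l = shape q d k" by (rule nth_equalityI) (auto simp: len lj)
    ultimately show "l \<in> shape q d ` S" by blast
  next
    fix l assume "l \<in> shape q d ` S"
    then obtain k where k: "l = shape q d k" "k \<in> S" by blast
    have "sorted_wrt (\<ge>) l"
      unfolding sorted_wrt_iff_nth_Suc_transp[OF transp_ge] using k by (simp add: S_def)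
    moreover have "set l \<subseteq> {x \<in> parity_class q. 0 \<le> x \<and> x \<le> u}"
    proof
      fix y assume "y \<in> set l"
      then obtain j where j: "j < d" "y = of_int (k j) + of_int q / 2" using k by (auto simp: in_set_conv_nth)
      then have "0 \<le> k j" "k j \<le> U" using k(2) by (auto simp: S_def)
      then show "y \<in> {x \<in> parity_class q. 0 \<le> x \<and> x \<le> u}"
        unfolding j(2) u_def mem_Collect_eq nonneg_iff le_iff by (simp add: parity_class_def)
    qed
    ultimately show "l \<in> decr_tuples d {x \<in> parity_class q. 0 \<le> x \<and> x \<le> u}"
      using k(1) by (simp add: decr_tuples_def)
  qed
  have neg: "negate_last (shape q d k) = shape q d (flip k)" for k
  proof (cases d)
    case 0
    then show ?thesis by (simp add: negate_last_def shape_def)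
  next
    case (Suc c)
    then show ?thesis by (simp add: negate_last_def shape_def flip_def)
  qed
  \<comment> \<open>For d = 0 there is no last entry, but \<open>flip\<close> would still act at
    index 0; that case is treated apart.\<close>
  have "S \<union> flip ` S = {k \<in> signed_tuples q U d. dominant q d k}" if d: "0 < d"
  proof (intro equalityI subsetI)
    fix k assume "k \<in> S \<union> flip ` S"
    then show "k \<in> {k \<in> signed_tuples q U d. dominant q d k}"
    proof
      assume "k \<in> S"
      then show ?thesis using q U by (auto simp: S_def signed_tuples_def tup_def dominant_def nabs_def)
    next
      assume "k \<in> flip ` S"
      then obtain k0 where k0: "k0 \<in> S" "k = flip k0" by blast
      have "dominant q d k"
        unfolding dominant_def
      proof (intro allI impI)
        fix j assume j: "Suc j < d"
        have "0 \<le> k0 (Suc j)" "k0 (Suc j) \<le> k0 j" using k0(1) j by (auto simp: S_def)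
        moreover have "k j = k0 j"
        proof -
          have "j \<noteq> d - 1" using j by linarith
          then show ?thesis by (simp add: k0(2) flip_def)
        qed
        moreover have "nabs q (k (Suc j)) = k0 (Suc j)"
          using \<open>0 \<le> k0 (Suc j)\<close> q by (auto simp: k0(2) flip_def nabs_def)
        ultimately show "nabs q (k (Suc j)) \<le> k j" by simp
      qed
      moreover have "k \<in> signed_tuples q U d"
      proof -
        have k: "0 \<le> k0 j" "k0 j \<le> U" if "j < d" for j using k0(1) that by (auto simp: S_def)
        have "- U - q \<le> flip k0 j \<and> flip k0 j \<le> U" if "j < d" for j
          using k[OF that] q U by (cases "j = d - 1") (auto simp: flip_def)
        moreover have "flip k0 j = 0" if "d \<le> j" for j using k0(1) that d by (auto simp: flip_def S_def)
        ultimately show ?thesis by (simp add: k0(2) signed_tuples_def tup_def)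
      qed
      ultimately show ?thesis by simp
    qed
  next
    fix k assume k: "k \<in> {k \<in> signed_tuples q U d. dominant q d k}"
    have ge: "0 \<le> k j" if "Suc j < d" for j
      using k that nabs_ge(2)[OF q(2), of "k (Suc j)"] by (fastforce simp: dominant_def)
    have dom: "nabs q (k (Suc j)) \<le> k j" if "Suc j < d" for j using k that by (simp add: dominant_def)
    have bnd: "- U - q \<le> k j" "k j \<le> U" if "j < d" for j using k that by (auto simp: signed_tuples_def tup_def)
    have zero: "k j = 0" if "d \<le> j" for j using k that by (auto simp: signed_tuples_def tup_def)
    have dec: "k (Suc j) \<le> k j" if "Suc j < d" for j
      using dom[OF that] nabs_ge(1)[OF q(2), of "k (Suc j)"] by linarith
    show "k \<in> S \<union> flip ` S"
    proof (cases "0 \<le> k (d - 1)")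
      case True
      have "0 \<le> k j" if "j < d" for j
      proof (cases "Suc j < d")
        case False
        then have "j = d - 1" using that by simp
        then show ?thesis using True by simp
      qed (rule ge)
      then have "k \<in> S" using bnd zero dec by (simp add: S_def)
      then show ?thesis by simp
    next
      case False
      have "flip k \<in> S"
        unfolding S_def mem_Collect_eq
      proof (intro conjI allI impI)
        fix j assume j: "j < d"
        show "0 \<le> flip k j" using ge[of j] j False q by (cases "j = d - 1") (auto simp: flip_def)
        show "flip k j \<le> U" using bnd[OF j] by (cases "j = d - 1") (auto simp: flip_def)
      next
        fix j assume "d \<le> j"
        then have "j \<noteq> d - 1" "k j = 0" using zero[of j] d by auto
        then show "flip k j = 0" by (simp add: flip_def)
      next
        fix j assume j: "Suc j < d"
        show "flip k (Suc j) \<le> flip k j"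
        proof (cases "Suc j = d - 1")
          case True
          then have "flip k (Suc j) = nabs q (k (Suc j))" using False by (simp add: flip_def nabs_def)
          moreover have "flip k j = k j" using True by (simp add: flip_def)
          ultimately show ?thesis using dom[OF j] by simp
        next
          case False
          moreover have "j \<noteq> d - 1" using j by linarith
          ultimately show ?thesis using dec[OF j] by (simp add: flip_def)
        qed
      qed
      moreover have "flip (flip k) = k" by (simp add: flip_def)
      ultimately have "k \<in> flip ` S" by (metis image_eqI)
      then show ?thesis by simp
    qed
  qed
  then have pos: ?thesis if "0 < d"
    unfolding u_def[symmetric] box P image_image neg using that by (simp add: image_Un[symmetric] image_image[symmetric])
  have zero: ?thesis if "d = 0"
    unfolding u_def[symmetric] box P image_image neg using that
    by (auto simp: S_def shape_def signed_tuples_def tup_def dominant_def)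
  show ?thesis using pos zero by blast
qed

text \<open>The prefactor with exponent u = U + q/2 absorbs the factors with exponent q/2 by which
  \<open>so_even\<close> and \<open>so_rec\<close> differ.\<close>

lemma prod_powr_rect:
  fixes x :: "nat \<Rightarrow> real"
  assumes "\<And>i. i \<in> I \<Longrightarrow> 0 < x i"
  shows "(\<Prod>i\<in>I. x i) powr (of_int U + of_int q / 2) * (\<Prod>i\<in>I. (1 / x i) powr (- of_int q / 2)) =
    (\<Prod>i\<in>I. x i powi (U + q))"
proof -
  have "(\<Prod>i\<in>I. x i) powr (of_int U + of_int q / 2) = (\<Prod>i\<in>I. x i powr (of_int U + of_int q / 2))"
    by (rule prod_powr_distrib)
  moreover have "x i powr (of_int U + of_int q / 2) * (1 / x i) powr (- of_int q / 2) = x i powi (U + q)" if "i \<in> I" for i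
  proof -
    have "(1 / x i) powr (- of_int q / 2) = x i powr (of_int q / 2)"
      using assms[OF that] by (simp add: powr_divide powr_minus_divide)
    moreover have "x i powr (of_int U + of_int q / 2) * x i powr (of_int q / 2) = x i powr of_int (U + q)"
      by (simp add: powr_add[symmetric] add.commute)
    ultimately show ?thesis
      using assms[OF that] powr_real_of_int'[of "x i" "U + q"] by simp
  qed
  ultimately show ?thesis by (simp add: prod.distrib[symmetric])
qed

theorem theorem4p5:
  fixes N :: nat and p :: "nat \<Rightarrow> real" and \<alpha> u :: real
    and M :: "'a measure" and W :: "nat \<Rightarrow> nat \<Rightarrow> 'a \<Rightarrow> nat"
  assumes "1 \<le> N"
    and "\<And>j. j \<in> {1..N} \<Longrightarrow> 0 < p j \<and> p j < 1"
    and "0 \<le> \<alpha>"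
    and "\<And>j. j \<in> {1..N} \<Longrightarrow> \<alpha> * p j < 1"
    and "sym_geometric_weights M N p \<alpha> W"
    and "2 * u \<in> \<nat>"
  shows
    "let A = c_const N p \<alpha> *
           measure M {\<omega> \<in> space M. real (last_passage (\<lambda>i j. W i j \<omega>) N N) \<le> 2 * u};
         B = (\<Sum>mu\<in>decr_tuples N {k. real k \<le> 2 * u}.
           \<alpha> ^ oddrows (conjugate mu) * schur N mu (map p [1..<N + 1]));
         C1 = (\<Prod>i\<in>{1..N}. p i) powr u *
           s_DB N (replicate N u) (map (\<lambda>i. 1 / p i) [1..<N + 1]) \<alpha>;
         C2 = (\<alpha> * (\<Prod>i\<in>{1..N}. p i)) powr u *
           so_even (N + 1) (replicate (N + 1) u) (map (\<lambda>i. 1 / p i) [1..<N + 1] @ [1 / \<alpha>]);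
         D = (\<lambda>n. (\<alpha> * (\<Prod>i\<in>{1..N}. p i)) powr u *
           (\<Sum>l\<in>signed_box (N - n) u.
              so_even (n + 1) (replicate (2 * n + 1 - N) u @ l)
                (map (\<lambda>i. 1 / p i) [1..<n + 1] @ [1 / \<alpha>]) *
              so_even (N - n) l (map (\<lambda>i. 1 / p i) [n + 1..<N + 1])))
     in A = B \<and> B = C1 \<and>
        (0 < \<alpha> \<longrightarrow> C1 = C2 \<and> (\<forall>n::nat. \<lceil>(real N - 1) / 2\<rceil> \<le> int n \<and> n \<le> N \<longrightarrow> C2 = D n))"
proof -
  obtain m :: nat where m: "2 * u = real m" using assms(6) by (auto elim: Nats_cases)
  obtain N' where N': "N = Suc N'" using assms(1) by (cases N) auto
  \<comment> \<open>The integer 2 u gives the integral part U of u and the parity q that marks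
    half-integers, so u = U + q/2.\<close>
  define U where "U = int m div 2"
  define q where "q = int m mod 2"
  have q: "0 \<le> q" "q \<le> 1" by (auto simp: q_def)
  have U: "0 \<le> U" by (simp add: U_def)
  have mUq: "int m = 2 * U + q" by (simp add: U_def q_def)
  have u: "u = of_int U + of_int q / 2"
  proof -
    have "2 * u = of_int (int m)" using m by simp
    then show ?thesis unfolding mUq by simp
  qed
  have replicate: "replicate n u = shape q n (\<lambda>_. U)" for n
    by (rule nth_equalityI) (simp_all add: u)
  have p: "0 < p i" "p i < 1" if "1 \<le> i" "i \<le> N" for i using assms(2)[of i] that by auto
  \<comment> \<open>The last variable a is \<alpha> when \<alpha> > 0; for \<alpha> = 0 it runs
    through positive values near 0.\<close>
  define y where "y = (\<lambda>a i. if i < N then p (Suc i) else (a :: real))"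
  have y_pos: "0 < y a i" if "0 < a" for a i using that p by (simp add: y_def)
  have y_lt: "y a i * y a j < 1" if a: "0 < a" "\<And>j. j \<in> {1..N} \<Longrightarrow> a * p j < 1" and ij: "i < Suc N" "j < Suc N" "i \<noteq> j" for a i j
  proof -
    have "p (Suc i) * p (Suc j) < 1 * 1" if "i < N" "j < N"
      using that p[of "Suc i"] p[of "Suc j"] by (intro mult_strict_mono) auto
    then show ?thesis using ij a(2)[of "Suc i"] a(2)[of "Suc j"] by (auto simp: y_def mult.commute)
  qed
  have prod_p: "(\<Prod>i\<in>{1..N}. p i) = (\<Prod>i<N. p (Suc i))"
    by (rule prod.reindex_bij_witness[where i = Suc and j = "\<lambda>i. i - 1"]) auto
  have prod_y: "a * (\<Prod>i\<in>{1..N}. p i) = (\<Prod>i<Suc N. y a i)" for a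
    unfolding prod_p by (simp add: y_def)
  define X where "X = map (\<lambda>i. 1 / p i) [1..<N + 1]"
  have X: "length X = N" "\<And>i. i < N \<Longrightarrow> X ! i = 1 / p (Suc i)"
    unfolding X_def by (simp_all del: upt_Suc)

  define B where "B = (\<lambda>a. \<Sum>mu\<in>decr_tuples N {k. real k \<le> 2 * u}. a ^ oddrows (conjugate mu) * schur N mu (map p [1..<N + 1]))"
  have B: "B a = (\<Sum>\<mu>\<in>partitions_le N m. a ^ nat (alt_sum (Suc N) \<mu>) * gts N \<mu> (\<lambda>i. p (Suc i)))" for a
  proof -
    have "{k. real k \<le> 2 * u} = {..m}" unfolding m by auto
    moreover have "a ^ oddrows (conjugate l) * schur N l (map p [1..<N + 1]) =
        a ^ nat (alt_sum (Suc N) (fun_of_list l)) * gts N (fun_of_list l) (\<lambda>i. p (Suc i))" if "l \<in> decr_tuples N {..m}" for l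
    proof -
      have l: "length l = N" "sorted_wrt (\<ge>) l" using that by (auto simp: decr_tuples_def)
      have "schur N l (map p [1..<N + 1]) = gts N (fun_of_list l) (\<lambda>i. p (Suc i))"
        unfolding schur_eq_gts[OF l] by (rule gts_cong) (auto simp: fun_of_list_def l(1) simp del: upt_Suc)
      moreover have "oddrows (conjugate l) = nat (alt_sum (Suc N) (fun_of_list l))"
        using oddrows_conjugate[OF l(2)] l(1) by simp
      ultimately show ?thesis by simp
    qed
    ultimately show ?thesis unfolding B_def by (simp only: sum_decr_tuples)
  qed

  have "{\<omega> \<in> space M. real (last_passage (\<lambda>i j. W i j \<omega>) N N) \<le> 2 * u} =
      {\<omega> \<in> space M. last_passage (\<lambda>i j. W i j \<omega>) N N \<le> m}" unfolding m by simp
  then have A: "c_const N p \<alpha> * measure M {\<omega> \<in> space M. real (last_passage (\<lambda>i j. W i j \<omega>) N N) \<le> 2 * u} = B \<alpha>"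
    using last_passage_distribution[of M N' p \<alpha> W m] assms array_sum_eq_gts[of m "\<lambda>i. p (Suc i)" \<alpha> N']
    unfolding B N' by simp

  \<comment> \<open>The rectangular character with its prefactor, to which B, C and D are all
    reduced for positive a.\<close>
  define R where "R = (\<lambda>a. (\<Prod>i<Suc N. y a i powi (U + q)) * so_rec q (Suc N) (\<lambda>_. U) (\<lambda>i. 1 / y a i))"
  have BR: "B a = R a" if a: "0 < a" "\<And>j. j \<in> {1..N} \<Longrightarrow> a * p j < 1" for a
  proof -
    have "B a = even_sum (Suc N) m (y a)"
      unfolding B even_sum_Suc by (intro sum.cong refl arg_cong2[where f = "(*)"] gts_cong) (auto simp: y_def)
    also have "\<dots> = R a"
      unfolding R_def by (rule even_sum_eq_so_rect[OF q U mUq]) (use y_pos y_lt a in auto)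
    finally show ?thesis .
  qed

  define C where "C = (\<lambda>a. (\<Prod>i<N. p (Suc i) powi (U + q)) * (\<Sum>k\<in>{- U - q..U}. a ^ nat (U - k) *
    so_rec q N (rect_join N' U (\<lambda>i. if i = 0 then k else 0)) (\<lambda>i. 1 / p (Suc i))))"
  have C1: "(\<Prod>i\<in>{1..N}. p i) powr u * s_DB N (replicate N u) X a = C a" for a
  proof -
    have "s_DB N (replicate N u) X a = (\<Prod>i<N. (X ! i) powr (- of_int q / 2)) *
        (\<Sum>k\<in>{- U - q..U}. a ^ nat (U - k) * so_rec q N (rect_join N' U (\<lambda>i. if i = 0 then k else 0)) (\<lambda>i. X ! i))"
      unfolding replicate unfolding N' by (rule s_DB_rect[OF q U]) (use X p N' in auto)
    also have "(\<Prod>i<N. (X ! i) powr (- of_int q / 2)) = (\<Prod>i<N. (1 / p (Suc i)) powr (- of_int q / 2))"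
      by (intro prod.cong) (auto simp: X)
    also have "(\<Sum>k\<in>{- U - q..U}. a ^ nat (U - k) * so_rec q N (rect_join N' U (\<lambda>i. if i = 0 then k else 0)) (\<lambda>i. X ! i)) =
        (\<Sum>k\<in>{- U - q..U}. a ^ nat (U - k) * so_rec q N (rect_join N' U (\<lambda>i. if i = 0 then k else 0)) (\<lambda>i. 1 / p (Suc i)))"
      by (intro sum.cong refl arg_cong2[where f = "(*)"] so_rec_cong) (auto simp: X)
    finally show ?thesis
      using prod_powr_rect[of "{..<N}" "\<lambda>i. p (Suc i)" U q] p unfolding C_def prod_p u by (simp add: mult.assoc[symmetric])
  qed
  \<comment> \<open>One splitting step removes the variable a; together with the prefactor its power
    becomes a ^ (U - k), as in \<open>s_DB_rect\<close>.\<close>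
  have RC: "R a = C a" if a: "0 < a" for a
  proof -
    have "so_rec q (Suc N) (\<lambda>_. U) (\<lambda>i. 1 / y a i) = (\<Sum>k\<in>signed_tuples q U 1.
        so_rec q 1 k (\<lambda>i. 1 / y a (Suc N - 1 - i)) * so_rec q (Suc N - 1) (rect_join (Suc N - 2 * 1) U k) (\<lambda>i. 1 / y a i))"
      by (rule so_rect_split[OF q U]) (use assms(1) in simp)
    also have "\<dots> = (\<Sum>k\<in>{- U - q..U}. (1 / a) powi (k + q) *
        so_rec q N (rect_join N' U (\<lambda>i. if i = 0 then k else 0)) (\<lambda>i. 1 / p (Suc i)))"
    proof (rule sum.reindex_bij_witness[where i = "\<lambda>k i. if i = 0 then k else 0" and j = "\<lambda>k. k 0"], goal_cases)
      case (1 k)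
      then show ?case by (auto simp: signed_tuples_def tup_def fun_eq_iff)
    next
      case (5 k)
      then have "k = (\<lambda>i. if i = 0 then k 0 else 0)" by (auto simp: signed_tuples_def tup_def fun_eq_iff)
      then have "so_rec q N (rect_join N' U (\<lambda>i. if i = 0 then k 0 else 0)) (\<lambda>i. 1 / p (Suc i)) =
          so_rec q N (rect_join N' U k) (\<lambda>i. 1 / y a i)"
        by (intro so_rec_cong) (auto simp: y_def)
      then show ?case using N' by (simp add: y_def)
    qed (auto simp: signed_tuples_def tup_def)
    finally have "R a = (\<Prod>i<N. p (Suc i) powi (U + q)) * (\<Sum>k\<in>{- U - q..U}. (a powi (U + q) * (1 / a) powi (k + q)) *
        so_rec q N (rect_join N' U (\<lambda>i. if i = 0 then k else 0)) (\<lambda>i. 1 / p (Suc i)))"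
      unfolding R_def by (simp add: y_def sum_distrib_left mult_ac)
    also have "\<dots> = C a"
      unfolding C_def
    proof (intro arg_cong2[where f = "(*)"] sum.cong refl)
      fix k assume "k \<in> {- U - q..U}"
      then have "int (nat (U - k)) = U - k" by simp
      then have "a ^ nat (U - k) = a powi (U - k)" by (metis power_int_of_nat)
      also have "U - k = (U + q) - (k + q)" by simp
      also have "a powi ((U + q) - (k + q)) = a powi (U + q) * (1 / a) powi (k + q)"
        using a by (subst powi_diff) (auto simp: power_int_divide_distrib)
      finally show "a powi (U + q) * (1 / a) powi (k + q) = a ^ nat (U - k)" by simp
    qed
    finally show ?thesis .
  qed
  have BC: "B \<alpha> = C \<alpha>"
  proof (cases "0 < \<alpha>")
    case True
    then show ?thesis using BR RC assms(4) by simp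
  next
    case False
    then have \<alpha>: "\<alpha> = 0" using assms(3) by simp
    have "(B \<longlongrightarrow> B 0) (at_right 0)"
      unfolding B by (intro tendsto_intros)
    moreover have "(C \<longlongrightarrow> C 0) (at_right 0)"
      unfolding C_def by (intro tendsto_intros)
    moreover have "\<forall>\<^sub>F a in at_right 0. B a = C a"
    proof -
      have "\<forall>\<^sub>F a :: real in at_right 0. a \<in> {0<..<1}"
        by (rule eventually_at_right_real) simp
      then show ?thesis
      proof (rule eventually_mono)
        fix a :: real assume a: "a \<in> {0<..<1}"
        have "a * p j < 1" if "j \<in> {1..N}" for j
        proof -
          have "a * p j < 1 * 1" using a p[of j] that by (intro mult_strict_mono) auto
          then show ?thesis by simp
        qed
        then show "B a = C a" using BR[of a] RC[of a] a by simp
      qed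
    qed
    ultimately have "B 0 = C 0"
      by (intro tendsto_unique[OF _ tendsto_cong[THEN iffD1]]) auto
    then show ?thesis by (simp add: \<alpha>)
  qed

  have C2: "(\<alpha> * (\<Prod>i\<in>{1..N}. p i)) powr u * so_even (N + 1) (replicate (N + 1) u) (X @ [1 / \<alpha>]) = R \<alpha>"
    if \<alpha>: "0 < \<alpha>"
  proof -
    have nth: "(X @ [1 / \<alpha>]) ! i = 1 / y \<alpha> i" if "i < Suc N" for i
      using that by (auto simp: nth_append X y_def)
    have "so_even (Suc N) (shape q (Suc N) (\<lambda>_. U)) (X @ [1 / \<alpha>]) = (\<Prod>i<Suc N. ((X @ [1 / \<alpha>]) ! i) powr (- of_int q / 2)) *
        so_rec q (Suc N) (\<lambda>_. U) (\<lambda>i. (X @ [1 / \<alpha>]) ! i)"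
      by (rule so_even_shape[OF q]) (simp only: nth zero_less_divide_1_iff y_pos[OF \<alpha>])
    also have "(\<Prod>i<Suc N. ((X @ [1 / \<alpha>]) ! i) powr (- of_int q / 2)) = (\<Prod>i<Suc N. (1 / y \<alpha> i) powr (- of_int q / 2))"
      by (intro prod.cong refl) (simp only: lessThan_iff nth)
    also have "so_rec q (Suc N) (\<lambda>_. U) (\<lambda>i. (X @ [1 / \<alpha>]) ! i) = so_rec q (Suc N) (\<lambda>_. U) (\<lambda>i. 1 / y \<alpha> i)"
      by (intro so_rec_cong refl nth)
    finally show ?thesis
      unfolding prod_y replicate R_def Suc_eq_plus1[symmetric]
      by (simp only: prod_powr_rect[OF y_pos[OF \<alpha>], symmetric] u mult.assoc)
  qed

  have D: "(\<alpha> * (\<Prod>i\<in>{1..N}. p i)) powr u * (\<Sum>l\<in>signed_box (N - n) u.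
      so_even (n + 1) (replicate (2 * n + 1 - N) u @ l) (map (\<lambda>i. 1 / p i) [1..<n + 1] @ [1 / \<alpha>]) *
      so_even (N - n) l (map (\<lambda>i. 1 / p i) [n + 1..<N + 1])) = R \<alpha>"
    if \<alpha>: "0 < \<alpha>" and n: "N \<le> 2 * n + 1" "n \<le> N" for n
  proof -
    define d where "d = N - n"
    define a where "a = 2 * n + 1 - N"
    have ad: "a + d = Suc n" using n by (simp add: a_def d_def)
    \<comment> \<open>The positions n to N are reversed: \<alpha> moves to position n, and removal
      from the end meets p (n + 1), ..., p N in this order.\<close>
    define \<sigma> where "\<sigma> = (\<lambda>j. if n \<le> j \<and> j \<le> N then n + N - j else j)"
    define Y where "Y = map (\<lambda>i. 1 / p i) [1..<n + 1] @ [1 / \<alpha>]"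
    define Z where "Z = map (\<lambda>i. 1 / p i) [n + 1..<N + 1]"
    have Y: "Y ! i = 1 / y \<alpha> (\<sigma> i)" if "i < Suc n" for i
    proof (cases "i < n")
      case True
      then show ?thesis using n by (simp add: Y_def nth_append y_def \<sigma>_def del: upt_Suc)
    next
      case False
      then have "i = n" using that by simp
      then show ?thesis using n by (simp add: Y_def nth_append y_def \<sigma>_def del: upt_Suc)
    qed
    have Z: "Z ! i = 1 / y \<alpha> (\<sigma> (Suc N - 1 - i))" if "i < d" for i
    proof -
      have i: "n + i < N" "n \<le> N - i" "N - i \<le> N" "n + N - (N - i) = n + i" "i < N - n" using that n by (auto simp: d_def)
      then have "\<sigma> (Suc N - 1 - i) = n + i" by (simp add: \<sigma>_def)
      then show ?thesis using i(1,5) by (simp add: Z_def y_def del: upt_Suc)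
    qed
    have \<sigma>: "\<sigma> permutes {..<Suc N}"
    proof (rule bij_imp_permutes)
      show "bij_betw \<sigma> {..<Suc N} {..<Suc N}"
        by (rule bij_betw_byWitness[where f' = \<sigma>]) (use n in \<open>auto simp: \<sigma>_def\<close>)
    qed (simp add: \<sigma>_def)
    have soY: "so_even (Suc n) (shape q (Suc n) l) Y = (\<Prod>i<Suc n. (1 / y \<alpha> (\<sigma> i)) powr (- of_int q / 2)) *
        so_rec q (Suc n) l (\<lambda>i. 1 / y \<alpha> (\<sigma> i))" for l
    proof -
      have "so_even (Suc n) (shape q (Suc n) l) Y = (\<Prod>i<Suc n. (Y ! i) powr (- of_int q / 2)) * so_rec q (Suc n) l (\<lambda>i. Y ! i)"
        by (rule so_even_shape[OF q]) (simp only: Y zero_less_divide_1_iff y_pos[OF \<alpha>])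
      also have "(\<Prod>i<Suc n. (Y ! i) powr (- of_int q / 2)) = (\<Prod>i<Suc n. (1 / y \<alpha> (\<sigma> i)) powr (- of_int q / 2))"
        by (intro prod.cong refl) (simp only: lessThan_iff Y)
      also have "so_rec q (Suc n) l (\<lambda>i. Y ! i) = so_rec q (Suc n) l (\<lambda>i. 1 / y \<alpha> (\<sigma> i))"
        by (intro so_rec_cong refl Y)
      finally show ?thesis .
    qed
    have soZ: "so_even d (shape q d l) Z = (\<Prod>i<d. (1 / y \<alpha> (\<sigma> (Suc N - 1 - i))) powr (- of_int q / 2)) *
        so_rec q d l (\<lambda>i. 1 / y \<alpha> (\<sigma> (Suc N - 1 - i)))" for l
    proof -
      have "so_even d (shape q d l) Z = (\<Prod>i<d. (Z ! i) powr (- of_int q / 2)) * so_rec q d l (\<lambda>i. Z ! i)"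
        by (rule so_even_shape[OF q]) (simp only: Z zero_less_divide_1_iff y_pos[OF \<alpha>])
      also have "(\<Prod>i<d. (Z ! i) powr (- of_int q / 2)) = (\<Prod>i<d. (1 / y \<alpha> (\<sigma> (Suc N - 1 - i))) powr (- of_int q / 2))"
        by (intro prod.cong refl) (simp only: lessThan_iff Z)
      also have "so_rec q d l (\<lambda>i. Z ! i) = so_rec q d l (\<lambda>i. 1 / y \<alpha> (\<sigma> (Suc N - 1 - i)))"
        by (intro so_rec_cong refl Z)
      finally show ?thesis .
    qed
    have join: "replicate a u @ shape q d k = shape q (Suc n) (rect_join a U k)" for k
      by (rule nth_equalityI) (auto simp: ad[symmetric] nth_append u rect_join_def)
    let ?P = "(\<Prod>i<Suc n. (1 / y \<alpha> (\<sigma> i)) powr (- of_int q / 2)) *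
      (\<Prod>i<d. (1 / y \<alpha> (\<sigma> (Suc N - 1 - i))) powr (- of_int q / 2))"
    let ?G = "\<lambda>k. so_rec q d k (\<lambda>i. 1 / y \<alpha> (\<sigma> (Suc N - 1 - i))) * so_rec q (Suc n) (rect_join a U k) (\<lambda>i. 1 / y \<alpha> (\<sigma> i))"
    have inj: "inj_on (shape q d) {k \<in> signed_tuples q U d. dominant q d k}"
    proof (rule inj_onI)
      fix k k' assume k: "k \<in> {k \<in> signed_tuples q U d. dominant q d k}" "k' \<in> {k \<in> signed_tuples q U d. dominant q d k}"
        and eq: "shape q d k = shape q d k'"
      show "k = k'"
      proof
        fix j show "k j = k' j"
          using k arg_cong[OF eq, of "\<lambda>l. l ! j"] by (cases "j < d") (auto simp: signed_tuples_def tup_def)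
      qed
    qed
    have "(\<Sum>l\<in>signed_box d u. so_even (Suc n) (replicate a u @ l) Y * so_even d l Z) =
        (\<Sum>k\<in>{k \<in> signed_tuples q U d. dominant q d k}. ?P * ?G k)"
      unfolding u signed_box_eq[OF q U] sum.reindex[OF inj] o_def unfolding u[symmetric] join soY soZ
      by (intro sum.cong refl) (simp only: mult_ac)
    \<comment> \<open>Tuples that are not dominant contribute 0, so the signed box may be enlarged
      to the one of \<open>so_rect_split\<close>.\<close>
    also have "\<dots> = (\<Sum>k\<in>signed_tuples q U d. ?P * ?G k)"
      by (rule sum.mono_neutral_left) (auto simp: so_rec_not_dominant)
    also have "\<dots> = ?P * (\<Sum>k\<in>signed_tuples q U d. ?G k)" by (simp only: sum_distrib_left)
    also have "(\<Sum>k\<in>signed_tuples q U d. ?G k) = so_rec q (Suc N) (\<lambda>_. U) (\<lambda>i. 1 / y \<alpha> (\<sigma> i))"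
    proof -
      have "2 * d \<le> Suc N" "Suc N - d = Suc n" "Suc N - 2 * d = a" using n by (auto simp: d_def a_def)
      then show ?thesis using so_rect_split[OF q U, of d "Suc N" "\<lambda>i. 1 / y \<alpha> (\<sigma> i)"] by simp
    qed
    also have "\<dots> = so_rec q (Suc N) (\<lambda>_. U) (\<lambda>i. 1 / y \<alpha> i)"
      by (rule so_rect_permute[OF q U \<sigma>]) (use y_pos y_lt \<alpha> assms(4) in auto)
    also have "?P = (\<Prod>i<Suc N. (1 / y \<alpha> i) powr (- of_int q / 2))"
    proof -
      let ?h = "\<lambda>i. (1 / y \<alpha> (\<sigma> i)) powr (- of_int q / 2)"
      have "(\<Prod>i<d. ?h (Suc N - 1 - i)) = (\<Prod>i\<in>{Suc n..<Suc N}. ?h i)"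
        by (rule prod.reindex_bij_witness[where i = "\<lambda>i. N - i" and j = "\<lambda>i. N - i"]) (use n in \<open>auto simp: d_def\<close>)
      moreover have "(\<Prod>i<Suc N. ?h i) = (\<Prod>i<Suc n. ?h i) * (\<Prod>i\<in>{Suc n..<Suc N}. ?h i)"
        using prod.atLeastLessThan_concat[of 0 "Suc n" "Suc N" ?h] n by (simp add: atLeast0LessThan)
      moreover have "(\<Prod>i<Suc N. ?h i) = (\<Prod>i<Suc N. (1 / y \<alpha> i) powr (- of_int q / 2))"
        using prod.permute[OF \<sigma>, of "\<lambda>i. (1 / y \<alpha> i) powr (- of_int q / 2)"] by (simp add: o_def)
      ultimately show ?thesis by simp
    qed
    finally have "(\<Sum>l\<in>signed_box d u. so_even (Suc n) (replicate a u @ l) Y * so_even d l Z) =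
        (\<Prod>i<Suc N. (1 / y \<alpha> i) powr (- of_int q / 2)) * so_rec q (Suc N) (\<lambda>_. U) (\<lambda>i. 1 / y \<alpha> i)" .
    then show ?thesis
      unfolding prod_y R_def d_def[symmetric] a_def[symmetric] Y_def[symmetric] Z_def[symmetric]
      unfolding Suc_eq_plus1[symmetric]
      by (simp only: prod_powr_rect[OF y_pos[OF \<alpha>], symmetric] u mult.assoc)
  qed
  \<comment> \<open>The lower bound on n says exactly that 2 (N - n) is at most N + 1, the condition
    for splitting off N - n of the N + 1 variables.\<close>
  have range: "N \<le> 2 * n + 1" if "\<lceil>(real N - 1) / 2\<rceil> \<le> int n" for n
  proof -
    have "(real N - 1) / 2 \<le> real n" using that by (simp add: ceiling_le_iff)
    then have "real N \<le> real (2 * n + 1)" by simp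
    then show ?thesis by (simp only: of_nat_le_iff)
  qed
  have B_\<alpha>: "(\<Sum>mu\<in>decr_tuples N {k. real k \<le> 2 * u}.
      \<alpha> ^ oddrows (conjugate mu) * schur N mu (map p [1..<N + 1])) = B \<alpha>"
    by (simp only: B_def)
  show ?thesis
    unfolding Let_def X_def[symmetric] A B_\<alpha> C1
  proof (intro conjI impI allI)
    show "B \<alpha> = C \<alpha>" by (rule BC)
  next
    assume "0 < \<alpha>"
    then show "C \<alpha> = (\<alpha> * (\<Prod>i\<in>{1..N}. p i)) powr u * so_even (N + 1) (replicate (N + 1) u) (X @ [1 / \<alpha>])"
      by (simp only: C2 RC)
  next
    fix n assume "0 < \<alpha>" "\<lceil>(real N - 1) / 2\<rceil> \<le> int n \<and> n \<le> N"
    then show "(\<alpha> * (\<Prod>i\<in>{1..N}. p i)) powr u * so_even (N + 1) (replicate (N + 1) u) (X @ [1 / \<alpha>]) =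
        (\<alpha> * (\<Prod>i\<in>{1..N}. p i)) powr u * (\<Sum>l\<in>signed_box (N - n) u.
          so_even (n + 1) (replicate (2 * n + 1 - N) u @ l) (map (\<lambda>i. 1 / p i) [1..<n + 1] @ [1 / \<alpha>]) *
          so_even (N - n) l (map (\<lambda>i. 1 / p i) [n + 1..<N + 1]))"
      using range[of n] by (simp only: C2 D)
  qed simp
qed

end
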